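(* Let $g\ge2$ and let $f$ be the continuous class function $f(U)=\det(1-U)$. Then, with $q$ running over prime powers $q\equiv1\bmod6$, $$\lim_{q\to\infty}\frac{1}{|\mathfrak H(3g)|}\sum_{\chi\in\mathfrak H(3g)}f(q^{1/6}\Theta_\chi)=(1+o(1))\int_{U(3g)}f(U)\,\overline{\det(1-\wedge^3U)}\,dU,$$ where the $o(1)$ tends to $0$ as $g\to\infty$. Specifically, $f(q^{1/6}\Theta_\chi)=L(\tfrac13,\chi)$ for $\chi\in\mathfrak H(3g)$, and $$\lim_{q\to\infty}\frac{1}{|\mathfrak H(3g)|}\sum_{\chi\in\mathfrak H(3g)}L(\tfrac13,\chi)=g+O(1)$$ and $$\int_{U(3g)}\det(1-U)\,\overline{\det(1-\wedge^3U)}\,dU=g+1.$$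
   Context: Let $q$ be a prime power with $q\equiv1\bmod 6$. $\mathcal M$ is the set of monic polynomials in $\mathbb F_q[T]$; $|F|=q^{\deg F}$. Cubic characters: fix an isomorphism $\Omega$ from the cube roots of unity in $\mathbb F_q^*$ to $\mu_3=\{1,\xi_3,\xi_3^2\}\subset\mathbb C^*$, $\xi_3=e^{2\pi i/3}$. For a monic irreducible (prime) $P$ and $a\in\mathbb F_q[T]$, put $\chi_P(a)=0$ if $P\mid a$, and otherwise $\chi_P(a)=\alpha\in\mu_3$ where $a^{(q^{\deg P}-1)/3}\equiv\Omega^{-1}(\alpha)\bmod P$. For monic $F=P_1^{e_1}\cdots P_k^{e_k}$ put $\chi_F(a)=\prod_i\chi_{P_i}(a)^{e_i}$. The genus of a primitive cubic character $\chi$ is $\deg\mathrm{cond}(\chi)-2+\delta_\chi$, where $\delta_\chi=0$ if $\chi$ is trivial on $\mathbb F_q^*$ (even) and $\delta_\chi=1$ otherwise (odd). $\mathfrak H(3g)$ is the set of characters $\chi_F$ of genus $3g$ with $F$ monic square-free; equivalently $\mathfrak H(3g)=\{\chi_F: F \text{ monic square-free},\ \deg F=3g+1\}$; all these characters are odd. $L(s,\chi)=\sum_{F\in\mathcal M}\chi(F)|F|^{-s}$, which for nontrivial $\chi$ is a polynomial in $q^{-s}$ (grouping the terms by degree). By the Riemann Hypothesis (Weil) there is a conjugacy class of unitary matrices $\Theta_\chi$, of dimension equal to the genus, with $L(s,\chi)=(1-q^{-s})^{1-\delta_\chi}\det(1-q^{\frac12-s}\Theta_\chi)$; so for $\chi\in\mathfrak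 H(3g)$, $\Theta_\chi$ is a conjugacy class in $U(3g)$ and $L(s,\chi)=\det(1-q^{\frac12-s}\Theta_\chi)$. $U(N)$ is the group of $N\times N$ unitary matrices, $dU$ its Haar probability measure, and $\det(1-\wedge^3U)=\prod_{1\le i_1<i_2<i_3\le N}(1-x_{i_1}x_{i_2}x_{i_3})$, where $x_1,\dots,x_N$ are the eigenvalues of $U$. The $O(1)$ is bounded by an absolute constant, independent of $g$ and $q$. *)

theory Defs
  imports
    "HOL-Probability.Probability_Measure"
    "HOL-Algebra.Polynomial_Divisibility"
    "HOL-Number_Theory.Prime_Powers"
    "Jordan_Normal_Form.Char_Poly"
    "Jordan_Normal_Form.Schur_Decomposition"
begin

text \<open>
  Finite fields are HOL-Algebra rings \<open>K\<close>, because the order \<open>q\<close> has to vary inside the statement.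
  Elements of \<open>K[T]\<close> are elements of \<open>poly_ring K\<close>: coefficient lists with the leading
  coefficient first, the zero polynomial being the empty list.
\<close>

definition admissible :: "nat set" where
  "admissible = {q. primepow q \<and> q mod 6 = 1}"

definition q_to_infinity :: "nat filter" where
  "q_to_infinity = inf at_top (principal admissible)"

definition mu3 :: "complex set" where
  "mu3 = {1, cis (2 * pi / 3), cis (2 * pi / 3) ^ 2}"

definition cube_roots :: "'a ring \<Rightarrow> 'a set" where
  "cube_roots K = {z \<in> carrier K. z [^]\<^bsub>K\<^esub> (3::nat) = \<one>\<^bsub>K\<^esub>}"

definition cube_root_iso :: "'a ring \<Rightarrow> ('a \<Rightarrow> complex) \<Rightarrow> bool" where
  "cube_root_iso K \<Omega> \<longleftrightarrow>
     bij_betw \<Omega> (cube_roots K) mu3 \<and>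
     (\<forall>x\<in>cube_roots K. \<forall>y\<in>cube_roots K. \<Omega> (x \<otimes>\<^bsub>K\<^esub> y) = \<Omega> x * \<Omega> y)"

definition field_family :: "(nat \<Rightarrow> 'a ring) \<Rightarrow> (nat \<Rightarrow> 'a \<Rightarrow> complex) \<Rightarrow> bool" where
  "field_family K \<Omega> \<longleftrightarrow>
     (\<forall>q\<in>admissible. field (K q) \<and> finite (carrier (K q)) \<and> card (carrier (K q)) = q \<and>
        cube_root_iso (K q) (\<Omega> q))"

definition monic_polys :: "'a ring \<Rightarrow> 'a list set" where
  "monic_polys K = {F \<in> carrier (poly_ring K). F \<noteq> [] \<and> Polynomials.lead_coeff F = \<one>\<^bsub>K\<^esub>}"

definition monic_primes :: "'a ring \<Rightarrow> 'a list set" where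
  "monic_primes K = {P \<in> monic_polys K. pirreducible\<^bsub>K\<^esub> (carrier K) P}"

definition squarefree_poly :: "'a ring \<Rightarrow> 'a list \<Rightarrow> bool" where
  "squarefree_poly K F \<longleftrightarrow>
     (\<forall>D\<in>carrier (poly_ring K).
        (D \<otimes>\<^bsub>poly_ring K\<^esub> D) pdivides\<^bsub>K\<^esub> F \<longrightarrow> D \<in> Units (poly_ring K))"

definition prime_exponent :: "'a ring \<Rightarrow> 'a list \<Rightarrow> 'a list \<Rightarrow> nat" where
  "prime_exponent K P F = (GREATEST e. (P [^]\<^bsub>poly_ring K\<^esub> (e::nat)) pdivides\<^bsub>K\<^esub> F)"

text \<open>In the congruence below, \<open>z\<close> is \<open>\<Omega>\<inverse> \<alpha>\<close>, and \<open>[z]\<close> is the constant polynomial \<open>z \<noteq> 0\<close>.\<close>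

definition prime_cubic_char ::
    "'a ring \<Rightarrow> ('a \<Rightarrow> complex) \<Rightarrow> 'a list \<Rightarrow> 'a list \<Rightarrow> complex" where
  "prime_cubic_char K \<Omega> P a =
     (if P pdivides\<^bsub>K\<^esub> a then 0
      else (THE \<alpha>. \<exists>z\<in>cube_roots K. \<alpha> = \<Omega> z \<and>
              P pdivides\<^bsub>K\<^esub>
                ((a [^]\<^bsub>poly_ring K\<^esub> ((card (carrier K) ^ Polynomials.degree P - 1) div 3 :: nat))
                   \<ominus>\<^bsub>poly_ring K\<^esub> [z])))"

definition cubic_char ::
    "'a ring \<Rightarrow> ('a \<Rightarrow> complex) \<Rightarrow> 'a list \<Rightarrow> 'a list \<Rightarrow> complex" where
  "cubic_char K \<Omega> F a =
     (\<Prod>P\<in>{P \<in> monic_primes K. P pdivides\<^bsub>K\<^esub> F}.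
        prime_cubic_char K \<Omega> P a ^ prime_exponent K P F)"

text \<open>
  The conductor of a Dirichlet character \<open>\<psi>\<close> on \<open>K[T]\<close> is the monic \<open>C\<close> of least degree such that
  the nonzero values \<open>\<psi> a\<close> depend only on \<open>a\<close> modulo \<open>C\<close>.
\<close>

definition conductor_degree :: "'a ring \<Rightarrow> ('a list \<Rightarrow> complex) \<Rightarrow> nat" where
  "conductor_degree K \<psi> =
     (LEAST d. \<exists>C\<in>monic_polys K. Polynomials.degree C = d \<and>
        (\<forall>a\<in>carrier (poly_ring K). \<forall>b\<in>carrier (poly_ring K).
           \<psi> a \<noteq> 0 \<and> \<psi> b \<noteq> 0 \<and> C pdivides\<^bsub>K\<^esub> (a \<ominus>\<^bsub>poly_ring K\<^esub> b) \<longrightarrow> \<psi> a = \<psi> b))"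

definition char_delta :: "'a ring \<Rightarrow> ('a list \<Rightarrow> complex) \<Rightarrow> nat" where
  "char_delta K \<psi> = (if \<forall>c\<in>carrier K - {\<zero>\<^bsub>K\<^esub>}. \<psi> [c] = 1 then 0 else 1)"

definition char_genus :: "'a ring \<Rightarrow> ('a list \<Rightarrow> complex) \<Rightarrow> int" where
  "char_genus K \<psi> = int (conductor_degree K \<psi>) - 2 + int (char_delta K \<psi>)"

definition cubic_family :: "'a ring \<Rightarrow> ('a \<Rightarrow> complex) \<Rightarrow> nat \<Rightarrow> ('a list \<Rightarrow> complex) set" where
  "cubic_family K \<Omega> n =
     {cubic_char K \<Omega> F | F. F \<in> monic_polys K \<and> squarefree_poly K F \<and>
        char_genus K (cubic_char K \<Omega> F) = int n}"

definition L_function :: "'a ring \<Rightarrow> ('a list \<Rightarrow> complex) \<Rightarrow> complex \<Rightarrow> complex" where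
  "L_function K \<psi> s =
     (\<Sum>n. (\<Sum>F\<in>{F \<in> monic_polys K. Polynomials.degree F = n}.
            \<psi> F * of_nat (card (carrier K) ^ n) powr (- s)))"

definition unitary_group :: "nat \<Rightarrow> complex mat set" where
  "unitary_group N = {U \<in> carrier_mat N N. mat_adjoint U * U = 1\<^sub>m N}"

text \<open>
  The conjugacy class of \<open>\<Theta>\<^sub>\<psi>\<close>: two unitary matrices with the same characteristic polynomial
  are conjugate in the unitary group.
\<close>

definition frobenius_class :: "'a ring \<Rightarrow> ('a list \<Rightarrow> complex) \<Rightarrow> complex mat set" where
  "frobenius_class K \<psi> =
     {\<Theta> \<in> unitary_group (nat (char_genus K \<psi>)).
        \<forall>s. L_function K \<psi> s =
          (1 - of_nat (card (carrier K)) powr (- s)) ^ (1 - char_delta K \<psi>) *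
          Determinant.det (1\<^sub>m (nat (char_genus K \<psi>)) -
            (of_nat (card (carrier K)) powr (1 / 2 - s)) \<cdot>\<^sub>m \<Theta>)}"

text \<open>
  The type of matrices carries no topology; the Borel \<open>\<sigma>\<close>-algebra of \<open>U(N)\<close> is the one
  generated by the matrix entries.
\<close>

definition unitary_borel :: "nat \<Rightarrow> complex mat measure" where
  "unitary_borel N =
     vimage_algebra (unitary_group N)
       (\<lambda>U. \<lambda>ij\<in>{..<N} \<times> {..<N}. U $$ ij) (Pi\<^sub>M ({..<N} \<times> {..<N}) (\<lambda>_. borel))"

definition haar_prob :: "nat \<Rightarrow> complex mat measure \<Rightarrow> bool" where
  "haar_prob N M \<longleftrightarrow>
     prob_space M \<and> sets M = sets (unitary_borel N) \<and>
     (\<forall>V\<in>unitary_group N. distr M M (\<lambda>U. V * U) = M)"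

definition f_det :: "complex mat \<Rightarrow> complex" where
  "f_det A = Determinant.det (1\<^sub>m (dim_row A) - A)"

definition eigenvalue_list :: "complex mat \<Rightarrow> complex list" where
  "eigenvalue_list U = (SOME xs. char_poly U = (\<Prod>x\<leftarrow>xs. [:- x, 1:]))"

definition det_one_minus_wedge3 :: "complex mat \<Rightarrow> complex" where
  "det_one_minus_wedge3 U =
     (let xs = eigenvalue_list U in
      \<Prod>(i, j, k)\<in>{(i, j, k). i < j \<and> j < k \<and> k < length xs}. 1 - xs ! i * xs ! j * xs ! k)"

definition wedge3_integral :: "complex mat measure \<Rightarrow> complex" where
  "wedge3_integral M = integral\<^sup>L M (\<lambda>U. f_det U * cnj (det_one_minus_wedge3 U))"

definition family_average ::
    "'a ring \<Rightarrow> ('a \<Rightarrow> complex) \<Rightarrow> nat \<Rightarrow> (('a list \<Rightarrow> complex) \<Rightarrow> complex) \<Rightarrow> complex" where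
  "family_average K \<Omega> n \<Phi> =
     (\<Sum>\<psi>\<in>cubic_family K \<Omega> n. \<Phi> \<psi>) / of_nat (card (cubic_family K \<Omega> n))"

end

theory Submission
  imports Defs "HOL-Computational_Algebra.Polynomial_FPS" "HOL-Algebra.Weak_Morphisms"
    "HOL-Real_Asymp.Real_Asymp"
begin

text \<open>
  The limit is exactly \<open>g + 1\<close>, and so is the Haar integral.

  For a monic modulus \<open>F\<close>, let \<open>J F f\<close> be the product of the cubic characters of the leading coefficients
  of \<open>f * A mod F\<close>, where \<open>A\<close> runs over the monic polynomials of degree less than \<open>degree F\<close>. By the
  argument of the lemma of Gauss, this is the cubic residue symbol if \<open>F\<close> is prime; it is multiplicative in both
  arguments and satisfies the reciprocity law. Put \<open>N = 3 * g + 1\<close>. The average of \<open>L(1/3)\<close> is a weighted sum of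
  \<open>J F f\<close> over square-free \<open>F\<close> of degree \<open>N\<close> and monic \<open>f\<close> of degree \<open>n < N\<close>. The cubes \<open>f\<close> contribute
  \<open>1 + O(1/q)\<close> for each \<open>n\<close> divisible by 3, in total \<open>g + 1\<close>. For the other \<open>f\<close> the condition on \<open>F\<close> is
  expanded over the squares dividing it: for small squares the complete sums over \<open>F\<close> vanish, and for large
  squares the Poisson summation formula in \<open>f\<close> leads to sums over \<open>F\<close> of cubic Gauss sums. A Farey
  dissection, in which the Euclidean algorithm evaluates the symbol, confines these to multiples of
  cubes, which saves a power of \<open>q\<close>.

  By left invariance under monomial matrices, the integral of \<open>det(1 - U)\<close> against the conjugate of a product
  of \<open>m\<close> traces of powers of \<open>U\<close> is \<open>(-1)^m\<close> if the total degree is at most the dimension, and 0 otherwise.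
  So it evaluates symmetric functions of the eigenvalues at the point where all power sums are \<open>-1\<close>.
  There the power sums of the third exterior power are \<open>-1\<close> as well, and by Newton's identities every coefficient
  of its characteristic polynomial contributes 1; those of degree at most \<open>3 * g\<close> are \<open>g + 1\<close> in number.
\<close>

hide_const (open) Polynomials.degree Polynomials.lead_coeff up_ring.coeff up_ring.monom Coset.order
  Divisibility.prime Divisibility.irreducible Module.smult

text \<open>At the point 1/3 the weight \<open>q^(-n/3)\<close> exactly offsets the
  \<open>q^(n/3)\<close> cubes of degree \<open>n\<close>. That is why every degree divisible by 3
  counts equally and the mean grows with \<open>g\<close>. All other terms only have to lose a fixed
  power of \<open>q\<close>; their constants may depend on \<open>N\<close> in any way. The obstacle
  is the range where a square of degree \<open>2 * d\<close> divides \<open>F\<close> and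
  \<open>2 * d + n\<close> exceeds \<open>N\<close>: periodicity of the symbol modulo
  \<open>f\<close> no longer helps. Square-root cancellation inside single Gauss sums gives
  \<open>q^(3 * N / 2)\<close> for the sum over all moduli of degree \<open>N\<close>, which is too
  much when \<open>N\<close> is large against the dual length \<open>m + 1\<close>. The dissection
  gives \<open>q^(4 * N / 3)\<close>, and this leads to the final saving \<open>q^(-1/6)\<close>.
  Defining the symbol by Gauss products serves this aim: it is defined for any modulus without
  factoring it, ignores constant factors of the modulus, and so can be followed through the
  Euclidean algorithm.\<close>

definition below :: "nat \<Rightarrow> 'k::zero poly set" where
  "below n = {p. p = 0 \<or> degree p < n}"

definition monics :: "nat \<Rightarrow> 'k::{zero,one} poly set" where
  "monics n = {p. degree p = n \<and> lead_coeff p = 1}"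

definition monics_below :: "nat \<Rightarrow> 'k::{zero,one} poly set" where
  "monics_below n = {p. degree p < n \<and> lead_coeff p = 1}"

text \<open>The zero polynomial has \<open>degree\<close> 0 and needs a separate clause in the
  definition. In terms of coefficients that clause disappears, and \<open>below n\<close> is visibly
  a vector space.\<close>

lemma below_iff: "p \<in> below n \<longleftrightarrow> (\<forall>i\<ge>n. coeff p i = 0)"
proof
  assume "p \<in> below n"
  then show "\<forall>i\<ge>n. coeff p i = 0" unfolding below_def
    by (metis (mono_tags, lifting) coeff_0 coeff_eq_0 le_trans linorder_not_le mem_Collect_eq)
next
  assume h: "\<forall>i\<ge>n. coeff p i = 0"
  show "p \<in> below n"
  proof (cases "p = 0")
    case False
    then have "coeff p (degree p) \<noteq> 0" by simp
    with h show ?thesis by (auto simp: below_def not_le)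
  qed (auto simp: below_def)
qed

lemma below_0 [simp]: "0 \<in> below n" by (simp add: below_def)
lemma below_zero [simp]: "below 0 = {0}" by (auto simp: below_def)
lemma below_add: "p \<in> below n \<Longrightarrow> r \<in> below n \<Longrightarrow> p + r \<in> below n"
  for p r :: "'k::comm_monoid_add poly" by (auto simp: below_iff)
lemma below_diff: "p \<in> below n \<Longrightarrow> r \<in> below n \<Longrightarrow> p - r \<in> below n"
  for p r :: "'k::ab_group_add poly" by (auto simp: below_iff)
lemma below_uminus: "p \<in> below n \<Longrightarrow> - p \<in> below n"
  for p :: "'k::ab_group_add poly" by (auto simp: below_iff)
lemma below_mono: "p \<in> below n \<Longrightarrow> n \<le> m \<Longrightarrow> p \<in> below m" by (auto simp: below_def)
lemma below_smult: "p \<in> below n \<Longrightarrow> smult c p \<in> below n"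
  for p :: "'k::comm_semiring_0 poly" by (auto simp: below_iff)

lemma below_Suc: "(below (Suc n) :: 'k::zero poly set) = (\<lambda>(c,p). pCons c p) ` (UNIV \<times> below n)"
proof -
  have "p \<in> below (Suc n) \<longleftrightarrow> (\<exists>c r. r \<in> below n \<and> p = pCons c r)" for p :: "'k poly"
  proof
    assume h: "p \<in> below (Suc n)"
    obtain c r where p: "p = pCons c r" by (cases p) auto
    have "r \<in> below n" using h p by (auto simp: below_iff coeff_pCons split: nat.splits)
    then show "\<exists>c r. r \<in> below n \<and> p = pCons c r" using p by auto
  qed (auto simp: below_iff coeff_pCons split: nat.splits)
  then show ?thesis by (auto simp: image_iff)
qed

lemma finite_card_below:
  "finite (below n :: 'k::{finite,zero} poly set) \<and> card (below n :: 'k poly set) = CARD('k) ^ n"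
proof (induction n)
  case (Suc n)
  have inj: "inj_on (\<lambda>(c,p). pCons c p) (UNIV \<times> (below n :: 'k poly set))"
    by (auto simp: inj_on_def)
  show ?case unfolding below_Suc using Suc by (simp add: card_image[OF inj] card_cartesian_product)
qed simp

lemma finite_below [simp]: "finite (below n :: 'k::{finite,zero} poly set)"
  and card_below: "card (below n :: 'k::{finite,zero} poly set) = CARD('k) ^ n"
  using finite_card_below by auto

lemma monics_eq: "monics n = (\<lambda>r. monom 1 n + r) ` (below n :: 'k::comm_ring_1 poly set)"
proof -
  have "p \<in> monics n \<longleftrightarrow> (\<exists>r. r \<in> below n \<and> p = monom 1 n + r)" for p :: "'k poly"
  proof
    assume p: "p \<in> monics n"
    have "p - monom 1 n \<in> below n"
      using p by (auto simp: below_iff monics_def coeff_eq_0)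
    then show "\<exists>r. r \<in> below n \<and> p = monom 1 n + r" by (intro exI[of _ "p - monom 1 n"]) auto
  next
    assume "\<exists>r. r \<in> below n \<and> p = monom 1 n + r"
    then obtain r where r: "r \<in> below n" "p = monom 1 n + r" by auto
    have c: "coeff p n = 1" using r by (auto simp: below_iff)
    have "degree p \<le> n" by (rule degree_le) (use r in \<open>auto simp: below_iff\<close>)
    moreover have "n \<le> degree p" using c by (intro le_degree) auto
    ultimately show "p \<in> monics n" using c by (auto simp: monics_def)
  qed
  then show ?thesis by (auto simp: image_iff)
qed

lemma finite_monics [simp]: "finite (monics n :: 'k::{finite,comm_ring_1} poly set)"
  by (simp add: monics_eq)
lemma card_monics: "card (monics n :: 'k::{finite,comm_ring_1} poly set) = CARD('k) ^ n"
  unfolding monics_eq by (subst card_image) (auto simp: inj_on_def card_below)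

lemma monics_below_eq: "monics_below n = (\<Union>i<n. monics i)"
  by (auto simp: monics_below_def monics_def)
lemma finite_monics_below [simp]: "finite (monics_below n :: 'k::{finite,comm_ring_1} poly set)"
  by (simp add: monics_below_eq)
lemma card_monics_below:
  "card (monics_below n :: 'k::{finite,comm_ring_1} poly set) = (\<Sum>i<n. CARD('k) ^ i)"
proof -
  have "monics i \<inter> monics j = ({} :: 'k poly set)" if "i \<noteq> j" for i j
    using that by (auto simp: monics_def)
  then show ?thesis unfolding monics_below_eq by (simp add: card_UN_disjoint card_monics)
qed

lemma monics_nz: "p \<in> monics n \<Longrightarrow> p \<noteq> 0" for p :: "'k::zero_neq_one poly"
  by (auto simp: monics_def)
lemma monics_below_nz: "p \<in> monics_below n \<Longrightarrow> p \<noteq> 0" for p :: "'k::zero_neq_one poly"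
  by (auto simp: monics_below_def)

lemma monics_mult: "p \<in> monics a \<Longrightarrow> r \<in> monics b \<Longrightarrow> p * r \<in> monics (a + b)"
  for p r :: "'k::idom poly"
proof -
  assume h: "p \<in> monics a" "r \<in> monics b"
  have "p \<noteq> 0" "r \<noteq> 0" using h monics_nz by auto
  then show ?thesis using h unfolding monics_def by (auto simp: degree_mult_eq coeff_mult_degree_sum)
qed
lemma monics_add_below: "p \<in> monics n \<Longrightarrow> r \<in> below n \<Longrightarrow> p + r \<in> monics n"
  for p r :: "'k::comm_ring_1 poly"
  unfolding monics_eq by (auto simp: add.assoc intro!: imageI below_add)
lemma monics_diff_below: "p \<in> monics n \<Longrightarrow> r \<in> below n \<Longrightarrow> p - r \<in> monics n"
  for p r :: "'k::comm_ring_1 poly"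
  using monics_add_below[OF _ below_uminus] by fastforce

section \<open>Residues modulo a polynomial and the permutations of a residue system\<close>

lemma mod_below: "F \<noteq> 0 \<Longrightarrow> x mod F \<in> below (degree F)" for x F :: "'k::field poly"
  using degree_mod_less[of F x] by (auto simp: below_def)
lemma below_mod: "x \<in> below (degree F) \<Longrightarrow> x mod F = x" for x F :: "'k::field poly"
  by (auto simp: below_def mod_poly_less)
lemma mod_eq_below_unique:
  fixes x F r :: "'k::field poly"
  assumes "F dvd x - r" "r \<in> below (degree F)" shows "x mod F = r"
  using assms by (metis below_mod mod_eq_dvd_iff)

lemma below_mult: "p \<in> below a \<Longrightarrow> r \<noteq> 0 \<Longrightarrow> degree r \<le> b \<Longrightarrow> p * r \<in> below (a + b)"
  for p r :: "'k::idom poly"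
  by (cases "p = 0") (auto simp: below_def degree_mult_eq)

lemma below_dvd_0: "x \<in> below (degree F) \<Longrightarrow> F dvd x \<Longrightarrow> x = 0" for x F :: "'k::field poly"
  by (metis below_mod dvd_imp_mod_0)

lemma mod_eq_dvd: "x mod F = y mod F \<Longrightarrow> F dvd x - y" for x y F :: "'k::field poly"
  by (simp add: mod_eq_dvd_iff)

lemma bij_betw_endo: "finite A \<Longrightarrow> inj_on f A \<Longrightarrow> f ` A \<subseteq> A \<Longrightarrow> bij_betw f A A"
  by (simp add: bij_betw_def endo_inj_surj)

lemma bij_shift_mod:
  fixes F x0 :: "'k::{field,finite} poly" assumes "F \<noteq> 0"
  shows "bij_betw (\<lambda>x. (x0 + x) mod F) (below (degree F)) (below (degree F))"
proof -
  have "inj_on (\<lambda>x. (x0 + x) mod F) (below (degree F))"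
  proof (rule inj_onI)
    fix x y assume x: "x \<in> below (degree F)" and y: "y \<in> below (degree F)" and
      e: "(x0 + x) mod F = (x0 + y) mod F"
    have "F dvd (x0 + x) - (x0 + y)" by (rule mod_eq_dvd[OF e])
    then have "F dvd x - y" by simp
    then have "x - y = 0" using below_dvd_0[OF below_diff[OF x y]] by simp
    then show "x = y" by simp
  qed
  moreover have "(\<lambda>x. (x0 + x) mod F) ` below (degree F) \<subseteq> below (degree F)"
    using mod_below[OF assms] by auto
  ultimately show ?thesis by (intro bij_betw_endo) auto
qed

lemma bij_mult_mod:
  fixes F c :: "'k::{field_gcd,finite} poly" assumes "F \<noteq> 0" "coprime c F"
  shows "bij_betw (\<lambda>x. (c * x) mod F) (below (degree F)) (below (degree F))"
proof -
  have "inj_on (\<lambda>x. (c * x) mod F) (below (degree F))"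
  proof (rule inj_onI)
    fix x y assume x: "x \<in> below (degree F)" and y: "y \<in> below (degree F)" and
      e: "(c * x) mod F = (c * y) mod F"
    have "F dvd c * x - c * y" by (rule mod_eq_dvd[OF e])
    then have "F dvd c * (x - y)" by (simp add: algebra_simps)
    then have "F dvd x - y" using assms(2) by (metis coprime_commute coprime_dvd_mult_right_iff)
    then have "x - y = 0" using below_dvd_0[OF below_diff[OF x y]] by simp
    then show "x = y" by simp
  qed
  moreover have "(\<lambda>x. (c * x) mod F) ` below (degree F) \<subseteq> below (degree F)"
    using mod_below[OF assms(1)] by auto
  ultimately show ?thesis by (intro bij_betw_endo) auto
qed

lemma coprime_inverse_mod:
  fixes F c :: "'k::field_gcd poly" assumes "coprime c F"
  obtains d where "F dvd c * d - 1" "coprime d F"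
proof -
  obtain x y where xy: "bezout_coefficients c F = (x, y)" by (cases "bezout_coefficients c F")
  have "x * c + y * F = gcd c F" using bezout_coefficients[OF xy] .
  then have e: "x * c + y * F = 1" using assms by simp
  then have "c * x - 1 = - (y * F)" by (simp add: algebra_simps)
  then have "F dvd c * x - 1" by simp
  moreover have "coprime x F"
  proof (rule coprimeI)
    fix z assume "z dvd x" "z dvd F"
    then have "z dvd x * c + y * F" by simp
    with e show "is_unit z" by simp
  qed
  ultimately show ?thesis using that by blast
qed

section \<open>The cubic residue symbol\<close>

text \<open>The intended \<open>om\<close> is the cubic character
  \<open>x \<mapsto> \<Omega> (x^((q-1)/3))\<close> of the constant field, extended by 0. The axiom
  \<open>om_ker\<close> is what makes it nontrivial: too few elements satisfy
  \<open>x^((q-1)/3) = 1\<close>.\<close>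

locale cubic_char_field =
  fixes om :: "'k::{field_gcd,finite} \<Rightarrow> complex" and q :: nat
  assumes om_mult: "om (x * y) = om x * om y"
    and om_0 [simp]: "om 0 = 0"
    and om_cube: "x \<noteq> 0 \<Longrightarrow> om x ^ 3 = 1"
    and om_ker: "om x = 1 \<Longrightarrow> x ^ ((q - 1) div 3) = 1"
    and q_card: "q = CARD('k)"
    and q6: "q mod 6 = 1"
begin

definition J :: "'k poly \<Rightarrow> 'k poly \<Rightarrow> complex" where
  "J F f = (\<Prod>A\<in>monics_below (degree F). om (lead_coeff ((f * A) mod F)))"

lemma om_nz: "x \<noteq> 0 \<Longrightarrow> om x \<noteq> 0"
  using om_cube[of x] by auto
lemma om_eq_0 [simp]: "om x = 0 \<longleftrightarrow> x = 0"
  using om_nz by auto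
lemma om_1 [simp]: "om 1 = 1"
  using om_mult[of 1 1] om_nz[of 1] by auto
lemma om_inverse: "x \<noteq> 0 \<Longrightarrow> om (inverse x) = om x ^ 2"
proof -
  assume x: "x \<noteq> 0"
  have "om (inverse x) * om x = 1" using x by (simp flip: om_mult)
  moreover have "om x ^ 2 * om x = 1" using om_cube[OF x] by (simp add: power3_eq_cube power2_eq_square)
  ultimately show ?thesis using om_nz[OF x] by (metis mult_right_cancel)
qed
text \<open>The order of \<open>om (-1)\<close> divides both 2 and 3. This is why no sign appears in
  the reciprocity law and why moduli and arguments may be negated freely.\<close>

lemma om_minus [simp]: "om (- x) = om x"
proof -
  have "om (-1) * om (-1) = 1" by (simp flip: om_mult)
  moreover have "om (-1) ^ 3 = 1" by (rule om_cube) simp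
  ultimately have "om (-1) = 1" by (simp add: power3_eq_cube)
  then show ?thesis using om_mult[of "-1" x] by simp
qed
lemma norm_om: "cmod (om x) \<le> 1"
proof (cases "x = 0")
  case False
  have "cmod (om x) ^ 3 = 1" using om_cube[OF False] by (metis norm_one norm_power)
  then show ?thesis using power_eq_imp_eq_base[of "cmod (om x)" 3 1] by simp
qed simp

lemma q_ge: "q \<ge> 7"
proof -
  have "q \<noteq> 1" unfolding q_card by (metis UNIV_I card_1_singletonE singletonD zero_neq_one)
  with q6 show ?thesis by presburger
qed

lemma J_1 [simp]: "J 1 f = 1"
  by (simp add: J_def monics_below_eq)

lemma J_one_right [simp]: "J F 1 = 1"
  unfolding J_def
  by (rule prod.neutral) (auto simp: monics_below_def mod_poly_less)

lemma J_mod: "J F (f mod F) = J F f"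
  by (simp add: J_def mod_mult_left_eq)
lemma J_cong: "F dvd f - g \<Longrightarrow> J F f = J F g"
  by (metis J_mod mod_eq_dvd_iff)

text \<open>The monic multiple of \<open>F / gcd F f\<close> is one of the multipliers
  \<open>A\<close>, and it makes \<open>f * A\<close> divisible by \<open>F\<close>; the product
  then contains the factor \<open>om 0\<close>.\<close>

lemma J_eq_0:
  assumes "F \<noteq> 0" "\<not> coprime F f" shows "J F f = 0"
proof -
  define g where "g = gcd F f"
  have g: "g \<noteq> 0" "g dvd F" "g dvd f" using assms by (auto simp: g_def)
  have gu: "\<not> is_unit g" using assms(2) unfolding g_def by (subst is_unit_gcd)
  obtain a b where a: "F = g * a" and b: "f = g * b" using g unfolding dvd_def by blast
  have a0: "a \<noteq> 0" using a assms(1) by auto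
  have dg: "degree g > 0" using gu g(1) by (simp add: is_unit_iff_degree)
  define A where "A = smult (inverse (lead_coeff a)) a"
  have "A \<in> monics_below (degree F)"
    using a0 g(1) dg by (auto simp: A_def monics_below_def a degree_mult_eq)
  moreover have "f * A = F * smult (inverse (lead_coeff a)) b"
    by (simp add: A_def a b mult_ac)
  then have "(f * A) mod F = 0" by (metis dvd_imp_mod_0 dvd_triv_left)
  ultimately show ?thesis unfolding J_def
    by (intro prod_zero) (auto intro!: bexI[of _ A])
qed

text \<open>Multiplication by a unit permutes the residues up to scalars; the scalars multiply up to the
  symbol, as in the lemma of Gauss.\<close>

lemma gauss_perm:
  fixes F :: "'k poly"
  assumes F: "F \<noteq> 0" and cop: "coprime F f"
  defines "r \<equiv> \<lambda>A. (f * A) mod F"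
  shows "\<And>A. A \<in> monics_below (degree F) \<Longrightarrow> r A \<noteq> 0"
    and "bij_betw (\<lambda>A. smult (inverse (lead_coeff (r A))) (r A)) (monics_below (degree F)) (monics_below (degree F))"
proof -
  show r0: "r A \<noteq> 0" if "A \<in> monics_below (degree F)" for A
  proof
    assume "r A = 0"
    then have "F dvd f * A" by (auto simp: r_def)
    then have "F dvd A"  by (rule coprime_dvd_mult_right_iff[OF cop, THEN iffD1])
    then show False using that below_dvd_0[of A F] monics_below_nz[OF that]
      by (auto simp: below_def monics_below_def)
  qed
  let ?h = "\<lambda>A. smult (inverse (lead_coeff (r A))) (r A)"
  have "inj_on ?h (monics_below (degree F))"
  proof (rule inj_onI)
    fix A B assume A: "A \<in> monics_below (degree F)" and B: "B \<in> monics_below (degree F)" and e: "?h A = ?h B"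
    define a b where "a = inverse (lead_coeff (r A))" and "b = inverse (lead_coeff (r B))"
    have ab: "a \<noteq> 0" "b \<noteq> 0" using r0[OF A] r0[OF B] by (auto simp: a_def b_def)
    have "smult a (r A) = smult b (r B)" using e by (simp add: a_def b_def)
    then have "(f * smult a A) mod F = (f * smult b B) mod F"
      by (simp add: r_def mod_smult_left)
    then have "F dvd f * smult a A - f * smult b B" by (rule mod_eq_dvd)
    then have "F dvd f * (smult a A - smult b B)" by (simp add: algebra_simps)
    then have "F dvd smult a A - smult b B" by (rule coprime_dvd_mult_right_iff[OF cop, THEN iffD1])
    moreover have "smult a A - smult b B \<in> below (degree F)"
      using A B by (intro below_diff below_smult) (auto simp: below_def monics_below_def)
    ultimately have e2: "smult a A = smult b B" using below_dvd_0 by fastforce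
    have "a * lead_coeff A = b * lead_coeff B" using arg_cong[OF e2, of lead_coeff] ab by simp
    then have "a = b" using A B by (simp add: monics_below_def)
    then show "A = B" using e2 ab by (metis smult_cancel)
  qed
  moreover have "?h ` monics_below (degree F) \<subseteq> monics_below (degree F)"
  proof -
    have "degree (r A) < degree F" if "A \<in> monics_below (degree F)" for A
      using mod_below[OF F, of "f*A"] r0[OF that] by (auto simp: below_def r_def)
    then show ?thesis using r0 by (auto simp: monics_below_def)
  qed
  ultimately show "bij_betw ?h (monics_below (degree F)) (monics_below (degree F))"
    by (intro bij_betw_endo) auto
qed

text \<open>Multiplication by \<open>g\<close> sends \<open>A\<close> to a scalar times another
  monic residue \<open>h A\<close>. The scalars multiply up to \<open>J F g\<close>, and since
  \<open>h\<close> is a permutation the rest is the product for \<open>f\<close>.\<close>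

lemma J_mult: assumes "F \<noteq> 0" shows "J F (f * g) = J F f * J F g"
proof (cases "coprime F f \<and> coprime F g")
  case False
  then have "\<not> coprime F (f * g)" by simp
  then show ?thesis using False J_eq_0[OF assms] by auto
next
  case True
  define r where "r = (\<lambda>A. (g * A) mod F)"
  define h where "h = (\<lambda>A. smult (inverse (lead_coeff (r A))) (r A))"
  have r0: "r A \<noteq> 0" if "A \<in> monics_below (degree F)" for A
    using gauss_perm(1)[OF assms _ that] True by (simp add: r_def)
  have bij: "bij_betw h (monics_below (degree F)) (monics_below (degree F))"
    using gauss_perm(2)[OF assms, of g] True by (simp add: h_def r_def)
  have "om (lead_coeff ((f * g * A) mod F)) = om (lead_coeff (r A)) * om (lead_coeff ((f * h A) mod F))"
    if A: "A \<in> monics_below (degree F)" for A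
  proof -
    have rA: "r A = smult (lead_coeff (r A)) (h A)" using r0[OF A] by (simp add: h_def)
    have "(f * g * A) mod F = (f * r A) mod F" unfolding r_def
      by (simp add: mod_mult_right_eq mult.assoc)
    also have "\<dots> = smult (lead_coeff (r A)) ((f * h A) mod F)"
      by (subst rA) (simp only: mult_smult_right mod_smult_left)
    finally have "(f * g * A) mod F = smult (lead_coeff (r A)) ((f * h A) mod F)" .
    then show ?thesis by (simp add: om_mult)
  qed
  then have "J F (f * g) = (\<Prod>A\<in>monics_below (degree F). om (lead_coeff (r A))) *
      (\<Prod>A\<in>monics_below (degree F). om (lead_coeff ((f * h A) mod F)))"
    by (simp add: J_def prod.distrib)
  also have "(\<Prod>A\<in>monics_below (degree F). om (lead_coeff ((f * h A) mod F))) = J F f"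
    unfolding J_def by (rule prod.reindex_bij_betw[OF bij])
  finally show ?thesis by (simp add: J_def r_def mult.commute)
qed

lemma J_power: "F \<noteq> 0 \<Longrightarrow> J F (f ^ n) = J F f ^ n"
  by (induction n) (auto simp: J_mult)

lemma J_cube: assumes "F \<noteq> 0" "coprime F f" shows "J F f ^ 3 = 1"
proof -
  have "om (lead_coeff (f * A mod F)) ^ 3 = 1" if "A \<in> monics_below (degree F)" for A
    using gauss_perm(1)[OF assms that] by (simp add: om_cube)
  then show ?thesis by (simp add: J_def prod_power_distrib)
qed

lemma norm_J: "norm (J F f) \<le> 1"
  unfolding J_def by (subst prod_norm[symmetric]) (auto intro!: prod_le_1 norm_om)

lemma J_coprime_nz: "F \<noteq> 0 \<Longrightarrow> coprime F f \<Longrightarrow> J F f \<noteq> 0"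
  using J_cube by force

lemma J_eq_0_iff: "F \<noteq> 0 \<Longrightarrow> J F f = 0 \<longleftrightarrow> \<not> coprime F f"
  using J_eq_0 J_coprime_nz by blast

text \<open>The number is \<open>1 + q + ... + q^(d-1)\<close>, and \<open>q\<close> is 1 modulo 3.
  So the symbol of a constant, a power with this exponent of a cube root of unity, is governed by
  the degree of the modulus.\<close>

lemma card_monics_below_mod3: "card (monics_below d :: 'k poly set) mod 3 = d mod 3"
proof (induction d)
  case (Suc d)
  have "q mod 3 = 1" using q6 by presburger
  then have "q ^ d mod 3 = 1" by (simp add: power_mod[symmetric, of q d 3])
  moreover have "card (monics_below (Suc d) :: 'k poly set) = card (monics_below d :: 'k poly set) + q ^ d"
    by (simp only: card_monics_below q_card sum.lessThan_Suc)
  ultimately have "card (monics_below (Suc d) :: 'k poly set) mod 3 = (d mod 3 + 1) mod 3"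
    using Suc mod_add_eq[of "card (monics_below d :: 'k poly set)" 3 "q ^ d"] by simp
  then show ?case by (simp add: mod_Suc_eq)
qed (simp add: card_monics_below)

lemma cube_root_power_mod: "z ^ 3 = 1 \<Longrightarrow> z ^ n = z ^ (n mod 3)" for z :: complex
proof -
  assume z: "z ^ 3 = 1"
  have "z ^ n = z ^ (3 * (n div 3) + n mod 3)" by simp
  also have "\<dots> = z ^ (n mod 3)" by (simp only: power_add power_mult z power_one mult_1)
  finally show ?thesis .
qed

lemma J_const: "J F [:c:] = om c ^ degree F"
proof (cases "c = 0")
  case True
  show ?thesis
  proof (cases "degree F = 0")
    case True then show ?thesis by (simp add: J_def monics_below_eq)
  next
    case False
    then have "(1::'k poly) \<in> monics_below (degree F)" by (auto simp: monics_below_def)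
    then show ?thesis using True False unfolding J_def
      by (intro trans[OF prod_zero]) (auto intro!: bexI[of _ "1::'k poly"])
  qed
next
  case False
  have "om (lead_coeff (([:c:] * A) mod F)) = om c" if "A \<in> monics_below (degree F)" for A
    using that by (auto simp: monics_below_def mod_poly_less)
  then have "J F [:c:] = om c ^ card (monics_below (degree F) :: 'k poly set)"
    by (simp add: J_def)
  also have "\<dots> = om c ^ (degree F mod 3)"
    by (subst cube_root_power_mod[OF om_cube[OF False]]) (simp only: card_monics_below_mod3)
  also have "\<dots> = om c ^ degree F"
    by (rule cube_root_power_mod[OF om_cube[OF False], symmetric])
  finally show ?thesis .
qed

lemma J_smult: "F \<noteq> 0 \<Longrightarrow> J F (smult c f) = om c ^ degree F * J F f"
  using J_mult[of F "[:c:]" f] by (simp add: J_const)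
lemma J_minus [simp]: "F \<noteq> 0 \<Longrightarrow> J F (- f) = J F f"
  using J_smult[of F "-1" f] by simp

end

text \<open>Each shift by \<open>x\<close> leaves the total unchanged. Averaging over all
  \<open>x\<close> in \<open>below d\<close> replaces the terms by the vanishing local sums.\<close>

lemma sum_shift_vanish:
  fixes g :: "'k::{comm_ring_1,finite} poly \<Rightarrow> complex"
  assumes fin: "finite Z" and cl: "\<And>z x. z \<in> Z \<Longrightarrow> x \<in> below d \<Longrightarrow> z + x \<in> Z"
    and z: "\<And>z. z \<in> Z \<Longrightarrow> (\<Sum>x\<in>below d. g (z + x)) = 0"
  shows "(\<Sum>z\<in>Z. g z) = 0"
proof -
  have "(\<Sum>z\<in>Z. g z) = (\<Sum>z\<in>Z. g (z + x))" if x: "x \<in> below d" for x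
    by (rule sum.reindex_bij_witness[of _ "\<lambda>z. z + x" "\<lambda>z. z - x"])
       (use cl[OF _ x] cl[OF _ below_uminus[OF x]] in auto)
  then have "(\<Sum>x\<in>(below d :: 'k poly set). (\<Sum>z\<in>Z. g z)) = (\<Sum>x\<in>below d. \<Sum>z\<in>Z. g (z + x))"
    by (rule sum.cong[OF refl])
  also have "\<dots> = (\<Sum>z\<in>Z. \<Sum>x\<in>below d. g (z + x))" by (rule sum.swap)
  also have "\<dots> = 0" using z by simp
  finally show ?thesis by (auto simp: card_below)
qed

lemma lead_coeff_monics_div:
  fixes P Y :: "'k::field poly"
  assumes P: "P \<in> monics a" and Y: "Y \<in> monics n" and "a \<le> n"
  shows "Y div P \<in> monics (n - a)"
proof -
  have P0: "P \<noteq> 0" and dP: "degree P = a" using P monics_nz by (auto simp: monics_def)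
  have "Y mod P \<in> below n" using mod_below[OF P0, of Y] dP \<open>a \<le> n\<close> by (auto intro: below_mono)
  then have "Y - Y mod P \<in> monics n" using Y by (rule monics_diff_below[rotated])
  moreover have e: "Y - Y mod P = P * (Y div P)" by (simp add: minus_mod_eq_mult_div)
  ultimately have m: "P * (Y div P) \<in> monics n" by simp
  then have "Y div P \<noteq> 0" using monics_nz by fastforce
  then show ?thesis using m P P0 by (auto simp: monics_def degree_mult_eq coeff_mult_degree_sum)
qed

text \<open>Lagrange's bound for the number of roots in the residue field of \<open>P\<close>,
  phrased with representatives so that no quotient ring has to be formed. A root is split off by
  synthetic division.\<close>

lemma card_mod_roots_le:
  fixes P :: "'k::{field_gcd,finite} poly" and p :: "'k poly poly"
  assumes P: "prime_elem P" and "\<exists>i. \<not> P dvd coeff p i"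
  shows "card {x \<in> below (degree P). P dvd poly p x} \<le> degree p"
  using assms(2)
proof (induction "degree p" arbitrary: p rule: less_induct)
  case less
  show ?case
  proof (cases "\<exists>a\<in>below (degree P). P dvd poly p a")
    case False
    then have e: "{x \<in> below (degree P). P dvd poly p x} = {}" by auto
    show ?thesis unfolding e by simp
  next
    case True
    then obtain a where a: "a \<in> below (degree P)" "P dvd poly p a" by auto
    define s where "s = synthetic_div p a"
    have e: "p + smult a s = pCons (poly p a) s" unfolding s_def by (rule synthetic_div_correct)
    have ev: "poly p x = (x - a) * poly s x + poly p a" for x
      using arg_cong[OF e, of "\<lambda>p. poly p x"] by (simp add: algebra_simps)
    have dp: "degree p \<noteq> 0"
    proof
      assume "degree p = 0"
      then obtain c where c: "p = [:c:]" by (meson degree_eq_zeroE)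
      then show False using a(2) less(2) by (auto simp: coeff_pCons gr0_conv_Suc split: nat.splits)
    qed
    have ds: "degree s = degree p - 1" by (simp add: s_def degree_synthetic_div)
    \<comment> \<open>If \<open>P\<close> divided all coefficients of the quotient \<open>s\<close>,
      then by the division identity it would divide all coefficients of \<open>p\<close> as
      well.\<close>
    have "\<exists>i. \<not> P dvd coeff s i"
    proof (rule ccontr)
      assume h: "\<not> (\<exists>i. \<not> P dvd coeff s i)"
      have "P dvd coeff p i" for i
      proof -
        have "coeff p i = coeff (pCons (poly p a) s) i - a * coeff s i"
          using arg_cong[OF e, of "\<lambda>p. coeff p i"] by (simp add: algebra_simps)
        then show ?thesis using h a(2) by (auto simp: coeff_pCons split: nat.splits)
      qed
      then show False using less(2) by auto
    qed
    then have IH: "card {x \<in> below (degree P). P dvd poly s x} \<le> degree s"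
      using less(1)[of s] ds dp by auto
    have "{x \<in> below (degree P). P dvd poly p x} \<subseteq> insert a {x \<in> below (degree P). P dvd poly s x}"
    proof
      fix x assume x: "x \<in> {x \<in> below (degree P). P dvd poly p x}"
      then have "P dvd (x - a) * poly s x" using ev[of x] a(2) by (simp add: dvd_add_left_iff)
      then have "P dvd x - a \<or> P dvd poly s x" using P by (simp add: prime_elem_dvd_mult_iff)
      then show "x \<in> insert a {x \<in> below (degree P). P dvd poly s x}"
        using x a(1) below_dvd_0[of "x - a" P] below_diff[of x _ a] by auto
    qed
    then have "card {x \<in> below (degree P). P dvd poly p x} \<le> card (insert a {x \<in> below (degree P). P dvd poly s x})"
      by (intro card_mono) auto
    also have "\<dots> \<le> Suc (degree s)" using IH by (subst card_insert_if) auto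
    finally show ?thesis using ds dp by simp
  qed
qed

lemma monic_prime_divisor:
  fixes F :: "'k::field_gcd poly" assumes F0: "F \<noteq> 0" and "\<not> is_unit F"
  obtains P where "prime_elem P" "lead_coeff P = 1" "P dvd F"
proof -
  obtain P' where P': "P' dvd F" "prime_elem P'"
    using prime_divisor_exists[OF assms] prime_imp_prime_elem by blast
  define P where "P = smult (inverse (lead_coeff P')) P'"
  have P'0: "P' \<noteq> 0" using P' by auto
  have "lead_coeff P = 1" using P'0 by (simp add: P_def)
  moreover have "P dvd F" using P' P'0 by (simp add: P_def smult_dvd)
  moreover have "prime_elem P"
  proof -
    have "P = P' * [:inverse (lead_coeff P'):]" by (simp add: P_def)
    moreover have "is_unit [:inverse (lead_coeff P'):]" using P'0 by (simp add: is_unit_triv)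
    ultimately show ?thesis using P'(2) prime_elem_mult_unit_left by (metis mult.commute)
  qed
  ultimately show ?thesis using that by blast
qed

context cubic_char_field
begin

text \<open>Otherwise all \<open>q - 1\<close> nonzero constants would be roots of
  \<open>X^((q-1)/3) - 1\<close>.\<close>

lemma om_nontriv: "\<exists>x. x \<noteq> 0 \<and> om x \<noteq> 1"
proof (rule ccontr)
  assume "\<not> ?thesis"
  then have h: "x ^ ((q - 1) div 3) = 1" if "x \<noteq> 0" for x :: 'k using om_ker that by auto
  define e where "e = (q - 1) div 3"
  have e: "0 < e" "e < q - 1" using q_ge q6 unfolding e_def by presburger+
  define p :: "'k poly" where "p = monom 1 e - 1"
  have "coeff p e = 1" using e by (simp add: p_def)
  then have p0: "p \<noteq> 0" by auto
  have "degree p \<le> e" unfolding p_def by (rule degree_diff_le) (auto simp: degree_monom_le)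
  have "UNIV - {0} \<subseteq> {x. poly p x = 0}" using h by (auto simp: p_def poly_monom e_def)
  then have "card (UNIV - {0 :: 'k}) \<le> card {x. poly p x = 0}" by (intro card_mono) auto
  also have "\<dots> \<le> degree p" by (rule card_poly_roots_bound[OF p0])
  finally show False using \<open>degree p \<le> e\<close> e q_card by (simp add: card_Diff_singleton)
qed

text \<open>Scaling \<open>E\<close> by the inverse square of its leading coefficient is an
  involution that inverts this coefficient. Since \<open>om\<close> of an inverse is the square of
  \<open>om\<close>, the product \<open>Y\<close> equals \<open>Y^2\<close>.\<close>

lemma prod_om_below: "(\<Prod>E\<in>below k - {0}. om (lead_coeff E)) = 1"
proof -
  define Y where "Y = (\<Prod>E\<in>below k - {0}. om (lead_coeff E))"
  define h where "h = (\<lambda>E :: 'k poly. smult (inverse (lead_coeff E) ^ 2) E)"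
  have lc: "lead_coeff (h E) = inverse (lead_coeff E)" if "E \<noteq> 0" for E
    using that by (simp add: h_def power2_eq_square)
  have hG: "h G = smult (inverse (lead_coeff G) ^ 2) G" for G by (simp add: h_def)
  have hh: "h (h E) = E" if "E \<noteq> 0" for E
    unfolding hG[of "h E"] lc[OF that] using that by (simp add: hG power2_eq_square field_simps)
  have "Y = (\<Prod>E\<in>below k - {0}. om (lead_coeff (h E)))"
    unfolding Y_def
    by (rule prod.reindex_bij_witness[of _ h h]) (auto simp: hh, auto simp: h_def below_smult)
  also have "\<dots> = (\<Prod>E\<in>below k - {0}. om (lead_coeff E) ^ 2)"
    by (rule prod.cong) (auto simp: lc om_inverse)
  also have "\<dots> = Y ^ 2" by (simp add: Y_def prod_power_distrib)
  finally have "Y = Y ^ 2" .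
  moreover have "Y \<noteq> 0" by (auto simp: Y_def)
  ultimately show ?thesis by (simp add: Y_def power2_eq_square)
qed

text \<open>In the Gauss products of both symbols the same remainders occur, up to sign: writing
  \<open>Q * A = P * B\<^sub>0 + R\<^sub>0\<close>, the multipliers \<open>B\<close> of \<open>P\<close> are \<open>B\<^sub>0 - E\<close> with \<open>degree E < b - a\<close>, and those with
  \<open>E \<noteq> 0\<close> contribute a product over all leading coefficients, which is 1.\<close>

lemma J_recip_le:
  assumes P: "P \<in> monics a" and Q: "Q \<in> monics b" and "a \<le> b"
  shows "J Q P = J P Q"
proof -
  have P0: "P \<noteq> 0" "degree P = a" and Q0: "Q \<noteq> 0" "degree Q = b"
    using P Q monics_nz by (auto simp: monics_def)
  define B0 where "B0 = (\<lambda>A. (Q * A) div P)"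
  define R0 where "R0 = (\<lambda>A. (Q * A) mod P)"
  have QA: "Q * A = P * B0 A + R0 A" for A by (simp add: B0_def R0_def)
  have R0: "R0 A \<in> below a" for A using mod_below[OF P0(1)] P0 by (auto simp: R0_def)
  define g where "g = (\<lambda>(A, E). B0 A - E)"
  let ?D = "monics_below a \<times> below (b - a)"
  have B0m: "B0 A \<in> monics (b + \<alpha> - a)" if "A \<in> monics \<alpha>" for A \<alpha>
    unfolding B0_def using lead_coeff_monics_div[OF P monics_mult[OF Q that]] \<open>a \<le> b\<close> by simp
  have gm: "B0 A - E \<in> monics (b + \<alpha> - a)" if "A \<in> monics \<alpha>" "E \<in> below (b - a)" for A E \<alpha>
    using B0m[OF that(1)] that(2) by (auto intro!: monics_diff_below intro: below_mono)
  have PE: "P * E \<in> below b" if "E \<in> below (b - a)" for E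
    using below_mult[OF that P0(1), of a] P0 \<open>a \<le> b\<close> by (simp add: mult.commute)
  \<comment> \<open>Up to a multiple of \<open>Q\<close>, \<open>P * (B0 A - E)\<close> is
    \<open>- (R0 A + P * E)\<close>, and the degree of the latter is already below
    \<open>b\<close>.\<close>
  have rem: "(P * (B0 A - E)) mod Q = - (R0 A + P * E)" if "E \<in> below (b - a)" for A E
  proof (rule mod_eq_below_unique)
    have "P * (B0 A - E) - - (R0 A + P * E) = Q * A" using QA[of A] by (simp add: algebra_simps)
    then show "Q dvd P * (B0 A - E) - - (R0 A + P * E)" by simp
    show "- (R0 A + P * E) \<in> below (degree Q)" unfolding Q0
      using R0 PE[OF that] \<open>a \<le> b\<close> by (intro below_uminus below_add) (auto intro: below_mono)
  qed
  have remom: "om (lead_coeff ((P * (B0 A - E)) mod Q)) = om (lead_coeff (R0 A + P * E))"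
    if "E \<in> below (b - a)" for A E
    by (simp only: rem[OF that] lead_coeff_minus om_minus)
  have quo: "(P * (B0 A - E)) div Q = A" if "E \<in> below (b - a)" for A E
  proof -
    have "Q * ((P * (B0 A - E)) div Q) = P * (B0 A - E) - (P * (B0 A - E)) mod Q"
      by (simp add: minus_mod_eq_mult_div)
    also have "\<dots> = Q * A" unfolding rem[OF that] using QA[of A] by (simp add: algebra_simps)
    finally show ?thesis using Q0 by simp
  qed
  have inj: "inj_on g ?D"
  proof (rule inj_onI, clarsimp simp: g_def)
    fix A E A' E' assume E: "E \<in> below (b - a)" "E' \<in> below (b - a)" and e: "B0 A - E = B0 A' - E'"
    have "A = A'" using quo[OF E(1), of A] quo[OF E(2), of A'] e by simp
    then show "A = A' \<and> E = E'" using e by simp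
  qed
  \<comment> \<open>For the converse, a multiplier \<open>B\<close> of degree at least
    \<open>b - a\<close> determines \<open>A\<close> as the quotient of \<open>P * B\<close> by
    \<open>Q\<close>. The degree of \<open>E = B0 A - B\<close> is then bounded because
    \<open>P * E\<close> is a combination of two remainders.\<close>
  have img: "g ` ?D = (monics_below b - monics_below (b - a) :: 'k poly set)"
  proof (intro equalityI subsetI)
    fix B assume "B \<in> g ` ?D"
    then obtain A E where AE: "A \<in> monics_below a" "E \<in> below (b - a)" "B = B0 A - E"
      by (auto simp: g_def)
    have "B \<in> monics (b + degree A - a)"
      using gm[of A "degree A" E] AE by (auto simp: monics_def monics_below_def)
    then show "B \<in> monics_below b - monics_below (b - a)"
      using AE(1) \<open>a \<le> b\<close> by (auto simp: monics_def monics_below_def)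
  next
    fix B :: "'k poly" assume "B \<in> monics_below b - monics_below (b - a)"
    then have B: "B \<in> monics (degree B)" "degree B < b" "b - a \<le> degree B"
      by (auto simp: monics_def monics_below_def)
    define A where "A = (P * B) div Q"
    define \<alpha> where "\<alpha> = a + degree B - b"
    have A: "A \<in> monics \<alpha>" unfolding A_def \<alpha>_def
      using lead_coeff_monics_div[OF Q monics_mult[OF P B(1)]] B by simp
    define E where "E = B0 A - B"
    have "P * E = - R0 A - (P * B) mod Q"
      using QA[of A] minus_mod_eq_mult_div[of "P*B" Q] by (simp add: E_def A_def algebra_simps)
    moreover have "- R0 A - (P * B) mod Q \<in> below b"
      using R0 mod_below[OF Q0(1)] Q0 \<open>a \<le> b\<close> by (intro below_diff below_uminus) (auto intro: below_mono)
    ultimately have "P * E \<in> below b" by simp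
    then have "E \<in> below (b - a)"
      using P0 by (cases "E = 0") (auto simp: below_def degree_mult_eq)
    moreover have "A \<in> monics_below a" using A B by (auto simp: monics_def monics_below_def \<alpha>_def)
    ultimately show "B \<in> g ` ?D" by (intro image_eqI[of _ _ "(A, E)"]) (auto simp: g_def E_def)
  qed
  \<comment> \<open>These multipliers are too small for a reduction: \<open>P * B\<close> is monic
    and is its own remainder modulo \<open>Q\<close>.\<close>
  have small: "om (lead_coeff ((P * B) mod Q)) = 1" if "B \<in> monics_below (b - a)" for B
  proof -
    have m: "P * B \<in> monics (a + degree B)" using that by (intro monics_mult[OF P]) (auto simp: monics_def monics_below_def)
    then have "(P * B) mod Q = P * B"
      using that Q0 by (intro mod_poly_less) (auto simp: monics_def monics_below_def)
    then show ?thesis using m by (auto simp: monics_def)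
  qed
  have sub: "monics_below (b - a) \<subseteq> (monics_below b :: 'k poly set)" by (auto simp: monics_below_def)
  have "J Q P = (\<Prod>B\<in>monics_below (b - a). om (lead_coeff ((P * B) mod Q))) *
                (\<Prod>B\<in>monics_below b - monics_below (b - a). om (lead_coeff ((P * B) mod Q)))"
    unfolding J_def Q0 by (subst mult.commute, rule prod.subset_diff[OF sub]) simp
  also have "(\<Prod>B\<in>monics_below (b - a). om (lead_coeff ((P * B) mod Q))) = 1"
    using small by (intro prod.neutral) auto
  also have "(\<Prod>B\<in>monics_below b - monics_below (b - a). om (lead_coeff ((P * B) mod Q))) =
     (\<Prod>(A,E)\<in>?D. om (lead_coeff (R0 A + P * E)))"
    unfolding img[symmetric] prod.reindex[OF inj]
    by (intro prod.cong) (auto simp: g_def remom)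
  also have "\<dots> = (\<Prod>A\<in>monics_below a. \<Prod>E\<in>below (b - a). om (lead_coeff (R0 A + P * E)))"
    by (simp add: prod.cartesian_product)
  also have "\<dots> = (\<Prod>A\<in>monics_below a. om (lead_coeff (R0 A)))"
  proof (intro prod.cong refl)
    fix A
    \<comment> \<open>For nonzero \<open>E\<close> the term \<open>P * E\<close> has degree at least
      \<open>a\<close> and dominates \<open>R0 A\<close>.\<close>
    have "lead_coeff (R0 A + P * E) = lead_coeff E" if "E \<in> below (b - a) - {0}" for E
    proof -
      have "degree (P * E) = a + degree E" using that P0 by (auto simp: degree_mult_eq)
      then have "degree (R0 A) < degree (P * E) \<or> R0 A = 0" using R0[of A] by (auto simp: below_def)
      then have "lead_coeff (R0 A + P * E) = lead_coeff (P * E)" using lead_coeff_add_le by fastforce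
      also have "\<dots> = lead_coeff P * lead_coeff E" by (rule lead_coeff_mult)
      also have "lead_coeff P = 1" using P unfolding monics_def by blast
      finally show ?thesis by simp
    qed
    then have "(\<Prod>E\<in>below (b - a) - {0}. om (lead_coeff (R0 A + P * E))) = 1"
      using prod_om_below[of "b - a"] by simp
    moreover have "(\<Prod>E\<in>below (b - a). om (lead_coeff (R0 A + P * E))) =
      om (lead_coeff (R0 A + P * 0)) * (\<Prod>E\<in>below (b - a) - {0}. om (lead_coeff (R0 A + P * E)))"
      by (rule prod.remove) auto
    ultimately show "(\<Prod>E\<in>below (b - a). om (lead_coeff (R0 A + P * E))) = om (lead_coeff (R0 A))"
      by simp
  qed
  also have "\<dots> = J P Q" by (simp add: J_def P0 R0_def)
  finally show ?thesis by simp
qed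

lemma J_recip: assumes "lead_coeff P = 1" "lead_coeff Q = 1" shows "J P Q = J Q P"
  using J_recip_le[of P "degree P" Q "degree Q"] J_recip_le[of Q "degree Q" P "degree P"] assms
  by (cases "degree P \<le> degree Q") (auto simp: monics_def)

lemma J_0: "degree F \<noteq> 0 \<Longrightarrow> J F 0 = 0"
  by (cases "F = 0") (auto simp: is_unit_iff_degree intro!: J_eq_0)

text \<open>Reciprocity turns multiplicativity in the argument into multiplicativity in the modulus.
  It needs a monic argument, hence the scaling of \<open>f\<close> and the separate case
  \<open>f = 0\<close>.\<close>

lemma J_mult_left:
  assumes F: "lead_coeff F = 1" and G: "lead_coeff G = 1"
  shows "J (F * G) f = J F f * J G f"
proof (cases "f = 0")
  case True
  have FG: "F \<noteq> 0" "G \<noteq> 0" using F G by auto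
  show ?thesis
  proof (cases "degree F = 0 \<or> degree G = 0")
    case True
    then have "F = 1 \<or> G = 1" using F G by (metis degree_eq_zeroE lead_coeff_pCons(2) one_pCons)
    then show ?thesis by auto
  next
    case False
    then show ?thesis using True \<open>f = 0\<close> FG J_0[of "F * G"] J_0[of F] by (simp add: degree_mult_eq)
  qed
next
  case False
  define c where "c = lead_coeff f"
  define h where "h = smult (inverse c) f"
  have h: "f = smult c h" "lead_coeff h = 1" "h \<noteq> 0" using False by (auto simp: h_def c_def)
  have nz: "F \<noteq> 0" "G \<noteq> 0" using F G by auto
  have "J (F * G) h = J h (F * G)" using F G h by (intro J_recip) (auto simp: lead_coeff_mult)
  also have "\<dots> = J h F * J h G" using h by (intro J_mult) auto
  also have "\<dots> = J F h * J G h" using F G h by (simp add: J_recip)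
  finally show ?thesis using nz by (simp add: h(1) J_smult degree_mult_eq power_add)
qed

lemma J_power_left: "lead_coeff F = 1 \<Longrightarrow> J (F ^ n) f = J F f ^ n"
  by (induction n) (auto simp: J_mult_left lead_coeff_power)

text \<open>The lemma of Gauss: comparing the products of all \<open>f * A\<close> and of all
  \<open>A\<close> modulo \<open>P\<close> gives \<open>f^M = c\<close> with
  \<open>M = (q^d - 1) / (q - 1)\<close>, where \<open>d\<close> is the degree of \<open>P\<close>.
  So \<open>c\<close> is the norm of \<open>f\<close> from the residue field to the
  constants.\<close>

lemma J_prime_power:
  assumes P: "prime_elem P" and f: "\<not> P dvd f"
  obtains c where "c \<noteq> 0" "P dvd f ^ card (monics_below (degree P) :: 'k poly set) - [:c:]" "J P f = om c"
proof -
  have P0: "P \<noteq> 0" using P by auto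
  have cop: "coprime P f" using P f by (simp add: prime_elem_imp_coprime)
  let ?S = "monics_below (degree P) :: 'k poly set"
  define r where "r = (\<lambda>A. (f * A) mod P)"
  define h where "h = (\<lambda>A. smult (inverse (lead_coeff (r A))) (r A))"
  have r0: "r A \<noteq> 0" if "A \<in> ?S" for A using gauss_perm(1)[OF P0 cop that] by (simp add: r_def)
  have bij: "bij_betw h ?S ?S" using gauss_perm(2)[OF P0 cop] by (simp add: h_def r_def)
  define c where "c = (\<Prod>A\<in>?S. lead_coeff (r A))"
  have rh: "r A = [:lead_coeff (r A):] * h A" if "A \<in> ?S" for A using r0[OF that] by (simp add: h_def)
  have pc: "(\<Prod>A\<in>?S. [:lead_coeff (r A):]) = [:c:]"
    unfolding c_def by (induction rule: finite_induct[OF finite_monics_below]) (auto simp: one_pCons)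
  have "(\<Prod>A\<in>?S. f * A) mod P = (\<Prod>A\<in>?S. r A) mod P"
    unfolding r_def by (simp add: mod_prod_eq)
  also have "(\<Prod>A\<in>?S. r A) = [:c:] * (\<Prod>A\<in>?S. h A)"
    unfolding pc[symmetric] prod.distrib[symmetric] by (rule prod.cong) (use rh in auto)
  also have "(\<Prod>A\<in>?S. h A) = (\<Prod>A\<in>?S. A)" by (rule prod.reindex_bij_betw[OF bij])
  finally have "P dvd (\<Prod>A\<in>?S. f * A) - [:c:] * (\<Prod>A\<in>?S. A)" by (rule mod_eq_dvd)
  then have "P dvd (f ^ card ?S - [:c:]) * (\<Prod>A\<in>?S. A)"
    by (simp add: prod.distrib algebra_simps)
  moreover have "\<not> P dvd (\<Prod>A\<in>?S. A)"
  proof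
    assume "P dvd (\<Prod>A\<in>?S. A)"
    moreover have "\<exists>A\<in>S. P dvd A" if "finite S" "P dvd (\<Prod>A\<in>S. A)" for S
      using that by (induction S) (use P in \<open>auto simp: prime_elem_dvd_mult_iff prime_elem_def\<close>)
    ultimately obtain A where "A \<in> ?S" "P dvd A" by (meson finite_monics_below)
    then show False using below_dvd_0[of A P] monics_below_nz[of A] by (auto simp: below_def monics_below_def)
  qed
  ultimately have "P dvd f ^ card ?S - [:c:]" using P by (simp add: prime_elem_dvd_mult_iff)
  moreover have "c \<noteq> 0" using r0 by (auto simp: c_def)
  moreover have "J P f = om c"
  proof -
    have "om (\<Prod>A\<in>S. lead_coeff (r A)) = (\<Prod>A\<in>S. om (lead_coeff (r A)))" if "finite S" for S
      using that by induction (auto simp: om_mult)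
    then show ?thesis by (simp add: c_def J_def r_def)
  qed
  ultimately show ?thesis using that by blast
qed

lemma card_monics_below_mult: "card (monics_below d :: 'k poly set) * (q - 1) = q ^ d - 1"
proof (induction d)
  case (Suc d)
  have "q ^ d \<ge> 1" using q_ge by (simp add: Suc_leI)
  then show ?case using Suc q_ge by (simp add: card_monics_below q_card algebra_simps diff_mult_distrib2)
qed (simp add: card_monics_below)

text \<open>If the symbol were trivial, all \<open>q^d - 1\<close> nonzero residues would be roots
  of \<open>X^(M * e) - 1\<close>, whose degree is a third of that number.\<close>

lemma J_prime_nontriv:
  assumes P: "prime_elem P" obtains f where "coprime P f" "J P f \<noteq> 1"
proof -
  have "\<exists>f. coprime P f \<and> J P f \<noteq> 1"
  proof (rule ccontr)
    assume h: "\<not> ?thesis"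
    define M where "M = card (monics_below (degree P) :: 'k poly set)"
    define e where "e = (q - 1) div 3"
    define p :: "'k poly poly" where "p = monom 1 (M * e) - 1"
    have P0: "P \<noteq> 0" "\<not> is_unit P" using P by (auto simp: prime_elem_def)
    then have dP: "degree P > 0" by (simp add: is_unit_iff_degree)
    have e3: "e * 3 = q - 1" using q6 q_ge unfolding e_def by presburger
    then have e0: "e > 0" using q_ge by simp
    have "(1 :: 'k poly) \<in> monics_below (degree P)" using dP by (simp add: monics_below_def)
    then have M0: "M > 0" unfolding M_def card_gt_0_iff by (metis empty_iff finite_monics_below)
    have "coeff p (M * e) = 1" using e0 M0 by (simp add: p_def)
    then have 1: "\<exists>i. \<not> P dvd coeff p i" using P0 by metis
    have "below (degree P) - {0} \<subseteq> {x \<in> below (degree P). P dvd poly p x}"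
    proof
      fix x :: "'k poly" assume x: "x \<in> below (degree P) - {0}"
      then have nd: "\<not> P dvd x" using below_dvd_0 by blast
      obtain c where c: "c \<noteq> 0" "P dvd x ^ M - [:c:]" "J P x = om c" using J_prime_power[OF P nd] unfolding M_def by metis
      have "om c = 1" using h c nd P by (metis prime_elem_imp_coprime)
      then have "c ^ e = 1" using om_ker by (simp add: e_def)
      then have "[:c:] ^ e = 1" by (simp add: poly_const_pow one_pCons)
      moreover have "x ^ M mod P = [:c:] mod P" using c(2) by (simp add: mod_eq_dvd_iff)
      then have "(x ^ M) ^ e mod P = [:c:] ^ e mod P" by (metis power_mod)
      ultimately have "P dvd (x ^ M) ^ e - 1" by (metis mod_eq_dvd_iff)
      then show "x \<in> {x \<in> below (degree P). P dvd poly p x}"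
        using x by (simp add: p_def poly_monom power_mult)
    qed
    then have "card (below (degree P) - {0 :: 'k poly}) \<le> card {x \<in> below (degree P). P dvd poly p x}"
      by (intro card_mono) auto
    also have "\<dots> \<le> degree p" by (rule card_mod_roots_le[OF P 1])
    also have "\<dots> \<le> M * e" unfolding p_def by (rule degree_diff_le) (auto simp: degree_monom_le)
    finally have "q ^ degree P - 1 \<le> M * e" by (simp add: card_Diff_singleton card_below q_card)
    moreover have "M * e * 3 = q ^ degree P - 1" using card_monics_below_mult[of "degree P"] e3 by (simp add: mult.assoc M_def)
    moreover have "M * e > 0" using M0 e0 by simp
    ultimately show False by linarith
  qed
  then show ?thesis using that by blast
qed

definition cube_poly :: "'k poly \<Rightarrow> bool" where
  "cube_poly F \<longleftrightarrow> (\<exists>H. lead_coeff H = 1 \<and> F = H ^ 3)"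

text \<open>A prime whose exact exponent is divisible by 3 can be removed without making the rest a
  cube, so induction on the degree reaches a prime with a good exponent.\<close>

lemma noncube_prime:
  assumes "lead_coeff F = 1" "\<not> cube_poly F"
  obtains P e G where "prime_elem P" "lead_coeff P = 1" "\<not> 3 dvd e" "\<not> P dvd G" "lead_coeff G = 1" "F = P ^ e * G"
proof -
  have "\<exists>P e G. prime_elem P \<and> lead_coeff P = 1 \<and> \<not> 3 dvd e \<and> \<not> P dvd G \<and> lead_coeff G = 1 \<and> F = P ^ e * G"
    using assms
  proof (induction "degree F" arbitrary: F rule: less_induct)
    case less
    have F0: "F \<noteq> 0" using less by auto
    have "F \<noteq> 1" using less(3) unfolding cube_poly_def by (metis lead_coeff_1 power_one)
    then have "\<not> is_unit F" using less(2)
      by (metis degree_eq_zeroE is_unit_iff_degree F0 lead_coeff_pCons(2) one_pCons)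
    then obtain P where P: "prime_elem P" "lead_coeff P = 1" "P dvd F" by (rule monic_prime_divisor[OF F0])
    have P0: "P \<noteq> 0" "\<not> is_unit P" using P by (auto simp: prime_elem_def)
    obtain G where G: "F = P ^ multiplicity P F * G" "\<not> P dvd G"
      using multiplicity_decompose'[OF F0 P0(2)] by metis
    define e where "e = multiplicity P F"
    have lG: "lead_coeff G = 1" using arg_cong[OF G(1), of lead_coeff] less(2) P by (simp add: lead_coeff_mult lead_coeff_power)
    have e0: "e > 0" unfolding e_def using multiplicity_gt_zero_iff[OF F0 P0(2)] P(3) by simp
    show ?case
    proof (cases "3 dvd e")
      case False
      then show ?thesis using P G lG by (auto simp: e_def)
    next
      case True
      then obtain k where k: "e = k * 3" by (auto elim: dvdE)
      have nc: "\<not> cube_poly G"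
      proof
        assume "cube_poly G"
        then obtain H where H: "lead_coeff H = 1" "G = H ^ 3" by (auto simp: cube_poly_def)
        have "F = (P ^ k * H) ^ 3" using G(1) H k by (simp add: e_def power_mult power_mult_distrib)
        moreover have "lead_coeff (P ^ k * H) = 1" using P H by (simp add: lead_coeff_mult lead_coeff_power)
        ultimately show False using less(3) by (auto simp: cube_poly_def)
      qed
      have G0: "G \<noteq> 0" using lG by auto
      have dP: "degree P > 0" using P0 by (simp add: is_unit_iff_degree)
      have "degree F = e * degree P + degree G"
        by (subst G(1)) (use P0 G0 in \<open>simp add: degree_mult_eq degree_power_eq e_def\<close>)
      then have "degree G < degree F" using e0 dP by simp
      from less(1)[OF this lG nc] obtain P2 e2 G2 where h: "prime_elem P2" "lead_coeff P2 = 1" "\<not> 3 dvd e2"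
        "\<not> P2 dvd G2" "lead_coeff G2 = 1" "G = P2 ^ e2 * G2" by auto
      have "\<not> P2 dvd P ^ e"
      proof
        assume "P2 dvd P ^ e"
        then have "P2 dvd P" using h(1) prime_elem_dvd_power by blast
        then have "P dvd P2"
          using irreducibleD'[OF prime_elem_imp_irreducible[OF P(1)], of P2] prime_elem_not_unit[OF h(1)] by blast
        moreover have "e2 \<noteq> 0" using h(3) by (metis dvd_0_right)
        then have "P2 dvd P2 ^ e2" by simp
        then have "P2 dvd G" using h(6) by simp
        ultimately show False using G(2) by (meson dvd_trans)
      qed
      then have "\<not> P2 dvd P ^ e * G2" using h(1,4) by (simp add: prime_elem_dvd_mult_iff)
      moreover have "lead_coeff (P ^ e * G2) = 1" using P h by (simp add: lead_coeff_mult lead_coeff_power)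
      moreover have "F = P2 ^ e2 * (P ^ e * G2)" using G(1) h(6) by (simp add: e_def mult_ac)
      ultimately show ?thesis using h by blast
    qed
  qed
  then show ?thesis using that by blast
qed

text \<open>With \<open>F = P^e * G\<close> as above, the Chinese remainder theorem provides
  \<open>f\<close> congruent to 1 modulo \<open>G\<close> and to some \<open>a\<close> with
  nontrivial symbol modulo \<open>P\<close>. Its symbol is \<open>J P a ^ e\<close>, which is not 1
  because 3 does not divide \<open>e\<close>.\<close>

lemma J_nontriv:
  assumes F: "lead_coeff F = 1" "\<not> cube_poly F" obtains f where "coprime F f" "J F f \<noteq> 1"
proof -
  obtain P e G where h: "prime_elem P" "lead_coeff P = 1" "\<not> 3 dvd e" "\<not> P dvd G" "lead_coeff G = 1" "F = P ^ e * G"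
    using noncube_prime[OF F] .
  obtain a where a: "coprime P a" "J P a \<noteq> 1" using J_prime_nontriv[OF h(1)] .
  have P0: "P \<noteq> 0" using h(1) by auto
  have G0: "G \<noteq> 0" using h(5) by auto
  have "coprime G P" using h(1,4) by (metis coprime_commute prime_elem_imp_coprime)
  then obtain d where d: "P dvd G * d - 1" using coprime_inverse_mod by metis
  define f where "f = 1 + G * d * (a - 1)"
  have "f - a = (G * d - 1) * (a - 1)" by (simp add: f_def algebra_simps)
  then have fa: "P dvd f - a" using d by simp
  have f1: "G dvd f - 1" by (simp add: f_def)
  have "J F f = J P f ^ e * J G f" using h by (simp add: J_mult_left J_power_left lead_coeff_power)
  also have "J G f = 1" using J_cong[OF f1] by simp
  also have "J P f = J P a" by (rule J_cong[OF fa])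
  finally have e: "J F f = J P a ^ e" by simp
  have c3: "J P a ^ 3 = 1" using J_cube[OF P0 a(1)] .
  have "J P a ^ e \<noteq> 1"
  proof -
    have "e mod 3 = 1 \<or> e mod 3 = 2" using h(3) by (simp add: dvd_eq_mod_eq_0) linarith
    moreover have "J P a ^ 2 \<noteq> 1" using c3 a(2) by (auto simp: power3_eq_cube power2_eq_square)
    ultimately show ?thesis using cube_root_power_mod[OF c3, of e] a(2) by auto
  qed
  moreover have "coprime F f" using e J_coprime_nz[OF P0 a(1)] J_eq_0[of F f] F by fastforce
  ultimately show ?thesis using that e by metis
qed

text \<open>Orthogonality: multiplication by a residue \<open>c\<close> with
  \<open>J F c \<noteq> 1\<close> permutes the residues and multiplies the sum by
  \<open>J F c\<close>.\<close>

lemma sum_J_complete: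
  assumes F: "lead_coeff F = 1" "\<not> cube_poly F"
  shows "(\<Sum>x\<in>below (degree F). J F (x0 + x)) = 0"
proof -
  have F0: "F \<noteq> 0" using F by auto
  have "(\<Sum>x\<in>below (degree F). J F (x0 + x)) = (\<Sum>x\<in>below (degree F). J F ((x0 + x) mod F))"
    by (simp add: J_mod)
  also have "\<dots> = (\<Sum>x\<in>below (degree F). J F x)" by (rule sum.reindex_bij_betw[OF bij_shift_mod[OF F0]])
  finally have 1: "(\<Sum>x\<in>below (degree F). J F (x0 + x)) = (\<Sum>x\<in>below (degree F). J F x)" .
  obtain c where c: "coprime F c" "J F c \<noteq> 1" using J_nontriv[OF F] .
  have "(\<Sum>x\<in>below (degree F). J F x) = (\<Sum>x\<in>below (degree F). J F ((c * x) mod F))"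
    by (rule sum.reindex_bij_betw[OF bij_mult_mod[OF F0], symmetric]) (use c in \<open>simp add: coprime_commute\<close>)
  also have "\<dots> = J F c * (\<Sum>x\<in>below (degree F). J F x)"
    by (simp add: J_mod J_mult[OF F0] sum_distrib_left)
  finally show ?thesis using c(2) 1 by simp
qed

end

section \<open>Additive characters and Gauss sums\<close>

lemma subgroup_multiple:
  fixes H :: "'k::comm_ring_1 set"
  assumes "0 \<in> H" "\<And>a b. a \<in> H \<Longrightarrow> b \<in> H \<Longrightarrow> a - b \<in> H" "h \<in> H"
  shows "of_int k * h \<in> H"
proof (induction k rule: int_induct[where k = 0])
  case base then show ?case using assms by simp
next
  case (step1 i)
  have "of_int (i + 1) * h = of_int i * h - (0 - h)" by (simp add: algebra_simps)
  then show ?case using assms step1 by metis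
next
  case (step2 i)
  have "of_int (i - 1) * h = of_int i * h - h" by (simp add: algebra_simps)
  then show ?case using assms step2 by metis
qed

text \<open>Modulo a maximal proper additive subgroup \<open>H\<close> the field is cyclic,
  generated by any \<open>x\<close> outside \<open>H\<close>. The character sends
  \<open>j * x + H\<close> to the \<open>j\<close>-th power of a root of unity of order
  \<open>p\<close>, the order of \<open>x\<close> modulo \<open>H\<close>.\<close>

lemma additive_char_exists:
  "\<exists>psi :: 'k::{field,finite} \<Rightarrow> complex. (\<forall>x y. psi (x + y) = psi x * psi y) \<and>
     (\<forall>x. cmod (psi x) = 1) \<and> (\<exists>x. psi x \<noteq> 1)"
proof -
  define S where "S = {H :: 'k set. 0 \<in> H \<and> (\<forall>a\<in>H. \<forall>b\<in>H. a - b \<in> H) \<and> H \<noteq> UNIV}"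
  have "{0 :: 'k} \<noteq> UNIV" by (metis UNIV_I singletonD zero_neq_one)
  then have "{0} \<in> S" by (simp add: S_def)
  then have "Max (card ` S) \<in> card ` S" by (intro Max_in) auto
  then obtain H where H: "H \<in> S" and cH: "card H = Max (card ` S)" by auto
  have mx: "card H' \<le> card H" if "H' \<in> S" for H' unfolding cH using that by (intro Max_ge) auto
  have H0: "0 \<in> H" and Hd: "\<And>a b. a \<in> H \<Longrightarrow> b \<in> H \<Longrightarrow> a - b \<in> H" and "H \<noteq> UNIV"
    using H by (auto simp: S_def)
  have Hm: "of_int k * h \<in> H" if "h \<in> H" for k h by (rule subgroup_multiple[OF H0 Hd that])
  have Ha: "a + b \<in> H" if "a \<in> H" "b \<in> H" for a b
    using Hd[OF that(1) Hd[OF H0 that(2)]] by simp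
  obtain x where x: "x \<notin> H" using \<open>H \<noteq> UNIV\<close> by auto
  \<comment> \<open>\<open>K\<close> is the subgroup generated by \<open>H\<close> and
    \<open>x\<close>; maximality of \<open>H\<close> makes it the whole field.\<close>
  define K where "K = {y. \<exists>j. y - of_int j * x \<in> H}"
  have KU: "K = UNIV"
  proof (rule ccontr)
    assume "K \<noteq> UNIV"
    moreover have "0 \<in> K" using H0 by (auto simp: K_def intro: exI[of _ 0])
    moreover have "a - b \<in> K" if ab: "a \<in> K" "b \<in> K" for a b
    proof -
      obtain i j where "a - of_int i * x \<in> H" "b - of_int j * x \<in> H" using ab unfolding K_def by blast
      then have "(a - of_int i * x) - (b - of_int j * x) \<in> H" by (rule Hd)
      then have "(a - b) - of_int (i - j) * x \<in> H" by (simp add: algebra_simps)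
      then show ?thesis unfolding K_def by blast
    qed
    ultimately have "K \<in> S" by (simp add: S_def)
    then have "card K \<le> card H" by (rule mx)
    moreover have "H \<subset> K"
    proof -
      have "H \<subseteq> K" by (auto simp: K_def intro: exI[of _ 0])
      moreover have "x \<in> K" using H0 by (auto simp: K_def intro: exI[of _ 1])
      ultimately show ?thesis using x by auto
    qed
    ultimately show False using psubset_card_mono[of K H] by simp
  qed
  define p where "p = (LEAST p. 0 < p \<and> of_nat p * x \<in> H)"
  have "CHAR('k) > 0" by (rule finite_imp_CHAR_pos) simp
  then have "0 < CHAR('k) \<and> of_nat CHAR('k) * x \<in> H" using H0 by simp
  then have p: "0 < p" "of_nat p * x \<in> H" unfolding p_def by (metis (mono_tags, lifting) LeastI)+
  have pl: "p \<le> j" if "0 < j" "of_nat j * x \<in> H" for j unfolding p_def using that by (simp add: Least_le)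
  have p1: "p \<noteq> 1" using p(2) x by (intro notI) simp
  \<comment> \<open>The remainder of \<open>j\<close> modulo \<open>p\<close> also brings
    \<open>x\<close> into \<open>H\<close>, so by minimality of \<open>p\<close> it is 0. This makes
    the value at \<open>y\<close> independent of the choice of \<open>j\<close>.\<close>
  have pd: "int p dvd j" if "of_int j * x \<in> H" for j
  proof -
    have "of_int (j mod int p) * x = of_int j * x - of_int (j div int p) * (of_nat p * x)"
    proof -
      have "(of_int j :: 'k) = of_int (j div int p * int p + j mod int p)" by simp
      also have "\<dots> = of_int (j div int p) * of_nat p + of_int (j mod int p)"
        by (simp only: of_int_add of_int_mult of_int_of_nat_eq)
      finally show ?thesis by (simp add: algebra_simps)
    qed
    then have jH: "of_int (j mod int p) * x \<in> H" using Hd[OF that Hm[OF p(2)]] by simp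
    define r where "r = nat (j mod int p)"
    have rj: "j mod int p = int r" using p(1) by (simp add: r_def)
    have "of_nat r * x \<in> H" using jH unfolding rj by simp
    moreover have "r < p" using pos_mod_bound[of "int p" j] p(1) unfolding rj by simp
    ultimately have "r = 0" using pl[of r] by auto
    then show ?thesis using rj by auto
  qed
  define ix where "ix = (\<lambda>y. SOME j. y - of_int j * x \<in> H)"
  have ix: "y - of_int (ix y) * x \<in> H" for y
    using KU someI_ex[of "\<lambda>j. y - of_int j * x \<in> H"] by (auto simp: ix_def K_def)
  define psi where "psi = (\<lambda>y. cis (2 * pi * real_of_int (ix y) / real p))"
  have val: "psi y = cis (2 * pi * real_of_int j / real p)" if "y - of_int j * x \<in> H" for y j
  proof -
    have "(y - of_int (ix y) * x) - (y - of_int j * x) \<in> H" by (rule Hd[OF ix that])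
    then have "of_int (j - ix y) * x \<in> H" by (simp add: algebra_simps)
    from pd[OF this] obtain k where "j - ix y = int p * k" by (auto simp: dvd_def)
    then have "j = ix y + int p * k" by simp
    then have "2 * pi * real_of_int j / real p = 2 * pi * real_of_int (ix y) / real p + 2 * pi * real_of_int k"
      using p(1) by (simp add: field_simps)
    moreover have "cis (2 * pi * real_of_int k) = 1" by (rule cis_multiple_2pi) simp
    ultimately show ?thesis by (simp add: psi_def flip: cis_mult)
  qed
  have "psi (y + z) = psi y * psi z" for y z
  proof -
    have "(y - of_int (ix y) * x) + (z - of_int (ix z) * x) \<in> H" by (rule Ha[OF ix ix])
    then have "(y + z) - of_int (ix y + ix z) * x \<in> H" by (simp add: algebra_simps)
    from val[OF this] show ?thesis by (simp add: psi_def cis_mult add_divide_distrib distrib_left)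
  qed
  moreover have "psi x \<noteq> 1"
  proof
    assume 1: "psi x = 1"
    have "psi x = cis (2 * pi * real_of_int 1 / real p)" by (rule val) (simp add: H0)
    then have "cos (2 * pi / real p) = 1" using 1 by (simp add: complex_eq_iff)
    then obtain n :: int where "2 * pi / real p = real_of_int n * 2 * pi" using cos_one_2pi_int by auto
    then have "1 = real_of_int n * real p" using p(1) by (simp add: field_simps)
    then have "real_of_int 1 = real_of_int (n * int p)" by simp
    then have "1 = n * int p" by linarith
    then show False using p1 by (metis dvd_triv_right int_dvd_int_iff nat_dvd_1_iff_1 of_nat_1)
  qed
  ultimately show ?thesis by (intro exI[of _ psi]) (auto simp: psi_def)
qed

lemma coeff_mult_lead:
  fixes r G :: "'k::idom poly" assumes "r \<in> below (Suc n)"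
  shows "coeff (r * G) (n + degree G) = coeff r n * lead_coeff G"
proof (cases "r = 0 \<or> degree r < n")
  case True
  then have "coeff r n = 0" by (auto intro: coeff_eq_0)
  moreover have "coeff (r * G) (n + degree G) = 0"
  proof (cases "r = 0")
    case False
    then have "degree (r * G) < n + degree G" using True degree_mult_le[of r G] by simp
    then show ?thesis by (rule coeff_eq_0)
  qed simp
  ultimately show ?thesis by simp
next
  case False
  then have "degree r = n" using assms by (auto simp: below_def)
  then show ?thesis using coeff_mult_degree_sum[of r G] by simp
qed

locale cubic_psi = cubic_char_field +
  fixes psi :: "'a \<Rightarrow> complex"
  assumes psi_add: "psi (x + y) = psi x * psi y"
    and norm_psi [simp]: "cmod (psi x) = 1"
    and psi_nontriv: "\<exists>x. psi x \<noteq> 1"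
begin

lemma psi_nz [simp]: "psi x \<noteq> 0" using norm_psi[of x] by (metis norm_zero zero_neq_one)
lemma psi_0 [simp]: "psi 0 = 1" using psi_add[of 0 0] by simp
lemma psi_minus: "psi (- x) = cnj (psi x)"
proof -
  have "psi (- x) * psi x = 1" by (simp flip: psi_add)
  moreover have "cnj (psi x) * psi x = 1" using complex_norm_square[of "psi x"] by (simp add: mult.commute)
  ultimately show ?thesis by (metis mult_right_cancel psi_nz)
qed

text \<open>For monic \<open>F\<close> the coefficient is that of \<open>1/T\<close> in the
  expansion of \<open>x / F\<close>, so this is the standard additive character evaluated at the
  fraction \<open>x / F\<close>. For constant \<open>F\<close> the remainder is 0 and the value is
  1.\<close>

definition ee :: "'a poly \<Rightarrow> 'a poly \<Rightarrow> complex" where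
  "ee F x = psi (coeff (x mod F) (degree F - 1))"

lemma ee_add: "ee F (x + y) = ee F x * ee F y"
  by (simp add: ee_def poly_mod_add_left psi_add)
lemma ee_0 [simp]: "ee F 0 = 1" by (simp add: ee_def)
lemma norm_ee [simp]: "cmod (ee F x) = 1" by (simp add: ee_def)
lemma ee_minus: "ee F (- x) = cnj (ee F x)"
  by (simp add: ee_def poly_mod_minus_left psi_minus)
lemma ee_mult_mod: "ee F (w * (x mod F)) = ee F (w * x)"
  by (simp add: ee_def mod_mult_right_eq)
lemma ee_small: "x \<in> below (degree F - 1) \<Longrightarrow> ee F x = 1"
  using below_mod[of x F] below_mono[of x "degree F - 1" "degree F"] by (simp add: ee_def below_iff)

text \<open>The fraction \<open>x / F\<close> does not change when it is expanded by
  \<open>G\<close>. All changes of modulus below are such identities between fractions.\<close>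

lemma ee_scale:
  assumes F: "lead_coeff F = 1" and G: "lead_coeff G = 1"
  shows "ee (F * G) (x * G) = ee F x"
proof (cases "degree F = 0")
  case True
  then have F1: "F = 1" using F by (metis degree_eq_zeroE lead_coeff_pCons(2) one_pCons)
  show ?thesis unfolding F1 by (simp add: ee_def)
next
  case False
  have nz: "F \<noteq> 0" "G \<noteq> 0" using F G by auto
  have 1: "(x * G) mod (F * G) = (x mod F) * G" by (rule mod_mult_mult2)
  have 2: "degree (F * G) - 1 = (degree F - 1) + degree G" using False nz by (simp add: degree_mult_eq)
  have "x mod F \<in> below (Suc (degree F - 1))" using mod_below[OF nz(1), of x] False by simp
  from coeff_mult_lead[OF this, of G] show ?thesis unfolding ee_def 1 2 G by simp
qed

text \<open>The polynomials of degree less than \<open>M\<close> and the residues of degree less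
  than \<open>degree F - M\<close> annihilate each other under the pairing
  \<open>ee F (w * x)\<close>.\<close>

lemma sum_ee:
  assumes F: "F \<noteq> 0" and M: "M \<le> degree F"
  shows "(\<Sum>w\<in>below M. ee F (w * x)) = (if x mod F \<in> below (degree F - M) then of_nat q ^ M else 0)"
proof (cases "x mod F \<in> below (degree F - M)")
  case True
  have "ee F (w * x) = 1" if w: "w \<in> below M" for w
  proof -
    have "w * (x mod F) \<in> below (degree F - 1)"
    proof (cases "w = 0 \<or> x mod F = 0")
      case False
      then have "degree (w * (x mod F)) < degree F - 1" using w True M
        by (auto simp: below_def degree_mult_eq)
      then show ?thesis by (auto simp: below_def)
    qed auto
    then show ?thesis by (metis ee_mult_mod ee_small)
  qed
  then show ?thesis using True by (simp add: card_below q_card)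
next
  case False
  define r where "r = x mod F"
  have r: "r \<noteq> 0" "degree r < degree F" "\<not> degree r < degree F - M"
    using False mod_below[OF F, of x] by (auto simp: r_def below_def)
  define i where "i = degree F - 1 - degree r"
  have i: "i < M" "i + degree r = degree F - 1" using r by (auto simp: i_def)
  obtain c where c: "psi c \<noteq> 1" using psi_nontriv by auto
  \<comment> \<open>A monomial that lifts the leading term of the residue \<open>r\<close> to degree
    \<open>degree F - 1\<close> with coefficient \<open>c\<close>. The character then takes the
    value \<open>psi c\<close>, which is not 1.\<close>
  define w0 where "w0 = monom (c / lead_coeff r) i"
  have w0: "w0 \<in> below M" using i by (auto simp: w0_def below_iff)
  have "ee F (w0 * x) = psi c"
  proof -
    have d: "coeff (w0 * r) (degree F - 1) = c"
    proof -
      have "degree F - Suc i = degree r" "\<not> degree F - Suc 0 < i" using i by auto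
      then show ?thesis using r(1) by (simp add: w0_def coeff_monom_mult)
    qed
    have "degree (w0 * r) < degree F"
      using degree_mult_le[of w0 r] degree_monom_le[of "c / lead_coeff r" i] i r by (simp add: w0_def)
    then have "(w0 * r) mod F = w0 * r" by (rule mod_poly_less)
    then have "ee F (w0 * r) = psi c" using d by (simp add: ee_def)
    then show ?thesis by (simp add: r_def ee_mult_mod)
  qed
  then have "ee F (w0 * x) \<noteq> 1" using c by simp
  moreover have "(\<Sum>w\<in>below M. ee F (w * x)) = (\<Sum>w\<in>below M. ee F ((w + w0) * x))"
    by (rule sum.reindex_bij_witness[of _ "\<lambda>w. w + w0" "\<lambda>w. w - w0"])
       (use w0 in \<open>auto intro: below_add below_diff\<close>)
  then have "(\<Sum>w\<in>below M. ee F (w * x)) = (\<Sum>w\<in>below M. ee F (w * x) * ee F (w0 * x))"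
    by (simp only: distrib_right ee_add)
  then have "(\<Sum>w\<in>below M. ee F (w * x)) = (\<Sum>w\<in>below M. ee F (w * x)) * ee F (w0 * x)"
    unfolding sum_distrib_right .
  ultimately have "(\<Sum>w\<in>below M. ee F (w * x)) = 0" by (metis mult_cancel_left1)
  then show ?thesis using False by simp
qed

lemma ee_nontriv:
  assumes "F \<noteq> 0" "\<not> F dvd x" obtains t where "ee F (t * x) \<noteq> 1"
proof -
  have "x mod F \<noteq> 0" using assms by (simp add: mod_eq_0_iff_dvd)
  then have "(\<Sum>w\<in>below (degree F). ee F (w * x)) = 0"
    using sum_ee[OF assms(1), of "degree F" x] by simp
  moreover have "(\<Sum>w\<in>(below (degree F) :: 'a poly set). 1 :: complex) \<noteq> 0"
    using q_ge q_card by (simp add: card_below)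
  ultimately have "\<exists>t. ee F (t * x) \<noteq> 1" by (metis (mono_tags, lifting) sum.cong)
  then show ?thesis using that by blast
qed

definition Gs :: "'a poly \<Rightarrow> 'a poly \<Rightarrow> complex" where
  "Gs w F = (\<Sum>y\<in>below (degree F). J F y * ee F (w * y))"

lemma norm_Gs: "cmod (Gs w F) \<le> real q ^ degree F"
proof -
  have "cmod (Gs w F) \<le> (\<Sum>y\<in>(below (degree F) :: 'a poly set). 1)"
    unfolding Gs_def by (rule sum_norm_le) (simp add: norm_mult norm_J)
  then show ?thesis by (simp add: card_below q_card)
qed

lemma Gs_0: "lead_coeff F = 1 \<Longrightarrow> \<not> cube_poly F \<Longrightarrow> Gs 0 F = 0"
  using sum_J_complete[of F 0] by (simp add: Gs_def)

text \<open>Substitute \<open>c^3 * y\<close> for \<open>y\<close>: the cubic symbol does not notice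
  the cube, while the additive character does.\<close>

lemma Gs_cube_mult:
  assumes F: "F \<noteq> 0" and c: "coprime c F"
  shows "Gs (w * c ^ 3) F = Gs w F"
proof -
  have c3: "coprime (c ^ 3) F" using c by simp
  have "Gs w F = (\<Sum>y\<in>below (degree F). J F ((c ^ 3 * y) mod F) * ee F (w * ((c ^ 3 * y) mod F)))"
    unfolding Gs_def by (rule sum.reindex_bij_betw[OF bij_mult_mod[OF F c3], symmetric])
  also have "\<dots> = Gs (w * c ^ 3) F"
    unfolding Gs_def
    by (rule sum.cong) (use J_cube[OF F, of c] c F in
      \<open>auto simp: J_mod J_mult J_power ee_mult_mod mult.assoc coprime_commute\<close>)
  finally show ?thesis by simp
qed

text \<open>Residues modulo \<open>A * F\<close> are parametrised as
  \<open>y1 * F + y2 * A^2\<close>. The square is chosen so that the symbols of \<open>A\<close> and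
  \<open>F\<close> combine, by reciprocity, to \<open>J F A ^ 3 = 1\<close>; in return the frequency
  modulo \<open>F\<close> becomes \<open>w * A\<close>.\<close>

lemma Gs_mult:
  assumes A: "lead_coeff A = 1" and F: "lead_coeff F = 1" and c: "coprime A F"
  shows "Gs w (A * F) = Gs w A * Gs (w * A) F"
proof -
  have nz: "A \<noteq> 0" "F \<noteq> 0" using A F by auto
  define h where "h = (\<lambda>(y1, y2). (y1 * F + y2 * A ^ 2) mod (A * F))"
  let ?D = "below (degree A) \<times> (below (degree F) :: 'a poly set)"
  have inj: "inj_on h ?D"
  proof (rule inj_onI, clarsimp simp: h_def)
    fix y1 y2 z1 z2
    assume y: "y1 \<in> below (degree A)" "y2 \<in> below (degree F)" "z1 \<in> below (degree A)" "z2 \<in> below (degree F)"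
      and e: "(y1 * F + y2 * A ^ 2) mod (A * F) = (z1 * F + z2 * A ^ 2) mod (A * F)"
    have "A * F dvd (y1 * F + y2 * A ^ 2) - (z1 * F + z2 * A ^ 2)" by (rule mod_eq_dvd[OF e])
    moreover have "(y1 * F + y2 * A ^ 2) - (z1 * F + z2 * A ^ 2) = (y1 - z1) * F + A * ((y2 - z2) * A)"
      and "(y1 * F + y2 * A ^ 2) - (z1 * F + z2 * A ^ 2) = F * (y1 - z1) + A ^ 2 * (y2 - z2)"
      by (simp_all add: algebra_simps power2_eq_square)
    ultimately have "A dvd (y1 - z1) * F + A * ((y2 - z2) * A)" "F dvd F * (y1 - z1) + A ^ 2 * (y2 - z2)"
      by (metis dvd_mult_left, metis dvd_mult_right)
    then have "A dvd F * (y1 - z1)" "F dvd A ^ 2 * (y2 - z2)"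
      by (simp_all add: dvd_add_left_iff dvd_add_right_iff mult.commute)
    then have "A dvd y1 - z1" "F dvd y2 - z2"
      using c by (simp_all add: coprime_dvd_mult_right_iff coprime_commute)
    then show "y1 = z1 \<and> y2 = z2" using y below_dvd_0 below_diff by (metis eq_iff_diff_eq_0)
  qed
  have "h ` ?D \<subseteq> below (degree (A * F))" using mod_below[of "A * F"] nz by (auto simp: h_def)
  moreover have "card (h ` ?D) = card (below (degree (A * F)) :: 'a poly set)"
    unfolding card_image[OF inj] using nz by (simp add: card_cartesian_product card_below degree_mult_eq power_add)
  ultimately have img: "h ` ?D = below (degree (A * F))" by (intro card_subset_eq) auto
  have JAF: "J A F = J F A" by (rule J_recip[OF A F])
  have J3: "J F A ^ 3 = 1" by (rule J_cube[OF nz(2)]) (use c in \<open>simp add: coprime_commute\<close>)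
  have "J (A * F) (h (y1, y2)) * ee (A * F) (w * h (y1, y2)) =
        (J A y1 * ee A (w * y1)) * (J F y2 * ee F (w * A * y2))" for y1 y2
  proof -
    have "J (A * F) (h (y1, y2)) = J A (y1 * F + y2 * A ^ 2) * J F (y1 * F + y2 * A ^ 2)"
      unfolding h_def by (simp only: case_prod_conv J_mod J_mult_left[OF A F])
    also have "J A (y1 * F + y2 * A ^ 2) = J A (y1 * F)" by (rule J_cong) (simp add: power2_eq_square)
    also have "J F (y1 * F + y2 * A ^ 2) = J F (y2 * A ^ 2)" by (rule J_cong) simp
    also have "J A (y1 * F) * J F (y2 * A ^ 2) = J A y1 * J F y2 * J F A ^ 3"
      using nz by (simp add: J_mult J_power JAF power3_eq_cube power2_eq_square)
    also have "\<dots> = J A y1 * J F y2" by (simp add: J3)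
    finally have 1: "J (A * F) (h (y1, y2)) = J A y1 * J F y2" .
    have "ee (A * F) (w * h (y1, y2)) = ee (A * F) (w * (y1 * F + y2 * A ^ 2))"
      unfolding h_def by (simp only: case_prod_conv ee_mult_mod)
    also have "w * (y1 * F + y2 * A ^ 2) = (w * y1) * F + (w * A * y2) * A"
      by (simp add: algebra_simps power2_eq_square)
    also have "ee (A * F) \<dots> = ee (A * F) ((w * y1) * F) * ee (F * A) ((w * A * y2) * A)"
      by (simp only: ee_add mult.commute[of A F])
    also have "\<dots> = ee A (w * y1) * ee F (w * A * y2)" by (simp only: ee_scale[OF A F] ee_scale[OF F A])
    finally show ?thesis using 1 by simp
  qed
  then have "(\<Sum>p\<in>?D. J (A * F) (h p) * ee (A * F) (w * h p)) =
     (\<Sum>(y1, y2)\<in>?D. (J A y1 * ee A (w * y1)) * (J F y2 * ee F (w * A * y2)))"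
    by (intro sum.cong) auto
  also have "\<dots> = Gs w A * Gs (w * A) F"
    by (simp add: Gs_def sum_product sum.cartesian_product)
  finally show ?thesis unfolding Gs_def[of w "A * F"] img[symmetric] sum.reindex[OF inj] by simp
qed

text \<open>If the symbol has period \<open>D\<close>, then shifting \<open>y\<close> by a multiple
  of \<open>D\<close> changes only the additive factor, and some shift changes it
  nontrivially.\<close>

lemma Gs_support:
  assumes H: "H \<noteq> 0" and per: "\<And>y t. J H (y + D * t) = J H y" and nd: "\<not> H dvd w * D"
  shows "Gs w H = 0"
proof -
  obtain t where t: "ee H (t * (w * D)) \<noteq> 1" using ee_nontriv[OF H nd] .
  have "Gs w H = (\<Sum>y\<in>below (degree H). J H ((D * t + y) mod H) * ee H (w * ((D * t + y) mod H)))"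
    unfolding Gs_def by (rule sum.reindex_bij_betw[OF bij_shift_mod[OF H], symmetric])
  also have "\<dots> = (\<Sum>y\<in>below (degree H). ee H (t * (w * D)) * (J H y * ee H (w * y)))"
  proof (rule sum.cong[OF refl])
    fix y
    have "J H ((D * t + y) mod H) = J H y" using per[of y t] by (simp add: J_mod add.commute)
    moreover have "w * (D * t + y) = t * (w * D) + w * y" by (simp add: algebra_simps)
    then have "ee H (w * ((D * t + y) mod H)) = ee H (t * (w * D)) * ee H (w * y)"
      by (simp add: ee_mult_mod ee_add)
    ultimately show "J H ((D * t + y) mod H) * ee H (w * ((D * t + y) mod H)) =
      ee H (t * (w * D)) * (J H y * ee H (w * y))" by simp
  qed
  also have "\<dots> = ee H (t * (w * D)) * Gs w H" by (simp add: Gs_def sum_distrib_left)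
  finally show ?thesis using t by simp
qed

text \<open>Expanding the square and summing over \<open>w\<close> leaves the diagonal
  \<open>y = z\<close>, where the symbol is at most 1 in absolute value.\<close>

lemma Gs_parseval:
  assumes F: "F \<noteq> 0"
  shows "(\<Sum>w\<in>below (degree F). (cmod (Gs w F))\<^sup>2) \<le> real q ^ (2 * degree F)"
proof -
  let ?N = "degree F"
  have e: "complex_of_real ((cmod (Gs w F))\<^sup>2) =
      (\<Sum>y\<in>below ?N. \<Sum>z\<in>below ?N. J F y * cnj (J F z) * ee F (w * (y - z)))" for w
  proof -
    have "complex_of_real ((cmod (Gs w F))\<^sup>2) = Gs w F * cnj (Gs w F)" by (rule complex_norm_square)
    also have "\<dots> = (\<Sum>y\<in>below ?N. \<Sum>z\<in>below ?N. (J F y * ee F (w * y)) * (cnj (J F z) * ee F (- (w * z))))"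
      by (simp add: Gs_def sum_product ee_minus)
    also have "\<dots> = (\<Sum>y\<in>below ?N. \<Sum>z\<in>below ?N. J F y * cnj (J F z) * ee F (w * (y - z)))"
      by (intro sum.cong refl) (simp add: right_diff_distrib ee_add[of F _ "- _", simplified] mult_ac)
    finally show ?thesis .
  qed
  have "complex_of_real (\<Sum>w\<in>below ?N. (cmod (Gs w F))\<^sup>2) =
      (\<Sum>w\<in>below ?N. \<Sum>y\<in>below ?N. \<Sum>z\<in>below ?N. J F y * cnj (J F z) * ee F (w * (y - z)))"
    by (simp only: of_real_sum e)
  also have "\<dots> = (\<Sum>y\<in>below ?N. \<Sum>w\<in>below ?N. \<Sum>z\<in>below ?N. J F y * cnj (J F z) * ee F (w * (y - z)))"
    by (rule sum.swap)
  also have "\<dots> = (\<Sum>y\<in>below ?N. \<Sum>z\<in>below ?N. \<Sum>w\<in>below ?N. J F y * cnj (J F z) * ee F (w * (y - z)))"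
    by (rule sum.cong[OF refl], rule sum.swap)
  also have "\<dots> = (\<Sum>y\<in>below ?N. \<Sum>z\<in>below ?N. if z = y then J F y * cnj (J F y) * of_nat q ^ ?N else 0)"
  proof (intro sum.cong refl)
    fix y z :: "'a poly" assume y: "y \<in> below ?N" and z: "z \<in> below ?N"
    have "(y - z) mod F = y - z" by (rule below_mod[OF below_diff[OF y z]])
    then have "(\<Sum>w\<in>below ?N. ee F (w * (y - z))) = (if y = z then of_nat q ^ ?N else 0)"
      by (subst sum_ee[OF F]) auto
    then show "(\<Sum>w\<in>below ?N. J F y * cnj (J F z) * ee F (w * (y - z))) =
       (if z = y then J F y * cnj (J F y) * of_nat q ^ ?N else 0)"
      by (simp flip: sum_distrib_left)
  qed
  also have "\<dots> = (\<Sum>y\<in>below ?N. J F y * cnj (J F y) * of_nat q ^ ?N)"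
    by (simp add: sum.delta)
  also have "\<dots> = complex_of_real (\<Sum>y\<in>below ?N. (cmod (J F y))\<^sup>2 * real q ^ ?N)"
    by (simp flip: complex_norm_square)
  finally have "(\<Sum>w\<in>below ?N. (cmod (Gs w F))\<^sup>2) = (\<Sum>y\<in>below ?N. (cmod (J F y))\<^sup>2 * real q ^ ?N)"
    by (simp only: of_real_eq_iff)
  also have "\<dots> \<le> (\<Sum>y\<in>(below ?N :: 'a poly set). 1 * real q ^ ?N)"
    by (intro sum_mono mult_right_mono) (auto simp: norm_J power_le_one)
  also have "\<dots> = real q ^ (2 * ?N)" by (simp add: card_below q_card mult_2 power_add)
  finally show ?thesis .
qed

text \<open>By \<open>sum_ee\<close>, summing \<open>ee F (w * (y - T^n))\<close> over
  \<open>w\<close> of degree at most \<open>m\<close> detects the monic \<open>y\<close> of degree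
  \<open>n\<close>. The shift by \<open>T^n\<close> produces the factor
  \<open>psi (- coeff w m)\<close>.\<close>

lemma poisson:
  assumes F: "F \<in> monics N" and n: "n + m + 1 = N"
  shows "(\<Sum>f\<in>monics n. J F f) = (\<Sum>w\<in>below (m + 1). psi (- coeff w m) * Gs w F) / of_nat q ^ (m + 1)"
proof -
  have F0: "F \<noteq> 0" and dF: "degree F = N" using F monics_nz by (auto simp: monics_def)
  define T :: "'a poly" where "T = monom 1 n"
  have TN: "T \<in> below N" using n by (auto simp: T_def below_iff)
  have ph: "psi (- coeff w m) = ee F (- (w * T))" if w: "w \<in> below (m + 1)" for w
  proof -
    have "w * T \<in> below N" using w n by (auto simp: below_iff T_def coeff_monom_mult mult.commute[of w])
    then have "(w * T) mod F = w * T" using below_mod[of "w * T" F] dF by simp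
    moreover have "coeff (w * T) (N - 1) = coeff w m" using n by (auto simp: T_def coeff_monom_mult mult.commute[of w])
    ultimately have "ee F (w * T) = psi (coeff w m)" using dF by (simp add: ee_def)
    then show ?thesis by (simp add: ee_minus psi_minus)
  qed
  have "(\<Sum>w\<in>below (m + 1). psi (- coeff w m) * Gs w F) =
        (\<Sum>w\<in>below (m + 1). \<Sum>y\<in>below N. J F y * ee F (w * (y - T)))"
  proof (rule sum.cong[OF refl])
    fix w :: "'a poly" assume w: "w \<in> below (m + 1)"
    have "ee F (w * (y - T)) = ee F (- (w * T)) * ee F (w * y)" for y
      by (simp add: algebra_simps flip: ee_add)
    then show "psi (- coeff w m) * Gs w F = (\<Sum>y\<in>below N. J F y * ee F (w * (y - T)))"
      by (simp add: ph[OF w] Gs_def dF sum_distrib_left mult_ac)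
  qed
  also have "\<dots> = (\<Sum>y\<in>below N. \<Sum>w\<in>below (m + 1). J F y * ee F (w * (y - T)))" by (rule sum.swap)
  also have "\<dots> = (\<Sum>y\<in>below N. if y \<in> monics n then J F y * of_nat q ^ (m + 1) else 0)"
  proof (rule sum.cong[OF refl])
    fix y :: "'a poly" assume y: "y \<in> below N"
    have "(y - T) mod F = y - T" using below_mod[of "y - T" F] below_diff[OF y TN] dF by simp
    moreover have "degree F - (m + 1) = n" using dF n by simp
    ultimately have "(\<Sum>w\<in>below (m + 1). ee F (w * (y - T))) = (if y - T \<in> below n then of_nat q ^ (m + 1) else 0)"
      by (subst sum_ee[OF F0]) (use dF n in auto)
    moreover have "y - T \<in> below n \<longleftrightarrow> y \<in> monics n"
      unfolding monics_eq T_def[symmetric] by (auto simp: image_iff intro: bexI[of _ "y - T"])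
    ultimately show "(\<Sum>w\<in>below (m + 1). J F y * ee F (w * (y - T))) =
       (if y \<in> monics n then J F y * of_nat q ^ (m + 1) else 0)"
      by (simp flip: sum_distrib_left)
  qed
  also have "\<dots> = (\<Sum>y\<in>monics n. J F y * of_nat q ^ (m + 1))"
    by (rule sum.mono_neutral_cong_right[OF finite_below]) (use n in \<open>auto simp: monics_def below_def\<close>)
  also have "\<dots> = (\<Sum>y\<in>monics n. J F y) * of_nat q ^ (m + 1)" by (simp add: sum_distrib_right)
  finally show ?thesis using q_ge by simp
qed

end

section \<open>Sums of Gauss sums over all moduli\<close>

lemma below_multI:
  fixes x y :: "'k::idom poly"
  assumes "x \<in> below a" "y \<in> below b" "a + b \<le> Suc c" shows "x * y \<in> below c"
  using assms by (cases "x = 0 \<or> y = 0") (auto simp: below_def degree_mult_eq)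

lemma lead_coeff_dominant:
  fixes z Q s :: "'k::idom poly"
  assumes z: "z \<in> monics n" and Q: "Q \<noteq> 0" and s: "s \<in> below (n + degree Q)"
  shows "z * Q + s \<noteq> 0" "degree (z * Q + s) = n + degree Q" "lead_coeff (z * Q + s) = lead_coeff Q"
proof -
  have d: "degree (z * Q) = n + degree Q" "lead_coeff (z * Q) = lead_coeff Q" "z * Q \<noteq> 0"
    using z Q monics_nz[OF z] by (auto simp: monics_def degree_mult_eq coeff_mult_degree_sum)
  have c: "coeff (z * Q + s) (n + degree Q) = lead_coeff Q" using d s by (auto simp: below_iff)
  then have "n + degree Q \<le> degree (z * Q + s)" using Q by (intro le_degree) auto
  moreover have "degree (z * Q + s) \<le> n + degree Q"
    by (rule degree_add_le) (use d s in \<open>auto simp: below_def\<close>)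
  ultimately show e: "degree (z * Q + s) = n + degree Q" by simp
  show "lead_coeff (z * Q + s) = lead_coeff Q" using c e by simp
  then show "z * Q + s \<noteq> 0" using Q by (metis leading_coeff_0_iff)
qed

context cubic_char_field
begin

lemma J_smult_left: assumes "c \<noteq> 0" shows "J (smult c F) f = J F f"
proof -
  have "(f * A) mod smult c F = (f * A) mod F" for A
    using assms by (simp add: mod_smult_right)
  then show ?thesis using assms by (simp add: J_def)
qed

text \<open>A constant factor of the modulus has no effect, one of the argument contributes a power
  of \<open>om\<close>. The exponent \<open>2 * degree G\<close> stands for
  \<open>- degree G\<close>, since the values are cube roots of unity.\<close>

lemma J_recip_general:
  assumes F: "F \<noteq> 0" and G: "G \<noteq> 0"
  shows "J F G = om (lead_coeff G) ^ degree F * om (lead_coeff F) ^ (2 * degree G) * J G F"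
proof -
  define a b where "a = lead_coeff F" and "b = lead_coeff G"
  have ab: "a \<noteq> 0" "b \<noteq> 0" using F G by (auto simp: a_def b_def)
  define F' G' where "F' = smult (inverse a) F" and "G' = smult (inverse b) G"
  have F': "F = smult a F'" "lead_coeff F' = 1" "F' \<noteq> 0" "degree F' = degree F"
    using ab F by (auto simp: F'_def a_def)
  have G': "G = smult b G'" "lead_coeff G' = 1" "G' \<noteq> 0" "degree G' = degree G"
    using ab G by (auto simp: G'_def b_def)
  have 1: "J F G = om b ^ degree F * J F' G'"
    using F' G' ab by (metis J_smult J_smult_left)
  have 2: "J G F = om a ^ degree G * J F' G'"
    using F' G' ab by (metis J_smult J_smult_left J_recip)
  have "om a ^ (2 * degree G) * om a ^ degree G = (om a ^ 3) ^ degree G"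
    by (simp flip: power_mult power_add)
  then have "om a ^ (2 * degree G) * om a ^ degree G = 1" using om_cube[OF ab(1)] by simp
  then show ?thesis unfolding a_def[symmetric] b_def[symmetric] 1 2 by (simp add: mult.assoc[symmetric])
qed

lemma om_power_le: "cmod (om x ^ n) \<le> 1"
  by (simp add: norm_power norm_om power_le_one)

text \<open>The Euclidean algorithm on \<open>(Q, b)\<close> evaluates the symbol up to a factor that only depends on
  degrees and leading coefficients.\<close>

lemma J_farey:
  assumes "Q \<noteq> 0" "bs * Q - b * Qs = 1" "t \<noteq> 0" "t * Qs \<in> below (n + degree Q)"
  shows "\<exists>\<kappa>. cmod \<kappa> \<le> 1 \<and> (\<forall>z\<in>monics n. J (z * Q + t * Qs) (z * b + t * bs) = \<kappa> * J t z)"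
  using assms
proof (induction "degree Q" arbitrary: Q Qs b bs rule: less_induct)
  case less
  show ?case
  proof (cases "degree Q = 0")
    case True
    then obtain c where c: "Q = [:c:]" "c \<noteq> 0" using less(2) by (metis degree_eq_zeroE pCons_0_0)
    \<comment> \<open>For constant \<open>Q = c\<close> the determinant condition gives
      \<open>c * y = t\<close> modulo \<open>F\<close>. Removing \<open>c\<close>, applying
      reciprocity, and using \<open>F = c * z\<close> modulo \<open>t\<close> account for the three
      groups of factors.\<close>
    define \<kappa> where "\<kappa> = om c ^ (2 * n) * (om (lead_coeff t) ^ n * om c ^ (2 * degree t)) * om c ^ degree t"
    have "J (z * Q + t * Qs) (z * b + t * bs) = \<kappa> * J t z" if z: "z \<in> monics n" for z
    proof -
      define F where "F = z * Q + t * Qs"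
      define y where "y = z * b + t * bs"
      have F: "F \<noteq> 0" "degree F = n" "lead_coeff F = c"
        using lead_coeff_dominant[OF z less(2,5)] c True by (simp_all add: F_def)
      have "smult c y - t = F * b + t * (bs * Q - b * Qs - 1)"
        unfolding F_def y_def c by (simp add: algebra_simps smult_add_right)
      then have dv: "F dvd smult c y - t" using less(3) by simp
      have "(om c ^ n) ^ 3 = 1" using om_cube[OF c(2)] by (metis mult.commute power_mult power_one)
      then have "J F y = om c ^ (2 * n) * (om c ^ n * J F y)"
        by (simp add: power3_eq_cube mult_2 power_add mult.assoc[symmetric])
      also have "om c ^ n * J F y = J F (smult c y)" using J_smult[OF F(1), of c y] F by simp
      also have "\<dots> = J F t" by (rule J_cong[OF dv])
      also have "\<dots> = om (lead_coeff t) ^ n * om c ^ (2 * degree t) * J t F"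
        using J_recip_general[OF F(1) less(4)] F by simp
      also have "J t F = J t (smult c z)" by (rule J_cong) (simp add: F_def c)
      also have "\<dots> = om c ^ degree t * J t z" by (rule J_smult[OF less(4)])
      finally show ?thesis by (simp add: F_def y_def \<kappa>_def mult_ac)
    qed
    moreover have "cmod \<kappa> \<le> 1"
      unfolding \<kappa>_def norm_mult by (intro mult_le_one om_power_le mult_nonneg_nonneg norm_ge_zero)
    ultimately show ?thesis by blast
  next
    case False
    define a where "a = b div Q"
    define b1 where "b1 = b - a * Q"
    define bs1 where "bs1 = bs - a * Qs"
    have b1m: "b1 = b mod Q" by (simp add: b1_def a_def minus_div_mult_eq_mod)
    have det1: "bs1 * Q - b1 * Qs = 1" using less(3) by (simp add: b1_def bs1_def algebra_simps)
    have nunit: "bs' * Q \<noteq> 1" for bs'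
    proof
      assume "bs' * Q = 1"
      then have "Q dvd 1" by (metis dvd_triv_right)
      then show False using False less(2) by (simp add: is_unit_iff_degree)
    qed
    have b10: "b1 \<noteq> 0" using det1 nunit[of bs1] by auto
    have Qs0: "Qs \<noteq> 0" using det1 nunit[of bs1] by auto
    have db1: "degree b1 < degree Q" using b10 less(2) unfolding b1m by (metis degree_mod_less)
    \<comment> \<open>The degree condition is inherited: the determinant identity
      \<open>bs1 * Q = 1 + b1 * Qs\<close> bounds \<open>bs1\<close> in terms of
      \<open>Qs\<close>.\<close>
    have tb: "t * bs1 \<in> below (n + degree b1)"
    proof (cases "bs1 = 0")
      case bs0: False
      have "bs1 * Q = 1 + b1 * Qs" using det1 by (simp add: algebra_simps)
      then have "degree bs1 + degree Q = degree (1 + b1 * Qs)" using bs0 less(2) by (metis degree_mult_eq)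
      also have "\<dots> \<le> degree b1 + degree Qs"
        by (rule degree_add_le) (use b10 Qs0 in \<open>auto simp: degree_mult_eq\<close>)
      finally have "degree bs1 + degree Q \<le> degree b1 + degree Qs" .
      moreover have "degree t + degree Qs < n + degree Q"
        using less(4,5) Qs0 by (auto simp: below_def degree_mult_eq)
      ultimately show ?thesis using less(4) bs0 by (auto simp: below_def degree_mult_eq)
    qed simp
    \<comment> \<open>After division, reciprocity exchanges modulus and argument. The exchange is
      the rotation that takes \<open>(Q, b1)\<close> to \<open>(b1, - Q)\<close>; it keeps
      determinant 1, and its sign is invisible to the symbol.\<close>
    have det2: "(- Qs) * b1 - (- Q) * bs1 = 1" using det1 by (simp add: algebra_simps)
    obtain \<kappa> where k: "cmod \<kappa> \<le> 1"
      "\<And>z. z \<in> monics n \<Longrightarrow> J (z * b1 + t * bs1) (z * (- Q) + t * (- Qs)) = \<kappa> * J t z"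
      using less(1)[OF db1 b10 det2 less(4) tb] by blast
    define \<kappa>' where "\<kappa>' = om (lead_coeff b1) ^ (n + degree Q) * om (lead_coeff Q) ^ (2 * (n + degree b1)) * \<kappa>"
    have "J (z * Q + t * Qs) (z * b + t * bs) = \<kappa>' * J t z" if z: "z \<in> monics n" for z
    proof -
      define F where "F = z * Q + t * Qs"
      define y where "y = z * b1 + t * bs1"
      have F: "F \<noteq> 0" "degree F = n + degree Q" "lead_coeff F = lead_coeff Q"
        unfolding F_def by (rule lead_coeff_dominant[OF z less(2,5)])+
      have y: "y \<noteq> 0" "degree y = n + degree b1" "lead_coeff y = lead_coeff b1"
        unfolding y_def by (rule lead_coeff_dominant[OF z b10 tb])+
      have "(z * b + t * bs) - y = F * a" by (simp add: F_def y_def b1_def bs1_def algebra_simps)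
      then have "J F (z * b + t * bs) = J F y" by (intro J_cong) simp
      also have "\<dots> = om (lead_coeff y) ^ degree F * om (lead_coeff F) ^ (2 * degree y) * J y F"
        by (rule J_recip_general[OF F(1) y(1)])
      also have "J y F = J y (- F)" using y(1) by simp
      also have "- F = z * (- Q) + t * (- Qs)" by (simp add: F_def)
      also have "J y \<dots> = \<kappa> * J t z" unfolding y_def by (rule k(2)[OF z])
      finally have "J F (z * b + t * bs) = om (lead_coeff b1) ^ (n + degree Q) *
          om (lead_coeff Q) ^ (2 * (n + degree b1)) * (\<kappa> * J t z)"
        unfolding F(3) y(3) unfolding F(2) y(2) .
      then show ?thesis by (simp only: F_def \<kappa>'_def mult.assoc)
    qed
    moreover have "cmod \<kappa>' \<le> 1"
      unfolding \<kappa>'_def norm_mult by (intro mult_le_one om_power_le k(1) mult_nonneg_nonneg norm_ge_zero)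
    ultimately show ?thesis by blast
  qed
qed

text \<open>Pigeonhole: there are \<open>q^(\<mu> + 1)\<close> candidates \<open>Q\<close>, but only
  \<open>q^\<mu>\<close> possible high-order parts of \<open>Q * y mod F\<close>. A denominator of
  least degree is coprime to its numerator.\<close>

lemma dirichlet_approx:
  fixes F y :: "'k poly"
  assumes F: "F \<in> monics N" and y: "y \<in> below N" and mu: "\<mu> < N"
  obtains Q b where "Q \<in> monics (degree Q)" "degree Q \<le> \<mu>" "b \<in> below (degree Q)" "coprime Q b"
    "Q * y - b * F \<in> below (N - \<mu>)"
proof -
  have F0: "F \<noteq> 0" and dF: "degree F = N" using F monics_nz by (auto simp: monics_def)
  \<comment> \<open>Division by \<open>T\<close> cuts off the part of degree below
    \<open>N - \<mu>\<close>; two candidates with equal quotients differ by a good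
    denominator.\<close>
  define T :: "'k poly" where "T = monom 1 (N - \<mu>)"
  have T0: "T \<noteq> 0" "degree T = N - \<mu>" by (auto simp: T_def degree_monom_eq)
  define r where "r = (\<lambda>Q. (Q * y) mod F)"
  have r: "r Q \<in> below N" for Q using mod_below[OF F0] by (simp add: r_def dF)
  have "(\<lambda>Q. r Q div T) ` below (\<mu> + 1) \<subseteq> below \<mu>"
  proof clarify
    fix Q :: "'k poly"
    show "r Q div T \<in> below \<mu>"
    proof (cases "r Q div T = 0")
      case False
      have "T * (r Q div T) = r Q - r Q mod T" by (simp add: minus_mod_eq_mult_div)
      moreover have "r Q mod T \<in> below N" using mod_below[OF T0(1), of "r Q"] T0 by (auto intro: below_mono)
      ultimately have "T * (r Q div T) \<in> below N" using below_diff[OF r] by metis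
      then show ?thesis using False T0 mu by (auto simp: below_def degree_mult_eq)
    qed simp
  qed
  then have "card ((\<lambda>Q. r Q div T) ` below (\<mu> + 1)) \<le> card (below \<mu> :: 'k poly set)" by (intro card_mono) auto
  also have "\<dots> < card (below (\<mu> + 1) :: 'k poly set)" using q_ge q_card by (simp add: card_below)
  finally have "\<not> inj_on (\<lambda>Q. r Q div T) (below (\<mu> + 1))" by (rule pigeonhole)
  then obtain Q1 Q2 where Q12: "Q1 \<in> below (\<mu> + 1)" "Q2 \<in> below (\<mu> + 1)" "Q1 \<noteq> Q2" "r Q1 div T = r Q2 div T"
    by (auto simp: inj_on_def)
  define good where "good = (\<lambda>Q. Q \<noteq> 0 \<and> (Q * y) mod F \<in> below (N - \<mu>))"
  have "r (Q1 - Q2) = r Q1 - r Q2" by (simp add: r_def left_diff_distrib poly_mod_diff_left)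
  also have "\<dots> = (T * (r Q1 div T) + r Q1 mod T) - (T * (r Q2 div T) + r Q2 mod T)" by (simp only: mult_div_mod_eq)
  also have "\<dots> = r Q1 mod T - r Q2 mod T" unfolding Q12(4) by (rule add_diff_cancel_left)
  also have "\<dots> \<in> below (N - \<mu>)" using mod_below[OF T0(1)] T0 by (auto intro: below_diff)
  finally have g12: "good (Q1 - Q2)" using Q12 by (simp add: good_def r_def)
  define Q0 where "Q0 = arg_min degree good"
  have Q0: "good Q0" unfolding Q0_def by (rule arg_min_natI[where P = good, OF g12])
  have Q0m: "degree Q0 \<le> degree Q'" if "good Q'" for Q' unfolding Q0_def by (rule arg_min_nat_le[where P = good, OF that])
  have nz: "Q0 \<noteq> 0" using Q0 by (simp add: good_def)
  define Q where "Q = smult (inverse (lead_coeff Q0)) Q0"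
  have Qm: "Q \<in> monics (degree Q)" "degree Q = degree Q0" "Q \<noteq> 0" using nz by (auto simp: Q_def monics_def)
  have gQ: "good Q" using Q0 Qm(3) by (auto simp: good_def Q_def mod_smult_left intro: below_smult)
  have dQ: "degree Q \<le> \<mu>"
    using Q0m[OF g12] below_diff[OF Q12(1,2)] Q12(3) unfolding Qm(2) by (auto simp: below_def)
  define b where "b = (Q * y) div F"
  have t: "Q * y - b * F = (Q * y) mod F" by (simp add: b_def minus_div_mult_eq_mod)
  have tb: "Q * y - b * F \<in> below (N - \<mu>)" using gQ unfolding t by (simp add: good_def)
  have "coprime Q b"
  proof (rule coprimeI)
    fix g assume g: "g dvd Q" "g dvd b"
    then obtain Q' b' where Q': "Q = g * Q'" "b = g * b'" by (auto simp: dvd_def)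
    have nz': "g \<noteq> 0" "Q' \<noteq> 0" using Q' Qm(3) by auto
    define t' where "t' = Q' * y - b' * F"
    have "Q * y - b * F = g * t'" by (simp add: Q' t'_def algebra_simps)
    then have "g * t' \<in> below (N - \<mu>)" using tb by simp
    then have t': "t' \<in> below (N - \<mu>)" using nz' by (cases "t' = 0") (auto simp: below_def degree_mult_eq)
    have "(Q' * y) mod F = t'"
      by (rule mod_eq_below_unique) (use t' dF in \<open>auto simp: t'_def intro: below_mono\<close>)
    then have "good Q'" using t' nz' by (simp add: good_def)
    from Q0m[OF this] have "degree g = 0" using Qm(2) Q' nz' by (simp add: degree_mult_eq)
    then show "is_unit g" using nz' by (simp add: is_unit_iff_degree)
  qed
  moreover have "b \<in> below (degree Q)"
  proof (cases "b = 0")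
    case False
    have "Q * y \<in> below (N + degree Q)" using below_mult[OF y Qm(3)] by (simp add: mult.commute)
    moreover have "Q * y - b * F \<in> below (N + degree Q)" using tb by (rule below_mono) simp
    ultimately have "Q * y - (Q * y - b * F) \<in> below (N + degree Q)" by (rule below_diff)
    then have "b * F \<in> below (N + degree Q)" by simp
    then show ?thesis using False F0 dF by (auto simp: below_def degree_mult_eq)
  qed simp
  ultimately show ?thesis using that Qm(1) dQ tb by blast
qed

text \<open>The cross difference \<open>Q2 * b1 - Q1 * b2\<close>, multiplied by \<open>F\<close>,
  has degree less than \<open>N\<close> and must vanish. So in this ultrametric setting the Farey
  arcs are disjoint, and the dissection is an exact partition.\<close>

lemma dirichlet_unique:
  fixes F y :: "'k poly"
  assumes F: "F \<in> monics N" and mu: "\<mu> < N"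
    and 1: "lead_coeff Q1 = 1" "degree Q1 \<le> \<mu>" "coprime Q1 b1" "Q1 * y - b1 * F \<in> below (N - \<mu>)"
    and 2: "lead_coeff Q2 = 1" "degree Q2 \<le> \<mu>" "coprime Q2 b2" "Q2 * y - b2 * F \<in> below (N - \<mu>)"
  shows "Q1 = Q2 \<and> b1 = b2"
proof -
  have nz: "Q1 \<noteq> 0" "Q2 \<noteq> 0" using 1 2 by auto
  have "F * (Q2 * b1 - Q1 * b2) = (Q2 * y - b2 * F) * Q1 - (Q1 * y - b1 * F) * Q2"
    by (simp add: algebra_simps)
  moreover have "(Q2 * y - b2 * F) * Q1 \<in> below N" "(Q1 * y - b1 * F) * Q2 \<in> below N"
    using below_mult[OF 2(4) nz(1) 1(2)] below_mult[OF 1(4) nz(2) 2(2)] mu by simp_all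
  ultimately have "F * (Q2 * b1 - Q1 * b2) \<in> below N" by (metis below_diff)
  moreover have "F \<noteq> 0" "degree F = N" using F monics_nz by (auto simp: monics_def)
  ultimately have e: "Q2 * b1 = Q1 * b2" using below_dvd_0[of "F * (Q2 * b1 - Q1 * b2)" F] by auto
  have "Q1 dvd Q2 * b1" unfolding e by simp
  then have d1: "Q1 dvd Q2" using 1(3) by (simp add: coprime_dvd_mult_left_iff)
  have "Q2 dvd Q1 * b2" unfolding e[symmetric] by simp
  then have d2: "Q2 dvd Q1" using 2(3) by (simp add: coprime_dvd_mult_left_iff)
  have "Q1 = Q2" using poly_dvd_antisym[OF _ d1 d2] 1(1) 2(1) by simp
  then show ?thesis using e nz by simp
qed

text \<open>The column \<open>(Q, b)\<close> becomes the first column of a matrix of determinant 1.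
  Its inverse supplies the coordinates on the Farey arc around \<open>b / Q\<close>.\<close>

lemma unimodular_completion:
  fixes Q b :: "'k poly"
  assumes Q: "Q \<noteq> 0" and c: "coprime Q b"
  obtains Qs bs where "bs * Q - b * Qs = 1" "Qs \<in> below (degree Q)"
proof -
  obtain d where d: "Q dvd b * d - 1" using coprime_inverse_mod[of b Q] c by (metis coprime_commute)
  define Qs where "Qs = (- d) mod Q"
  have "Q dvd Qs - (- d)" unfolding Qs_def by (metis mod_mod_trivial mod_eq_dvd_iff)
  then have "Q dvd b * (Qs + d)" by simp
  then have "Q dvd b * (Qs + d) - (b * d - 1)" using d by (rule dvd_diff)
  then have "Q dvd 1 + b * Qs" by (simp add: algebra_simps)
  then obtain bs where "1 + b * Qs = Q * bs" by (auto simp: dvd_def)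
  then have "bs * Q - b * Qs = 1" by (simp add: algebra_simps)
  moreover have "Qs \<in> below (degree Q)" unfolding Qs_def by (rule mod_below[OF Q])
  ultimately show ?thesis using that by blast
qed

end

lemma below_cancel:
  fixes Q y :: "'k::idom poly"
  assumes "Q * y \<in> below (n + degree Q)" "Q \<noteq> 0" shows "y \<in> below n"
  using assms by (cases "y = 0") (auto simp: below_def degree_mult_eq)

lemma monics_cancel:
  fixes Q z :: "'k::idom poly"
  assumes "z * Q \<in> monics (n + degree Q)" "lead_coeff Q = 1" shows "z \<in> monics n"
proof -
  have nz: "z \<noteq> 0" "Q \<noteq> 0" using monics_nz[OF assms(1)] by auto
  have "lead_coeff (z * Q) = lead_coeff z * lead_coeff Q" by (rule lead_coeff_mult)
  moreover have "lead_coeff (z * Q) = 1" using assms(1) unfolding monics_def by blast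
  ultimately have "lead_coeff z = 1" using assms(2) by simp
  moreover have "degree z = n" using assms(1) nz by (auto simp: monics_def degree_mult_eq)
  ultimately show ?thesis by (simp add: monics_def)
qed

lemma sum_power_le: "(\<Sum>k\<le>K. real q ^ k) \<le> 2 * real q ^ K" if "q \<ge> 2"
proof (induction K)
  case (Suc K)
  have "2 * real q ^ K \<le> real q * real q ^ K" using that by (intro mult_right_mono) auto
  then show ?case using Suc by simp
qed simp

context cubic_psi
begin

definition const_cube :: "'a poly \<Rightarrow> bool" where
  "const_cube t \<longleftrightarrow> (\<exists>c h. lead_coeff h = 1 \<and> c \<noteq> 0 \<and> t = smult c (h ^ 3))"

definition Cs :: "'a poly \<Rightarrow> nat \<Rightarrow> complex" where
  "Cs w N = (\<Sum>F\<in>monics N. Gs w F)"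

lemma sum_J_complete_gen:
  assumes t: "t \<noteq> 0" "\<not> const_cube t"
  shows "(\<Sum>x\<in>below (degree t). J t (x0 + x)) = 0"
proof -
  define c where "c = lead_coeff t"
  define s where "s = smult (inverse c) t"
  have c: "c \<noteq> 0" using t by (simp add: c_def)
  have ts: "t = smult c s" "lead_coeff s = 1" "degree s = degree t" using c by (auto simp: s_def c_def)
  have "\<not> cube_poly s"
    using t(2) ts(1) c unfolding const_cube_def cube_poly_def by blast
  from sum_J_complete[OF ts(2) this, of x0] show ?thesis
    unfolding ts(3) by (subst ts(1)) (simp add: J_smult_left[OF c])
qed

text \<open>The cube root has degree at most \<open>(M - 1) div 3\<close>, and the constant gives
  another factor \<open>q\<close>; the 2 comes from summing the geometric series.\<close>

lemma card_const_cube: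
  assumes "M > 0"
  shows "real (card {t \<in> below M. const_cube t}) \<le> 2 * real q ^ (1 + (M - 1) div 3)"
proof -
  let ?K = "(M - 1) div 3"
  have "{t \<in> below M. const_cube t} \<subseteq> (\<lambda>(c, h). smult c (h ^ 3)) ` (UNIV \<times> (\<Union>k\<le>?K. monics k))"
  proof
    fix t assume "t \<in> {t \<in> below M. const_cube t}"
    then obtain c h where t: "t \<in> below M" "lead_coeff h = 1" "c \<noteq> 0" "t = smult c (h ^ 3)"
      by (auto simp: const_cube_def)
    have h0: "h \<noteq> 0" using t by auto
    have "degree t = 3 * degree h" using t h0 by (simp add: degree_power_eq)
    then have "3 * degree h < M" using t h0 by (auto simp: below_def)
    then have "degree h \<le> ?K" using assms by (simp add: less_eq_div_iff_mult_less_eq) 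
    then have "(c, h) \<in> UNIV \<times> (\<Union>k\<le>?K. monics k)" using t by (auto simp: monics_def)
    then show "t \<in> (\<lambda>(c, h). smult c (h ^ 3)) ` (UNIV \<times> (\<Union>k\<le>?K. monics k))"
      using t(4) by (intro image_eqI[of _ _ "(c, h)"]) auto
  qed
  then have "card {t \<in> below M. const_cube t} \<le> card (UNIV \<times> (\<Union>k\<le>?K. monics k) :: ('a \<times> 'a poly) set)"
    by (intro surj_card_le) auto
  also have "\<dots> \<le> q * (\<Sum>k\<le>?K. q ^ k)"
    unfolding card_cartesian_product q_card[symmetric]
    by (intro mult_left_mono order_trans[OF card_UN_le]) (auto simp: card_monics q_card)
  finally have "real (card {t \<in> below M. const_cube t}) \<le> real (q * (\<Sum>k\<le>?K. q ^ k))" by (simp only: of_nat_le_iff)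
  also have "\<dots> = real q * (\<Sum>k\<le>?K. real q ^ k)" by simp
  also have "\<dots> \<le> real q * (2 * real q ^ ?K)" using q_ge by (intro mult_left_mono sum_power_le) auto
  finally show ?thesis by simp
qed

text \<open>On the arc of \<open>b / Q\<close> with \<open>t = Q * y - b * F\<close> fixed, the
  symbol is a constant times \<open>J t z\<close>, and the phase \<open>w * y / F\<close> equals
  \<open>w * b / Q + w * t / (Q * F)\<close>. The second fraction does not change when
  \<open>z\<close> runs through a residue system modulo \<open>t\<close>, so the sum vanishes unless
  \<open>t\<close> is a constant times a cube.\<close>

lemma farey_inner:
  assumes Q: "Q \<in> monics \<rho>" "\<rho> \<le> \<mu>" "\<mu> < N" and w: "degree w \<le> 2 * \<mu> + 1"
    and det: "bs * Q - b * Qs = 1" "Qs \<in> below \<rho>" and t: "t \<in> below (N - \<mu>)"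
  shows "cmod (\<Sum>z\<in>monics (N - \<rho>). J (z * Q + t * Qs) (z * b + t * bs) * ee (z * Q + t * Qs) (w * (z * b + t * bs)))
     \<le> (if const_cube t then real q ^ (N - \<rho>) else 0)"
proof (cases "const_cube t")
  case True
  have "cmod (\<Sum>z\<in>monics (N - \<rho>). J (z * Q + t * Qs) (z * b + t * bs) * ee (z * Q + t * Qs) (w * (z * b + t * bs)))
    \<le> (\<Sum>z\<in>(monics (N - \<rho>) :: 'a poly set). 1)"
    by (rule sum_norm_le) (simp add: norm_mult norm_J)
  then show ?thesis using True by (simp add: card_monics q_card)
next
  case nc: False
  have Q0: "Q \<noteq> 0" "degree Q = \<rho>" "lead_coeff Q = 1" using Q(1) monics_nz by (auto simp: monics_def)
  show ?thesis
  proof (cases "t = 0")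
    case True
    \<comment> \<open>For \<open>t = 0\<close> modulus and argument share the factor
      \<open>z\<close>, whose degree \<open>N - \<rho>\<close> is positive.\<close>
    have "J (z * Q) (z * b) = 0" if z: "z \<in> monics (N - \<rho>)" for z
    proof (rule J_eq_0)
      show "z * Q \<noteq> 0" using z Q0 monics_nz by auto
      have "degree z > 0" "z \<noteq> 0" using z Q by (auto simp: monics_def)
      then have "\<not> is_unit z" by (simp add: is_unit_iff_degree)
      then show "\<not> coprime (z * Q) (z * b)" by (meson coprime_common_divisor dvd_triv_left)
    qed
    then show ?thesis using True nc by simp
  next
    case t0: False
    define \<tau> where "\<tau> = degree t"
    have tau: "\<tau> < N - \<mu>" using t t0 by (auto simp: \<tau>_def below_def)
    have tQs: "t * Qs \<in> below (N - \<rho> + degree Q)"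
      using below_multI[OF t det(2), of N] Q Q0 by simp
    obtain \<kappa> where k: "\<And>z. z \<in> monics (N - \<rho>) \<Longrightarrow> J (z * Q + t * Qs) (z * b + t * bs) = \<kappa> * J t z"
      using J_farey[OF Q0(1) det(1) t0 tQs] by blast
    define Fz where "Fz = (\<lambda>z. z * Q + t * Qs)"
    have Fz: "lead_coeff (Fz z) = 1" "degree (Fz z) = N" "Fz z \<noteq> 0" if "z \<in> monics (N - \<rho>)" for z
      using lead_coeff_dominant[OF that Q0(1) tQs] Q Q0 by (auto simp: Fz_def)
    define h where "h = (\<lambda>z. ee (Fz z * Q) (w * t))"
    have eeq: "ee (Fz z) (w * (z * b + t * bs)) = ee Q (w * b) * h z" if z: "z \<in> monics (N - \<rho>)" for z
    proof -
      have "Q * (z * b + t * bs) = b * Fz z + t * (bs * Q - b * Qs)"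
        by (simp add: Fz_def algebra_simps)
      then have e: "Q * (z * b + t * bs) = b * Fz z + t" using det by simp
      have "ee (Fz z) (w * (z * b + t * bs)) = ee (Fz z * Q) ((w * (z * b + t * bs)) * Q)"
        by (rule ee_scale[OF Fz(1)[OF z] Q0(3), symmetric])
      also have "(w * (z * b + t * bs)) * Q = w * (Q * (z * b + t * bs))" by (simp only: mult_ac)
      also have "\<dots> = (w * b) * Fz z + w * t" unfolding e by (simp add: algebra_simps)
      also have "ee (Fz z * Q) \<dots> = ee (Q * Fz z) ((w * b) * Fz z) * h z"
        by (simp only: ee_add h_def mult.commute[of Q])
      also have "ee (Q * Fz z) ((w * b) * Fz z) = ee Q (w * b)" by (rule ee_scale[OF Q0(3) Fz(1)[OF z]])
      finally show ?thesis .
    qed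
    have hinv: "h (z + x) = h z" if z: "z \<in> monics (N - \<rho>)" and x: "x \<in> below \<tau>" for z x
    proof -
      have zx: "z + x \<in> monics (N - \<rho>)"
        using z x tau Q by (intro monics_add_below) (auto intro: below_mono)
      define A B where "A = Fz z" and "B = Fz (z + x)"
      have AB: "lead_coeff A = 1" "lead_coeff B = 1" "A \<noteq> 0" "B \<noteq> 0" "degree A = N" "degree B = N"
        using Fz[OF z] Fz[OF zx] by (auto simp: A_def B_def)
      have lAQ: "lead_coeff (A * Q) = 1" "lead_coeff (B * Q) = 1" "lead_coeff (A * B) = 1"
        unfolding lead_coeff_mult using AB Q0 by simp_all
      have BA: "B = A + x * Q" by (simp add: A_def B_def Fz_def algebra_simps)
      \<comment> \<open>The two fractions differ by \<open>w * t * x\<close> over the product of the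
        moduli, of degree \<open>2 * N\<close>. The limit \<open>2 * \<mu> + 1\<close> for the
        degree of \<open>w\<close> is exactly what keeps the numerator below degree
        \<open>2 * N - 1\<close>.\<close>
      have sm: "ee (A * B) (w * t * x) = 1"
      proof (rule ee_small)
        have "x * (w * t) \<in> below (\<tau> + (degree w + \<tau>))"
        proof (cases "w * t = 0")
          case False
          then show ?thesis using x by (intro below_mult) (auto simp: degree_mult_eq \<tau>_def)
        qed auto
        moreover have "\<tau> + (degree w + \<tau>) \<le> degree (A * B) - 1"
          using AB w tau by (simp add: degree_mult_eq)
        ultimately show "w * t * x \<in> below (degree (A * B) - 1)" by (simp add: below_mono mult_ac)
      qed
      have "h z = ee ((A * Q) * B) ((w * t) * B)" unfolding h_def A_def[symmetric]
        by (rule ee_scale[OF lAQ(1) AB(2), symmetric])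
      also have "(w * t) * B = (w * t) * A + (w * t * x) * Q" unfolding BA by (simp add: algebra_simps)
      also have "ee ((A * Q) * B) \<dots> = ee ((B * Q) * A) ((w * t) * A) * ee ((A * B) * Q) ((w * t * x) * Q)"
        unfolding ee_add by (simp only: mult_ac)
      also have "ee ((B * Q) * A) ((w * t) * A) = h (z + x)" unfolding h_def B_def[symmetric]
        by (rule ee_scale[OF lAQ(2) AB(1)])
      also have "ee ((A * B) * Q) ((w * t * x) * Q) = 1" using ee_scale[OF lAQ(3) Q0(3)] sm by simp
      finally show ?thesis by simp
    qed
    have "(\<Sum>z\<in>monics (N - \<rho>). J t z * h z) = 0"
    proof (rule sum_shift_vanish[where d = \<tau>])
      fix z x :: "'a poly" assume "z \<in> monics (N - \<rho>)" "x \<in> below \<tau>"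
      then show "z + x \<in> monics (N - \<rho>)"
        using tau Q by (intro monics_add_below) (auto intro: below_mono)
    next
      fix z :: "'a poly" assume z: "z \<in> monics (N - \<rho>)"
      have "(\<Sum>x\<in>below \<tau>. J t (z + x) * h (z + x)) = (\<Sum>x\<in>below \<tau>. J t (z + x)) * h z"
        by (simp add: hinv[OF z] sum_distrib_right)
      then show "(\<Sum>x\<in>below \<tau>. J t (z + x) * h (z + x)) = 0"
        using sum_J_complete_gen[OF t0 nc] by (simp add: \<tau>_def)
    qed simp
    moreover have "(\<Sum>z\<in>monics (N - \<rho>). J (z * Q + t * Qs) (z * b + t * bs) * ee (z * Q + t * Qs) (w * (z * b + t * bs)))
      = \<kappa> * ee Q (w * b) * (\<Sum>z\<in>monics (N - \<rho>). J t z * h z)"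
      unfolding sum_distrib_left
    proof (rule sum.cong[OF refl])
      fix z :: "'a poly" assume z: "z \<in> monics (N - \<rho>)"
      show "J (z * Q + t * Qs) (z * b + t * bs) * ee (z * Q + t * Qs) (w * (z * b + t * bs)) =
        \<kappa> * ee Q (w * b) * (J t z * h z)"
        unfolding k[OF z] eeq[OF z, unfolded Fz_def] by (simp only: mult_ac)
    qed
    ultimately show ?thesis using nc by simp
  qed
qed

text \<open>The unimodular substitution between \<open>(F, y)\<close> and \<open>(t, z)\<close> maps
  the arc to a full product set. Then \<open>farey_inner\<close> leaves only the few
  \<open>t\<close> that are cubes up to constants.\<close>

lemma farey_block:
  assumes Q: "Q \<in> monics \<rho>" "\<rho> \<le> \<mu>" "\<mu> < N" and w: "degree w \<le> 2 * \<mu> + 1"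
    and b: "b \<in> below \<rho>" "coprime Q b"
  shows "cmod (\<Sum>(F, y)\<in>{(F, y). F \<in> monics N \<and> y \<in> below N \<and> Q * y - b * F \<in> below (N - \<mu>)}. J F y * ee F (w * y))
    \<le> 2 * real q ^ (1 + (N - \<mu> - 1) div 3) * real q ^ (N - \<rho>)"
proof -
  have Q0: "Q \<noteq> 0" "degree Q = \<rho>" "lead_coeff Q = 1" using Q(1) monics_nz by (auto simp: monics_def)
  obtain Qs bs where det: "bs * Q - b * Qs = 1" "Qs \<in> below \<rho>"
    using unimodular_completion[OF Q0(1) b(2)] Q0 by metis
  let ?W = "{(F, y). F \<in> monics N \<and> y \<in> below N \<and> Q * y - b * F \<in> below (N - \<mu>)}"
  let ?g = "\<lambda>F y. J F y * ee F (w * y)"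
  have tQs: "t * Qs \<in> below N" if "t \<in> below (N - \<mu>)" for t
    using below_multI[OF that det(2), of N] Q by simp
  have m1: "b * (z * Q + t * Qs) + t = Q * (z * b + t * bs)" for z t
  proof -
    have "b * (z * Q + t * Qs) + t = Q * (z * b + t * bs) - t * (bs * Q - b * Qs - 1)"
      by (simp add: algebra_simps)
    then show ?thesis using det by simp
  qed
  have "(\<Sum>(F, y)\<in>?W. ?g F y) =
    (\<Sum>(t, z)\<in>below (N - \<mu>) \<times> monics (N - \<rho>). ?g (z * Q + t * Qs) (z * b + t * bs))"
  \<comment> \<open>Both directions are given by the matrix of determinant 1 and its inverse; the
    ten identities below are its cofactor relations, and the degree conditions follow from
    \<open>t * Qs\<close> having degree below \<open>N\<close>.\<close>
  proof (rule sum.reindex_bij_witness[of _ "\<lambda>(t, z). (z * Q + t * Qs, z * b + t * bs)"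
        "\<lambda>(F, y). (Q * y - b * F, bs * F - Qs * y)"], goal_cases)
    case (1 a)
    obtain F y where a: "a = (F, y)" by (cases a)
    have "(bs * F - Qs * y) * Q + (Q * y - b * F) * Qs = F * (bs * Q - b * Qs)"
         "(bs * F - Qs * y) * b + (Q * y - b * F) * bs = y * (bs * Q - b * Qs)" by (simp_all add: algebra_simps)
    then show ?case using det a by simp
  next
    case (2 a)
    then obtain F y where a: "a = (F, y)" "F \<in> monics N" "y \<in> below N" "Q * y - b * F \<in> below (N - \<mu>)" by auto
    have "(bs * F - Qs * y) * Q + (Q * y - b * F) * Qs = F * (bs * Q - b * Qs)" by (simp add: algebra_simps)
    then have "(bs * F - Qs * y) * Q = F - (Q * y - b * F) * Qs" using det by (simp add: algebra_simps)
    then have "(bs * F - Qs * y) * Q \<in> monics (N - \<rho> + degree Q)"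
      using monics_diff_below[OF a(2) tQs[OF a(4)]] Q Q0 by simp
    then show ?case using a monics_cancel Q0 by auto
  next
    case (3 p)
    obtain t z where p: "p = (t, z)" by (cases p)
    have "Q * (z * b + t * bs) - b * (z * Q + t * Qs) = t * (bs * Q - b * Qs)"
         "bs * (z * Q + t * Qs) - Qs * (z * b + t * bs) = z * (bs * Q - b * Qs)" by (simp_all add: algebra_simps)
    then show ?case using det p by simp
  next
    case (4 p)
    then obtain t z where p: "p = (t, z)" "t \<in> below (N - \<mu>)" "z \<in> monics (N - \<rho>)" by auto
    have "z * Q \<in> monics N" using monics_mult[OF p(3) Q(1)] Q by simp
    then have F: "z * Q + t * Qs \<in> monics N" using tQs[OF p(2)] by (rule monics_add_below)
    have "b * (z * Q + t * Qs) \<in> below (N + \<rho>)"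
      using below_mult[OF b(1), of "z * Q + t * Qs" N] F monics_nz[OF F] by (simp add: monics_def add.commute)
    moreover have "t \<in> below (N + \<rho>)" using p(2) by (rule below_mono) simp
    ultimately have "Q * (z * b + t * bs) \<in> below (N + degree Q)"
      unfolding m1[symmetric] Q0 by (rule below_add)
    then have "z * b + t * bs \<in> below N" using Q0(1) by (rule below_cancel)
    moreover have "Q * (z * b + t * bs) - b * (z * Q + t * Qs) = t" unfolding m1[symmetric] by simp
    ultimately show ?case using F p by simp
  next
    case (5 a)
    obtain F y where a: "a = (F, y)" by (cases a)
    have "(bs * F - Qs * y) * Q + (Q * y - b * F) * Qs = F * (bs * Q - b * Qs)"
         "(bs * F - Qs * y) * b + (Q * y - b * F) * bs = y * (bs * Q - b * Qs)" by (simp_all add: algebra_simps)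
    then show ?case using det a by simp
  qed
  also have "\<dots> = (\<Sum>t\<in>below (N - \<mu>). \<Sum>z\<in>monics (N - \<rho>). ?g (z * Q + t * Qs) (z * b + t * bs))"
    by (simp add: sum.cartesian_product)
  finally have "cmod (\<Sum>(F, y)\<in>?W. ?g F y) \<le>
      (\<Sum>t\<in>below (N - \<mu>). if const_cube t then real q ^ (N - \<rho>) else 0)"
    using sum_norm_le[of "below (N - \<mu>)", OF farey_inner[OF Q w det]] by simp
  also have "\<dots> = real (card {t \<in> below (N - \<mu>). const_cube t}) * real q ^ (N - \<rho>)"
    by (simp add: sum.If_cases Int_def)
  also have "\<dots> \<le> 2 * real q ^ (1 + (N - \<mu> - 1) div 3) * real q ^ (N - \<rho>)"
    using Q by (intro mult_right_mono card_const_cube) auto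
  finally show ?thesis .
qed

text \<open>There are \<open>q^\<rho>\<close> denominators of degree \<open>\<rho>\<close> with at
  most \<open>q^\<rho>\<close> numerators each, and an arc contributes about
  \<open>q^(N - \<rho>)\<close> times the number of cubes. Summing over
  \<open>\<rho> \<le> \<mu>\<close> gives \<open>q^(N + \<mu>)\<close> times that number.\<close>

lemma Cs_farey:
  assumes mu: "\<mu> < N" and w: "degree w \<le> 2 * \<mu> + 1"
  shows "cmod (Cs w N) \<le> 4 * real q ^ (N + \<mu> + 1 + (N - \<mu> - 1) div 3)"
proof -
  define S where "S = {(F, y) \<in> monics N \<times> below N. coprime F (y :: 'a poly)}"
  define Fs where "Fs = (SIGMA Q:(\<Union>\<rho>\<le>\<mu>. monics \<rho>). {b \<in> below (degree Q). coprime Q (b :: 'a poly)})"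
  define R where "R = (\<lambda>(Q, b) (F, y). Q * y - b * F \<in> (below (N - \<mu>) :: 'a poly set))"
  define g where "g = (\<lambda>(F, y). J F y * ee F (w * y))"
  have finS: "finite S" by (rule finite_subset[of _ "monics N \<times> below N"]) (auto simp: S_def)
  have finF: "finite Fs" by (auto simp: Fs_def)
  have ex: "\<exists>qb. qb \<in> Fs \<and> R qb p" if "p \<in> S" for p
  proof -
    obtain F y where p: "p = (F, y)" "F \<in> monics N" "y \<in> below N" using \<open>p \<in> S\<close> by (auto simp: S_def)
    obtain Q b where "Q \<in> monics (degree Q)" "degree Q \<le> \<mu>" "b \<in> below (degree Q)" "coprime Q b"
      "Q * y - b * F \<in> below (N - \<mu>)" using dirichlet_approx[OF p(2,3) mu] by blast
    then show ?thesis using p by (intro exI[of _ "(Q, b)"]) (auto simp: Fs_def R_def)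
  qed
  define ph where "ph = (\<lambda>p. SOME qb. qb \<in> Fs \<and> R qb p)"
  have ph: "ph p \<in> Fs" "R (ph p) p" if "p \<in> S" for p
    using someI_ex[OF ex[OF that]] by (auto simp: ph_def)
  have uniq: "ph p = qb" if "p \<in> S" "qb \<in> Fs" "R qb p" for p qb
  proof -
    obtain F y where p: "p = (F, y)" "F \<in> monics N" using \<open>p \<in> S\<close> by (auto simp: S_def)
    obtain Q1 b1 where 1: "ph p = (Q1, b1)" by (cases "ph p")
    obtain Q2 b2 where 2: "qb = (Q2, b2)" by (cases qb)
    have "Q1 = Q2 \<and> b1 = b2"
      by (rule dirichlet_unique[OF p(2) mu]) (use ph[OF that(1)] that 1 2 p in \<open>auto simp: Fs_def R_def monics_def\<close>)
    then show ?thesis using 1 2 by simp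
  qed
  have "Cs w N = (\<Sum>p\<in>monics N \<times> below N. g p)"
    unfolding Cs_def Gs_def sum.cartesian_product[symmetric] g_def
    by (simp add: monics_def)
  also have "\<dots> = (\<Sum>p\<in>S. g p)"
    by (rule sum.mono_neutral_right) (auto simp: S_def g_def intro!: J_eq_0 dest: monics_nz)
  also have "\<dots> = (\<Sum>qb\<in>Fs. \<Sum>p\<in>{p \<in> S. ph p = qb}. g p)"
    by (rule sum.group[OF finS finF, symmetric]) (use ph in auto)
  finally have "cmod (Cs w N) \<le> (\<Sum>qb\<in>Fs. cmod (\<Sum>p\<in>{p \<in> S. ph p = qb}. g p))"
    by (simp add: norm_sum)
  also have "\<dots> \<le> (\<Sum>(Q, b)\<in>Fs. 2 * real q ^ (1 + (N - \<mu> - 1) div 3) * real q ^ (N - degree Q))"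
  proof (rule sum_mono)
    fix qb assume "qb \<in> Fs"
    then obtain Q b where qbe: "qb = (Q, b)" and qb: "(Q, b) \<in> Fs" by (cases qb) auto
    then have Q: "Q \<in> monics (degree Q)" "degree Q \<le> \<mu>" "b \<in> below (degree Q)" "coprime Q b"
      by (auto simp: Fs_def monics_def)
    have "(\<Sum>p\<in>{p \<in> S. ph p = (Q, b)}. g p) =
      (\<Sum>p\<in>{(F, y). F \<in> monics N \<and> y \<in> below N \<and> Q * y - b * F \<in> below (N - \<mu>)}. g p)"
    proof (rule sum.mono_neutral_left)
      show "finite {(F, y). F \<in> monics N \<and> y \<in> below N \<and> Q * y - b * F \<in> below (N - \<mu>)}"
        by (rule finite_subset[of _ "monics N \<times> below N"]) auto
      show "{p \<in> S. ph p = (Q, b)} \<subseteq> {(F, y). F \<in> monics N \<and> y \<in> below N \<and> Q * y - b * F \<in> below (N - \<mu>)}"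
      proof
        fix p assume p: "p \<in> {p \<in> S. ph p = (Q, b)}"
        then show "p \<in> {(F, y). F \<in> monics N \<and> y \<in> below N \<and> Q * y - b * F \<in> below (N - \<mu>)}"
          using ph(2)[of p] by (auto simp: S_def R_def)
      qed
      show "\<forall>p\<in>{(F, y). F \<in> monics N \<and> y \<in> below N \<and> Q * y - b * F \<in> below (N - \<mu>)} - {p \<in> S. ph p = (Q, b)}. g p = 0"
      proof
        fix p assume "p \<in> {(F, y). F \<in> monics N \<and> y \<in> below N \<and> Q * y - b * F \<in> below (N - \<mu>)} - {p \<in> S. ph p = (Q, b)}"
        then obtain F y where p: "F \<in> monics N" "y \<in> below N" "Q * y - b * F \<in> below (N - \<mu>)"
          and n: "\<not> ((F, y) \<in> S \<and> ph (F, y) = (Q, b))" and pe: "p = (F, y)" by (cases p) auto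
        have "\<not> (F, y) \<in> S" using n uniq[OF _ qb] p by (auto simp: R_def)
        then have "\<not> coprime F y" using p by (auto simp: S_def)
        then show "g p = 0" using J_eq_0 monics_nz[OF p(1)] by (simp add: g_def pe)
      qed
    qed
    then show "cmod (\<Sum>p\<in>{p \<in> S. ph p = qb}. g p) \<le>
        (case qb of (Q, b) \<Rightarrow> 2 * real q ^ (1 + (N - \<mu> - 1) div 3) * real q ^ (N - degree Q))"
      using farey_block[OF Q(1,2) mu w Q(3,4)] by (simp add: g_def qbe)
  qed
  also have "\<dots> \<le> (\<Sum>(Q, b)\<in>(SIGMA Q:(\<Union>\<rho>\<le>\<mu>. monics \<rho> :: 'a poly set). (below (degree Q) :: 'a poly set)). 2 * real q ^ (1 + (N - \<mu> - 1) div 3) * real q ^ (N - degree Q))"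
    by (rule sum_mono2) (auto simp: Fs_def)
  also have "\<dots> = (\<Sum>Q\<in>(\<Union>\<rho>\<le>\<mu>. monics \<rho> :: 'a poly set). 2 * real q ^ (1 + (N - \<mu> - 1) div 3) * (real q ^ degree Q * real q ^ (N - degree Q)))"
    by (subst sum.Sigma[symmetric]) (auto simp: card_below q_card mult_ac)
  also have "\<dots> = (\<Sum>\<rho>\<le>\<mu>. \<Sum>Q\<in>(monics \<rho> :: 'a poly set). 2 * real q ^ (1 + (N - \<mu> - 1) div 3) * (real q ^ degree Q * real q ^ (N - degree Q)))"
    by (rule sum.UNION_disjoint) (auto simp: monics_def[of "_ :: nat"] finite_monics[unfolded monics_def])
  also have "\<dots> = (\<Sum>\<rho>\<le>\<mu>. 2 * real q ^ (1 + (N - \<mu> - 1) div 3) * real q ^ N * real q ^ \<rho>)"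
  proof (rule sum.cong[OF refl])
    fix \<rho> assume "\<rho> \<in> {..\<mu>}"
    then have "real q ^ \<rho> * real q ^ (N - \<rho>) = real q ^ N" using mu by (simp flip: power_add)
    then have "(\<Sum>Q\<in>(monics \<rho> :: 'a poly set). 2 * real q ^ (1 + (N - \<mu> - 1) div 3) * (real q ^ degree Q * real q ^ (N - degree Q)))
      = (\<Sum>Q\<in>(monics \<rho> :: 'a poly set). 2 * real q ^ (1 + (N - \<mu> - 1) div 3) * real q ^ N)"
      by (intro sum.cong) (auto simp: monics_def)
    then show "(\<Sum>Q\<in>(monics \<rho> :: 'a poly set). 2 * real q ^ (1 + (N - \<mu> - 1) div 3) * (real q ^ degree Q * real q ^ (N - degree Q)))
      = 2 * real q ^ (1 + (N - \<mu> - 1) div 3) * real q ^ N * real q ^ \<rho>"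
      by (simp add: card_monics q_card)
  qed
  also have "\<dots> = 2 * real q ^ (1 + (N - \<mu> - 1) div 3) * real q ^ N * (\<Sum>\<rho>\<le>\<mu>. real q ^ \<rho>)"
    by (simp add: sum_distrib_left)
  also have "\<dots> \<le> 2 * real q ^ (1 + (N - \<mu> - 1) div 3) * real q ^ N * (2 * real q ^ \<mu>)"
    using q_ge by (intro mult_left_mono sum_power_le) auto
  also have "\<dots> = 4 * real q ^ (N + \<mu> + 1 + (N - \<mu> - 1) div 3)" by (simp add: power_add)
  finally show ?thesis .
qed

text \<open>The exponent is three-fold clearing of
  \<open>N + \<mu> + 1 + (N - \<mu> - 1) / 3\<close> with \<open>2 * \<mu>\<close> replaced by the
  degree of \<open>w\<close>.\<close>

definition Bd :: "'a poly \<Rightarrow> nat \<Rightarrow> real" where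
  "Bd w N = real q powr ((4 * real N + real (degree w) + 2) / 3)"

text \<open>The smallest admissible \<open>\<mu>\<close> is half the degree of \<open>w\<close>. If
  that is not below \<open>N\<close>, the trivial bound \<open>q^(2 * N)\<close> is already good
  enough.\<close>

lemma Cs_bound: "cmod (Cs w N) \<le> 4 * Bd w N"
proof -
  define m where "m = degree w"
  define \<mu> where "\<mu> = m div 2"
  have q1: "real q \<ge> 1" using q_ge by simp
  have pw: "real q ^ k \<le> Bd w N" if "3 * k \<le> 4 * N + m + 2" for k
  proof -
    have "real q ^ k = real q powr real k" using q_ge by (simp add: powr_realpow)
    also have "\<dots> \<le> Bd w N" unfolding Bd_def
      by (rule powr_mono) (use that q1 in \<open>auto simp: m_def field_simps\<close>)
    finally show ?thesis .
  qed
  show ?thesis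
  proof (cases "\<mu> < N")
    case True
    define r where "r = N - \<mu> - 1"
    define k where "k = r div 3"
    have "3 * k \<le> r" "2 * \<mu> \<le> m" by (simp_all add: \<mu>_def k_def)
    moreover have "N = r + \<mu> + 1" using True by (simp add: r_def)
    ultimately have "3 * (N + \<mu> + 1 + k) \<le> 4 * N + m + 2" by simp
    then have "3 * (N + \<mu> + 1 + (N - \<mu> - 1) div 3) \<le> 4 * N + m + 2" by (simp add: r_def k_def)
    moreover have "degree w \<le> 2 * \<mu> + 1" by (simp add: \<mu>_def m_def)
    ultimately show ?thesis using Cs_farey[OF True, of w] pw by fastforce
  next
    case False
    have "cmod (Cs w N) \<le> (\<Sum>F\<in>(monics N :: 'a poly set). real q ^ N)"
      unfolding Cs_def by (rule sum_norm_le) (use norm_Gs[of w] in \<open>auto simp: monics_def\<close>)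
    also have "\<dots> = real q ^ (2 * N)" by (simp add: card_monics q_card power_add mult_2)
    also have "\<dots> \<le> Bd w N" using False by (intro pw) (simp add: \<mu>_def)
    also have "\<dots> \<le> 4 * Bd w N" using powr_ge_zero[of "real q"] by (simp add: Bd_def)
    finally show ?thesis .
  qed
qed

end

section \<open>Moduli coprime to given primes\<close>

definition mprimes :: "'k::field_gcd poly set" where
  "mprimes = {P. prime_elem P \<and> lead_coeff P = 1}"

lemma mprimesD:
  assumes "P \<in> mprimes"
  shows "prime_elem P" "lead_coeff P = 1" "P \<noteq> 0" "\<not> is_unit P" "degree P > 0"
proof -
  show 1: "prime_elem P" "lead_coeff P = 1" using assms by (auto simp: mprimes_def)
  then show 2: "P \<noteq> 0" "\<not> is_unit P" by (auto simp: prime_elem_def)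
  then show "degree P > 0" by (simp add: is_unit_iff_degree)
qed

lemma mprimes_coprime:
  assumes "P \<in> mprimes" "Q \<in> mprimes" "P \<noteq> Q" shows "coprime P Q"
proof -
  have "\<not> P dvd Q"
  proof
    assume d: "P dvd Q"
    then have "Q dvd P"
      using irreducibleD'[OF prime_elem_imp_irreducible[OF mprimesD(1)[OF assms(2)]] d] mprimesD(4)[OF assms(1)] by blast
    then have "P = Q" using poly_dvd_antisym[OF _ d] mprimesD(2) assms by metis
    then show False using assms by simp
  qed
  then show ?thesis using mprimesD(1)[OF assms(1)] by (metis prime_elem_imp_coprime)
qed

lemma mprimes_coprime_iff: "P \<in> mprimes \<Longrightarrow> coprime P F \<longleftrightarrow> \<not> P dvd F"
  using mprimesD prime_elem_imp_coprime by (metis coprime_common_divisor dvd_refl)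

lemma monics_power: "P \<in> monics p \<Longrightarrow> P ^ b \<in> monics (b * p)" for P :: "'k::idom poly"
  by (induction b) (auto intro: monics_mult simp: monics_def[of 0])

definition coprime_monics :: "'k::field_gcd poly set \<Rightarrow> nat \<Rightarrow> 'k poly set" where
  "coprime_monics S N = {F \<in> monics N. \<forall>P\<in>S. coprime P F}"

lemma finite_coprime_monics [simp]: "finite (coprime_monics S N :: 'k::{field_gcd,finite} poly set)"
  by (simp add: coprime_monics_def)

lemma mult_primepower_dvd_cancel:
  fixes P :: "'k::field_gcd poly"
  assumes "P \<in> mprimes" "\<not> P dvd F" "\<not> P dvd G" "P ^ a * F = P ^ b * G"
  shows "a = b \<and> F = G"
proof -
  have "a \<le> b" if "P ^ a * F = P ^ b * G" "\<not> P dvd G" for a b F G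
  proof (rule ccontr)
    assume "\<not> a \<le> b"
    then have "P ^ a = P ^ b * P ^ (a - b)" by (simp flip: power_add)
    then have "P ^ (a - b) * F = G" using that(1) mprimesD(3)[OF assms(1)] by (simp add: mult.assoc)
    moreover have "P dvd P ^ (a - b)" using \<open>\<not> a \<le> b\<close> by (simp add: dvd_power)
    ultimately show False using that(2) by auto
  qed
  from this[OF assms(4,3)] this[OF assms(4)[symmetric] assms(2)] have "a = b" by simp
  then show ?thesis using assms(4) mprimesD(3)[OF assms(1)] by simp
qed

lemma prime_split_bij:
  fixes P :: "'k::{field_gcd,finite} poly"
  assumes P: "P \<in> mprimes" and S: "S \<subseteq> mprimes" and PS: "P \<notin> S"
  shows "bij_betw (\<lambda>(b, F). P ^ b * F)
    (SIGMA b:{..N div degree P}. coprime_monics (insert P S) (N - b * degree P)) (coprime_monics S N)"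
  unfolding bij_betw_def
proof
  have nd: "\<not> P dvd F" if "F \<in> coprime_monics (insert P S) n" for F n
    using that mprimes_coprime_iff[OF P] by (auto simp: coprime_monics_def)
  show "inj_on (\<lambda>(b, F). P ^ b * F) (SIGMA b:{..N div degree P}. coprime_monics (insert P S) (N - b * degree P))"
    by (rule inj_onI) (use mult_primepower_dvd_cancel[OF P nd nd] in fastforce)
  have dP: "degree P > 0" by (rule mprimesD(5)[OF P])
  have cop: "coprime R (P ^ b)" if "R \<in> S" for R b
    using mprimes_coprime[of R P] that S P PS by auto
  show "(\<lambda>(b, F). P ^ b * F) ` (SIGMA b:{..N div degree P}. coprime_monics (insert P S) (N - b * degree P)) = coprime_monics S N"
  proof (intro equalityI subsetI)
    fix F assume "F \<in> (\<lambda>(b, F). P ^ b * F) ` (SIGMA b:{..N div degree P}. coprime_monics (insert P S) (N - b * degree P))"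
    then obtain b G where b: "b \<le> N div degree P" and G: "G \<in> coprime_monics (insert P S) (N - b * degree P)" and F: "F = P ^ b * G"
      by auto
    have "P ^ b \<in> monics (b * degree P)" using mprimesD(2)[OF P] by (intro monics_power) (simp add: monics_def)
    moreover have "b * degree P \<le> N" using b dP by (metis div_times_less_eq_dividend le_trans mult_le_mono1)
    ultimately have "F \<in> monics N" using monics_mult[of "P ^ b" "b * degree P" G "N - b * degree P"] G
      by (simp add: F coprime_monics_def)
    moreover have "coprime R F" if "R \<in> S" for R
      using cop[OF that, of b] G that by (simp add: F coprime_monics_def)
    ultimately show "F \<in> coprime_monics S N" by (simp add: coprime_monics_def)
  next
    fix F assume F: "F \<in> coprime_monics S N"
    then have F0: "F \<noteq> 0" "F \<in> monics N" using monics_nz by (auto simp: coprime_monics_def)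
    obtain G where G: "F = P ^ multiplicity P F * G" "\<not> P dvd G"
      using multiplicity_decompose'[OF F0(1) mprimesD(4)[OF P]] by metis
    define b where "b = multiplicity P F"
    have G0: "G \<noteq> 0" using G by auto
    have "degree F = b * degree P + degree G"
      by (subst G(1)) (use mprimesD[OF P] G0 in \<open>simp add: degree_mult_eq degree_power_eq b_def\<close>)
    then have dF: "N = b * degree P + degree G" using F0 by (simp add: monics_def)
    have "lead_coeff F = lead_coeff (P ^ b) * lead_coeff G" using arg_cong[OF G(1), of lead_coeff] by (simp only: lead_coeff_mult b_def)
    then have "lead_coeff G = 1" using F0 mprimesD[OF P] by (simp add: monics_def lead_coeff_power)
    then have "G \<in> monics (N - b * degree P)" using dF by (simp add: monics_def)
    moreover have "coprime P G" using G(2) mprimes_coprime_iff[OF P] by simp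
    moreover have "coprime R G" if "R \<in> S" for R
    proof -
      have "coprime R F" using F that by (simp add: coprime_monics_def)
      then show ?thesis by (subst (asm) G(1)) simp
    qed
    ultimately have "G \<in> coprime_monics (insert P S) (N - b * degree P)" by (auto simp: coprime_monics_def)
    moreover have "b \<le> N div degree P" using dF dP by (simp add: less_eq_div_iff_mult_less_eq)
    ultimately show "F \<in> (\<lambda>(b, F). P ^ b * F) ` (SIGMA b:{..N div degree P}. coprime_monics (insert P S) (N - b * degree P))"
      using G(1) by (intro image_eqI[of _ _ "(b, G)"]) (auto simp: b_def)
  qed
qed

context cubic_psi
begin

definition CS :: "'a poly set \<Rightarrow> 'a poly \<Rightarrow> nat \<Rightarrow> complex" where
  "CS S w N = (\<Sum>F\<in>coprime_monics S N. Gs w F)"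

lemma CS_empty: "CS {} w N = Cs w N"
  by (simp add: CS_def Cs_def coprime_monics_def)

lemma CS_cube:
  assumes "\<And>F. \<forall>P\<in>S. coprime P F \<Longrightarrow> coprime c F"
  shows "CS S (w * c ^ 3) N = CS S w N"
  unfolding CS_def
  by (rule sum.cong[OF refl], rule Gs_cube_mult) (use assms in \<open>auto simp: coprime_monics_def dest: monics_nz\<close>)

text \<open>Factor each modulus as a power of \<open>P\<close> times a part prime to
  \<open>P\<close>; twisted multiplicativity moves the power into the frequency.\<close>

lemma CS_split:
  assumes P: "P \<in> mprimes" and S: "S \<subseteq> mprimes" and PS: "P \<notin> S"
  shows "CS S w N = (\<Sum>b\<le>N div degree P. Gs w (P ^ b) * CS (insert P S) (w * P ^ b) (N - b * degree P))"
proof -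
  have "CS S w N = (\<Sum>(b, F)\<in>(SIGMA b:{..N div degree P}. coprime_monics (insert P S) (N - b * degree P)). Gs w (P ^ b * F))"
    unfolding CS_def
    by (subst sum.reindex_bij_betw[OF prime_split_bij[OF P S PS], symmetric]) (simp add: case_prod_unfold)
  also have "\<dots> = (\<Sum>(b, F)\<in>(SIGMA b:{..N div degree P}. coprime_monics (insert P S) (N - b * degree P)).
      Gs w (P ^ b) * Gs (w * P ^ b) F)"
  proof (rule sum.cong[OF refl], clarify)
    fix b F assume F: "F \<in> coprime_monics (insert P S) (N - b * degree P)"
    show "Gs w (P ^ b * F) = Gs w (P ^ b) * Gs (w * P ^ b) F"
      by (rule Gs_mult) (use F mprimesD[OF P] in \<open>auto simp: coprime_monics_def monics_def lead_coeff_power\<close>)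
  qed
  also have "\<dots> = (\<Sum>b\<le>N div degree P. \<Sum>F\<in>coprime_monics (insert P S) (N - b * degree P). Gs w (P ^ b) * Gs (w * P ^ b) F)"
    by (rule sum.Sigma[symmetric]) auto
  finally show ?thesis by (simp add: CS_def sum_distrib_left)
qed

lemma Gs_one [simp]: "Gs w 1 = 1"
  by (simp add: Gs_def)

text \<open>Loss factors for the exponent of \<open>P\<close> in the frequency modulo 3. They are
  chosen so that \<open>16 - cw a\<close> is the sum of the weights up to \<open>a\<close> for
  \<open>a < 3\<close>. One period sums to 14, and the whole series with ratio at most 1/15 to at
  most 15, so the tail beyond \<open>a\<close> is at most \<open>cw a - 1\<close>.\<close>

definition cw :: "nat \<Rightarrow> real" where
  "cw r = (if r mod 3 = 0 then 8 else if r mod 3 = 1 then 4 else 2)"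

lemma cw_pos: "cw r > 0" "cw r \<ge> 0" by (auto simp: cw_def)

lemma sum_cw_le:
  assumes x: "0 \<le> x" "15 * x \<le> 1"
  shows "(\<Sum>j<n. cw j * x ^ (j div 3)) \<le> 15"
proof -
  have e: "(\<Sum>j<3 * k. cw j * x ^ (j div 3)) = 14 * (\<Sum>i<k. x ^ i)" for k
  proof (induction k)
    case (Suc k)
    have "3 * Suc k = Suc (Suc (Suc (3 * k)))" by simp
    then have "(\<Sum>j<3 * Suc k. cw j * x ^ (j div 3)) =
       (\<Sum>j<3 * k. cw j * x ^ (j div 3)) + cw (3 * k) * x ^ ((3 * k) div 3)
        + cw (Suc (3 * k)) * x ^ (Suc (3 * k) div 3) + cw (Suc (Suc (3 * k))) * x ^ (Suc (Suc (3 * k)) div 3)"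
      by (simp only: sum.lessThan_Suc)
    moreover have "Suc (3 * k) div 3 = k" "Suc (Suc (3 * k)) div 3 = k" "Suc (3 * k) mod 3 = 1" "Suc (Suc (3 * k)) mod 3 = 2"
      by (simp_all add: div_Suc mod_Suc)
    moreover from this(3,4) have "cw (3 * k) = 8" "cw (Suc (3 * k)) = 4" "cw (Suc (Suc (3 * k))) = 2"
      by (simp_all add: cw_def)
    ultimately show ?case using Suc by (simp add: algebra_simps)
  qed simp
  have "(\<Sum>j<n. cw j * x ^ (j div 3)) \<le> (\<Sum>j<3 * n. cw j * x ^ (j div 3))"
    by (rule sum_mono2) (use x cw_pos in auto)
  also have "\<dots> = 14 * (\<Sum>i<n. x ^ i)" by (rule e)
  also have "\<dots> \<le> 14 * (15 / 14)"
  proof (rule mult_left_mono)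
    have "(1 - x) * (\<Sum>i<n. x ^ i) = 1 - x ^ n" by (simp add: one_diff_power_eq)
    moreover have "0 \<le> x ^ n" using x by simp
    ultimately have "(1 - x) * (\<Sum>i<n. x ^ i) \<le> 1" by simp
    moreover have "14 / 15 * (\<Sum>i<n. x ^ i) \<le> (1 - x) * (\<Sum>i<n. x ^ i)"
      by (rule mult_right_mono) (use x in \<open>auto intro: sum_nonneg\<close>)
    ultimately show "(\<Sum>i<n. x ^ i) \<le> 15 / 14" by simp
  qed simp
  finally show ?thesis by simp
qed

lemma Bd_pos: "Bd w N > 0" using q_ge by (simp add: Bd_def)

text \<open>The loss in a factor \<open>P ^ b\<close> of the modulus outweighs the trivial bound for the Gauss sum,
  since \<open>C\<^sup>S\<close> only depends on the exponent of \<open>P\<close> in \<open>w\<close> modulo 3.\<close>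

lemma CS_bound:
  assumes q15: "q \<ge> 15" and fin: "finite S" and S: "S \<subseteq> mprimes"
  shows "w \<noteq> 0 \<Longrightarrow> cmod (CS S w N) \<le> 4 * 8 ^ card S * Bd w N"
  using fin S
proof (induction S arbitrary: w N rule: finite_induct)
  case empty
  then show ?case using Cs_bound by (simp add: CS_empty)
next
  case (insert P S)
  have P: "P \<in> mprimes" and S: "S \<subseteq> mprimes" using insert by auto
  define K where "K = 4 * (8::real) ^ card S"
  have K: "K > 0" by (simp add: K_def)
  have IHS: "cmod (CS S w N) \<le> K * Bd w N" if "w \<noteq> 0" for w N
    using insert(3)[OF that S] by (simp add: K_def)
  define p where "p = degree P"
  have p: "p > 0" using mprimesD[OF P] by (simp add: p_def)
  have red: "CS (insert P S) (w * P ^ j) N = CS (insert P S) (w * P ^ (j mod 3)) N" for w j N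
  proof -
    have e: "P ^ j = P ^ (j mod 3) * (P ^ (j div 3)) ^ 3"
      by (simp flip: power_mult power_add)
    have "w * P ^ j = (w * P ^ (j mod 3)) * (P ^ (j div 3)) ^ 3"
      by (subst e) (simp only: mult.assoc)
    also have "CS (insert P S) \<dots> N = CS (insert P S) (w * P ^ (j mod 3)) N" by (rule CS_cube) simp
    finally show ?thesis .
  qed
  define x where "x = 1 / real q ^ p"
  have "real q ^ 1 \<le> real q ^ p" using p q15 by (intro power_increasing) auto
  moreover have "15 \<le> real q" using q15 by simp
  ultimately have "15 \<le> real q ^ p" unfolding power_one_right by linarith
  then have x: "0 \<le> x" "15 * x \<le> 1" using q15 by (auto simp: x_def divide_le_eq_1_pos)
  \<comment> \<open>The trivial bound for the Gauss sum modulo \<open>P^b\<close> times the bound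
    for the shorter sum reproduces the old bound, except that each cube removed from the frequency
    gains a factor \<open>x = q^(-p)\<close>.\<close>
  have BdP: "real q ^ (b * p) * Bd (w0 * P ^ ((a + b) mod 3)) (N - b * p) = Bd (w0 * P ^ a) N * x ^ ((a + b) div 3)"
    if "w0 \<noteq> 0" "b * p \<le> N" for w0 a b N
  proof -
    have qp: "real q > 0" using q15 by simp
    have d: "degree (w0 * P ^ j) = degree w0 + j * p" for j
      using that mprimesD[OF P] by (simp add: degree_mult_eq degree_power_eq p_def)
    have "real q ^ (b * p) = real q powr (real b * real p)" using powr_realpow[OF qp, of "b * p"] by simp
    moreover have "x ^ ((a + b) div 3) = real q powr (- (real p * real ((a + b) div 3)))"
      using powr_realpow[OF qp, of "p * ((a + b) div 3)"]
      by (simp add: x_def power_divide powr_minus_divide flip: power_mult)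
    moreover have "real b * real p + (4 * real (N - b * p) + real (degree w0 + (a + b) mod 3 * p) + 2) / 3
      = (4 * real N + real (degree w0 + a * p) + 2) / 3 + - (real p * real ((a + b) div 3))"
    proof -
      define D R where "D = (a + b) div 3" and "R = (a + b) mod 3"
      have "a + b = 3 * D + R" by (simp add: D_def R_def)
      then have "(real a + real b) * real p = (3 * real D + real R) * real p" by (metis of_nat_add of_nat_mult of_nat_numeral)
      then have 1: "real a * real p + real b * real p = 3 * (real D * real p) + real R * real p"
        by (simp add: distrib_right)
      have aux: "U + Y = 3 * Z + V \<Longrightarrow> Y + (4 * (n - Y) + (d + V) + 2) / 3 = (4 * n + (d + U) + 2) / 3 + - Z"
        for U Y Z V n d :: real by (simp add: field_simps)
      have 2: "real (N - b * p) = real N - real b * real p" using that(2) by (simp add: of_nat_diff)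
      show ?thesis unfolding D_def[symmetric] R_def[symmetric] 2 of_nat_add of_nat_mult mult.commute[of "real p" "real D"]
        by (rule aux[OF 1])
    qed
    ultimately show ?thesis unfolding Bd_def d by (simp flip: powr_add)
  qed
  \<comment> \<open>Strong induction on \<open>N\<close>: the term \<open>b = 0\<close> of
    \<open>CS_split\<close> is the sum to be bounded, and all other terms have shorter
    moduli.\<close>
  have main: "cmod (CS (insert P S) (w0 * P ^ a) N) \<le> cw a * K * Bd (w0 * P ^ a) N" if "w0 \<noteq> 0" "a < 3" for w0 a N
    using that
  proof (induction N arbitrary: w0 a rule: less_induct)
    case (less N)
    define w where "w = w0 * P ^ a"
    have w0: "w \<noteq> 0" using less mprimesD[OF P] by (simp add: w_def)
    let ?T = "\<lambda>b. Gs w (P ^ b) * CS (insert P S) (w * P ^ b) (N - b * p)"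
    have "CS S w N = (\<Sum>b\<le>N div p. ?T b)" unfolding p_def by (rule CS_split[OF P S insert(2)])
    also have "\<dots> = ?T 0 + (\<Sum>b\<in>{1..N div p}. ?T b)"
      by (subst sum.remove[of _ 0]) (auto intro!: sum.cong)
    finally have "CS (insert P S) w N = CS S w N - (\<Sum>b\<in>{1..N div p}. ?T b)" by simp
    then have "cmod (CS (insert P S) w N) \<le> cmod (CS S w N) + cmod (\<Sum>b\<in>{1..N div p}. ?T b)"
      using norm_triangle_ineq4[of "CS S w N" "\<Sum>b\<in>{1..N div p}. ?T b"] by simp
    also have "cmod (\<Sum>b\<in>{1..N div p}. ?T b) \<le> (\<Sum>b\<in>{1..N div p}. cw (a + b) * x ^ ((a + b) div 3) * (K * Bd w N))"
    proof (rule sum_norm_le)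
      fix b assume b: "b \<in> {1..N div p}"
      then have bp: "b * p \<le> N" using p by (simp add: less_eq_div_iff_mult_less_eq)
      have bp0: "b * p > 0" using b p by simp
      then have "0 < N" using bp by (rule less_le_trans)
      with bp0 have lt: "N - b * p < N" by (rule diff_less)
      have "cmod (Gs w (P ^ b)) \<le> real q ^ (b * p)"
        using norm_Gs[of w "P ^ b"] mprimesD[OF P] by (simp add: degree_power_eq p_def mult.commute)
      moreover have "cmod (CS (insert P S) (w * P ^ b) (N - b * p)) \<le> cw (a + b) * K * Bd (w0 * P ^ ((a + b) mod 3)) (N - b * p)"
      proof -
        have "CS (insert P S) (w * P ^ b) (N - b * p) = CS (insert P S) (w0 * P ^ ((a + b) mod 3)) (N - b * p)"
          using red[of w0 "a + b"] by (simp add: w_def power_add mult.assoc)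
        moreover have "cw (a + b) = cw ((a + b) mod 3)" by (simp add: cw_def)
        ultimately show ?thesis using less(1)[OF lt less(2), of "(a + b) mod 3"] by simp
      qed
      ultimately have "cmod (?T b) \<le> real q ^ (b * p) * (cw (a + b) * K * Bd (w0 * P ^ ((a + b) mod 3)) (N - b * p))"
        unfolding norm_mult by (intro mult_mono) auto
      also have "\<dots> = cw (a + b) * K * (real q ^ (b * p) * Bd (w0 * P ^ ((a + b) mod 3)) (N - b * p))" by (simp only: mult_ac)
      also have "\<dots> = cw (a + b) * x ^ ((a + b) div 3) * (K * Bd w N)"
        unfolding BdP[OF less(2) bp] w_def by (simp only: mult_ac)
      finally show "cmod (?T b) \<le> cw (a + b) * x ^ ((a + b) div 3) * (K * Bd w N)" .
    qed
    also have "\<dots> = (\<Sum>b\<in>{1..N div p}. cw (a + b) * x ^ ((a + b) div 3)) * (K * Bd w N)"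
      by (simp add: sum_distrib_right)
    \<comment> \<open>The part of the weight series beyond \<open>a\<close>, at most 15 minus the
      part up to \<open>a\<close>. Together with the 1 from the sum for \<open>S\<close> it gives
      back \<open>cw a\<close>, which closes the induction.\<close>
    also have "(\<Sum>b\<in>{1..N div p}. cw (a + b) * x ^ ((a + b) div 3)) \<le> cw a - 1"
    proof -
      have "(\<Sum>b\<in>{1..N div p}. cw (a + b) * x ^ ((a + b) div 3)) = (\<Sum>j\<in>{a + 1..a + N div p}. cw j * x ^ (j div 3))"
        by (rule sum.reindex_bij_witness[of _ "\<lambda>j. j - a" "\<lambda>b. a + b"]) auto
      moreover have "(\<Sum>j<a + N div p + 1. cw j * x ^ (j div 3)) =
          (\<Sum>j\<le>a. cw j * x ^ (j div 3)) + (\<Sum>j\<in>{a + 1..a + N div p}. cw j * x ^ (j div 3))"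
      proof -
        have "{..<a + N div p + 1} = {..a} \<union> {a + 1..a + N div p}" by auto
        then show ?thesis by (simp add: sum.union_disjoint)
      qed
      moreover have "(\<Sum>j\<le>a. cw j * x ^ (j div 3)) = 16 - cw a"
      proof -
        have "a = 0 \<or> a = 1 \<or> a = 2" using less(3) by auto
        moreover have "{..1} = {0, 1 :: nat}" "{..2} = {0, 1, 2 :: nat}" by auto
        moreover have "cw 0 = 8" "cw 1 = 4" "cw 2 = 2" by (simp_all add: cw_def)
        ultimately show ?thesis by (elim disjE) simp_all
      qed
      ultimately show ?thesis using sum_cw_le[OF x, of "a + N div p + 1"] by linarith
    qed
    finally have "cmod (CS (insert P S) w N) \<le> cmod (CS S w N) + (cw a - 1) * (K * Bd w N)"
      using K Bd_pos[of w N] by (simp add: mult_right_mono)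
    also have "\<dots> \<le> K * Bd w N + (cw a - 1) * (K * Bd w N)" using IHS[OF w0] by simp
    finally show ?case by (simp add: w_def algebra_simps)
  qed
  have "cmod (CS (insert P S) w N) \<le> cw 0 * K * Bd w N" using main[OF insert(4), of 0 N] by simp
  then show ?case using insert(1,2) by (simp add: cw_def K_def mult_ac)
qed

end

section \<open>Moduli divisible by given squares\<close>

definition sqdiv :: "'k::field_gcd poly set \<Rightarrow> nat \<Rightarrow> 'k poly set" where
  "sqdiv S N = {F \<in> monics N. \<forall>P\<in>S. P ^ 2 dvd F}"

definition prime_powers :: "'k::field_gcd poly set \<Rightarrow> ('k poly \<Rightarrow> nat) \<Rightarrow> 'k poly" where
  "prime_powers S b = (\<Prod>P\<in>S. P ^ b P)"

context
  fixes S :: "'k::field_gcd poly set"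
  assumes fin: "finite S" and S: "S \<subseteq> mprimes"
begin

lemma prime_powers_nz: "prime_powers S b \<noteq> 0"
  using fin S mprimesD(3) by (auto simp: prime_powers_def)

lemma degree_prime_powers: "degree (prime_powers S b) = (\<Sum>P\<in>S. b P * degree P)"
proof -
  have "degree (\<Prod>P\<in>S. P ^ b P) = (\<Sum>P\<in>S. degree (P ^ b P))"
    by (rule degree_prod_eq_sum_degree) (use S mprimesD(3) in auto)
  also have "\<dots> = (\<Sum>P\<in>S. b P * degree P)"
  proof (rule sum.cong[OF refl])
    fix P assume "P \<in> S"
    then have "P \<noteq> 0" using S mprimesD(3) by blast
    then show "degree (P ^ b P) = b P * degree P" by (simp add: degree_power_eq mult.commute)
  qed
  finally show ?thesis by (simp add: prime_powers_def)
qed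

lemma lead_coeff_prime_powers: "lead_coeff (prime_powers S b) = 1"
  using fin S unfolding prime_powers_def
proof (induction S)
  case (insert P T)
  have "(\<Prod>Q\<in>insert P T. Q ^ b Q) = P ^ b P * (\<Prod>Q\<in>T. Q ^ b Q)" using insert by simp
  moreover have "lead_coeff P = 1" using insert mprimesD(2) by blast
  ultimately show ?case using insert by (simp only: lead_coeff_mult lead_coeff_power insert_subset) simp
qed simp

lemma prime_powers_mult: "prime_powers S b * prime_powers S c = prime_powers S (\<lambda>P. b P + c P)"
  by (simp add: prime_powers_def power_add prod.distrib)

lemma prime_powers_power: "prime_powers S b ^ n = prime_powers S (\<lambda>P. b P * n)"
  by (simp add: prime_powers_def power_mult prod_power_distrib)

lemma coprime_prime_powers: "\<forall>P\<in>S. coprime P F \<Longrightarrow> coprime (prime_powers S b) F"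
  unfolding prime_powers_def by (rule prod_coprime_left) simp

lemma multiplicity_prime_powers:
  assumes F: "\<forall>P\<in>S. coprime P F" and P: "P \<in> S"
  shows "multiplicity P (prime_powers S b * F) = b P"
proof -
  have Pm: "P \<in> mprimes" using P S by auto
  define R where "R = (\<Prod>Q\<in>S - {P}. Q ^ b Q) * F"
  have "coprime P (\<Prod>Q\<in>S - {P}. Q ^ b Q)"
    by (rule prod_coprime_right) (use mprimes_coprime[OF Pm] S in auto)
  then have "coprime P R" using F P by (simp add: R_def)
  then have nd: "\<not> P dvd R" using mprimes_coprime_iff[OF Pm] by simp
  have e: "prime_powers S b * F = P ^ b P * R"
    using prod.remove[OF fin P, of "\<lambda>Q. Q ^ b Q"] by (simp add: prime_powers_def R_def mult.assoc)
  show ?thesis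
  proof (rule multiplicity_eqI)
    show "P ^ b P dvd prime_powers S b * F" unfolding e by simp
    show "\<not> P ^ Suc (b P) dvd prime_powers S b * F"
      unfolding e using nd mprimesD(3)[OF Pm] by (simp add: mult.commute[of P])
  qed
qed

lemma prime_powers_dvd: "(\<And>P. P \<in> S \<Longrightarrow> P ^ b P dvd F) \<Longrightarrow> prime_powers S b dvd F"
  using fin S unfolding prime_powers_def
proof (induction S)
  case (insert P T)
  have "coprime (P ^ b P) (\<Prod>Q\<in>T. Q ^ b Q)"
    by (rule prod_coprime_right) (use mprimes_coprime[of P] insert in auto)
  then show ?case using insert by (auto intro!: divides_mult)
qed simp

text \<open>The exponents are the multiplicities in the modulus of the primes in \<open>S\<close>,
  hence at least 2. The limit \<open>N\<close> follows from the degree and keeps the index set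
  finite.\<close>

lemma sqdiv_bij:
  "bij_betw (\<lambda>(b, F). prime_powers S b * F)
    (SIGMA b:{b \<in> Pi\<^sub>E S (\<lambda>_. {2..N}). degree (prime_powers S b) \<le> N}.
       coprime_monics S (N - degree (prime_powers S b))) (sqdiv S N)"
  unfolding bij_betw_def
proof
  let ?B = "{b \<in> Pi\<^sub>E S (\<lambda>_. {2..N}). degree (prime_powers S b) \<le> N}"
  show "inj_on (\<lambda>(b, F). prime_powers S b * F) (SIGMA b:?B. coprime_monics S (N - degree (prime_powers S b)))"
  proof (rule inj_onI, clarify)
    fix b F c G
    assume b: "b \<in> Pi\<^sub>E S (\<lambda>_. {2..N})" and c: "c \<in> Pi\<^sub>E S (\<lambda>_. {2..N})"
      and F: "F \<in> coprime_monics S (N - degree (prime_powers S b))" and G: "G \<in> coprime_monics S (N - degree (prime_powers S c))"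
      and e: "prime_powers S b * F = prime_powers S c * G"
    have "b P = c P" if "P \<in> S" for P
      using multiplicity_prime_powers[OF _ that, of F b] multiplicity_prime_powers[OF _ that, of G c] F G e
      by (auto simp: coprime_monics_def)
    then have "b = c" using b c by (meson PiE_ext)
    then show "b = c \<and> F = G" using e prime_powers_nz by simp
  qed
  show "(\<lambda>(b, F). prime_powers S b * F) ` (SIGMA b:?B. coprime_monics S (N - degree (prime_powers S b))) = sqdiv S N"
  proof (intro equalityI subsetI)
    fix F assume "F \<in> (\<lambda>(b, F). prime_powers S b * F) ` (SIGMA b:?B. coprime_monics S (N - degree (prime_powers S b)))"
    then obtain b G where b: "b \<in> Pi\<^sub>E S (\<lambda>_. {2..N})" "degree (prime_powers S b) \<le> N"
      and G: "G \<in> coprime_monics S (N - degree (prime_powers S b))" and F: "F = prime_powers S b * G" by auto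
    have "prime_powers S b \<in> monics (degree (prime_powers S b))" by (simp add: monics_def lead_coeff_prime_powers)
    from monics_mult[OF this, of G "N - degree (prime_powers S b)"] have "F \<in> monics N"
      using G b(2) by (simp add: F coprime_monics_def)
    moreover have "P ^ 2 dvd F" if "P \<in> S" for P
    proof -
      have "P ^ 2 dvd P ^ b P" using b(1) that by (intro le_imp_power_dvd) auto
      also have "\<dots> dvd prime_powers S b" unfolding prime_powers_def using fin that by (intro dvd_prodI) auto
      finally show ?thesis by (simp add: F)
    qed
    ultimately show "F \<in> sqdiv S N" by (simp add: sqdiv_def)
  next
    fix F assume F: "F \<in> sqdiv S N"
    then have F0: "F \<noteq> 0" "degree F = N" "lead_coeff F = 1" using monics_nz by (auto simp: sqdiv_def monics_def)
    define b where "b = restrict (\<lambda>P. multiplicity P F) S"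
    have bP: "b P = multiplicity P F" if "P \<in> S" for P using that by (simp add: b_def)
    have "prime_powers S b dvd F"
      by (rule prime_powers_dvd) (simp add: bP multiplicity_dvd)
    then obtain G where G: "F = prime_powers S b * G" by (auto simp: dvd_def)
    have G0: "G \<noteq> 0" using F0 G by auto
    have dF: "N = degree (prime_powers S b) + degree G"
      using F0(2) G prime_powers_nz G0 by (metis degree_mult_eq)
    have "lead_coeff F = lead_coeff (prime_powers S b) * lead_coeff G" unfolding G by (rule lead_coeff_mult)
    then have lG: "lead_coeff G = 1" using F0(3) lead_coeff_prime_powers by simp
    have "coprime P G" if P: "P \<in> S" for P
    proof -
      have Pm: "P \<in> mprimes" using P S by auto
      have "\<not> P dvd G"
      proof
        assume "P dvd G"
        moreover have "P ^ b P dvd prime_powers S b" unfolding prime_powers_def using fin P by (intro dvd_prodI) auto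
        ultimately have "P ^ b P * P dvd F" unfolding G by (intro mult_dvd_mono)
        then have "P ^ Suc (b P) dvd F" by (simp add: mult.commute)
        then show False unfolding bP[OF P]
          using power_dvd_iff_le_multiplicity[OF F0(1) mprimesD(4)[OF Pm], of "Suc (multiplicity P F)"] by simp
      qed
      then show ?thesis using mprimes_coprime_iff[OF Pm] by simp
    qed
    then have "G \<in> coprime_monics S (N - degree (prime_powers S b))"
      using lG dF by (simp add: coprime_monics_def monics_def)
    moreover have "b \<in> Pi\<^sub>E S (\<lambda>_. {2..N})"
    proof (rule PiE_I)
      fix P assume P: "P \<in> S"
      then have Pm: "P \<in> mprimes" using S by auto
      have "2 \<le> b P" using F P unfolding bP[OF P]
        using power_dvd_iff_le_multiplicity[OF F0(1) mprimesD(4)[OF Pm], of 2] by (simp add: sqdiv_def)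
      moreover have "P ^ b P dvd F" using bP[OF P] by (simp add: multiplicity_dvd)
      then have "degree (P ^ b P) \<le> N" using F0 by (metis dvd_imp_degree_le)
      then have "b P * degree P \<le> N" using mprimesD(3)[OF Pm] by (simp add: degree_power_eq mult.commute)
      then have "b P \<le> N" using mprimesD(5)[OF Pm]
        by (metis One_nat_def Suc_leI le_trans mult.right_neutral mult_le_mono2)
      ultimately show "b P \<in> {2..N}" by simp
    qed (simp add: b_def)
    ultimately show "F \<in> (\<lambda>(b, F). prime_powers S b * F) ` (SIGMA b:?B. coprime_monics S (N - degree (prime_powers S b)))"
      using G dF by (intro image_eqI[of _ _ "(b, G)"]) auto
  qed
qed

end

lemma finite_sqdiv [simp]: "finite (sqdiv S N :: 'k::{field_gcd,finite} poly set)"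
  by (simp add: sqdiv_def)

text \<open>Weighted by the degrees of the primes, this bounds the exponent that remains after the
  Poisson step. Equality holds at \<open>b = 2\<close>: exact squares are the worst case.\<close>

lemma cubefree_exponent_ineq: "2 \<le> b \<Longrightarrow> 2 * ((2 * b + 2) mod 3) + 14 \<le> 7 * (b::nat)"
proof -
  assume b: "2 \<le> b"
  have "b = 2 \<or> b = 3 \<or> 4 \<le> b" using b by linarith
  moreover have "(2 * b + 2) mod 3 \<le> 2" using mod_less_divisor[of 3 "2 * b + 2"] by linarith
  ultimately show ?thesis by auto
qed

lemma (in cubic_char_field) J_prime_powers:
  assumes "finite S" "S \<subseteq> mprimes"
  shows "J (prime_powers S b) f = (\<Prod>P\<in>S. J P f ^ b P)"
  using assms
proof (induction S)
  case (insert P T)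
  have "J (P ^ b P * prime_powers T b) f = J (P ^ b P) f * J (prime_powers T b) f"
    by (rule J_mult_left) (use insert mprimesD(2)[of P] lead_coeff_prime_powers[of T b] in \<open>auto simp: lead_coeff_power\<close>)
  then show ?case using insert mprimesD(2)[of P] by (simp add: prime_powers_def J_power_left)
qed (simp add: prime_powers_def)

context cubic_psi
begin

text \<open>The symbol modulo a product of prime powers depends only on the argument modulo the
  radical, so \<open>Gs_support\<close> applies with the radical as period.\<close>

lemma Gs_prime_powers_support:
  assumes "finite S" "S \<subseteq> mprimes" "\<not> prime_powers S b dvd w * prime_powers S (\<lambda>_. 1)"
  shows "Gs w (prime_powers S b) = 0"
proof (rule Gs_support[OF prime_powers_nz[OF assms(1,2)] _ assms(3)])
  fix y t
  have "J P (y + prime_powers S (\<lambda>_. 1) * t) = J P y" if "P \<in> S" for P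
  proof (rule J_cong)
    have "P dvd prime_powers S (\<lambda>_. 1)" unfolding prime_powers_def using assms(1) that by (auto intro: dvd_prodI)
    then show "P dvd y + prime_powers S (\<lambda>_. 1) * t - y" by simp
  qed
  then show "J (prime_powers S b) (y + prime_powers S (\<lambda>_. 1) * t) = J (prime_powers S b) y"
    by (simp add: J_prime_powers[OF assms(1,2)])
qed

lemma sum_Gs_sqdiv:
  assumes "finite S" "S \<subseteq> mprimes"
  shows "(\<Sum>F\<in>sqdiv S N. Gs w F) = (\<Sum>b\<in>{b \<in> Pi\<^sub>E S (\<lambda>_. {2..N}). degree (prime_powers S b) \<le> N}.
     Gs w (prime_powers S b) * CS S (w * prime_powers S b) (N - degree (prime_powers S b)))"
proof -
  let ?B = "{b \<in> Pi\<^sub>E S (\<lambda>_. {2..N}). degree (prime_powers S b) \<le> N}"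
  have finB: "finite ?B" using assms by (simp add: finite_PiE)
  have "(\<Sum>F\<in>sqdiv S N. Gs w F) = (\<Sum>(b, F)\<in>(SIGMA b:?B. coprime_monics S (N - degree (prime_powers S b))). Gs w (prime_powers S b * F))"
    by (subst sum.reindex_bij_betw[OF sqdiv_bij[OF assms], symmetric]) (simp add: case_prod_unfold)
  also have "\<dots> = (\<Sum>b\<in>?B. \<Sum>F\<in>coprime_monics S (N - degree (prime_powers S b)). Gs w (prime_powers S b * F))"
    by (rule sum.Sigma[symmetric]) (use finB in auto)
  also have "\<dots> = (\<Sum>b\<in>?B. \<Sum>F\<in>coprime_monics S (N - degree (prime_powers S b)). Gs w (prime_powers S b) * Gs (w * prime_powers S b) F)"
  proof (intro sum.cong refl)
    fix b F assume F: "F \<in> coprime_monics S (N - degree (prime_powers S b))"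
    show "Gs w (prime_powers S b * F) = Gs w (prime_powers S b) * Gs (w * prime_powers S b) F"
      by (rule Gs_mult) (use F lead_coeff_prime_powers[OF assms] coprime_prime_powers[OF assms] in
        \<open>auto simp: coprime_monics_def monics_def\<close>)
  qed
  finally show ?thesis by (simp add: CS_def sum_distrib_left)
qed

text \<open>Write \<open>H\<close> for the modulus part, \<open>D\<close> for its radical, and
  \<open>w * D = H * v\<close>. Multiplying the frequency \<open>w * H\<close> by the cube
  \<open>D^3\<close> gives \<open>v * H^2 * D^2\<close>. Removing the largest cube
  \<open>E^3\<close> from \<open>H^2 * D^2\<close> leaves \<open>v * R\<close>, whose degree is much
  smaller.\<close>

lemma CS_reduced_bound:
  assumes q15: "q \<ge> 15" and fin: "finite S" and S: "S \<subseteq> mprimes"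
    and w: "w \<in> below (m + 1)" "w \<noteq> 0" and dv: "prime_powers S b dvd w * prime_powers S (\<lambda>_. 1)"
    and hN: "degree (prime_powers S b) \<le> N"
  shows "cmod (CS S (w * prime_powers S b) (N - degree (prime_powers S b))) \<le> 4 * 8 ^ card S *
    real q powr ((4 * real N - 5 * real (degree (prime_powers S b)) + real m + real (degree (prime_powers S (\<lambda>_. 1)))
      + real (degree (prime_powers S (\<lambda>P. (2 * b P + 2) mod 3))) + 2) / 3)"
proof -
  define H D R E where "H = prime_powers S b" and "D = prime_powers S (\<lambda>_. 1)"
    and "R = prime_powers S (\<lambda>P. (2 * b P + 2) mod 3)" and "E = prime_powers S (\<lambda>P. (2 * b P + 2) div 3)"
  have nz: "H \<noteq> 0" "D \<noteq> 0" "R \<noteq> 0" using prime_powers_nz[OF fin S] by (auto simp: H_def D_def R_def)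
  obtain v where v: "w * D = H * v" using dv by (auto simp: dvd_def H_def D_def)
  have v0: "v \<noteq> 0" using v nz w by auto
  have dvv: "degree w + degree D = degree H + degree v"
    using v nz w v0 by (metis degree_mult_eq)
  have "H ^ 2 * D ^ 2 = prime_powers S (\<lambda>P. 2 * b P + 2)"
    unfolding H_def D_def prime_powers_power[OF fin S] prime_powers_mult[OF fin S] by (simp add: mult.commute)
  also have "\<dots> = prime_powers S (\<lambda>P. (2 * b P + 2) mod 3 + (2 * b P + 2) div 3 * 3)"
    by (simp only: mod_div_mult_eq)
  also have "\<dots> = R * E ^ 3"
    unfolding R_def E_def prime_powers_power[OF fin S] prime_powers_mult[OF fin S] ..
  finally have RE: "H ^ 2 * D ^ 2 = R * E ^ 3" .
  have "CS S (w * H) (N - degree H) = CS S (w * H * D ^ 3) (N - degree H)"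
    by (rule CS_cube[symmetric]) (auto simp: D_def intro: coprime_prime_powers[OF fin S])
  also have "w * H * D ^ 3 = (w * D) * H * D ^ 2" by (simp add: power2_eq_square power3_eq_cube mult_ac)
  also have "\<dots> = v * (H ^ 2 * D ^ 2)" unfolding v by (simp add: power2_eq_square mult_ac)
  also have "\<dots> = (v * R) * E ^ 3" unfolding RE by (simp add: mult_ac)
  also have "CS S ((v * R) * E ^ 3) (N - degree H) = CS S (v * R) (N - degree H)"
    by (rule CS_cube) (auto simp: E_def intro: coprime_prime_powers[OF fin S])
  finally have "cmod (CS S (w * H) (N - degree H)) \<le> 4 * 8 ^ card S * Bd (v * R) (N - degree H)"
    using CS_bound[OF q15 fin S, of "v * R"] v0 nz by simp
  also have "Bd (v * R) (N - degree H) \<le>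
    real q powr ((4 * real N - 5 * real (degree H) + real m + real (degree D) + real (degree R) + 2) / 3)"
    unfolding Bd_def
  proof (rule powr_mono)
    have "degree w \<le> m" using w by (auto simp: below_def)
    then have "real (degree H) + real (degree v) \<le> real m + real (degree D)" using dvv by linarith
    moreover have "real (degree (v * R)) = real (degree v) + real (degree R)" using v0 nz by (simp add: degree_mult_eq)
    moreover have "real (N - degree H) = real N - real (degree H)" using hN by (simp add: H_def of_nat_diff)
    ultimately show "(4 * real (N - degree H) + real (degree (v * R)) + 2) / 3 \<le>
      (4 * real N - 5 * real (degree H) + real m + real (degree D) + real (degree R) + 2) / 3"
      by (simp add: field_simps)
  qed (use q15 in simp)
  finally show ?thesis by (simp add: H_def D_def R_def)
qed

text \<open>Cauchy-Schwarz combines the sparsity of the frequencies with \<open>H dvd w * D\<close>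
  and Parseval. The condition on \<open>m\<close> makes the frequencies distinct residues modulo
  \<open>H\<close>.\<close>

lemma sum_Gs_support_bound:
  assumes fin: "finite S" and S: "S \<subseteq> mprimes"
    and mh: "m + 1 \<le> degree (prime_powers S b)"
  defines "H \<equiv> prime_powers S b" and "D \<equiv> prime_powers S (\<lambda>_. 1)"
  shows "(\<Sum>w\<in>{w \<in> below (m + 1). w \<noteq> 0 \<and> H dvd w * D}. cmod (Gs w H)) \<le>
    real q powr ((real m + 1 + real (degree D) - real (degree H)) / 2 + real (degree H))"
proof -
  let ?W = "{w \<in> below (m + 1). w \<noteq> 0 \<and> H dvd w * D}"
  define e where "e = real m + 1 + real (degree D) - real (degree H)"
  have qp: "real q > 0" using q_ge by simp
  have nz: "H \<noteq> 0" "D \<noteq> 0" using prime_powers_nz[OF fin S] by (auto simp: H_def D_def)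
  have finW: "finite ?W" by simp
  have v: "\<exists>v. w * D = H * v \<and> v \<noteq> 0 \<and> degree w + degree D = degree H + degree v" if wW: "w \<in> ?W" for w
  proof -
    obtain v where v: "w * D = H * v" using wW by (auto simp: dvd_def)
    moreover have "v \<noteq> 0" using v nz wW by auto
    ultimately show ?thesis using nz wW by (metis (mono_tags, lifting) degree_mult_eq mem_Collect_eq)
  qed
  have card: "real (card ?W) \<le> real q powr e"
  proof (cases "degree H \<le> m + degree D")
    case True
    \<comment> \<open>A frequency \<open>w\<close> is determined by the cofactor \<open>v\<close> in
      \<open>w * D = H * v\<close>, and the cofactors have degree at most
      \<open>m + degree D - degree H\<close>.\<close>
    have sub: "(\<lambda>w. (w * D) div H) ` ?W \<subseteq> below (m + 1 + degree D - degree H)"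
    proof clarify
      fix w assume w: "w \<in> below (m + 1)" "w \<noteq> 0" "H dvd w * D"
      then obtain v where "w * D = H * v" "v \<noteq> 0" "degree w + degree D = degree H + degree v" using v by blast
      then show "(w * D) div H \<in> below (m + 1 + degree D - degree H)"
        using w nz by (auto simp: below_def)
    qed
    have "inj_on (\<lambda>w. (w * D) div H) ?W"
    proof (rule inj_onI)
      fix x y assume x: "x \<in> ?W" and y: "y \<in> ?W" and e: "(x * D) div H = (y * D) div H"
      have "x * D = y * D" using x y e by (metis (mono_tags, lifting) dvd_mult_div_cancel mem_Collect_eq)
      then show "x = y" using nz by simp
    qed
    then have "card ?W \<le> card (below (m + 1 + degree D - degree H) :: 'a poly set)"
      using sub by (intro card_inj_on_le) auto
    then have "real (card ?W) \<le> real (q ^ (m + 1 + degree D - degree H))" by (simp add: card_below q_card)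
    also have "\<dots> = real q powr real (m + 1 + degree D - degree H)" by (simp add: powr_realpow[OF qp])
    also have "real (m + 1 + degree D - degree H) = e" using True by (simp add: e_def of_nat_diff)
    finally show ?thesis .
  next
    case False
    have e0: "?W = {}"
    proof (rule ccontr)
      assume "?W \<noteq> {}"
      then obtain w where w: "w \<in> ?W" by auto
      then have "degree w \<le> m" by (auto simp: below_def)
      then show False using v[OF w] False by auto
    qed
    show ?thesis unfolding e0 by simp
  qed
  have "(\<Sum>w\<in>?W. (cmod (Gs w H))\<^sup>2) \<le> (\<Sum>w\<in>below (degree H). (cmod (Gs w H))\<^sup>2)"
    by (rule sum_mono2) (use mh in \<open>auto simp: H_def intro: below_mono\<close>)
  also have "\<dots> \<le> real q ^ (2 * degree H)" by (rule Gs_parseval[OF nz(1)])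
  finally have pars: "(\<Sum>w\<in>?W. (cmod (Gs w H))\<^sup>2) \<le> real q powr (2 * real (degree H))"
    using powr_realpow[OF qp, of "2 * degree H"] by simp
  have "(\<Sum>w\<in>?W. cmod (Gs w H))\<^sup>2 \<le> real (card ?W) * (\<Sum>w\<in>?W. (cmod (Gs w H))\<^sup>2)"
    using Cauchy_Schwarz_ineq_sum[of "\<lambda>_. 1" "\<lambda>w. cmod (Gs w H)" ?W] by simp
  also have "\<dots> \<le> real q powr e * real q powr (2 * real (degree H))"
    by (intro mult_mono card pars sum_nonneg) auto
  also have "\<dots> = (real q powr (e / 2 + real (degree H)))\<^sup>2"
    by (simp add: power2_eq_square flip: powr_add)
  finally show ?thesis unfolding e_def by (rule power2_le_imp_le) simp
qed

end

section \<open>The average over square-free moduli\<close>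

lemma sum_Pow_alternating:
  "finite A \<Longrightarrow> (\<Sum>S\<in>Pow A. (- 1) ^ card S) = (if A = {} then 1 else 0 :: 'b::comm_ring_1)"
proof (induction A rule: finite_induct)
  case (insert x A)
  have "Pow (insert x A) = Pow A \<union> insert x ` Pow A" by (rule Pow_insert)
  moreover have "Pow A \<inter> insert x ` Pow A = {}" using insert by auto
  moreover have "inj_on (insert x) (Pow A)" using insert by (auto simp: inj_on_def)
  ultimately have "(\<Sum>S\<in>Pow (insert x A). (- 1) ^ card S) =
     (\<Sum>S\<in>Pow A. (- 1) ^ card S) + (\<Sum>S\<in>Pow A. (- 1 :: 'b) ^ card (insert x S))"
    using insert by (simp add: sum.union_disjoint sum.reindex)
  also have "(\<Sum>S\<in>Pow A. (- 1 :: 'b) ^ card (insert x S)) = (\<Sum>S\<in>Pow A. - ((- 1) ^ card S))"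
  proof (rule sum.cong[OF refl])
    fix S assume "S \<in> Pow A"
    then have "finite S" "x \<notin> S" using insert by (auto intro: finite_subset)
    then show "(- 1 :: 'b) ^ card (insert x S) = - ((- 1) ^ card S)" by simp
  qed
  finally show ?case by (simp add: sum_negf)
qed simp

definition sqfree_monics :: "nat \<Rightarrow> 'k::field_gcd poly set" where
  "sqfree_monics N = {F \<in> monics N. \<forall>P\<in>mprimes. \<not> P ^ 2 dvd F}"

lemma finite_sqfree_monics [simp]: "finite (sqfree_monics N :: 'k::{field_gcd,finite} poly set)"
  by (simp add: sqfree_monics_def)

lemma monicsD: "p \<in> monics n \<Longrightarrow> lead_coeff p = 1" "p \<in> monics n \<Longrightarrow> degree p = n"
  unfolding monics_def by blast+

lemma monics_factor:
  fixes F A B :: "'k::field poly"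
  assumes "F \<in> monics N" "F = A * B" "lead_coeff A = 1" shows "B \<in> monics (N - degree A)" "degree A \<le> N"
proof -
  have nz: "A \<noteq> 0" "B \<noteq> 0" using monics_nz[OF assms(1)] assms(2) by auto
  have "N = degree A + degree B" using assms(1,2) nz by (simp add: monics_def degree_mult_eq)
  moreover have "lead_coeff F = lead_coeff A * lead_coeff B" unfolding assms(2) by (rule lead_coeff_mult)
  then have "lead_coeff B = 1" using assms by (simp add: monics_def)
  ultimately show "B \<in> monics (N - degree A)" "degree A \<le> N" by (auto simp: monics_def)
qed

context cubic_char_field
begin

text \<open>A square of degree \<open>2 * a\<close> leaves at most \<open>q^(N - a)\<close>
  polynomials, which is at most \<open>q^(N - 1)\<close> for every \<open>a \<ge> 1\<close>. This
  crude count is enough because \<open>N\<close> is fixed while \<open>q\<close> grows.\<close>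

lemma card_not_sqfree: "real (card (monics N - sqfree_monics N :: 'k poly set)) \<le> real N * real q ^ (N - 1)"
proof -
  let ?A = "{a \<in> {1..N}. 2 * a \<le> N}"
  have "(monics N - sqfree_monics N :: 'k poly set) \<subseteq> (\<Union>a\<in>?A. (\<lambda>(A, G). A ^ 2 * G) ` (monics a \<times> monics (N - 2 * a)))" (is "?L \<subseteq> ?R")
  proof
    fix F :: "'k poly" assume "F \<in> ?L"
    then obtain P where F: "F \<in> monics N" and P: "P \<in> mprimes" and d: "P ^ 2 dvd F" by (auto simp: sqfree_monics_def)
    then obtain G where G: "F = P ^ 2 * G" by (auto simp: dvd_def)
    have l: "lead_coeff (P ^ 2) = 1" using mprimesD(2)[OF P] by (simp add: lead_coeff_power)
    have dg: "degree (P ^ 2) = 2 * degree P" using mprimesD(3)[OF P] by (simp add: degree_power_eq)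
    have "G \<in> monics (N - 2 * degree P)" "2 * degree P \<le> N" using monics_factor[OF F G l] dg by auto
    moreover have "P \<in> monics (degree P)" using mprimesD(2)[OF P] by (simp add: monics_def)
    ultimately show "F \<in> ?R" using G mprimesD(5)[OF P]
      by (intro UN_I[of "degree P"] image_eqI[of _ _ "(P, G)"]) auto
  qed
  then have "card ?L \<le> card ?R" by (intro card_mono) auto
  also have "\<dots> \<le> (\<Sum>a\<in>?A. card ((\<lambda>(A, G). A ^ 2 * G) ` ((monics a :: 'k poly set) \<times> (monics (N - 2 * a) :: 'k poly set))))"
    by (rule card_UN_le) simp
  also have "\<dots> \<le> (\<Sum>a\<in>?A. q ^ (N - 1))"
  proof (rule sum_mono)
    fix a assume a: "a \<in> ?A"
    have "card ((\<lambda>(A, G). A ^ 2 * G) ` ((monics a :: 'k poly set) \<times> (monics (N - 2 * a) :: 'k poly set))) \<le>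
      card ((monics a :: 'k poly set) \<times> (monics (N - 2 * a) :: 'k poly set))" by (rule card_image_le) simp
    also have "\<dots> = q ^ (a + (N - 2 * a))" by (simp add: card_cartesian_product card_monics q_card power_add)
    also have "\<dots> \<le> q ^ (N - 1)" using a q_ge by (intro power_increasing) auto
    finally show "card ((\<lambda>(A, G). A ^ 2 * G) ` ((monics a :: 'k poly set) \<times> (monics (N - 2 * a) :: 'k poly set))) \<le> q ^ (N - 1)" .
  qed
  also have "\<dots> = card ?A * q ^ (N - 1)" by simp
  also have "\<dots> \<le> N * q ^ (N - 1)"
  proof -
    have "card ?A \<le> card {1..N}" by (intro card_mono) auto
    then show ?thesis by simp
  qed
  finally have "real (card ?L) \<le> real (N * q ^ (N - 1))" by (simp only: of_nat_le_iff)
  then show ?thesis by simp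
qed

text \<open>A common monic divisor of degree \<open>a\<close> costs a factor \<open>q^(-a)\<close>,
  again at least one power of \<open>q\<close>.\<close>

lemma card_not_coprime:
  "real (card {(h, F). h \<in> (monics k :: 'k poly set) \<and> F \<in> monics N \<and> \<not> coprime F h}) \<le> real N * real q ^ (k + N - 1)"
proof -
  let ?A = "{a \<in> {1..N}. a \<le> k}"
  let ?g = "\<lambda>(A, h, G). (A * h, A * G)"
  have "{(h, F). h \<in> (monics k :: 'k poly set) \<and> F \<in> monics N \<and> \<not> coprime F h}
     \<subseteq> (\<Union>a\<in>?A. ?g ` (monics a \<times> monics (k - a) \<times> monics (N - a)))" (is "?L \<subseteq> ?R")
  proof clarify
    fix h F :: "'k poly" assume h: "h \<in> monics k" and F: "F \<in> monics N" and nc: "\<not> coprime F h"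
    define g where "g = gcd F h"
    have g0: "g \<noteq> 0" using monics_nz[OF h] by (simp add: g_def)
    define A where "A = smult (inverse (lead_coeff g)) g"
    have A0: "A \<noteq> 0" using g0 by (simp add: A_def)
    have lA: "lead_coeff A = 1" using g0 by (simp add: A_def)
    have "A dvd h" "A dvd F" using g0 by (simp_all add: A_def smult_dvd_iff g_def)
    then obtain h' G where h': "h = A * h'" and G: "F = A * G" unfolding dvd_def by blast
    have dA: "degree A = degree g" using g0 by (simp add: A_def)
    have "\<not> is_unit g" using nc unfolding g_def by (subst is_unit_gcd)
    then have "degree A \<noteq> 0" using g0 unfolding dA by (simp add: is_unit_iff_degree)
    then show "(h, F) \<in> ?R"
      using monics_factor[OF h h' lA] monics_factor[OF F G lA] lA h' G
      by (intro UN_I[of "degree A"] image_eqI[of _ _ "(A, h', G)"]) (auto simp: monics_def[of "degree A"])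
  qed
  then have "card ?L \<le> card ?R" by (intro card_mono) auto
  also have "\<dots> \<le> (\<Sum>a\<in>?A. card (?g ` ((monics a :: 'k poly set) \<times> (monics (k - a) :: 'k poly set) \<times> (monics (N - a) :: 'k poly set))))"
    by (rule card_UN_le) simp
  also have "\<dots> \<le> (\<Sum>a\<in>?A. q ^ (k + N - 1))"
  proof (rule sum_mono)
    fix a assume a: "a \<in> ?A"
    have "card (?g ` ((monics a :: 'k poly set) \<times> (monics (k - a) :: 'k poly set) \<times> (monics (N - a) :: 'k poly set))) \<le>
      card ((monics a :: 'k poly set) \<times> (monics (k - a) :: 'k poly set) \<times> (monics (N - a) :: 'k poly set))" by (rule card_image_le) simp
    also have "\<dots> = q ^ (a + ((k - a) + (N - a)))" by (simp add: card_cartesian_product card_monics q_card power_add)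
    also have "\<dots> \<le> q ^ (k + N - 1)" using a q_ge by (intro power_increasing) auto
    finally show "card (?g ` ((monics a :: 'k poly set) \<times> (monics (k - a) :: 'k poly set) \<times> (monics (N - a) :: 'k poly set))) \<le> q ^ (k + N - 1)" .
  qed
  also have "\<dots> = card ?A * q ^ (k + N - 1)" by simp
  also have "\<dots> \<le> N * q ^ (k + N - 1)"
  proof -
    have "card ?A \<le> card {1..N}" by (intro card_mono) auto
    then show ?thesis by simp
  qed
  finally have "real (card ?L) \<le> real (N * q ^ (k + N - 1))" by (simp only: of_nat_le_iff)
  then show ?thesis by simp
qed

text \<open>The symbol of \<open>h^3\<close> is 1 if \<open>h\<close> is prime to \<open>F\<close>
  and 0 otherwise, so the sum counts coprime pairs. Almost all of the \<open>q^(k + N)\<close> pairs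
  of monic polynomials qualify.\<close>

lemma cube_part:
  assumes N: "N > 0" and n: "n = 3 * k"
  shows "cmod ((\<Sum>F\<in>sqfree_monics N. \<Sum>f\<in>{f \<in> monics n. cube_poly f}. J F f) - of_nat q ^ (k + N))
    \<le> 2 * real N * real q ^ (k + N - 1)"
proof -
  have img: "{f \<in> monics n. cube_poly f} = (\<lambda>h. h ^ 3) ` (monics k :: 'k poly set)"
  proof (intro equalityI subsetI)
    fix f assume "f \<in> {f \<in> monics n. cube_poly f}"
    then obtain H where H: "lead_coeff H = 1" "f = H ^ 3" "degree f = n" by (auto simp: cube_poly_def monics_def)
    then have "H \<noteq> 0" by auto
    then have "H \<in> monics k" using H n by (simp add: monics_def degree_power_eq)
    then show "f \<in> (\<lambda>h. h ^ 3) ` monics k" using H by blast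
  next
    fix f assume "f \<in> (\<lambda>h. h ^ 3) ` (monics k :: 'k poly set)"
    then obtain H where H: "H \<in> monics k" "f = H ^ 3" by auto
    then show "f \<in> {f \<in> monics n. cube_poly f}" using monics_power[OF H(1), of 3] n by (auto simp: cube_poly_def monics_def)
  qed
  have inj: "inj_on (\<lambda>h. h ^ 3) (monics k :: 'k poly set)"
  proof (rule inj_onI)
    fix x y :: "'k poly" assume x: "x \<in> monics k" and y: "y \<in> monics k" and e: "x ^ 3 = y ^ 3"
    have "x dvd y" "y dvd x" using e by (metis dvd_refl pow_divides_pow_iff zero_less_numeral)+
    moreover have "lead_coeff x = lead_coeff y" using monicsD(1)[OF x] monicsD(1)[OF y] by simp
    ultimately show "x = y" by (intro poly_dvd_antisym)
  qed
  let ?K = "monics k :: 'k poly set" and ?M = "monics N :: 'k poly set" and ?Q = "sqfree_monics N :: 'k poly set"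
  define C where "C = {(h, F). h \<in> (monics k :: 'k poly set) \<and> F \<in> ?Q \<and> coprime F h}"
  define V where "V = {(h, F). h \<in> (monics k :: 'k poly set) \<and> F \<in> ?M \<and> \<not> coprime F h}"
  have "(\<Sum>F\<in>?Q. \<Sum>f\<in>{f \<in> monics n. cube_poly f}. J F f) = (\<Sum>F\<in>?Q. \<Sum>h\<in>monics k. if coprime F h then 1 else 0)"
    unfolding img sum.reindex[OF inj]
  proof (intro sum.cong refl)
    fix F h assume F: "F \<in> ?Q"
    then have F0: "F \<noteq> 0" using monics_nz by (auto simp: sqfree_monics_def)
    then show "(J F \<circ> (\<lambda>h. h ^ 3)) h = (if coprime F h then 1 else 0)"
      using J_cube[OF F0, of h] J_eq_0[OF F0, of h] by (auto simp: J_power[OF F0])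
  qed
  also have "\<dots> = (\<Sum>h\<in>monics k. \<Sum>F\<in>?Q. if coprime F h then 1 else 0)" by (rule sum.swap)
  also have "\<dots> = (\<Sum>p\<in>C. 1)"
  proof -
    have "C = (SIGMA h:monics k. {F \<in> ?Q. coprime F h})" by (auto simp: C_def)
    then show ?thesis by (simp add: sum.If_cases Int_def)
  qed
  finally have T: "(\<Sum>F\<in>?Q. \<Sum>f\<in>{f \<in> monics n. cube_poly f}. J F f) = of_nat (card C)" by simp
  have finMM: "finite (?K \<times> ?M)" by simp
  have "C \<subseteq> ?K \<times> ?M" by (auto simp: C_def sqfree_monics_def)
  then have c1: "card C \<le> q ^ (k + N)" using card_mono[OF finMM] by (auto simp: card_cartesian_product card_monics q_card power_add)
  have c2: "q ^ (k + N) \<le> card C + card V + q ^ k * card (?M - ?Q)"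
  proof -
    have "?K \<times> ?M \<subseteq> C \<union> V \<union> ?K \<times> (?M - ?Q)" by (auto simp: C_def V_def)
    moreover have "finite (C \<union> V \<union> ?K \<times> (?M - ?Q))"
      by (rule finite_subset[OF _ finMM]) (auto simp: C_def V_def sqfree_monics_def)
    ultimately have "card (?K \<times> ?M) \<le> card (C \<union> V \<union> ?K \<times> (?M - ?Q))" by (intro card_mono)
    also have "\<dots> \<le> card C + card V + card (?K \<times> (?M - ?Q))"
      by (meson card_Un_le add_le_mono1 le_trans)
    finally show ?thesis by (simp add: card_cartesian_product card_monics q_card power_add)
  qed
  have c3: "real (card V) \<le> real N * real q ^ (k + N - 1)" unfolding V_def by (rule card_not_coprime)
  have c4: "real (q ^ k * card (?M - ?Q)) \<le> real N * real q ^ (k + N - 1)"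
  proof -
    have "real q ^ k * real (card (?M - ?Q)) \<le> real q ^ k * (real N * real q ^ (N - 1))"
      by (intro mult_left_mono card_not_sqfree) simp
    also have "\<dots> = real N * real q ^ (k + N - 1)" using N by (simp add: power_add[symmetric])
    finally show ?thesis by simp
  qed
  have "real (card C) \<le> real (q ^ (k + N))" using c1 by (simp only: of_nat_le_iff)
  moreover have "real (q ^ (k + N)) \<le> real (card C) + real (card V) + real (q ^ k * card (?M - ?Q))"
    using c2 by (simp only: of_nat_le_iff flip: of_nat_add)
  ultimately have "\<bar>real (card C) - real (q ^ (k + N))\<bar> \<le> 2 * (real N * real q ^ (k + N - 1))"
    using c3 c4 by linarith
  then have "\<bar>real (card C) - real q ^ (k + N)\<bar> \<le> 2 * real N * real q ^ (k + N - 1)" by simp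
  moreover have "cmod (of_nat (card C) - of_nat q ^ (k + N)) = \<bar>real (card C) - real q ^ (k + N)\<bar>"
    by (metis norm_of_real of_real_diff of_real_of_nat_eq of_real_power)
  ultimately show ?thesis unfolding T by simp
qed

lemma no_cubes: "\<not> 3 dvd n \<Longrightarrow> {f \<in> monics n. cube_poly f} = {}"
proof (rule ccontr)
  assume n: "\<not> 3 dvd n" and "{f \<in> monics n. cube_poly f} \<noteq> {}"
  then obtain f where f: "f \<in> monics n" "cube_poly f" by auto
  then obtain H where "lead_coeff H = 1" "f = H ^ 3" unfolding cube_poly_def by blast
  then have H: "lead_coeff H = 1" "H ^ 3 \<in> monics n" using f(1) by simp_all
  then have "H \<noteq> 0" by auto
  then have "n = 3 * degree H" using H by (simp add: monics_def degree_power_eq)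
  then show False using n by simp
qed

lemma card_cubes: "real (card {f \<in> monics n. cube_poly f}) \<le> real q powr (real n / 3)"
proof (cases "3 dvd n")
  case True
  then obtain k where k: "n = 3 * k" by (auto simp: dvd_def)
  have "{f \<in> monics n. cube_poly f} \<subseteq> (\<lambda>h. h ^ 3) ` (monics k :: 'k poly set)"
  proof
    fix f assume "f \<in> {f \<in> monics n. cube_poly f}"
    then obtain H where H: "lead_coeff H = 1" "f = H ^ 3" "degree f = n" by (auto simp: cube_poly_def monics_def)
    then have "H \<noteq> 0" by auto
    then have "H \<in> monics k" using H k by (simp add: monics_def degree_power_eq)
    then show "f \<in> (\<lambda>h. h ^ 3) ` monics k" using H by blast
  qed
  then have "card {f \<in> monics n. cube_poly f} \<le> card (monics k :: 'k poly set)" by (intro surj_card_le) auto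
  then have "real (card {f \<in> monics n. cube_poly f}) \<le> real (q ^ k)" by (simp add: card_monics q_card)
  also have "\<dots> = real q powr (real n / 3)" using q_ge by (simp add: k powr_realpow)
  finally show ?thesis .
next
  case False
  show ?thesis unfolding no_cubes[OF False] by simp
qed

lemma sqdiv_empty:
  assumes "finite S" "S \<subseteq> mprimes" "2 * degree (prime_powers S (\<lambda>_. 1)) > N"
  shows "sqdiv S N = {}"
proof (rule ccontr)
  assume "sqdiv S N \<noteq> {}"
  then obtain F where F: "F \<in> sqdiv S N" by auto
  then have F0: "F \<noteq> 0" "degree F = N" using monics_nz by (auto simp: sqdiv_def monics_def)
  have "prime_powers S (\<lambda>_. 2) dvd F" by (rule prime_powers_dvd[OF assms(1,2)]) (use F in \<open>auto simp: sqdiv_def\<close>)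
  then have "degree (prime_powers S (\<lambda>_. 2)) \<le> N" using F0 by (metis dvd_imp_degree_le)
  then show False using assms(3) unfolding degree_prime_powers[OF assms(1,2)] by (simp add: sum_distrib_left)
qed

lemma sqdiv_eq:
  assumes "finite S" "S \<subseteq> mprimes" "2 * degree (prime_powers S (\<lambda>_. 1)) \<le> N"
  shows "bij_betw (\<lambda>G. prime_powers S (\<lambda>_. 2) * G) (monics (N - 2 * degree (prime_powers S (\<lambda>_. 1)))) (sqdiv S N)"
  unfolding bij_betw_def
proof
  let ?D = "prime_powers S (\<lambda>_. 2)"
  have nz: "?D \<noteq> 0" by (rule prime_powers_nz[OF assms(1,2)])
  have dD: "degree ?D = 2 * degree (prime_powers S (\<lambda>_. 1))"
    unfolding degree_prime_powers[OF assms(1,2)] by (simp add: sum_distrib_left)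
  have lD: "lead_coeff ?D = 1" by (rule lead_coeff_prime_powers[OF assms(1,2)])
  show "inj_on (\<lambda>G. ?D * G) (monics (N - 2 * degree (prime_powers S (\<lambda>_. 1))))"
    using nz by (auto simp: inj_on_def)
  show "(\<lambda>G. ?D * G) ` monics (N - 2 * degree (prime_powers S (\<lambda>_. 1))) = sqdiv S N"
  proof (intro equalityI subsetI)
    fix F assume "F \<in> (\<lambda>G. ?D * G) ` monics (N - 2 * degree (prime_powers S (\<lambda>_. 1)))"
    then obtain G where G: "G \<in> monics (N - 2 * degree (prime_powers S (\<lambda>_. 1)))" "F = ?D * G" by auto
    have "?D \<in> monics (degree ?D)" using lD by (simp add: monics_def)
    from monics_mult[OF this G(1)] have "F \<in> monics N" using G dD assms(3) by simp
    moreover have "P ^ 2 dvd F" if "P \<in> S" for P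
    proof -
      have "P ^ 2 dvd ?D" unfolding prime_powers_def using assms(1) that by (intro dvd_prodI) auto
      then show ?thesis using G by simp
    qed
    ultimately show "F \<in> sqdiv S N" by (simp add: sqdiv_def)
  next
    fix F assume F: "F \<in> sqdiv S N"
    have "?D dvd F" by (rule prime_powers_dvd[OF assms(1,2)]) (use F in \<open>auto simp: sqdiv_def\<close>)
    then obtain G where G: "F = ?D * G" by (auto simp: dvd_def)
    have "G \<in> monics (N - degree ?D)" using monics_factor(1)[OF _ G lD] F by (auto simp: sqdiv_def)
    then show "F \<in> (\<lambda>G. ?D * G) ` monics (N - 2 * degree (prime_powers S (\<lambda>_. 1)))" using G dD by auto
  qed
qed

lemma sum_J_monics:
  assumes F: "lead_coeff F = 1" "\<not> cube_poly F" "degree F \<le> n"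
  shows "(\<Sum>f\<in>monics n. J F f) = 0"
proof (rule sum_shift_vanish[where d = "degree F"])
  show "z + x \<in> monics n" if "z \<in> monics n" "x \<in> below (degree F)" for z x :: "'k poly"
    using that F(3) by (intro monics_add_below) (auto intro: below_mono)
qed (use sum_J_complete[OF F(1,2)] in auto)

text \<open>Here the cofactor \<open>G\<close> of the square has degree at least \<open>n\<close>.
  By reciprocity its symbol is \<open>J f G\<close>, and \<open>G\<close> runs through complete
  residue systems modulo the noncube \<open>f\<close>.\<close>

lemma sqdiv_small:
  assumes S: "finite S" "S \<subseteq> mprimes" and f: "f \<in> monics n" "\<not> cube_poly f"
    and d: "2 * degree (prime_powers S (\<lambda>_. 1)) + n \<le> N"
  shows "(\<Sum>F\<in>sqdiv S N. J F f) = 0"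
proof -
  let ?D = "prime_powers S (\<lambda>_. 2)" and ?M = "N - 2 * degree (prime_powers S (\<lambda>_. 1))"
  have lf: "lead_coeff f = 1" "degree f = n" using f by (auto simp: monics_def)
  have lD: "lead_coeff ?D = 1" by (rule lead_coeff_prime_powers[OF S])
  have "(\<Sum>F\<in>sqdiv S N. J F f) = (\<Sum>G\<in>monics ?M. J (?D * G) f)"
    using sum.reindex_bij_betw[OF sqdiv_eq[OF S], of N "\<lambda>F. J F f"] d by simp
  also have "\<dots> = (\<Sum>G\<in>monics ?M. J ?D f * J f G)"
  proof (rule sum.cong[OF refl])
    fix G :: "'k poly" assume "G \<in> monics ?M"
    then have lG: "lead_coeff G = 1" by (rule monicsD)
    show "J (?D * G) f = J ?D f * J f G" by (simp only: J_mult_left[OF lD lG] J_recip[OF lG lf(1)])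
  qed
  also have "\<dots> = J ?D f * (\<Sum>G\<in>monics ?M. J f G)" by (simp add: sum_distrib_left)
  also have "(\<Sum>G\<in>monics ?M. J f G) = 0" by (rule sum_J_monics) (use lf f d in auto)
  finally show ?thesis by simp
qed

lemma prime_powers_inj:
  assumes "finite S" "S \<subseteq> mprimes" "finite T" "T \<subseteq> mprimes" "prime_powers S (\<lambda>_. 1) = prime_powers T (\<lambda>_. 1)"
  shows "S \<subseteq> T"
proof
  fix P assume P: "P \<in> S"
  then have Pm: "P \<in> mprimes" using assms by auto
  have "P dvd prime_powers S (\<lambda>_. 1)" unfolding prime_powers_def using assms(1) P by (auto intro: dvd_prodI)
  then have d: "P dvd (\<Prod>Q\<in>T. Q)" using assms(5) by (simp add: prime_powers_def)
  show "P \<in> T"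
  proof (rule ccontr)
    assume "P \<notin> T"
    then have "coprime P (\<Prod>Q\<in>T. Q)" using assms(4) by (intro prod_coprime_right mprimes_coprime[OF Pm]) auto
    then show False using d mprimes_coprime_iff[OF Pm] by simp
  qed
qed

end

lemma finite_mprimes_le: "finite {P \<in> mprimes. degree (P :: 'k::{field_gcd,finite} poly) \<le> N}"
proof (rule finite_subset)
  show "{P \<in> mprimes. degree (P :: 'k poly) \<le> N} \<subseteq> (\<Union>i\<le>N. monics i)"
    using mprimesD(2) by (auto simp: monics_def)
qed simp

lemma not_cube_degree: "F \<in> monics N \<Longrightarrow> \<not> 3 dvd N \<Longrightarrow> lead_coeff H = 1 \<Longrightarrow> F \<noteq> H ^ 3"
  for F H :: "'k::field poly"
proof
  assume F: "F \<in> monics N" "\<not> 3 dvd N" "lead_coeff H = 1" "F = H ^ 3"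
  then have "H \<noteq> 0" by auto
  then have "N = 3 * degree H" using F by (simp add: monics_def degree_power_eq)
  then show False using F by simp
qed

context cubic_psi
begin

text \<open>A bound for the number of exponent vectors on the primes of \<open>S\<close>, times the
  constant of \<open>CS_bound\<close>; both use that \<open>S\<close> has at most \<open>N\<close>
  elements.\<close>

definition K0 :: "nat \<Rightarrow> real" where
  "K0 N = (real N + 1) ^ N * (4 * 8 ^ N)"

lemma K0_nonneg: "K0 N \<ge> 0" by (simp add: K0_def)

text \<open>Poisson summation in \<open>f\<close> gives Gauss sums with frequencies of degree at
  most \<open>m\<close>, and sorting the moduli by their exact exponents at the primes of
  \<open>S\<close> makes \<open>CS_reduced_bound\<close> and \<open>sum_Gs_support_bound\<close>
  applicable. The worst exponent vector determines the result.\<close>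

lemma sqdiv_bound:
  assumes q15: "q \<ge> 15" and fin: "finite S" and S: "S \<subseteq> mprimes"
    and N: "N = n + m + 1" "\<not> 3 dvd N"
    and d: "d = degree (prime_powers S (\<lambda>_. 1))" "m + 2 \<le> 2 * d" "2 * d \<le> N"
  shows "cmod (\<Sum>F\<in>sqdiv S N. \<Sum>f\<in>monics n. J F f) \<le>
    (if d \<le> m then K0 N * real q powr (4 * real N / 3 + (1 - real m - 9 * real d) / 6) else 0)"
proof -
  have qp: "real q > 0" "real q \<ge> 1" using q15 by auto
  define D where "D = prime_powers S (\<lambda>_. 1)"
  define H where "H = (\<lambda>b. prime_powers S b)"
  define r where "r = (\<lambda>b. degree (prime_powers S (\<lambda>P. (2 * b P + 2) mod 3)))"
  define B where "B = {b \<in> Pi\<^sub>E S (\<lambda>_. {2..N}). degree (H b) \<le> N}"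
  define W where "W = (\<lambda>b. {w \<in> below (m + 1). w \<noteq> 0 \<and> H b dvd w * D})"
  define E1 where "E1 = (\<lambda>b. (4 * real N - 5 * real (degree (H b)) + real m + real d + real (r b) + 2) / 3)"
  define E2 where "E2 = (\<lambda>b. (real m + 1 + real d - real (degree (H b))) / 2 + real (degree (H b)))"
  define K where "K = 4 * (8::real) ^ card S"
  have K: "K \<ge> 0" by (simp add: K_def)
  have dD: "degree D = d" by (simp add: D_def d)
  have finB: "finite B" using fin by (simp add: B_def finite_PiE)
  have finW: "finite (W b)" for b by (simp add: W_def)
  have dsum: "d = (\<Sum>P\<in>S. degree P)" using d(1) degree_prime_powers[OF fin S, of "\<lambda>_. 1"] by simp
  have hb: "14 * d + 2 * r b \<le> 7 * degree (H b)" if "b \<in> B" for b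
  proof -
    have "(\<Sum>P\<in>S. (2 * ((2 * b P + 2) mod 3) + 14) * degree P) \<le> (\<Sum>P\<in>S. 7 * b P * degree P)"
      by (intro sum_mono mult_right_mono cubefree_exponent_ineq) (use that in \<open>auto simp: B_def\<close>)
    moreover have "(\<Sum>P\<in>S. (2 * ((2 * b P + 2) mod 3) + 14) * degree P) = 14 * d + 2 * r b"
      unfolding r_def degree_prime_powers[OF fin S] dsum
      by (simp add: distrib_right sum.distrib sum_distrib_left mult.assoc)
    ultimately show ?thesis unfolding H_def degree_prime_powers[OF fin S] by (simp add: sum_distrib_left mult.assoc)
  qed
  have h2d: "2 * d \<le> degree (H b)" if "b \<in> B" for b using hb[OF that] by linarith
  \<comment> \<open>The degree of \<open>H b\<close> is at least \<open>2 * d\<close>, while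
    \<open>w * D\<close> has degree at most \<open>m + d\<close>; so for \<open>d > m\<close> no
    nonzero frequency survives.\<close>
  have W0: "W b = {}" if "b \<in> B" "\<not> d \<le> m" for b
  proof (rule ccontr)
    assume "W b \<noteq> {}"
    then obtain w where w: "w \<in> below (m + 1)" "w \<noteq> 0" "H b dvd w * D" by (auto simp: W_def)
    have "D \<noteq> 0" unfolding D_def by (rule prime_powers_nz[OF fin S])
    then have "degree (H b) \<le> degree w + d" using w dD dvd_imp_degree_le[OF w(3)] by (simp add: degree_mult_eq)
    then show False using h2d[OF that(1)] that(2) w by (auto simp: below_def)
  qed
  have inner: "cmod (\<Sum>F\<in>sqdiv S N. Gs w F) \<le>
      (\<Sum>b\<in>B. if w \<in> W b then cmod (Gs w (H b)) * (K * real q powr E1 b) else 0)"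
    if w: "w \<in> below (m + 1)" for w
  proof (cases "w = 0")
    case True
    \<comment> \<open>At frequency 0 the Gauss sum is a complete symbol sum. It vanishes because
      \<open>N\<close> is not divisible by 3, so that no modulus is a cube.\<close>
    have "(\<Sum>F\<in>sqdiv S N. Gs w F) = 0" unfolding True
    proof (rule sum.neutral, rule ballI)
      fix F assume F: "F \<in> sqdiv S N"
      then have "F \<in> monics N" by (simp add: sqdiv_def)
      then show "Gs 0 F = 0"
        using Gs_0[of F] monicsD(1) not_cube_degree[OF _ N(2)] unfolding cube_poly_def by blast
    qed
    then show ?thesis using K by (auto intro!: sum_nonneg)
  next
    case False
    have "(\<Sum>F\<in>sqdiv S N. Gs w F) = (\<Sum>b\<in>B. Gs w (H b) * CS S (w * H b) (N - degree (H b)))"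
      unfolding sum_Gs_sqdiv[OF fin S] B_def H_def ..
    then have "cmod (\<Sum>F\<in>sqdiv S N. Gs w F) \<le> (\<Sum>b\<in>B. cmod (Gs w (H b) * CS S (w * H b) (N - degree (H b))))"
      by (simp add: norm_sum)
    also have "\<dots> \<le> (\<Sum>b\<in>B. if w \<in> W b then cmod (Gs w (H b)) * (K * real q powr E1 b) else 0)"
    proof (rule sum_mono)
      fix b assume b: "b \<in> B"
      show "cmod (Gs w (H b) * CS S (w * H b) (N - degree (H b))) \<le>
         (if w \<in> W b then cmod (Gs w (H b)) * (K * real q powr E1 b) else 0)"
      proof (cases "H b dvd w * D")
        case dv: True
        have "cmod (CS S (w * H b) (N - degree (H b))) \<le> K * real q powr E1 b"
          using CS_reduced_bound[OF q15 fin S w False, of b N] dv b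
          by (simp add: H_def D_def K_def E1_def r_def d B_def)
        then show ?thesis using dv False w by (simp add: W_def norm_mult mult_left_mono)
      next
        case ndv: False
        then have "Gs w (H b) = 0" using Gs_prime_powers_support[OF fin S, of b w] by (simp add: H_def D_def)
        then show ?thesis using ndv by (simp add: W_def)
      qed
    qed
    finally show ?thesis .
  qed
  have "(\<Sum>F\<in>sqdiv S N. \<Sum>f\<in>monics n. J F f) =
     (\<Sum>F\<in>sqdiv S N. (\<Sum>w\<in>below (m + 1). psi (- coeff w m) * Gs w F) / of_nat q ^ (m + 1))"
    by (rule sum.cong[OF refl], rule poisson) (use N in \<open>auto simp: sqdiv_def\<close>)
  also have "\<dots> = (\<Sum>w\<in>below (m + 1). psi (- coeff w m) * (\<Sum>F\<in>sqdiv S N. Gs w F)) / of_nat q ^ (m + 1)"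
    unfolding sum_divide_distrib[symmetric] sum_distrib_left by (subst sum.swap) (rule refl)
  finally have "cmod (\<Sum>F\<in>sqdiv S N. \<Sum>f\<in>monics n. J F f) =
     cmod (\<Sum>w\<in>below (m + 1). psi (- coeff w m) * (\<Sum>F\<in>sqdiv S N. Gs w F)) / real q ^ (m + 1)"
    by (simp only: norm_divide norm_power norm_of_nat)
  also have "\<dots> \<le> (\<Sum>w\<in>below (m + 1). \<Sum>b\<in>B. if w \<in> W b then cmod (Gs w (H b)) * (K * real q powr E1 b) else 0) / real q ^ (m + 1)"
    by (intro divide_right_mono sum_norm_le) (auto simp: norm_mult intro: inner)
  also have "\<dots> = (\<Sum>b\<in>B. (\<Sum>w\<in>W b. cmod (Gs w (H b))) * (K * real q powr E1 b)) / real q ^ (m + 1)"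
  proof -
    have "(\<Sum>w\<in>below (m + 1). if w \<in> W b then cmod (Gs w (H b)) * (K * real q powr E1 b) else 0) =
       (\<Sum>w\<in>W b. cmod (Gs w (H b))) * (K * real q powr E1 b)" for b
    proof -
      have "below (m + 1) \<inter> {w. w \<in> W b} = W b" by (auto simp: W_def)
      then show ?thesis by (simp add: sum.If_cases sum_distrib_right)
    qed
    then show ?thesis by (subst sum.swap) simp
  qed
  finally have main: "cmod (\<Sum>F\<in>sqdiv S N. \<Sum>f\<in>monics n. J F f) \<le>
    (\<Sum>b\<in>B. (\<Sum>w\<in>W b. cmod (Gs w (H b))) * (K * real q powr E1 b)) / real q ^ (m + 1)" .
  show ?thesis
  proof (cases "d \<le> m")
    case False
    then have "(\<Sum>b\<in>B. (\<Sum>w\<in>W b. cmod (Gs w (H b))) * (K * real q powr E1 b)) = 0"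
      by (intro sum.neutral) (simp add: W0)
    then show ?thesis using main False by simp
  next
    case True
    define E where "E = 4 * real N / 3 + (1 - real m - 9 * real d) / 6"
    have "(\<Sum>b\<in>B. (\<Sum>w\<in>W b. cmod (Gs w (H b))) * (K * real q powr E1 b)) \<le> (\<Sum>b\<in>B. K * real q powr (E + real (m + 1)))"
    proof (rule sum_mono)
      fix b assume b: "b \<in> B"
      have "(\<Sum>w\<in>W b. cmod (Gs w (H b))) \<le> real q powr E2 b"
        unfolding W_def E2_def H_def D_def d(1)
        by (rule sum_Gs_support_bound[OF fin S]) (use h2d[OF b] d in \<open>simp add: H_def\<close>)
      then have "(\<Sum>w\<in>W b. cmod (Gs w (H b))) * (K * real q powr E1 b) \<le> real q powr E2 b * (K * real q powr E1 b)"
        using K by (intro mult_right_mono) auto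
      also have "\<dots> = K * real q powr (E1 b + E2 b)" by (simp add: powr_add)
      also have "\<dots> \<le> K * real q powr (E + real (m + 1))"
      proof (intro mult_left_mono powr_mono K qp)
        \<comment> \<open>In \<open>E1 b + E2 b\<close> the degree \<open>h\<close> of
          \<open>H b\<close> has coefficient \<open>-7/6\<close> and \<open>r b\<close> has
          coefficient \<open>1/3\<close>. So this inequality is precisely what replaces both by
          \<open>-14 * d / 6\<close>.\<close>
        have "14 * real d + 2 * real (r b) \<le> 7 * real (degree (H b))" using hb[OF b] by linarith
        then show "E1 b + E2 b \<le> E + real (m + 1)" by (simp add: E1_def E2_def E_def field_simps)
      qed
      finally show "(\<Sum>w\<in>W b. cmod (Gs w (H b))) * (K * real q powr E1 b) \<le> K * real q powr (E + real (m + 1))" .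
    qed
    also have "\<dots> = real (card B) * (K * real q powr E) * real q ^ (m + 1)"
    proof -
      have "real q powr (E + real (m + 1)) = real q powr E * real q ^ (m + 1)"
        unfolding powr_add by (simp only: powr_realpow[OF qp(1)])
      then show ?thesis by simp
    qed
    finally have "cmod (\<Sum>F\<in>sqdiv S N. \<Sum>f\<in>monics n. J F f) \<le> real (card B) * (K * real q powr E) * real q ^ (m + 1) / real q ^ (m + 1)"
      using main divide_right_mono[of _ _ "real q ^ (m + 1)"] by (meson order_trans zero_le_power of_nat_0_le_iff)
    also have "\<dots> = real (card B) * K * real q powr E" using qp by simp
    also have "\<dots> \<le> K0 N * real q powr E"
    proof (rule mult_right_mono)
      have cS: "card S \<le> N"
      proof -
        have "card S = (\<Sum>P\<in>S. 1)" by simp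
        also have "\<dots> \<le> (\<Sum>P\<in>S. degree P)" by (rule sum_mono) (use S mprimesD(5) in \<open>auto simp: Suc_le_eq\<close>)
        finally show ?thesis using dsum d(3) by simp
      qed
      have "card B \<le> card (Pi\<^sub>E S (\<lambda>_. {2..N}))" using fin by (intro card_mono finite_PiE) (auto simp: B_def)
      also have "\<dots> = (N - 1) ^ card S" using fin by (simp add: card_PiE)
      also have "\<dots> \<le> (N + 1) ^ card S" by (intro power_mono) auto
      also have "\<dots> \<le> (N + 1) ^ N" using cS by (intro power_increasing) auto
      finally have "real (card B) \<le> real ((N + 1) ^ N)" by (simp only: of_nat_le_iff)
      then have "real (card B) \<le> (real N + 1) ^ N" by (simp add: add.commute)
      moreover have "K \<le> 4 * 8 ^ N" unfolding K_def using cS by (intro mult_left_mono power_increasing) auto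
      ultimately show "real (card B) * K \<le> K0 N" unfolding K0_def using K by (intro mult_mono) auto
    qed simp
    finally show ?thesis using True by (simp add: E_def)
  qed
qed

lemma le_add_mult: "a \<le> b + c \<Longrightarrow> b \<le> k * x \<Longrightarrow> c \<le> x \<Longrightarrow> a \<le> (k + 1) * (x :: real)"
  by (simp add: distrib_right)

text \<open>Distinct sets of primes have distinct products, so the sum is at most the sum of
  \<open>q^(-degree)\<close> over all monic polynomials of degree at most \<open>N\<close>, where
  each degree contributes 1.\<close>

lemma sum_prime_sets:
  assumes "finite PP" "PP \<subseteq> (mprimes :: 'a poly set)"
  shows "(\<Sum>S\<in>{S \<in> Pow PP. degree (prime_powers S (\<lambda>_. 1)) \<le> N}. real q powr (- real (degree (prime_powers S (\<lambda>_. 1))))) \<le> real N + 1"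
proof -
  let ?A = "{S \<in> Pow PP. degree (prime_powers S (\<lambda>_. 1)) \<le> N}"
  let ?g = "\<lambda>S. prime_powers S (\<lambda>_. 1)"
  have qp: "real q > 0" using q_ge by simp
  have sub: "finite S" "S \<subseteq> mprimes" if "S \<in> ?A" for S using that assms by (auto intro: finite_subset)
  have inj: "inj_on ?g ?A"
  proof (rule inj_onI)
    fix S T assume S: "S \<in> ?A" and T: "T \<in> ?A" and e: "?g S = ?g T"
    show "S = T"
      using prime_powers_inj[OF sub[OF S] sub[OF T] e] prime_powers_inj[OF sub[OF T] sub[OF S] e[symmetric]] by simp
  qed
  have "(\<Sum>S\<in>?A. real q powr (- real (degree (?g S)))) = (\<Sum>G\<in>?g ` ?A. real q powr (- real (degree G)))"
    by (simp only: sum.reindex[OF inj] o_def)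
  also have "\<dots> \<le> (\<Sum>G\<in>(\<Union>i\<le>N. monics i :: 'a poly set). real q powr (- real (degree G)))"
  proof (rule sum_mono2)
    show "?g ` ?A \<subseteq> (\<Union>i\<le>N. monics i :: 'a poly set)"
      using lead_coeff_prime_powers[OF sub] by (auto simp: monics_def)
  qed auto
  also have "\<dots> = (\<Sum>i\<le>N. \<Sum>G\<in>(monics i :: 'a poly set). real q powr (- real (degree G)))"
    by (rule sum.UNION_disjoint) (auto simp: monicsD(2) dest: monicsD(2))
  also have "\<dots> = (\<Sum>i\<le>N. 1)"
  proof (rule sum.cong[OF refl])
    fix i
    have "(\<Sum>G\<in>(monics i :: 'a poly set). real q powr (- real (degree G))) = (\<Sum>G\<in>(monics i :: 'a poly set). real q powr (- real i))"
      by (rule sum.cong) (auto simp: monicsD(2))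
    also have "\<dots> = real q ^ i * real q powr (- real i)" by (simp add: card_monics q_card)
    also have "\<dots> = 1" using qp by (simp add: powr_minus powr_realpow)
    finally show "(\<Sum>G\<in>(monics i :: 'a poly set). real q powr (- real (degree G))) = 1" .
  qed
  finally show ?thesis by simp
qed

text \<open>Inclusion and exclusion over sets \<open>S\<close> of primes whose squares divide the
  modulus. With \<open>d\<close> the degree of the product of \<open>S\<close>, there are three
  ranges: for \<open>2 * d > N\<close> nothing is left, for \<open>2 * d + n \<le> N\<close> the
  sums vanish, and in between \<open>sqdiv_bound\<close> is used. A factor \<open>q^(-d)\<close> is
  kept to sum over \<open>S\<close>.\<close>

lemma noncube_part:
  assumes q15: "q \<ge> 15" and N: "n < N" "\<not> 3 dvd N"
  shows "cmod (\<Sum>F\<in>sqfree_monics N. \<Sum>f\<in>{f \<in> monics n. \<not> cube_poly f}. J F f)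
    \<le> (real N + 1) * (K0 N + 1) * real q powr (real N + real n / 3 - 1 / 6)"
proof -
  have qp: "real q > 0" "real q \<ge> 1" using q15 by auto
  define m where "m = N - n - 1"
  have m: "N = n + m + 1" using N by (simp add: m_def)
  define PP where "PP = {P \<in> mprimes. degree (P :: 'a poly) \<le> N}"
  have PP: "finite PP" "PP \<subseteq> mprimes" unfolding PP_def using finite_mprimes_le by auto
  define g where "g = (\<lambda>F. \<Sum>f\<in>{f \<in> monics n. \<not> cube_poly f}. J F f)"
  define dd where "dd = (\<lambda>S. degree (prime_powers S (\<lambda>_. 1 :: nat) :: 'a poly))"
  define c where "c = (K0 N + 1) * real q powr (real N + real n / 3 - 1 / 6)"
  have c0: "c \<ge> 0" using K0_nonneg by (simp add: c_def)
  have ind: "(if F \<in> sqfree_monics N then 1 else 0) = (\<Sum>S\<in>Pow PP. (- 1) ^ card S * (if F \<in> sqdiv S N then 1 else 0 :: complex))"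
    if F: "F \<in> monics N" for F
  proof -
    let ?A = "{P \<in> PP. P ^ 2 dvd F}"
    have "?A = {} \<longleftrightarrow> F \<in> sqfree_monics N"
    proof -
      have "degree P \<le> N" if "P \<in> mprimes" "P ^ 2 dvd F" for P
      proof -
        have "P dvd F" using that(2) by (metis dvd_mult_left power2_eq_square)
        then show ?thesis using dvd_imp_degree_le[of P F] monics_nz[OF F] monicsD(2)[OF F] by simp
      qed
      then show ?thesis using F by (auto simp: PP_def sqfree_monics_def)
    qed
    moreover have "(\<Sum>S\<in>Pow ?A. (- 1 :: complex) ^ card S) = (if ?A = {} then 1 else 0)"
      by (rule sum_Pow_alternating) (use PP in auto)
    moreover have "(\<Sum>S\<in>Pow PP. (- 1) ^ card S * (if F \<in> sqdiv S N then 1 else 0 :: complex)) = (\<Sum>S\<in>Pow ?A. (- 1) ^ card S)"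
      by (rule sum.mono_neutral_cong_right) (use PP F in \<open>auto simp: sqdiv_def\<close>)
    ultimately show ?thesis by simp
  qed
  have "(\<Sum>F\<in>sqfree_monics N. g F) = (\<Sum>F\<in>monics N. (if F \<in> sqfree_monics N then 1 else 0) * g F)"
    by (rule sum.mono_neutral_cong_left) (auto simp: sqfree_monics_def)
  also have "\<dots> = (\<Sum>F\<in>monics N. \<Sum>S\<in>Pow PP. (- 1) ^ card S * (if F \<in> sqdiv S N then 1 else 0) * g F)"
    by (rule sum.cong[OF refl]) (simp only: ind sum_distrib_right)
  also have "\<dots> = (\<Sum>S\<in>Pow PP. \<Sum>F\<in>monics N. (- 1) ^ card S * (if F \<in> sqdiv S N then 1 else 0) * g F)"
    by (rule sum.swap)
  also have "\<dots> = (\<Sum>S\<in>Pow PP. (- 1) ^ card S * (\<Sum>F\<in>sqdiv S N. g F))"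
  proof (rule sum.cong[OF refl])
    fix S
    have "(\<Sum>F\<in>monics N. (- 1) ^ card S * (if F \<in> sqdiv S N then 1 else 0) * g F) = (\<Sum>F\<in>sqdiv S N. (- 1) ^ card S * g F)"
      by (rule sum.mono_neutral_cong_right) (auto simp: sqdiv_def)
    then show "(\<Sum>F\<in>monics N. (- 1) ^ card S * (if F \<in> sqdiv S N then 1 else 0) * g F) = (- 1) ^ card S * (\<Sum>F\<in>sqdiv S N. g F)"
      by (simp add: sum_distrib_left)
  qed
  finally have "cmod (\<Sum>F\<in>sqfree_monics N. g F) \<le> (\<Sum>S\<in>Pow PP. cmod ((- 1) ^ card S * (\<Sum>F\<in>sqdiv S N. g F)))"
    by (simp only: norm_sum)
  also have "\<dots> \<le> (\<Sum>S\<in>Pow PP. if dd S \<le> N then c * real q powr (- real (dd S)) else 0)"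
  proof (rule sum_mono)
    fix S assume "S \<in> Pow PP"
    then have S: "finite S" "S \<subseteq> mprimes" using PP by (auto intro: finite_subset)
    define d where "d = dd S"
    have dS: "d = degree (prime_powers S (\<lambda>_. 1))" by (simp add: d_def dd_def)
    have "cmod (\<Sum>F\<in>sqdiv S N. g F) \<le> (if d \<le> N then c * real q powr (- real d) else 0)"
    proof (cases "2 * d > N")
      case True
      then have "sqdiv S N = {}" using sqdiv_empty[OF S] by (simp add: d_def dd_def)
      then show ?thesis using c0 by simp
    next
      case le: False
      show ?thesis
      proof (cases "2 * d + n \<le> N")
        case True
        have "(\<Sum>F\<in>sqdiv S N. g F) = (\<Sum>f\<in>{f \<in> monics n. \<not> cube_poly f}. \<Sum>F\<in>sqdiv S N. J F f)"
          unfolding g_def by (rule sum.swap)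
        also have "\<dots> = 0"
          by (rule sum.neutral) (use sqdiv_small[OF S] True in \<open>auto simp: d_def dd_def\<close>)
        finally show ?thesis using c0 by simp
      next
        case False
        then have d2: "m + 2 \<le> 2 * d" using m by simp
        have "{f \<in> monics n. \<not> cube_poly f} = monics n - {f \<in> monics n. cube_poly f}" by auto
        \<comment> \<open>Poisson summation needs all monic \<open>f\<close>, so the cubes are put
          back and estimated trivially; they are few.\<close>
        then have "g F = (\<Sum>f\<in>monics n. J F f) - (\<Sum>f\<in>{f \<in> monics n. cube_poly f}. J F f)" for F
          unfolding g_def by (simp add: sum_diff)
        then have le1: "cmod (\<Sum>F\<in>sqdiv S N. g F) \<le> cmod (\<Sum>F\<in>sqdiv S N. \<Sum>f\<in>monics n. J F f)
            + cmod (\<Sum>F\<in>sqdiv S N. \<Sum>f\<in>{f \<in> monics n. cube_poly f}. J F f)"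
          by (simp add: sum_subtractf norm_triangle_ineq4)
        have le2: "cmod (\<Sum>F\<in>sqdiv S N. \<Sum>f\<in>monics n. J F f) \<le> K0 N * real q powr (real N + real n / 3 - 1 / 6 - real d)"
        proof (cases "d \<le> m")
          case True
          \<comment> \<open>From \<open>d \<le> m\<close> and \<open>m + 2 \<le> 2 * d\<close>
            follows \<open>m \<ge> 2\<close>, and then the claim. Equality at
            \<open>m = d = 2\<close> is what limits the saving to \<open>1/6\<close>.\<close>
          have "3 * d \<ge> m + 4" using True d2 by linarith
          then have "4 * real N / 3 + (1 - real m - 9 * real d) / 6 \<le> real N + real n / 3 - 1 / 6 - real d"
            unfolding m by (simp add: field_simps)
          then have "K0 N * real q powr (4 * real N / 3 + (1 - real m - 9 * real d) / 6) \<le>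
             K0 N * real q powr (real N + real n / 3 - 1 / 6 - real d)"
            by (intro mult_left_mono powr_mono qp K0_nonneg)
          moreover have "2 * d \<le> N" using le by simp
          ultimately show ?thesis using sqdiv_bound[OF q15 S m N(2) dS d2] True by simp
        next
          case False
          moreover have "2 * d \<le> N" using le by simp
          ultimately have "cmod (\<Sum>F\<in>sqdiv S N. \<Sum>f\<in>monics n. J F f) \<le> 0"
            using sqdiv_bound[OF q15 S m N(2) dS d2] by simp
          then show ?thesis using K0_nonneg by (meson order_trans mult_nonneg_nonneg powr_ge_zero)
        qed
        have le3: "cmod (\<Sum>F\<in>sqdiv S N. \<Sum>f\<in>{f \<in> monics n. cube_poly f}. J F f) \<le> real q powr (real N + real n / 3 - 1 / 6 - real d)"
        proof -
          have le2: "2 * degree (prime_powers S (\<lambda>_. 1)) \<le> N" using le dS by simp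
          have "cmod (\<Sum>F\<in>sqdiv S N. \<Sum>f\<in>{f \<in> monics n. cube_poly f}. J F f) \<le>
            (\<Sum>F\<in>sqdiv S N. \<Sum>f\<in>{f \<in> monics n. cube_poly f}. 1)"
            by (intro sum_norm_le norm_J)
          also have "\<dots> = real (card (sqdiv S N)) * real (card {f \<in> monics n. cube_poly f})" by simp
          also have "card (sqdiv S N) = q ^ (N - 2 * d)"
            using bij_betw_same_card[OF sqdiv_eq[OF S le2]] by (simp add: card_monics q_card dS)
          also have "real (q ^ (N - 2 * d)) * real (card {f \<in> monics n. cube_poly f}) \<le> real q powr (real N - 2 * real d) * real q powr (real n / 3)"
          proof (rule mult_mono[OF _ card_cubes])
            have "real (q ^ (N - 2 * d)) = real q powr real (N - 2 * d)" using qp by (simp add: powr_realpow)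
            also have "real (N - 2 * d) = real N - 2 * real d" using le by (simp add: of_nat_diff)
            finally show "real (q ^ (N - 2 * d)) \<le> real q powr (real N - 2 * real d)" by simp
          qed auto
          also have "\<dots> = real q powr (real N - 2 * real d + real n / 3)" by (simp add: powr_add)
          also have "\<dots> \<le> real q powr (real N + real n / 3 - 1 / 6 - real d)"
          proof (intro powr_mono qp)
            have "real d \<ge> 1" using d2 by simp
            then show "real N - 2 * real d + real n / 3 \<le> real N + real n / 3 - 1 / 6 - real d" by simp
          qed
          finally show ?thesis .
        qed
        have "cmod (\<Sum>F\<in>sqdiv S N. g F) \<le> (K0 N + 1) * real q powr (real N + real n / 3 - 1 / 6 - real d)"
          by (rule le_add_mult[OF le1 le2 le3])
        also have "\<dots> = c * real q powr (- real d)"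
          unfolding c_def mult.assoc powr_add[symmetric] by (simp only: add_uminus_conv_diff)
        finally show ?thesis using le by simp
      qed
    qed
    then show "cmod ((- 1) ^ card S * (\<Sum>F\<in>sqdiv S N. g F)) \<le> (if dd S \<le> N then c * real q powr (- real (dd S)) else 0)"
      by (simp only: norm_mult norm_power norm_minus_cancel norm_one power_one mult_1 d_def)
  qed
  also have "\<dots> = c * (\<Sum>S\<in>{S \<in> Pow PP. dd S \<le> N}. real q powr (- real (dd S)))"
    using PP by (simp add: sum.If_cases Int_def sum_distrib_left)
  also have "\<dots> \<le> c * (real N + 1)"
    using sum_prime_sets[OF PP, of N] c0 by (intro mult_left_mono) (simp_all add: dd_def)
  finally show ?thesis by (simp add: g_def c_def mult_ac)
qed

end

text \<open>The additive character serves only as an auxiliary tool; neither the sums nor the bound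
  mention it, so any nontrivial one can be supplied here.\<close>

lemma (in cubic_char_field) noncube_part':
  assumes "q \<ge> 15" "n < N" "\<not> 3 dvd N"
  shows "cmod (\<Sum>F\<in>sqfree_monics N. \<Sum>f\<in>{f \<in> monics n. \<not> cube_poly f}. J F f)
    \<le> (real N + 1) * ((real N + 1) ^ N * (4 * 8 ^ N) + 1) * real q powr (real N + real n / 3 - 1 / 6)"
proof -
  obtain psi :: "'k \<Rightarrow> complex" where psi: "\<And>x y. psi (x + y) = psi x * psi y" "\<And>x. cmod (psi x) = 1" "\<exists>x. psi x \<noteq> 1"
    using additive_char_exists by blast
  interpret cubic_psi om q psi by unfold_locales (use psi in auto)
  show ?thesis using noncube_part[OF assms] by (simp add: K0_def)
qed

definition Cbound :: "nat \<Rightarrow> real" where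
  "Cbound N = 2 * (real N * ((real N + 1) * ((real N + 1) ^ N * (4 * 8 ^ N) + 1) + 2 * real N) + real N * (real N + 1))"

context cubic_char_field
begin

text \<open>The degrees \<open>n = 0, 3, ..., 3 * g\<close> each contribute \<open>q^N\<close>,
  since the weight cancels the number of cubes. Everything else, including the replacement of the
  number of square-free moduli by \<open>q^N\<close>, is smaller by \<open>q^(-1/6)\<close>.\<close>

lemma average_bound:
  assumes q: "q \<ge> 15" "2 * N \<le> q" and N: "N = 3 * g + 1"
  shows "cmod ((\<Sum>F\<in>sqfree_monics N. \<Sum>n<N. of_real (real q powr (- real n / 3)) * (\<Sum>f\<in>monics n. J F f))
      / of_nat (card (sqfree_monics N :: 'k poly set)) - of_nat (g + 1)) \<le> Cbound N * real q powr (- 1 / 6)"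
proof -
  have qp: "real q > 0" "real q \<ge> 1" using q by auto
  have N3: "\<not> 3 dvd N" "N > 0" using N by presburger+
  define A where "A = (real N + 1) * ((real N + 1) ^ N * (4 * 8 ^ N) + 1) + 2 * real N"
  have A0: "A \<ge> 0" by (simp add: A_def)
  define T where "T = (\<lambda>n. \<Sum>F\<in>sqfree_monics N. \<Sum>f\<in>monics n. J F f)"
  define M where "M = (\<lambda>n. if 3 dvd n then real q powr (real N + real n / 3) else 0)"
  have Tn: "cmod (T n - of_real (M n)) \<le> A * real q powr (real N + real n / 3 - 1 / 6)" if n: "n < N" for n
  proof -
    let ?C = "\<Sum>F\<in>sqfree_monics N. \<Sum>f\<in>{f \<in> monics n. cube_poly f}. J F f"
    let ?NC = "\<Sum>F\<in>sqfree_monics N. \<Sum>f\<in>{f \<in> monics n. \<not> cube_poly f}. J F f"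
    have "(\<Sum>f\<in>monics n. J F f) = (\<Sum>f\<in>{f \<in> monics n. cube_poly f}. J F f) + (\<Sum>f\<in>{f \<in> monics n. \<not> cube_poly f}. J F f)" for F
    proof -
      have e: "{f \<in> monics n. cube_poly f} \<union> {f \<in> monics n. \<not> cube_poly f} = (monics n :: 'k poly set)" by auto
      have "(\<Sum>f\<in>{f \<in> monics n. cube_poly f} \<union> {f \<in> monics n. \<not> cube_poly f}. J F f) =
         (\<Sum>f\<in>{f \<in> monics n. cube_poly f}. J F f) + (\<Sum>f\<in>{f \<in> monics n. \<not> cube_poly f}. J F f)"
        by (rule sum.union_disjoint) auto
      then show ?thesis unfolding e .
    qed
    then have "T n = ?C + ?NC" by (simp add: T_def sum.distrib)
    moreover have "cmod (?C - of_real (M n)) \<le> 2 * real N * real q powr (real N + real n / 3 - 1 / 6)"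
    proof (cases "3 dvd n")
      case True
      then obtain k where k: "n = 3 * k" by (auto simp: dvd_def)
      have "M n = real q ^ (k + N)"
        unfolding M_def k by (simp add: powr_realpow[OF qp(1), symmetric] add.commute)
      then have "cmod (?C - of_real (M n)) \<le> 2 * real N * real q ^ (k + N - 1)"
        using cube_part[OF N3(2) k] by simp
      also have "real q ^ (k + N - 1) = real q powr (real (k + N - 1))" by (simp add: powr_realpow[OF qp(1)])
      also have "real (k + N - 1) = real N + real n / 3 - 1" using N3(2) by (simp add: k of_nat_diff)
      also have "2 * real N * real q powr (real N + real n / 3 - 1) \<le> 2 * real N * real q powr (real N + real n / 3 - 1 / 6)"
        by (intro mult_left_mono powr_mono qp) auto
      finally show ?thesis .
    next
      case False
      have "?C = 0" unfolding no_cubes[OF False] by simp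
      then show ?thesis using False by (simp add: M_def)
    qed
    ultimately have "cmod (T n - of_real (M n)) \<le> 2 * real N * real q powr (real N + real n / 3 - 1 / 6)
       + (real N + 1) * ((real N + 1) ^ N * (4 * 8 ^ N) + 1) * real q powr (real N + real n / 3 - 1 / 6)"
      using norm_triangle_ineq[of "?C - of_real (M n)" ?NC] noncube_part'[OF q(1) n N3(1)] by (simp add: algebra_simps)
    then show ?thesis by (simp add: A_def distrib_right add.commute)
  qed
  define w where "w = (\<lambda>n. real q powr (- real n / 3))"
  define L where "L = (\<Sum>F\<in>sqfree_monics N. \<Sum>n<N. of_real (w n) * (\<Sum>f\<in>monics n. J F f))"
  have L: "L = (\<Sum>n<N. of_real (w n) * T n)"
    unfolding L_def T_def by (subst sum.swap) (simp add: sum_distrib_left)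
  have wM: "(\<Sum>n<N. w n * M n) = real (g + 1) * real q ^ N"
  proof -
    have "(\<Sum>n<N. w n * M n) = (\<Sum>n<N. if 3 dvd n then real q ^ N else 0)"
    proof (rule sum.cong[OF refl])
      fix n
      have "w n * real q powr (real N + real n / 3) = real q ^ N"
        unfolding w_def powr_add[symmetric] by (simp add: powr_realpow[OF qp(1)])
      then show "w n * M n = (if 3 dvd n then real q ^ N else 0)" by (simp add: M_def)
    qed
    also have "\<dots> = real (card {n \<in> {..<N}. 3 dvd n}) * real q ^ N"
      by (simp add: sum.If_cases Int_def)
    also have "{n \<in> {..<N}. 3 dvd n} = (\<lambda>k. 3 * k) ` {..g}" using N by (auto simp: dvd_def)
    also have "card ((\<lambda>k. 3 * k) ` {..g}) = g + 1" by (subst card_image) (auto simp: inj_on_def)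
    finally show ?thesis .
  qed
  have "cmod (L - of_real (real (g + 1) * real q ^ N)) = cmod (\<Sum>n<N. of_real (w n) * (T n - of_real (M n)))"
    unfolding wM[symmetric] L by (simp add: right_diff_distrib sum_subtractf)
  also have "\<dots> \<le> (\<Sum>n<N. A * real q powr (real N - 1 / 6))"
  proof (rule sum_norm_le)
    fix n assume "n \<in> {..<N}"
    then have "cmod (of_real (w n) * (T n - of_real (M n))) \<le> w n * (A * real q powr (real N + real n / 3 - 1 / 6))"
      using Tn[of n] by (simp add: norm_mult w_def mult_left_mono)
    also have "\<dots> = A * (real q powr (- real n / 3) * real q powr (real N + real n / 3 - 1 / 6))" by (simp add: w_def)
    also have "\<dots> = A * real q powr (real N - 1 / 6)" unfolding powr_add[symmetric] by simp
    finally show "cmod (of_real (w n) * (T n - of_real (M n))) \<le> A * real q powr (real N - 1 / 6)" .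
  qed
  finally have 1: "cmod (L - of_real (real (g + 1) * real q ^ N)) \<le> real N * A * real q powr (real N - 1 / 6)" by simp
  define h where "h = real (card (sqfree_monics N :: 'k poly set))"
  have sub: "sqfree_monics N \<subseteq> (monics N :: 'k poly set)" by (auto simp: sqfree_monics_def)
  have "real q ^ N - h = real (card (monics N - sqfree_monics N :: 'k poly set))"
    using card_mono[OF _ sub] by (simp add: h_def card_Diff_subset[OF _ sub] card_monics q_card of_nat_diff)
  then have h1: "0 \<le> real q ^ N - h" "real q ^ N - h \<le> real N * real q ^ (N - 1)" using card_not_sqfree[of N] by simp_all
  have qN: "real q ^ N = real q * real q ^ (N - 1)" using N3(2) by (metis power_minus_mult mult.commute)
  \<comment> \<open>The hypothesis \<open>2 * N \<le> q\<close> makes at least half of all monic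
    polynomials square-free, which bounds the denominator from below.\<close>
  have "2 * (real N * real q ^ (N - 1)) \<le> real q * real q ^ (N - 1)"
    unfolding mult.assoc[symmetric] using q(2) by (intro mult_right_mono) auto
  then have h2: "real q ^ N / 2 \<le> h" using h1(2) qN by simp
  have qN0: "real q ^ N > 0" using qp by simp
  then have h0: "h > 0" using h2 by linarith
  have e: "L / of_real h - of_nat (g + 1) = (L - of_real (real (g + 1) * h)) / of_real h"
    using h0 by (simp add: field_simps)
  have "cmod (L - of_real (real (g + 1) * h)) \<le> cmod (L - of_real (real (g + 1) * real q ^ N)) + cmod (of_real (real (g + 1) * (real q ^ N - h)))"
    using norm_triangle_ineq[of "L - of_real (real (g + 1) * real q ^ N)" "of_real (real (g + 1) * (real q ^ N - h))"]
    by (simp add: algebra_simps)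
  also have "cmod (of_real (real (g + 1) * (real q ^ N - h)) :: complex) = real (g + 1) * (real q ^ N - h)"
    unfolding norm_of_real using h1(1) by (intro abs_of_nonneg mult_nonneg_nonneg) auto
  also have "real (g + 1) * (real q ^ N - h) \<le> (real N + 1) * (real N * real q powr (real N - 1 / 6))"
  proof (intro mult_mono)
    have "real q ^ (N - 1) = real q powr (real (N - 1))" by (simp add: powr_realpow[OF qp(1)])
    also have "\<dots> \<le> real q powr (real N - 1 / 6)" by (intro powr_mono qp) (use N3(2) in \<open>simp add: of_nat_diff\<close>)
    finally show "real q ^ N - h \<le> real N * real q powr (real N - 1 / 6)"
      using h1(2) by (meson mult_left_mono of_nat_0_le_iff order_trans)
  qed (use N h1 in auto)
  finally have "cmod (L - of_real (real (g + 1) * h)) \<le> Cbound N / 2 * real q powr (real N - 1 / 6)"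
    using 1 by (simp add: Cbound_def A_def algebra_simps)
  then have "cmod (L / of_real h - of_nat (g + 1)) \<le> (Cbound N / 2 * real q powr (real N - 1 / 6)) / h"
    unfolding e norm_divide norm_of_real abs_of_pos[OF h0] using h0 by (intro divide_right_mono) auto
  also have "\<dots> \<le> (Cbound N / 2 * real q powr (real N - 1 / 6)) / (real q ^ N / 2)"
    by (rule divide_left_mono[OF h2]) (use h0 qN0 in \<open>auto simp: Cbound_def\<close>)
  also have "\<dots> = Cbound N * (real q powr (real N - 1 / 6) / real q powr real N)"
    by (simp add: powr_realpow[OF qp(1)])
  also have "\<dots> = Cbound N * real q powr (- 1 / 6)" by (simp flip: powr_diff)
  finally show ?thesis by (simp add: L_def w_def h_def)
qed

end

section \<open>Symbols with square-free modulus\<close>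

context cubic_char_field
begin

lemma sqfree_monicsD:
  assumes "F \<in> sqfree_monics N"
  shows "lead_coeff F = 1" "degree F = N" "F \<noteq> 0" "\<And>P. P \<in> mprimes \<Longrightarrow> \<not> P ^ 2 dvd F"
  using assms monicsD[of F N] monics_nz[of F N] by (auto simp: sqfree_monics_def)

lemma finite_mprime_divisors: "(F :: 'k poly) \<noteq> 0 \<Longrightarrow> finite {P \<in> mprimes. P dvd F}"
  by (rule finite_subset[OF _ finite_mprimes_le[of "degree F"]]) (auto dest: dvd_imp_degree_le)

lemma sqfree_eq_prime_powers:
  assumes F: "(F :: 'k poly) \<in> sqfree_monics N"
  shows "F = prime_powers {P \<in> mprimes. P dvd F} (\<lambda>_. 1)"
proof -
  note D = sqfree_monicsD[OF F]
  let ?S = "{P \<in> mprimes. P dvd F}"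
  have S: "finite ?S" "?S \<subseteq> mprimes" using finite_mprime_divisors[OF D(3)] by auto
  have "prime_powers ?S (\<lambda>_. 1) dvd F" by (rule prime_powers_dvd[OF S]) auto
  then obtain G where G: "F = prime_powers ?S (\<lambda>_. 1) * G" by (auto simp: dvd_def)
  have lG: "lead_coeff G = 1"
    using arg_cong[OF G, of lead_coeff] D(1) lead_coeff_prime_powers[OF S, of "\<lambda>_. 1"] by (simp add: lead_coeff_mult)
  have G0: "G \<noteq> 0" using lG by auto
  have "is_unit G"
  proof (rule ccontr)
    assume "\<not> is_unit G"
    then obtain P where P: "prime_elem P" "lead_coeff P = 1" "P dvd G" by (rule monic_prime_divisor[OF G0])
    then have "P dvd F" by (subst G) (rule dvd_mult)
    then have PS: "P \<in> ?S" using P by (simp add: mprimes_def)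
    have "P dvd prime_powers ?S (\<lambda>_. 1)" unfolding prime_powers_def using dvd_prodI[OF S(1) PS, of "\<lambda>P. P"] by simp
    then have "P * P dvd prime_powers ?S (\<lambda>_. 1) * G" using P(3) by (rule mult_dvd_mono)
    then have "P * P dvd F" using G by (simp only:)
    then show False using D(4) PS by (simp add: power2_eq_square)
  qed
  then have "G = 1" using lG by (metis is_unit_iff_degree G0 degree_eq_zeroE lead_coeff_pCons(2) one_pCons)
  then show ?thesis using G by simp
qed

lemma J_sqfree:
  assumes F: "F \<in> sqfree_monics N"
  shows "J F f = (\<Prod>P\<in>{P \<in> mprimes. P dvd F}. J P f)"
proof -
  have "J (prime_powers {P \<in> mprimes. P dvd F} (\<lambda>_. 1)) f = (\<Prod>P\<in>{P \<in> mprimes. P dvd F}. J P f ^ 1)"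
    by (rule J_prime_powers) (use finite_mprime_divisors[OF sqfree_monicsD(3)[OF F]] in auto)
  then show ?thesis using sqfree_eq_prime_powers[OF F] by simp
qed

text \<open>A prime divides the modulus if and only if the symbol vanishes at it, and a square-free
  monic modulus is the product of its primes. Hence summing over characters is the same as summing
  over moduli.\<close>

lemma J_sqfree_inject:
  assumes F: "F \<in> sqfree_monics N" and G: "G \<in> sqfree_monics M" and e: "\<And>f. J F f = J G f"
  shows "F = G"
proof -
  have "P dvd F \<longleftrightarrow> P dvd G" if P: "P \<in> mprimes" for P
  proof -
    have "P dvd H \<longleftrightarrow> J H P = 0" if "H \<noteq> 0" for H
      using J_eq_0_iff[OF that] mprimes_coprime_iff[OF P] by (simp add: coprime_commute)
    then show ?thesis using e sqfree_monicsD(3)[OF F] sqfree_monicsD(3)[OF G] by simp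
  qed
  then have "{P \<in> mprimes. P dvd F} = {P \<in> mprimes. P dvd G}" by auto
  then show ?thesis using sqfree_eq_prime_powers[OF F] sqfree_eq_prime_powers[OF G] by simp
qed

text \<open>A modulus \<open>C\<close> of smaller degree misses some prime \<open>P\<close> of
  \<open>F\<close>. One can then change the argument modulo \<open>P\<close> alone, keeping it 1
  modulo \<open>C\<close> and modulo \<open>F / P\<close>, and thereby change the symbol.\<close>

lemma J_conductor:
  assumes F: "F \<in> sqfree_monics N" and C: "C \<in> monics d"
    and h: "\<And>a b. J F a \<noteq> 0 \<Longrightarrow> J F b \<noteq> 0 \<Longrightarrow> C dvd a - b \<Longrightarrow> J F a = J F b"
  shows "N \<le> d"
proof (rule ccontr)
  assume less: "\<not> N \<le> d"
  note D = sqfree_monicsD[OF F]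
  have C0: "C \<noteq> 0" "degree C = d" using C monics_nz monicsD by blast+
  have "\<exists>P\<in>mprimes. P dvd F \<and> \<not> P dvd C"
  proof (rule ccontr)
    assume n: "\<not> ?thesis"
    have "prime_powers {P \<in> mprimes. P dvd F} (\<lambda>_. 1) dvd C"
      by (rule prime_powers_dvd) (use n finite_mprime_divisors[OF D(3)] in auto)
    then have "F dvd C" using sqfree_eq_prime_powers[OF F] by simp
    then show False using dvd_imp_degree_le[OF _ C0(1)] C0(2) D(2) less by fastforce
  qed
  then obtain P where P: "P \<in> mprimes" "P dvd F" "\<not> P dvd C" by blast
  obtain G where G: "F = P * G" using P(2) by (auto simp: dvd_def)
  have nG: "\<not> P dvd G"
  proof
    assume "P dvd G"
    then have "P ^ 2 dvd F" unfolding G power2_eq_square by (simp add: mult_dvd_mono)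
    then show False using D(4)[OF P(1)] by simp
  qed
  have lP: "lead_coeff P = 1" "prime_elem P" "P \<noteq> 0" using mprimesD[OF P(1)] by auto
  have lG: "lead_coeff G = 1" using arg_cong[OF G, of lead_coeff] D(1) lP(1) by (simp add: lead_coeff_mult)
  obtain c where c: "coprime P c" "J P c \<noteq> 1" using J_prime_nontriv[OF lP(2)] .
  have "\<not> P dvd G * C" using nG P(3) lP(2) by (simp add: prime_elem_dvd_mult_iff)
  then have "coprime (G * C) P" using mprimes_coprime_iff[OF P(1)] coprime_commute by blast
  then obtain t where t: "P dvd G * C * t - 1" using coprime_inverse_mod by metis
  \<comment> \<open>Chinese remainder witness: congruent to \<open>c\<close> modulo \<open>P\<close>
    and to 1 modulo \<open>G\<close> and \<open>C\<close>, because \<open>G * C * t\<close> is 1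
    modulo \<open>P\<close>.\<close>
  define a where "a = 1 + G * C * t * (c - 1)"
  have "a - c = (G * C * t - 1) * (c - 1)" by (simp add: a_def algebra_simps)
  then have ac: "P dvd a - c" using t by simp
  have aG: "G dvd a - 1" and aC: "C dvd a - 1" by (simp_all add: a_def)
  have "J F a = J P a * J G a" unfolding G by (rule J_mult_left[OF lP(1) lG])
  also have "J P a = J P c" by (rule J_cong[OF ac])
  also have "J G a = 1" using J_cong[OF aG] by simp
  finally have e: "J F a = J P c" by simp
  have "J P c \<noteq> 0" by (rule J_coprime_nz[OF lP(3) c(1)])
  then show False using h[of a 1] aC e c(2) by simp
qed

text \<open>On constants the symbol is \<open>om\<close> to the power of the degree of the modulus,
  and \<open>om\<close> has order exactly 3. So evenness is divisibility of the degree by 3.\<close>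

lemma J_const_trivial_iff: "(\<forall>c. c \<noteq> 0 \<longrightarrow> J F [:c:] = 1) \<longleftrightarrow> 3 dvd degree F"
proof
  assume "3 dvd degree F"
  then show "\<forall>c. c \<noteq> 0 \<longrightarrow> J F [:c:] = 1" using om_cube by (auto simp: J_const dvd_def power_mult)
next
  assume h: "\<forall>c. c \<noteq> 0 \<longrightarrow> J F [:c:] = 1"
  obtain c where c: "c \<noteq> 0" "om c \<noteq> 1" using om_nontriv by blast
  have "om c ^ (degree F mod 3) = 1" using h c(1) cube_root_power_mod[OF om_cube[OF c(1)]] by (simp add: J_const)
  moreover have "om c ^ 2 \<noteq> 1" using om_cube[OF c(1)] c(2) by (auto simp: power3_eq_cube power2_eq_square)
  moreover have "degree F mod 3 \<in> {0, 1, 2}" by auto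
  ultimately have "degree F mod 3 = 0" using c(2) by auto
  then show "3 dvd degree F" by auto
qed

end

section \<open>Transfer from type-based fields to carrier-based fields\<close>

text \<open>A field isomorphism from a carrier-based ring onto a whole type; preservation of 0 and 1
  follows from the two homomorphism laws.\<close>

locale field_transfer =
  fixes K :: "'b ring" and \<phi> :: "'b \<Rightarrow> 'k::{field_gcd,finite}"
  assumes field: "field K"
    and bij: "bij_betw \<phi> (carrier K) UNIV"
    and add: "x \<in> carrier K \<Longrightarrow> y \<in> carrier K \<Longrightarrow> \<phi> (x \<oplus>\<^bsub>K\<^esub> y) = \<phi> x + \<phi> y"
    and mult: "x \<in> carrier K \<Longrightarrow> y \<in> carrier K \<Longrightarrow> \<phi> (x \<otimes>\<^bsub>K\<^esub> y) = \<phi> x * \<phi> y"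
begin

sublocale K: field K by (rule field)
sublocale R: domain "poly_ring K"
  by (rule K.univ_poly_is_domain[OF K.carrier_is_subring])

lemma inj: "x \<in> carrier K \<Longrightarrow> y \<in> carrier K \<Longrightarrow> \<phi> x = \<phi> y \<longleftrightarrow> x = y"
  using bij by (auto simp: bij_betw_def inj_on_def)

lemma zero [simp]: "\<phi> \<zero>\<^bsub>K\<^esub> = 0"
  using add[of "\<zero>\<^bsub>K\<^esub>" "\<zero>\<^bsub>K\<^esub>"] K.l_zero[OF K.zero_closed] K.zero_closed by (metis add_cancel_left_left)

lemma eq_0: "x \<in> carrier K \<Longrightarrow> \<phi> x = 0 \<longleftrightarrow> x = \<zero>\<^bsub>K\<^esub>"
  using inj[of x "\<zero>\<^bsub>K\<^esub>"] by simp

lemma one [simp]: "\<phi> \<one>\<^bsub>K\<^esub> = 1"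
  using mult[of "\<one>\<^bsub>K\<^esub>" "\<one>\<^bsub>K\<^esub>"] eq_0[of "\<one>\<^bsub>K\<^esub>"] by simp

lemma eq_1: "x \<in> carrier K \<Longrightarrow> \<phi> x = 1 \<longleftrightarrow> x = \<one>\<^bsub>K\<^esub>"
  using inj[of x "\<one>\<^bsub>K\<^esub>"] by simp

lemma finsum: "finite A \<Longrightarrow> (\<And>i. i \<in> A \<Longrightarrow> f i \<in> carrier K) \<Longrightarrow> \<phi> (finsum K f A) = (\<Sum>i\<in>A. \<phi> (f i))"
  by (induction A rule: finite_induct) (auto simp: add K.finsum_closed Pi_def)

lemma pow: "x \<in> carrier K \<Longrightarrow> \<phi> (x [^]\<^bsub>K\<^esub> (n::nat)) = \<phi> x ^ n"
  by (induction n) (auto simp: mult)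

definition inv\<phi> :: "'k \<Rightarrow> 'b" where "inv\<phi> = inv_into (carrier K) \<phi>"

lemma inv\<phi> [simp]: "inv\<phi> x \<in> carrier K" "\<phi> (inv\<phi> x) = x"
  using bij unfolding inv\<phi>_def bij_betw_def by (metis UNIV_I inv_into_into, metis UNIV_I f_inv_into_f)

lemma inv\<phi>_mult: "inv\<phi> (x * y) = inv\<phi> x \<otimes>\<^bsub>K\<^esub> inv\<phi> y"
  using inj[of "inv\<phi> (x * y)" "inv\<phi> x \<otimes>\<^bsub>K\<^esub> inv\<phi> y"] by (simp add: mult)

lemma finite_carrier: "finite (carrier K)" and card_carrier: "card (carrier K) = CARD('k)"
  using bij_betw_finite[OF bij] bij_betw_same_card[OF bij] by simp_all

text \<open>The lists of the carrier-based polynomials start with the leading coefficient,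
  \<open>Poly\<close> expects the constant term first; hence the reversal.\<close>

definition \<Phi> :: "'b list \<Rightarrow> 'k poly" where
  "\<Phi> p = Poly (map \<phi> (rev p))"

lemma carrier_iff: "p \<in> carrier (poly_ring K) \<longleftrightarrow> p = [] \<or> (set p \<subseteq> carrier K \<and> hd p \<noteq> \<zero>\<^bsub>K\<^esub>)"
  by (simp add: univ_poly_def polynomial_def)

lemma coeff_\<Phi>: "coeff (\<Phi> p) i = \<phi> (K.coeff p i)"
proof (cases "i < length p")
  case True
  then show ?thesis by (simp add: \<Phi>_def nth_default_def K.coeff_nth rev_nth)
qed (simp add: \<Phi>_def nth_default_def K.coeff_length)

lemma set_carrier: "p \<in> carrier (poly_ring K) \<Longrightarrow> set p \<subseteq> carrier K"
  by (auto simp: carrier_iff)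

lemma coeff_carrier: "p \<in> carrier (poly_ring K) \<Longrightarrow> K.coeff p i \<in> carrier K"
  using set_carrier by (simp add: K.coeff_in_carrier)

lemma bij_\<Phi>: "bij_betw \<Phi> (carrier (poly_ring K)) UNIV"
  unfolding bij_betw_def
proof
  show "inj_on \<Phi> (carrier (poly_ring K))"
  proof (rule inj_onI)
    fix p r assume p: "p \<in> carrier (poly_ring K)" and r: "r \<in> carrier (poly_ring K)" and e: "\<Phi> p = \<Phi> r"
    have "K.coeff p i = K.coeff r i" for i
      using arg_cong[OF e, of "\<lambda>f. coeff f i"] inj coeff_carrier[OF p] coeff_carrier[OF r] by (simp add: coeff_\<Phi>)
    then have "K.coeff p = K.coeff r" by auto
    then show "p = r"
      using K.coeff_iff_polynomial_cond p r unfolding univ_poly_carrier[symmetric] by blast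
  qed
  show "\<Phi> ` carrier (poly_ring K) = UNIV"
  proof (rule UNIV_eq_I[symmetric])
    fix f
    have "\<exists>p\<in>carrier (poly_ring K). f = \<Phi> p"
    proof (cases "f = 0")
      case True
      then show ?thesis by (intro bexI[of _ "[]"]) (auto simp: \<Phi>_def carrier_iff)
    next
      case False
      define p where "p = map inv\<phi> (rev (coeffs f))"
      have "hd p = inv\<phi> (lead_coeff f)" "p \<noteq> []"
        using False by (simp_all add: p_def hd_map hd_rev last_coeffs_eq_coeff_degree)
      moreover have "inv\<phi> (lead_coeff f) \<noteq> \<zero>\<^bsub>K\<^esub>" using False by (metis inv\<phi>(2) zero leading_coeff_0_iff)
      ultimately have "p \<in> carrier (poly_ring K)" by (auto simp: carrier_iff p_def)
      moreover have "f = \<Phi> p" by (simp add: \<Phi>_def p_def rev_map[symmetric] o_def)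
      ultimately show ?thesis by blast
    qed
    then show "f \<in> \<Phi> ` carrier (poly_ring K)" by (simp only: image_iff)
  qed
qed

lemma \<Phi>_inj: "p \<in> carrier (poly_ring K) \<Longrightarrow> r \<in> carrier (poly_ring K) \<Longrightarrow> \<Phi> p = \<Phi> r \<longleftrightarrow> p = r"
  using bij_\<Phi> by (auto simp: bij_betw_def inj_on_def)

lemma \<Phi>_surj: obtains p where "p \<in> carrier (poly_ring K)" "\<Phi> p = f"
  using bij_\<Phi> unfolding bij_betw_def by (metis UNIV_I imageE)

lemma \<Phi>_mult:
  assumes p: "p \<in> carrier (poly_ring K)" and r: "r \<in> carrier (poly_ring K)"
  shows "\<Phi> (p \<otimes>\<^bsub>poly_ring K\<^esub> r) = \<Phi> p * \<Phi> r"
proof (rule poly_eqI)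
  fix i
  show "coeff (\<Phi> (p \<otimes>\<^bsub>poly_ring K\<^esub> r)) i = coeff (\<Phi> p * \<Phi> r) i"
    unfolding coeff_\<Phi> univ_poly_mult K.poly_mult_coeff[OF set_carrier[OF p] set_carrier[OF r]] coeff_mult
    by (subst finsum) (auto simp: coeff_carrier p r mult)
qed

lemma \<Phi>_add:
  assumes p: "p \<in> carrier (poly_ring K)" and r: "r \<in> carrier (poly_ring K)"
  shows "\<Phi> (p \<oplus>\<^bsub>poly_ring K\<^esub> r) = \<Phi> p + \<Phi> r"
  by (rule poly_eqI) (simp add: coeff_\<Phi> univ_poly_add K.poly_add_coeff set_carrier coeff_carrier p r add
      del: K.poly_add.simps)

lemma \<Phi>_minus:
  assumes p: "p \<in> carrier (poly_ring K)" and r: "r \<in> carrier (poly_ring K)"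
  shows "\<Phi> (p \<ominus>\<^bsub>poly_ring K\<^esub> r) = \<Phi> p - \<Phi> r"
proof -
  have "(p \<ominus>\<^bsub>poly_ring K\<^esub> r) \<oplus>\<^bsub>poly_ring K\<^esub> r = p"
    using p r by (simp add: a_minus_def R.a_assoc R.l_neg)
  then show ?thesis using \<Phi>_add[of "p \<ominus>\<^bsub>poly_ring K\<^esub> r" r] p r by (simp add: algebra_simps)
qed

lemma \<Phi>_const: "\<Phi> [c] = [:\<phi> c:]"
  by (simp add: \<Phi>_def)

lemma \<Phi>_one [simp]: "\<Phi> \<one>\<^bsub>poly_ring K\<^esub> = 1"
  by (simp add: univ_poly_one \<Phi>_const one_pCons)

lemma \<Phi>_zero [simp]: "\<Phi> \<zero>\<^bsub>poly_ring K\<^esub> = 0"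
  by (simp add: univ_poly_zero \<Phi>_def)

lemma \<Phi>_eq_0: "p \<in> carrier (poly_ring K) \<Longrightarrow> \<Phi> p = 0 \<longleftrightarrow> p = \<zero>\<^bsub>poly_ring K\<^esub>"
  using \<Phi>_inj[of p "\<zero>\<^bsub>poly_ring K\<^esub>"] by simp

lemma \<Phi>_pow: "p \<in> carrier (poly_ring K) \<Longrightarrow> \<Phi> (p [^]\<^bsub>poly_ring K\<^esub> (n::nat)) = \<Phi> p ^ n"
  by (induction n) (auto simp: \<Phi>_mult)

lemma const_carrier: "c \<in> carrier K \<Longrightarrow> c \<noteq> \<zero>\<^bsub>K\<^esub> \<Longrightarrow> [c] \<in> carrier (poly_ring K)"
  by (simp add: carrier_iff)

lemma pdivides_iff:
  assumes p: "p \<in> carrier (poly_ring K)" and r: "r \<in> carrier (poly_ring K)"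
  shows "p pdivides\<^bsub>K\<^esub> r \<longleftrightarrow> \<Phi> p dvd \<Phi> r"
proof
  assume "p pdivides\<^bsub>K\<^esub> r"
  then obtain s where "s \<in> carrier (poly_ring K)" "r = p \<otimes>\<^bsub>poly_ring K\<^esub> s" by (auto simp: pdivides_def factor_def)
  then show "\<Phi> p dvd \<Phi> r" using p by (simp add: \<Phi>_mult)
next
  assume "\<Phi> p dvd \<Phi> r"
  then obtain f where f: "\<Phi> r = \<Phi> p * f" by (auto simp: dvd_def)
  obtain s where s: "s \<in> carrier (poly_ring K)" "\<Phi> s = f" by (rule \<Phi>_surj)
  then have "r = p \<otimes>\<^bsub>poly_ring K\<^esub> s" using f p r \<Phi>_inj[of r "p \<otimes>\<^bsub>poly_ring K\<^esub> s"] by (simp add: \<Phi>_mult)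
  then show "p pdivides\<^bsub>K\<^esub> r" using s by (auto simp: pdivides_def factor_def)
qed

lemma Units_iff:
  assumes p: "p \<in> carrier (poly_ring K)"
  shows "p \<in> Units (poly_ring K) \<longleftrightarrow> is_unit (\<Phi> p)"
proof -
  have "p \<in> Units (poly_ring K) \<longleftrightarrow> p pdivides\<^bsub>K\<^esub> \<one>\<^bsub>poly_ring K\<^esub>"
    using p by (auto simp: Units_def pdivides_def factor_def R.m_comm) (metis R.m_comm)
  then show ?thesis using p by (simp add: pdivides_iff)
qed

lemma pirreducible_iff:
  assumes p: "p \<in> carrier (poly_ring K)"
  shows "pirreducible\<^bsub>K\<^esub> (carrier K) p \<longleftrightarrow> prime_elem (\<Phi> p)"
proof
  assume h: "pirreducible\<^bsub>K\<^esub> (carrier K) p"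
  have "irreducible (\<Phi> p)"
  proof (rule Factorial_Ring.irreducibleI)
    show "\<Phi> p \<noteq> 0" using R.ring_irreducibleE(1)[OF p h] p by (simp add: \<Phi>_eq_0)
    show "\<not> is_unit (\<Phi> p)" using R.ring_irreducibleE(4)[OF p h] p by (simp add: Units_iff)
    fix a b assume ab: "\<Phi> p = a * b"
    obtain a' b' where a: "a' \<in> carrier (poly_ring K)" "\<Phi> a' = a" and b: "b' \<in> carrier (poly_ring K)" "\<Phi> b' = b"
      by (metis \<Phi>_surj)
    have "p = a' \<otimes>\<^bsub>poly_ring K\<^esub> b'"
      using a b p ab \<Phi>_inj[of p "a' \<otimes>\<^bsub>poly_ring K\<^esub> b'"] by (simp add: \<Phi>_mult)
    then show "is_unit a \<or> is_unit b" using R.ring_irreducibleE(5)[OF p h a(1) b(1)] a b by (simp add: Units_iff)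
  qed
  then show "prime_elem (\<Phi> p)" by (rule irreducible_imp_prime_elem)
next
  assume h: "prime_elem (\<Phi> p)"
  then have i: "irreducible (\<Phi> p)" by (rule prime_elem_imp_irreducible)
  show "pirreducible\<^bsub>K\<^esub> (carrier K) p"
  proof (rule R.ring_irreducibleI)
    show "p \<in> carrier (poly_ring K) - {\<zero>\<^bsub>poly_ring K\<^esub>}" using p h \<Phi>_eq_0[OF p] by auto
    show "p \<notin> Units (poly_ring K)" using Units_iff[OF p] h prime_elem_not_unit by blast
    fix a b assume a: "a \<in> carrier (poly_ring K)" and b: "b \<in> carrier (poly_ring K)" and "p = a \<otimes>\<^bsub>poly_ring K\<^esub> b"
    then have "\<Phi> p = \<Phi> a * \<Phi> b" by (simp add: \<Phi>_mult)
    then show "a \<in> Units (poly_ring K) \<or> b \<in> Units (poly_ring K)"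
      using Factorial_Ring.irreducibleD[OF i] a b by (simp add: Units_iff)
  qed
qed

lemma degree_\<Phi>: assumes "p \<in> carrier (poly_ring K)" shows "degree (\<Phi> p) = length p - 1"
proof (cases "p = []")
  case False
  then have "hd p \<in> carrier K" "hd p \<noteq> \<zero>\<^bsub>K\<^esub>" using assms hd_in_set by (auto simp: carrier_iff)
  then have "coeff (\<Phi> p) (length p - 1) \<noteq> 0"
    unfolding coeff_\<Phi> K.lead_coeff_simp[OF False] using eq_0 by simp
  then have "length p - 1 \<le> degree (\<Phi> p)" by (rule le_degree)
  moreover have "degree (\<Phi> p) \<le> length p - 1"
    by (rule degree_le) (auto simp: coeff_\<Phi> K.coeff_length)
  ultimately show ?thesis by simp
qed (simp add: \<Phi>_def)

lemma monic_polys_iff: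
  assumes "p \<in> carrier (poly_ring K)"
  shows "p \<in> monic_polys K \<longleftrightarrow> lead_coeff (\<Phi> p) = 1"
proof (cases "p = []")
  case True
  then show ?thesis by (simp add: monic_polys_def \<Phi>_def)
next
  case False
  have "lead_coeff (\<Phi> p) = \<phi> (hd p)" unfolding degree_\<Phi>[OF assms] coeff_\<Phi> K.lead_coeff_simp[OF False] ..
  moreover have "hd p \<in> carrier K" using False set_carrier[OF assms] by auto
  ultimately show ?thesis using False assms by (simp add: monic_polys_def eq_1)
qed

lemma monic_polysD: "p \<in> monic_polys K \<Longrightarrow> p \<in> carrier (poly_ring K)"
  by (simp add: monic_polys_def)

lemma monics_iff:
  assumes "p \<in> carrier (poly_ring K)"
  shows "\<Phi> p \<in> monics n \<longleftrightarrow> p \<in> monic_polys K \<and> length p - 1 = n"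
  unfolding monics_def mem_Collect_eq monic_polys_iff[OF assms] degree_\<Phi>[OF assms] by (rule conj_commute)

lemma bij_monics: "bij_betw \<Phi> {p \<in> monic_polys K. length p - 1 = n} (monics n)"
proof -
  have "\<Phi> ` {p \<in> monic_polys K. length p - 1 = n} = monics n"
  proof (intro equalityI subsetI)
    fix f :: "'k poly" assume f: "f \<in> monics n"
    obtain p where p: "p \<in> carrier (poly_ring K)" "\<Phi> p = f" by (rule \<Phi>_surj)
    then show "f \<in> \<Phi> ` {p \<in> monic_polys K. length p - 1 = n}"
      using f monics_iff[OF p(1), of n] by (intro image_eqI[of _ _ p]) simp_all
  next
    fix f assume "f \<in> \<Phi> ` {p \<in> monic_polys K. length p - 1 = n}"
    then obtain p where p: "f = \<Phi> p" "p \<in> monic_polys K" "length p - 1 = n" by blast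
    then show "f \<in> monics n" using monics_iff[OF monic_polysD[OF p(2)]] by simp
  qed
  moreover have "inj_on \<Phi> {p \<in> monic_polys K. length p - 1 = n}"
    by (rule inj_on_subset[OF bij_betw_imp_inj_on[OF bij_\<Phi>]]) (auto dest: monic_polysD)
  ultimately show ?thesis by (simp add: bij_betw_def)
qed

lemma bij_monic_prime_divisors:
  assumes F: "F \<in> carrier (poly_ring K)"
  shows "bij_betw \<Phi> {P \<in> monic_primes K. P pdivides\<^bsub>K\<^esub> F} {P \<in> mprimes. P dvd \<Phi> F}"
proof -
  have iff: "P \<in> monic_primes K \<and> P pdivides\<^bsub>K\<^esub> F \<longleftrightarrow> \<Phi> P \<in> mprimes \<and> \<Phi> P dvd \<Phi> F" if "P \<in> carrier (poly_ring K)" for P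
    using that F by (auto simp: monic_primes_def mprimes_def monic_polys_iff pirreducible_iff pdivides_iff)
  have "\<Phi> ` {P \<in> monic_primes K. P pdivides\<^bsub>K\<^esub> F} = {P \<in> mprimes. P dvd \<Phi> F}"
  proof (intro equalityI subsetI)
    fix f assume f: "f \<in> {P \<in> mprimes. P dvd \<Phi> F}"
    obtain p where p: "p \<in> carrier (poly_ring K)" "\<Phi> p = f" by (rule \<Phi>_surj)
    then show "f \<in> \<Phi> ` {P \<in> monic_primes K. P pdivides\<^bsub>K\<^esub> F}" using f iff[OF p(1)] by auto
  next
    fix f assume "f \<in> \<Phi> ` {P \<in> monic_primes K. P pdivides\<^bsub>K\<^esub> F}"
    then obtain P where P: "f = \<Phi> P" "P \<in> monic_primes K" "P pdivides\<^bsub>K\<^esub> F" by auto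
    then show "f \<in> {P \<in> mprimes. P dvd \<Phi> F}" using iff[of P] by (auto simp: monic_primes_def dest: monic_polysD)
  qed
  moreover have "inj_on \<Phi> {P \<in> monic_primes K. P pdivides\<^bsub>K\<^esub> F}"
    by (rule inj_on_subset[OF bij_betw_imp_inj_on[OF bij_\<Phi>]]) (auto simp: monic_primes_def dest: monic_polysD)
  ultimately show ?thesis by (simp add: bij_betw_def)
qed

lemma squarefree_iff:
  assumes F: "F \<in> monic_polys K" "length F - 1 = N"
  shows "squarefree_poly K F \<longleftrightarrow> \<Phi> F \<in> sqfree_monics N"
proof -
  have Fc: "F \<in> carrier (poly_ring K)" by (rule monic_polysD[OF F(1)])
  have Fm: "\<Phi> F \<in> monics N" using bij_betwE[OF bij_monics] F by blast
  show ?thesis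
  proof
    assume h: "squarefree_poly K F"
    have "\<not> P ^ 2 dvd \<Phi> F" if P: "P \<in> mprimes" for P
    proof
      assume d: "P ^ 2 dvd \<Phi> F"
      obtain D where D: "D \<in> carrier (poly_ring K)" "\<Phi> D = P" by (rule \<Phi>_surj)
      then have "(D \<otimes>\<^bsub>poly_ring K\<^esub> D) pdivides\<^bsub>K\<^esub> F" using d Fc by (simp add: pdivides_iff \<Phi>_mult power2_eq_square)
      then have "is_unit P" using h D Units_iff[OF D(1)] unfolding squarefree_poly_def by blast
      then show False using mprimesD(4)[OF P] by simp
    qed
    then show "\<Phi> F \<in> sqfree_monics N" using Fm by (simp add: sqfree_monics_def)
  next
    assume h: "\<Phi> F \<in> sqfree_monics N"
    show "squarefree_poly K F" unfolding squarefree_poly_def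
    proof (intro ballI impI)
      fix D assume D: "D \<in> carrier (poly_ring K)" and d: "(D \<otimes>\<^bsub>poly_ring K\<^esub> D) pdivides\<^bsub>K\<^esub> F"
      have d2: "\<Phi> D * \<Phi> D dvd \<Phi> F" using d D Fc by (simp add: pdivides_iff \<Phi>_mult)
      then have D0: "\<Phi> D \<noteq> 0" using monics_nz[OF Fm] by auto
      have "is_unit (\<Phi> D)"
      proof (rule ccontr)
        assume "\<not> is_unit (\<Phi> D)"
        then obtain P where P: "prime_elem P" "lead_coeff P = 1" "P dvd \<Phi> D" by (rule monic_prime_divisor[OF D0])
        then have "P ^ 2 dvd \<Phi> F" using d2 unfolding power2_eq_square by (meson dvd_trans mult_dvd_mono)
        then show False using h P by (auto simp: sqfree_monics_def mprimes_def)
      qed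
      then show "D \<in> Units (poly_ring K)" using D by (simp add: Units_iff)
    qed
  qed
qed

lemma prime_exponent_sqfree:
  assumes F: "F \<in> carrier (poly_ring K)" "\<Phi> F \<in> sqfree_monics N" and P: "P \<in> monic_primes K" "P pdivides\<^bsub>K\<^esub> F"
  shows "prime_exponent K P F = 1"
  unfolding prime_exponent_def
proof (rule Greatest_equality)
  have Pc: "P \<in> carrier (poly_ring K)" using P by (auto simp: monic_primes_def dest: monic_polysD)
  then have Pm: "\<Phi> P \<in> mprimes" using bij_betwE[OF bij_monic_prime_divisors[OF F(1)]] P by auto
  show "(P [^]\<^bsub>poly_ring K\<^esub> (1::nat)) pdivides\<^bsub>K\<^esub> F" using P Pc by simp
  fix e :: nat assume "(P [^]\<^bsub>poly_ring K\<^esub> e) pdivides\<^bsub>K\<^esub> F"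
  then have d: "\<Phi> P ^ e dvd \<Phi> F" using Pc F by (simp add: pdivides_iff \<Phi>_pow)
  show "e \<le> 1"
  proof (rule ccontr)
    assume "\<not> e \<le> 1"
    then have "\<Phi> P ^ 2 dvd \<Phi> P ^ e" by (intro le_imp_power_dvd) simp
    then show False using d F(2) Pm by (auto simp: sqfree_monics_def dest: dvd_trans)
  qed
qed

end

section \<open>The cubic characters of the statement as symbols\<close>

lemma mu3_cube: "\<alpha> \<in> mu3 \<Longrightarrow> \<alpha> ^ 3 = 1"
proof -
  have "cis (2 * pi / 3) ^ 3 = 1" unfolding Complex.DeMoivre by simp
  moreover from this have "(cis (2 * pi / 3) ^ 2) ^ 3 = 1" by (metis power_commutes power_mult power_one mult.commute)
  ultimately show "\<alpha> \<in> mu3 \<Longrightarrow> \<alpha> ^ 3 = 1" by (auto simp: mu3_def)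
qed

locale cubic_transfer = field_transfer K \<phi> for K :: "'b ring" and \<phi> :: "'b \<Rightarrow> 'k::{field_gcd,finite}" +
  fixes \<Omega> :: "'b \<Rightarrow> complex"
  assumes \<Omega>: "cube_root_iso K \<Omega>" and card6: "CARD('k) mod 6 = 1"
begin

lemma card_third: "(CARD('k) - 1) div 3 * 3 = CARD('k) - 1"
  using card6 by presburger

lemma cube_rootsD: "z \<in> cube_roots K \<Longrightarrow> z \<in> carrier K"
  by (simp add: cube_roots_def)

lemma one_cube_root: "\<one>\<^bsub>K\<^esub> \<in> cube_roots K"
  by (simp add: cube_roots_def)

lemma \<Omega>_mult: "x \<in> cube_roots K \<Longrightarrow> y \<in> cube_roots K \<Longrightarrow> \<Omega> (x \<otimes>\<^bsub>K\<^esub> y) = \<Omega> x * \<Omega> y"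
  using \<Omega> by (simp add: cube_root_iso_def)

lemma \<Omega>_cube: "x \<in> cube_roots K \<Longrightarrow> \<Omega> x ^ 3 = 1"
  using \<Omega> mu3_cube bij_betwE unfolding cube_root_iso_def by blast

lemma \<Omega>_one: "\<Omega> \<one>\<^bsub>K\<^esub> = 1"
proof -
  have "\<Omega> \<one>\<^bsub>K\<^esub> * \<Omega> \<one>\<^bsub>K\<^esub> = \<Omega> \<one>\<^bsub>K\<^esub>" using \<Omega>_mult[OF one_cube_root one_cube_root] by simp
  moreover have "\<Omega> \<one>\<^bsub>K\<^esub> \<noteq> 0" using \<Omega>_cube[OF one_cube_root] by auto
  ultimately show ?thesis by simp
qed

lemma \<Omega>_eq_1: "x \<in> cube_roots K \<Longrightarrow> \<Omega> x = 1 \<Longrightarrow> x = \<one>\<^bsub>K\<^esub>"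
  using \<Omega> \<Omega>_one one_cube_root unfolding cube_root_iso_def bij_betw_def inj_on_def by metis

lemma fermat: assumes "a \<in> carrier K" "a \<noteq> \<zero>\<^bsub>K\<^esub>" shows "a [^]\<^bsub>K\<^esub> (CARD('k) - 1) = \<one>\<^bsub>K\<^esub>"
proof -
  interpret M: group "Multiplicative_Group.mult_of K" by (rule K.field_mult_group)
  have "Coset.order (Multiplicative_Group.mult_of K) = CARD('k) - 1"
    using finite_carrier by (simp add: Coset.order_def card_carrier)
  then show ?thesis using M.pow_order_eq_1[of a] assms by (simp add: Multiplicative_Group.nat_pow_mult_of)
qed

definition root :: "'k \<Rightarrow> 'b" where
  "root x = inv\<phi> x [^]\<^bsub>K\<^esub> ((CARD('k) - 1) div 3)"

lemma root: assumes "x \<noteq> 0" shows "root x \<in> cube_roots K"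
proof -
  have "inv\<phi> x \<noteq> \<zero>\<^bsub>K\<^esub>" using assms inv\<phi>(2) zero by metis
  then have "root x [^]\<^bsub>K\<^esub> (3::nat) = \<one>\<^bsub>K\<^esub>"
    unfolding root_def K.nat_pow_pow[OF inv\<phi>(1)] card_third by (rule fermat[OF inv\<phi>(1)])
  then show ?thesis by (simp add: cube_roots_def root_def)
qed

lemma \<phi>_root: "\<phi> (root x) = x ^ ((CARD('k) - 1) div 3)"
  by (simp add: root_def pow)

text \<open>The character of the constant field induced by \<open>\<Omega>\<close>: the power
  \<open>(q - 1) / 3\<close> maps nonzero constants to cube roots of unity.\<close>

definition om :: "'k \<Rightarrow> complex" where
  "om x = (if x = 0 then 0 else \<Omega> (root x))"

sublocale C: cubic_char_field om "CARD('k)"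
proof
  show "om (x * y) = om x * om y" for x y
  proof (cases "x = 0 \<or> y = 0")
    case False
    have "root (x * y) = root x \<otimes>\<^bsub>K\<^esub> root y" by (simp add: root_def inv\<phi>_mult K.nat_pow_distrib)
    then show ?thesis using False \<Omega>_mult[OF root root] by (simp add: om_def)
  qed (auto simp: om_def)
  show "om x = 1 \<Longrightarrow> x ^ ((CARD('k) - 1) div 3) = 1" for x
    using \<Omega>_eq_1[OF root, of x] \<phi>_root[of x] one by (metis om_def zero_neq_one)
qed (auto simp: om_def \<Omega>_cube root card6)

text \<open>The exponent \<open>(q^d - 1) / 3\<close> factors as \<open>M\<close> times
  \<open>(q - 1) / 3\<close>. Raising to the power \<open>M\<close> gives the constant
  \<open>c\<close> of \<open>J_prime_power\<close>, and the second power gives its cube root of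
  unity.\<close>

lemma prime_cubic_char_eq:
  assumes P: "P \<in> monic_primes K" and a: "a \<in> carrier (poly_ring K)"
  shows "prime_cubic_char K \<Omega> P a = C.J (\<Phi> P) (\<Phi> a)"
proof -
  have Pc: "P \<in> carrier (poly_ring K)" using P by (auto simp: monic_primes_def dest: monic_polysD)
  have pe: "prime_elem (\<Phi> P)" using P pirreducible_iff[OF Pc] by (simp add: monic_primes_def)
  then have P0: "\<Phi> P \<noteq> 0" by auto
  show ?thesis
  proof (cases "\<Phi> P dvd \<Phi> a")
    case True
    then have "\<not> coprime (\<Phi> P) (\<Phi> a)" using pe by (metis coprime_common_divisor dvd_refl prime_elem_not_unit)
    then show ?thesis using True P0 a Pc by (simp add: prime_cubic_char_def pdivides_iff C.J_eq_0)
  next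
    case False
    obtain c where c: "c \<noteq> 0" "\<Phi> P dvd \<Phi> a ^ card (monics_below (degree (\<Phi> P)) :: 'k poly set) - [:c:]" "C.J (\<Phi> P) (\<Phi> a) = om c"
      by (rule C.J_prime_power[OF pe False])
    define E where "E = (card (carrier K) ^ (length P - 1) - 1) div 3"
    define M where "M = card (monics_below (degree (\<Phi> P)) :: 'k poly set)"
    have "M * (CARD('k) - 1) = CARD('k) ^ (length P - 1) - 1"
      unfolding M_def degree_\<Phi>[OF Pc] by (rule C.card_monics_below_mult)
    then have "3 * E = 3 * (M * ((CARD('k) - 1) div 3))"
      using card_third unfolding E_def card_carrier
      by (metis mult.assoc mult.commute nonzero_mult_div_cancel_right zero_neq_numeral)
    then have E: "E = M * ((CARD('k) - 1) div 3)" by simp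
    have "\<Phi> a ^ M mod \<Phi> P = [:c:] mod \<Phi> P" using c(2) unfolding M_def by (simp add: mod_eq_dvd_iff)
    then have "(\<Phi> a ^ M) ^ ((CARD('k) - 1) div 3) mod \<Phi> P = [:c:] ^ ((CARD('k) - 1) div 3) mod \<Phi> P"
      by (metis power_mod)
    then have dE: "\<Phi> P dvd \<Phi> a ^ E - [:\<phi> (root c):]"
      unfolding E \<phi>_root by (simp add: power_mult poly_const_pow mod_eq_dvd_iff)
    have conv: "P pdivides\<^bsub>K\<^esub> ((a [^]\<^bsub>poly_ring K\<^esub> E) \<ominus>\<^bsub>poly_ring K\<^esub> [z]) \<longleftrightarrow> \<Phi> P dvd \<Phi> a ^ E - [:\<phi> z:]"
      if z: "z \<in> cube_roots K" for z
    proof -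
      have "z \<noteq> \<zero>\<^bsub>K\<^esub>" using \<Omega>_cube[OF z] z by (auto simp: cube_roots_def K.nat_pow_zero)
      then have "[z] \<in> carrier (poly_ring K)" using cube_rootsD[OF z] by (simp add: const_carrier)
      then show ?thesis using a Pc by (simp add: pdivides_iff \<Phi>_minus \<Phi>_pow \<Phi>_const)
    qed
    \<comment> \<open>Two constants congruent modulo a prime are equal, since their difference would
      otherwise be a unit divisible by it. This makes the definite description well defined.\<close>
    have uniq: "z = root c" if z: "z \<in> cube_roots K" "\<Phi> P dvd \<Phi> a ^ E - [:\<phi> z:]" for z
    proof -
      have "\<Phi> P dvd (\<Phi> a ^ E - [:\<phi> (root c):]) - (\<Phi> a ^ E - [:\<phi> z:])" using dE z(2) by (rule dvd_diff)
      then have d: "\<Phi> P dvd [:\<phi> z - \<phi> (root c):]" by simp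
      have "\<phi> z - \<phi> (root c) = 0"
      proof (rule ccontr)
        assume "\<phi> z - \<phi> (root c) \<noteq> 0"
        then have "is_unit [:\<phi> z - \<phi> (root c):]" by (simp add: is_unit_triv)
        then show False using d pe dvd_unit_imp_unit prime_elem_not_unit by blast
      qed
      then show ?thesis using inj[of z "root c"] cube_rootsD[OF z(1)] cube_rootsD[OF root[OF c(1)]] by simp
    qed
    have "(THE \<alpha>. \<exists>z\<in>cube_roots K. \<alpha> = \<Omega> z \<and>
        P pdivides\<^bsub>K\<^esub> ((a [^]\<^bsub>poly_ring K\<^esub> E) \<ominus>\<^bsub>poly_ring K\<^esub> [z])) = \<Omega> (root c)"
    proof (rule the_equality)
      show "\<exists>z\<in>cube_roots K. \<Omega> (root c) = \<Omega> z \<and> P pdivides\<^bsub>K\<^esub> ((a [^]\<^bsub>poly_ring K\<^esub> E) \<ominus>\<^bsub>poly_ring K\<^esub> [z])"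
        using root[OF c(1)] conv[OF root[OF c(1)]] dE by blast
    qed (use conv uniq in blast)
    then show ?thesis using False a Pc c(1,3) by (simp add: prime_cubic_char_def pdivides_iff E_def om_def)
  qed
qed

lemma cubic_char_eq:
  assumes F: "F \<in> carrier (poly_ring K)" "\<Phi> F \<in> sqfree_monics N" and a: "a \<in> carrier (poly_ring K)"
  shows "cubic_char K \<Omega> F a = C.J (\<Phi> F) (\<Phi> a)"
proof -
  have "cubic_char K \<Omega> F a = (\<Prod>P\<in>{P \<in> monic_primes K. P pdivides\<^bsub>K\<^esub> F}. C.J (\<Phi> P) (\<Phi> a))"
    unfolding cubic_char_def
    by (rule prod.cong) (use prime_exponent_sqfree[OF F] prime_cubic_char_eq[OF _ a] in auto)
  also have "\<dots> = (\<Prod>P\<in>{P \<in> mprimes. P dvd \<Phi> F}. C.J P (\<Phi> a))"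
    by (rule prod.reindex_bij_betw[OF bij_monic_prime_divisors[OF F(1)]])
  also have "\<dots> = C.J (\<Phi> F) (\<Phi> a)" by (rule C.J_sqfree[OF F(2), symmetric])
  finally show ?thesis .
qed

lemma conductor_degree_eq:
  assumes F: "F \<in> carrier (poly_ring K)" "\<Phi> F \<in> sqfree_monics N"
  shows "conductor_degree K (cubic_char K \<Omega> F) = N"
  unfolding conductor_degree_def
proof (rule Least_equality)
  have Fm: "F \<in> monic_polys K" "length F - 1 = N"
    using monics_iff[OF F(1)] F(2) by (auto simp: sqfree_monics_def)
  have eq: "cubic_char K \<Omega> F a = C.J (\<Phi> F) (\<Phi> a)" if "a \<in> carrier (poly_ring K)" for a
    by (rule cubic_char_eq[OF F that])
  have div: "C pdivides\<^bsub>K\<^esub> (a \<ominus>\<^bsub>poly_ring K\<^esub> b) \<longleftrightarrow> \<Phi> C dvd \<Phi> a - \<Phi> b"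
    if "C \<in> carrier (poly_ring K)" "a \<in> carrier (poly_ring K)" "b \<in> carrier (poly_ring K)" for C a b
    using that by (simp add: pdivides_iff \<Phi>_minus)
  show "\<exists>C\<in>monic_polys K. length C - 1 = N \<and>
     (\<forall>a\<in>carrier (poly_ring K). \<forall>b\<in>carrier (poly_ring K). cubic_char K \<Omega> F a \<noteq> 0 \<and> cubic_char K \<Omega> F b \<noteq> 0 \<and>
        C pdivides\<^bsub>K\<^esub> (a \<ominus>\<^bsub>poly_ring K\<^esub> b) \<longrightarrow> cubic_char K \<Omega> F a = cubic_char K \<Omega> F b)"
    using Fm F(1) eq div C.J_cong by (intro bexI[of _ F]) (auto simp del: One_nat_def)
  fix d assume "\<exists>C\<in>monic_polys K. length C - 1 = d \<and>
     (\<forall>a\<in>carrier (poly_ring K). \<forall>b\<in>carrier (poly_ring K). cubic_char K \<Omega> F a \<noteq> 0 \<and> cubic_char K \<Omega> F b \<noteq> 0 \<and>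
        C pdivides\<^bsub>K\<^esub> (a \<ominus>\<^bsub>poly_ring K\<^esub> b) \<longrightarrow> cubic_char K \<Omega> F a = cubic_char K \<Omega> F b)"
  then obtain C where C: "C \<in> monic_polys K" "length C - 1 = d"
    and h: "\<And>a b. a \<in> carrier (poly_ring K) \<Longrightarrow> b \<in> carrier (poly_ring K) \<Longrightarrow> cubic_char K \<Omega> F a \<noteq> 0 \<Longrightarrow> cubic_char K \<Omega> F b \<noteq> 0 \<Longrightarrow>
        C pdivides\<^bsub>K\<^esub> (a \<ominus>\<^bsub>poly_ring K\<^esub> b) \<Longrightarrow> cubic_char K \<Omega> F a = cubic_char K \<Omega> F b" by blast
  have "\<Phi> C \<in> monics d" using monics_iff[OF monic_polysD[OF C(1)]] C by simp
  then show "N \<le> d"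
  proof (rule C.J_conductor[OF F(2)])
    fix x y assume xy: "C.J (\<Phi> F) x \<noteq> 0" "C.J (\<Phi> F) y \<noteq> 0" "\<Phi> C dvd x - y"
    obtain a where a: "a \<in> carrier (poly_ring K)" "\<Phi> a = x" by (rule \<Phi>_surj)
    obtain b where b: "b \<in> carrier (poly_ring K)" "\<Phi> b = y" by (rule \<Phi>_surj)
    show "C.J (\<Phi> F) x = C.J (\<Phi> F) y"
      using h[OF a(1) b(1)] xy a b eq div[OF monic_polysD[OF C(1)] a(1) b(1)] by simp
  qed
qed

lemma char_delta_eq:
  assumes F: "F \<in> carrier (poly_ring K)" "\<Phi> F \<in> sqfree_monics N"
  shows "char_delta K (cubic_char K \<Omega> F) = (if 3 dvd N then 0 else 1)"
proof -
  have "(\<forall>c\<in>carrier K - {\<zero>\<^bsub>K\<^esub>}. cubic_char K \<Omega> F [c] = 1) \<longleftrightarrow> (\<forall>c. c \<noteq> 0 \<longrightarrow> C.J (\<Phi> F) [:c:] = 1)"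
  proof
    assume h: "\<forall>c\<in>carrier K - {\<zero>\<^bsub>K\<^esub>}. cubic_char K \<Omega> F [c] = 1"
    show "\<forall>c. c \<noteq> 0 \<longrightarrow> C.J (\<Phi> F) [:c:] = 1"
    proof (intro allI impI)
      fix c :: 'k assume c: "c \<noteq> 0"
      have i: "inv\<phi> c \<in> carrier K" "inv\<phi> c \<noteq> \<zero>\<^bsub>K\<^esub>" using c inv\<phi> zero by metis+
      show "C.J (\<Phi> F) [:c:] = 1"
        using h i cubic_char_eq[OF F const_carrier[OF i]] by (simp add: \<Phi>_const)
    qed
  next
    assume h: "\<forall>c. c \<noteq> 0 \<longrightarrow> C.J (\<Phi> F) [:c:] = 1"
    show "\<forall>c\<in>carrier K - {\<zero>\<^bsub>K\<^esub>}. cubic_char K \<Omega> F [c] = 1"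
    proof
      fix c assume "c \<in> carrier K - {\<zero>\<^bsub>K\<^esub>}"
      then have c: "c \<in> carrier K" "c \<noteq> \<zero>\<^bsub>K\<^esub>" by auto
      then have "\<phi> c \<noteq> 0" using eq_0 by simp
      then show "cubic_char K \<Omega> F [c] = 1"
        using h cubic_char_eq[OF F const_carrier[OF c]] by (simp add: \<Phi>_const)
    qed
  qed
  then show ?thesis unfolding char_delta_def C.J_const_trivial_iff C.sqfree_monicsD(2)[OF F(2)] by simp
qed

text \<open>The genus is \<open>N - 2\<close> if 3 divides \<open>N\<close> and \<open>N - 1\<close>
  otherwise. The value \<open>N - 2 = 3 * g\<close> is impossible in the even case because then 3
  would divide 2.\<close>

lemma char_genus_iff:
  assumes F: "F \<in> carrier (poly_ring K)" "\<Phi> F \<in> sqfree_monics N"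
  shows "char_genus K (cubic_char K \<Omega> F) = int (3 * g) \<longleftrightarrow> N = 3 * g + 1"
  unfolding char_genus_def conductor_degree_eq[OF F] char_delta_eq[OF F] by (auto simp: dvd_def) presburger+

definition family_polys :: "nat \<Rightarrow> 'b list set" where
  "family_polys g = {F \<in> carrier (poly_ring K). \<Phi> F \<in> sqfree_monics (3 * g + 1)}"

lemma cubic_family_eq: "cubic_family K \<Omega> (3 * g) = cubic_char K \<Omega> ` family_polys g"
proof -
  have "F \<in> monic_polys K \<and> squarefree_poly K F \<and> char_genus K (cubic_char K \<Omega> F) = int (3 * g) \<longleftrightarrow> F \<in> family_polys g" for F
  proof
    assume h: "F \<in> monic_polys K \<and> squarefree_poly K F \<and> char_genus K (cubic_char K \<Omega> F) = int (3 * g)"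
    then have F: "F \<in> carrier (poly_ring K)" "\<Phi> F \<in> sqfree_monics (length F - 1)"
      using squarefree_iff[of F] monic_polysD by blast+
    then show "F \<in> family_polys g" using h char_genus_iff[OF F, of g] by (metis (mono_tags, lifting) family_polys_def mem_Collect_eq)
  next
    assume h: "F \<in> family_polys g"
    then have F: "F \<in> carrier (poly_ring K)" "\<Phi> F \<in> sqfree_monics (3 * g + 1)" by (auto simp: family_polys_def)
    then have m: "F \<in> monic_polys K" "length F - 1 = 3 * g + 1"
      using monics_iff[OF F(1)] by (auto simp: sqfree_monics_def)
    show "F \<in> monic_polys K \<and> squarefree_poly K F \<and> char_genus K (cubic_char K \<Omega> F) = int (3 * g)"
      using m F squarefree_iff[OF m] char_genus_iff[OF F] by simp
  qed
  then show ?thesis by (auto simp: cubic_family_def image_def)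
qed

lemma bij_family_polys: "bij_betw \<Phi> (family_polys g) (sqfree_monics (3 * g + 1))"
proof -
  have "\<Phi> ` family_polys g = sqfree_monics (3 * g + 1)"
  proof (intro equalityI subsetI)
    fix f :: "'k poly" assume f: "f \<in> sqfree_monics (3 * g + 1)"
    obtain p where p: "p \<in> carrier (poly_ring K)" "\<Phi> p = f" by (rule \<Phi>_surj)
    then show "f \<in> \<Phi> ` family_polys g" using f by (auto simp: family_polys_def)
  qed (auto simp: family_polys_def)
  moreover have "inj_on \<Phi> (family_polys g)"
    by (rule inj_on_subset[OF bij_betw_imp_inj_on[OF bij_\<Phi>]]) (auto simp: family_polys_def)
  ultimately show ?thesis by (simp add: bij_betw_def)
qed

lemma inj_cubic_char: "inj_on (cubic_char K \<Omega>) (family_polys g)"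
proof (rule inj_onI)
  fix F G assume FG: "F \<in> family_polys g" "G \<in> family_polys g" and e: "cubic_char K \<Omega> F = cubic_char K \<Omega> G"
  then have F: "F \<in> carrier (poly_ring K)" "\<Phi> F \<in> sqfree_monics (3 * g + 1)"
    and G: "G \<in> carrier (poly_ring K)" "\<Phi> G \<in> sqfree_monics (3 * g + 1)" by (auto simp: family_polys_def)
  have "C.J (\<Phi> F) f = C.J (\<Phi> G) f" for f
  proof -
    obtain a where a: "a \<in> carrier (poly_ring K)" "\<Phi> a = f" by (rule \<Phi>_surj)
    show ?thesis using fun_cong[OF e, of a] cubic_char_eq[OF F a(1)] cubic_char_eq[OF G a(1)] a(2) by simp
  qed
  then have "\<Phi> F = \<Phi> G" by (rule C.J_sqfree_inject[OF F(2) G(2)])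
  then show "F = G" using \<Phi>_inj[OF F(1) G(1)] by simp
qed

text \<open>For \<open>n\<close> at least the degree of the modulus the coefficient is a multiple of
  a complete symbol sum. It vanishes because the degree \<open>3 * g + 1\<close> excludes a cube, so
  the series is finite.\<close>

lemma L_function_eq:
  assumes F: "F \<in> family_polys g"
  shows "L_function K (cubic_char K \<Omega> F) (1 / 3) =
    (\<Sum>n<3 * g + 1. of_real (real (CARD('k)) powr (- real n / 3)) * (\<Sum>f\<in>monics n. C.J (\<Phi> F) f))"
proof -
  let ?N = "3 * g + 1"
  have Fc: "F \<in> carrier (poly_ring K)" "\<Phi> F \<in> sqfree_monics ?N" using F by (auto simp: family_polys_def)
  have q0: "real (CARD('k)) > 0" by simp
  have tm: "(\<Sum>G\<in>{G \<in> monic_polys K. length G - 1 = n}. cubic_char K \<Omega> F G * of_nat (card (carrier K) ^ n) powr (- (1 / 3)))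
     = of_real (real (CARD('k)) powr (- real n / 3)) * (\<Sum>f\<in>monics n. C.J (\<Phi> F) f)" for n
  proof -
    have "(of_nat (card (carrier K) ^ n) :: complex) powr (- (1 / 3)) = of_real (real (CARD('k) ^ n)) powr of_real (- (1 / 3))"
      by (simp add: card_carrier)
    also have "\<dots> = of_real (real (CARD('k) ^ n) powr (- (1 / 3)))" by (rule powr_of_real) simp
    also have "real (CARD('k) ^ n) powr (- (1 / 3)) = (real (CARD('k)) powr real n) powr (- (1 / 3))"
      using q0 by (simp add: powr_realpow)
    also have "\<dots> = real (CARD('k)) powr (- real n / 3)" by (simp add: powr_powr)
    finally have w: "(of_nat (card (carrier K) ^ n) :: complex) powr (- (1 / 3)) = of_real (real (CARD('k)) powr (- real n / 3))" .
    have "(\<Sum>G\<in>{G \<in> monic_polys K. length G - 1 = n}. cubic_char K \<Omega> F G) =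
       (\<Sum>G\<in>{G \<in> monic_polys K. length G - 1 = n}. C.J (\<Phi> F) (\<Phi> G))"
      by (rule sum.cong) (auto intro!: cubic_char_eq[OF Fc] monic_polysD)
    also have "\<dots> = (\<Sum>f\<in>monics n. C.J (\<Phi> F) f)" by (rule sum.reindex_bij_betw[OF bij_monics])
    finally show ?thesis unfolding w sum_distrib_right[symmetric] by (simp only: mult.commute)
  qed
  have "\<not> 3 dvd ?N" by presburger
  then have nc: "\<not> C.cube_poly (\<Phi> F)"
    using C.no_cubes[of ?N] Fc(2) by (auto simp: sqfree_monics_def)
  have "L_function K (cubic_char K \<Omega> F) (1 / 3) = (\<Sum>n. of_real (real (CARD('k)) powr (- real n / 3)) * (\<Sum>f\<in>monics n. C.J (\<Phi> F) f))"
    unfolding L_function_def tm ..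
  also have "\<dots> = (\<Sum>n<?N. of_real (real (CARD('k)) powr (- real n / 3)) * (\<Sum>f\<in>monics n. C.J (\<Phi> F) f))"
  proof (rule suminf_finite)
    fix n assume "n \<notin> {..<?N}"
    then have "(\<Sum>f\<in>monics n. C.J (\<Phi> F) f) = 0"
      using C.sqfree_monicsD[OF Fc(2)] nc by (intro C.sum_J_monics) auto
    then show "of_real (real (CARD('k)) powr (- real n / 3)) * (\<Sum>f\<in>monics n. C.J (\<Phi> F) f) = (0 :: complex)" by simp
  qed simp
  finally show ?thesis .
qed

lemma family_average_L_bound:
  assumes "15 \<le> card (carrier K)" "2 * (3 * g + 1) \<le> card (carrier K)"
  shows "cmod (family_average K \<Omega> (3 * g) (\<lambda>\<psi>. L_function K \<psi> (1 / 3)) - of_nat (g + 1))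
    \<le> Cbound (3 * g + 1) * real (card (carrier K)) powr (- 1 / 6)"
proof -
  let ?S = "sqfree_monics (3 * g + 1) :: 'k poly set"
  let ?f = "\<lambda>F. \<Sum>n<3 * g + 1. of_real (real (CARD('k)) powr (- real n / 3)) * (\<Sum>f\<in>monics n. C.J F f)"
  have "(\<Sum>\<psi>\<in>cubic_family K \<Omega> (3 * g). L_function K \<psi> (1 / 3)) = (\<Sum>F\<in>family_polys g. L_function K (cubic_char K \<Omega> F) (1 / 3))"
    unfolding cubic_family_eq by (simp only: sum.reindex[OF inj_cubic_char] o_def)
  also have "\<dots> = (\<Sum>F\<in>family_polys g. ?f (\<Phi> F))" by (rule sum.cong[OF refl]) (rule L_function_eq)
  also have "\<dots> = (\<Sum>F\<in>?S. ?f F)" by (rule sum.reindex_bij_betw[OF bij_family_polys])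
  finally have 1: "(\<Sum>\<psi>\<in>cubic_family K \<Omega> (3 * g). L_function K \<psi> (1 / 3)) = (\<Sum>F\<in>?S. ?f F)" .
  have 2: "card (cubic_family K \<Omega> (3 * g)) = card ?S"
    unfolding cubic_family_eq card_image[OF inj_cubic_char] by (rule bij_betw_same_card[OF bij_family_polys])
  show ?thesis unfolding family_average_def 1 2 card_carrier
    by (rule C.average_bound) (use assms in \<open>simp_all add: card_carrier\<close>)
qed

lemma char_delta_family: "\<psi> \<in> cubic_family K \<Omega> (3 * g) \<Longrightarrow> char_delta K \<psi> = 1"
  unfolding cubic_family_eq using char_delta_eq[where N = "3 * g + 1"] by (auto simp: family_polys_def dvd_def) presburger+

end

text \<open>All that the theorem needs to know about one field. Quantifying over \<Omega> and
  \<open>g\<close> inside makes it a property of the field alone, so that a counterexample is a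
  single ring.\<close>

definition good_field :: "'b ring \<Rightarrow> bool" where
  "good_field K \<longleftrightarrow> (\<forall>\<Omega> g. cube_root_iso K \<Omega> \<and> card (carrier K) mod 6 = 1 \<longrightarrow>
     (\<forall>\<psi>\<in>cubic_family K \<Omega> (3 * g). char_delta K \<psi> = 1) \<and>
     (15 \<le> card (carrier K) \<and> 2 * (3 * g + 1) \<le> card (carrier K) \<longrightarrow>
       cmod (family_average K \<Omega> (3 * g) (\<lambda>\<psi>. L_function K \<psi> (1 / 3)) - of_nat (g + 1))
         \<le> Cbound (3 * g + 1) * real (card (carrier K)) powr (- 1 / 6)))"

lemma (in field_transfer) good_field: "good_field K"
  unfolding good_field_def
proof (intro allI impI)
  fix \<Omega> g assume "cube_root_iso K \<Omega> \<and> card (carrier K) mod 6 = 1"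
  then interpret cubic_transfer K \<phi> \<Omega>
    by unfold_locales (auto simp: card_carrier)
  show "(\<forall>\<psi>\<in>cubic_family K \<Omega> (3 * g). char_delta K \<psi> = 1) \<and>
     (15 \<le> card (carrier K) \<and> 2 * (3 * g + 1) \<le> card (carrier K) \<longrightarrow>
       cmod (family_average K \<Omega> (3 * g) (\<lambda>\<psi>. L_function K \<psi> (1 / 3)) - of_nat (g + 1))
         \<le> Cbound (3 * g + 1) * real (card (carrier K)) powr (- 1 / 6))"
    using char_delta_family family_average_L_bound by blast
qed

text \<open>The typed results apply to every carrier-based finite field by contradiction: a single type
  suffices, which is modelled on a counterexample if there is one.\<close>

definition bad_field :: "'b ring \<Rightarrow> bool" where
  "bad_field K \<longleftrightarrow> field K \<and> finite (carrier K) \<and> \<not> good_field K"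

definition two_field :: "bool ring" where
  "two_field = \<lparr>carrier = UNIV, mult = (\<and>), one = True, zero = False, add = (\<noteq>)\<rparr>"

lemma two_field: "field two_field"
proof (rule cring.cring_fieldI)
  show "cring two_field"
    by (rule cringI[OF abelian_groupI comm_monoidI]) (auto simp: two_field_def)
  show "Units two_field = carrier two_field - {\<zero>\<^bsub>two_field\<^esub>}"
    by (auto simp: Units_def two_field_def)
qed

text \<open>The type to be carved out must be a finite field in every case. The summand
  \<open>bool\<close> guarantees this by carrying the field with two elements when no counterexample
  exists over \<open>'b\<close>.\<close>

definition model :: "('b + bool) ring" where
  "model = (if \<exists>K :: 'b ring. bad_field K then image_ring Inl (SOME K. bad_field K) else image_ring Inr two_field)"

lemma model: "field (model :: ('b + bool) ring)" "finite (carrier (model :: ('b + bool) ring))"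
proof -
  have "field (model :: ('b + bool) ring) \<and> finite (carrier (model :: ('b + bool) ring))"
  proof (cases "\<exists>K :: 'b ring. bad_field K")
    case True
    define L where "L = (SOME K :: 'b ring. bad_field K)"
    have "bad_field L" unfolding L_def by (rule someI_ex[OF True])
    moreover have m: "model = (image_ring Inl L :: ('b + bool) ring)" using True by (simp add: model_def L_def)
    ultimately show ?thesis
      using field.inj_imp_image_ring_is_field[of L "Inl :: 'b \<Rightarrow> 'b + bool"]
      unfolding m by (simp add: bad_field_def image_ring_carrier)
  next
    case False
    then show ?thesis
      using field.inj_imp_image_ring_is_field[OF two_field, of "Inr :: bool \<Rightarrow> 'b + bool"]
      by (simp add: model_def image_ring_carrier)
  qed
  then show "field (model :: ('b + bool) ring)" "finite (carrier (model :: ('b + bool) ring))" by auto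
qed

typedef 'b model_field = "carrier (model :: ('b + bool) ring)"
proof -
  interpret field "model :: ('b + bool) ring" by (rule model)
  show ?thesis using zero_closed by blast
qed

instantiation model_field :: (type) field
begin

definition "0 = Abs_model_field \<zero>\<^bsub>model\<^esub>"
definition "1 = Abs_model_field \<one>\<^bsub>model\<^esub>"
definition "x + y = Abs_model_field (Rep_model_field x \<oplus>\<^bsub>model\<^esub> Rep_model_field y)"
definition "x * y = Abs_model_field (Rep_model_field x \<otimes>\<^bsub>model\<^esub> Rep_model_field y)"
definition "- x = Abs_model_field (\<ominus>\<^bsub>model\<^esub> Rep_model_field x)"
definition "x - y = Abs_model_field (Rep_model_field x \<ominus>\<^bsub>model\<^esub> Rep_model_field y)"
definition "inverse x = (if x = 0 then 0 else Abs_model_field (inv\<^bsub>model\<^esub> Rep_model_field x))"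
definition "x div y = (x :: 'a model_field) * inverse y"

instance
proof -
  interpret M: field "model :: ('a + bool) ring" by (rule model)
  note r [simp] = Rep_model_field[where 'b = 'a]
  note a [simp] = Abs_model_field_inverse[where 'b = 'a]
  have R [simp]:
    "Rep_model_field (0 :: 'a model_field) = \<zero>\<^bsub>model\<^esub>" "Rep_model_field (1 :: 'a model_field) = \<one>\<^bsub>model\<^esub>"
    "Rep_model_field (x + y) = Rep_model_field x \<oplus>\<^bsub>model\<^esub> Rep_model_field y"
    "Rep_model_field (x * y) = Rep_model_field x \<otimes>\<^bsub>model\<^esub> Rep_model_field y"
    "Rep_model_field (- x) = \<ominus>\<^bsub>model\<^esub> Rep_model_field x"
    "Rep_model_field (x - y) = Rep_model_field x \<ominus>\<^bsub>model\<^esub> Rep_model_field y" for x y :: "'a model_field"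
    by (simp_all add: zero_model_field_def one_model_field_def plus_model_field_def times_model_field_def
        uminus_model_field_def minus_model_field_def)
  show "OFCLASS('a model_field, field_class)"
  proof
    fix x y z :: "'a model_field"
    show "x + y + z = x + (y + z)" "x + y = y + x" "0 + x = x" "- x + x = 0" "x - y = x + - y"
      "x * y * z = x * (y * z)" "x * y = y * x" "1 * x = x" "(x + y) * z = x * z + y * z" "(0 :: 'a model_field) \<noteq> 1"
      by (simp_all add: Rep_model_field_inject[symmetric] M.a_ac M.l_neg M.r_neg M.m_ac
          M.l_distr M.r_distr a_minus_def)
    show "x div y = x * inverse y" by (simp add: divide_model_field_def)
    show "inverse (0 :: 'a model_field) = 0" by (simp add: inverse_model_field_def)
    assume x: "x \<noteq> 0"
    then have "Rep_model_field x \<noteq> \<zero>\<^bsub>model\<^esub>" by (simp add: Rep_model_field_inject[symmetric])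
    then have "Rep_model_field x \<in> Units model" by (simp add: M.field_Units)
    then have "inv\<^bsub>model\<^esub> Rep_model_field x \<in> carrier model"
      "inv\<^bsub>model\<^esub> Rep_model_field x \<otimes>\<^bsub>model\<^esub> Rep_model_field x = \<one>\<^bsub>model\<^esub>" by (simp_all add: M.Units_l_inv)
    then show "inverse x * x = 1" using x by (simp add: Rep_model_field_inject[symmetric] inverse_model_field_def)
  qed
qed

end

instance model_field :: (type) finite
proof
  have "inj (Rep_model_field :: 'a model_field \<Rightarrow> _)" by (simp add: inj_on_def Rep_model_field_inject)
  moreover have "range (Rep_model_field :: 'a model_field \<Rightarrow> _) \<subseteq> carrier model" using Rep_model_field by blast
  ultimately show "finite (UNIV :: 'a model_field set)" using model(2) by (metis finite_imageD finite_subset)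
qed

text \<open>Every nonzero element is a unit, so division has remainder 0 and the Euclidean structure
  is the trivial one. It is set up to obtain the class \<open>field_gcd\<close>, under which
  polynomials have gcds and unique factorisation.\<close>

instantiation model_field :: (type) "{unique_euclidean_ring, normalization_euclidean_semiring, normalization_semidom_multiplicative}"
begin

definition [simp]: "normalize_model_field (x :: 'a model_field) = (if x = 0 then 0 else 1 :: 'a model_field)"
definition [simp]: "unit_factor_model_field (x :: 'a model_field) = (x :: 'a model_field)"
definition [simp]: "modulo_model_field (x :: 'a model_field) (y :: 'a model_field) = (if y = 0 then x else 0 :: 'a model_field)"
definition [simp]: "euclidean_size_model_field x = (if x = (0 :: 'a model_field) then 0 else 1 :: nat)"
definition [simp]: "division_segment_model_field (x :: 'a model_field) = (1 :: 'a model_field)"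

instance
  by standard (simp_all add: dvd_field_iff field_split_simps split: if_splits)

end

instantiation model_field :: (type) euclidean_ring_gcd
begin

definition "gcd_model_field = (Euclidean_Algorithm.gcd :: 'a model_field \<Rightarrow> _)"
definition "lcm_model_field = (Euclidean_Algorithm.lcm :: 'a model_field \<Rightarrow> _)"
definition "Gcd_model_field = (Euclidean_Algorithm.Gcd :: 'a model_field set \<Rightarrow> _)"
definition "Lcm_model_field = (Euclidean_Algorithm.Lcm :: 'a model_field set \<Rightarrow> _)"

instance
  by standard (simp_all add: gcd_model_field_def lcm_model_field_def Gcd_model_field_def Lcm_model_field_def)

end

instance model_field :: (type) field_gcd ..

text \<open>If any field over \<open>'b\<close> failed, the chosen one \<open>L\<close> would be bad
  and at the same time isomorphic to the type \<open>'b model_field\<close>, for which the typed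
  results hold.\<close>

lemma finite_field_good:
  fixes K :: "'b ring" assumes "field K" "finite (carrier K)" shows "good_field K"
proof (rule ccontr)
  assume "\<not> good_field K"
  then have ex: "\<exists>K :: 'b ring. bad_field K" using assms by (auto simp: bad_field_def)
  define L where "L = (SOME K :: 'b ring. bad_field K)"
  have L: "bad_field L" unfolding L_def by (rule someI_ex[OF ex])
  have m: "model = (image_ring Inl L :: ('b + bool) ring)" using ex by (simp add: model_def L_def)
  have iso: "Inl \<in> ring_iso L (model :: ('b + bool) ring)"
    unfolding m by (rule inj_imp_image_ring_iso) simp
  have c: "carrier model = (Inl ` carrier L :: ('b + bool) set)" by (simp add: m image_ring_carrier)
  let ?\<phi> = "\<lambda>x. Abs_model_field (Inl x) :: 'b model_field"
  interpret field_transfer L ?\<phi>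
  proof (rule field_transfer.intro)
    show "field L" using L by (simp add: bad_field_def)
    show "bij_betw ?\<phi> (carrier L) UNIV"
      unfolding bij_betw_def
    proof
      show "inj_on ?\<phi> (carrier L)"
        by (auto simp: inj_on_def Abs_model_field_inject c)
      show "?\<phi> ` carrier L = UNIV"
        using c by (metis (no_types, lifting) Abs_model_field_cases UNIV_eq_I image_iff)
    qed
    fix x y assume xy: "x \<in> carrier L" "y \<in> carrier L"
    then show "?\<phi> (x \<oplus>\<^bsub>L\<^esub> y) = ?\<phi> x + ?\<phi> y" "?\<phi> (x \<otimes>\<^bsub>L\<^esub> y) = ?\<phi> x * ?\<phi> y"
      using iso by (simp_all add: plus_model_field_def times_model_field_def Abs_model_field_inverse c ring_iso_def Ring.ring_hom_def)
  qed
  show False using L good_field by (simp add: bad_field_def)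
qed

section \<open>The limit over q and the Frobenius classes\<close>

lemma field_familyD:
  assumes "field_family K \<Omega>" "q \<in> admissible"
  shows "good_field (K q)" "card (carrier (K q)) = q" "cube_root_iso (K q) (\<Omega> q)" "q mod 6 = 1"
  using assms finite_field_good by (auto simp: field_family_def admissible_def)

lemma family_average_limit:
  assumes K: "field_family K \<Omega>"
  shows "((\<lambda>q. family_average (K q) (\<Omega> q) (3 * g) (\<lambda>\<psi>. L_function (K q) \<psi> (1 / 3))) \<longlongrightarrow> of_nat (g + 1)) q_to_infinity"
  unfolding Lim_null[of _ "of_nat (g + 1)"]
proof (rule Lim_null_comparison)
  show "\<forall>\<^sub>F q in q_to_infinity. cmod (family_average (K q) (\<Omega> q) (3 * g) (\<lambda>\<psi>. L_function (K q) \<psi> (1 / 3)) - of_nat (g + 1))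
     \<le> Cbound (3 * g + 1) * real q powr (- 1 / 6)"
    unfolding q_to_infinity_def eventually_inf_principal
    using eventually_ge_at_top[of "max 15 (2 * (3 * g + 1))"]
  proof eventually_elim
    case (elim q)
    show ?case
    proof
      assume "q \<in> admissible"
      note F = field_familyD[OF K this]
      have q: "15 \<le> q" "2 * (3 * g + 1) \<le> q" using elim by simp_all
      show "cmod (family_average (K q) (\<Omega> q) (3 * g) (\<lambda>\<psi>. L_function (K q) \<psi> (1 / 3)) - of_nat (g + 1))
        \<le> Cbound (3 * g + 1) * real q powr (- 1 / 6)"
        using F(1)[unfolded good_field_def F(2)] F(3,4) q by blast
    qed
  qed
  have "((\<lambda>q. Cbound (3 * g + 1) * real q powr (- 1 / 6)) \<longlongrightarrow> 0) at_top" by real_asymp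
  then show "((\<lambda>q. Cbound (3 * g + 1) * real q powr (- 1 / 6)) \<longlongrightarrow> 0) q_to_infinity"
    unfolding q_to_infinity_def by (rule tendsto_mono[OF inf_le1])
qed

text \<open>At \<open>s = 1/3\<close> the scaling exponent is \<open>1/2 - 1/3 = 1/6\<close>, and
  for odd characters the extra factor of the L-function has exponent 0.\<close>

lemma f_det_frobenius:
  assumes K: "field_family K \<Omega>" and q: "q \<in> admissible" and \<psi>: "\<psi> \<in> cubic_family (K q) (\<Omega> q) (3 * g)"
    and \<Theta>: "\<Theta> \<in> frobenius_class (K q) \<psi>"
  shows "f_det (complex_of_real (real q powr (1 / 6)) \<cdot>\<^sub>m \<Theta>) = L_function (K q) \<psi> (1 / 3)"
proof -
  note F = field_familyD[OF K q]
  have d: "char_delta (K q) \<psi> = 1" using F \<psi> by (auto simp: good_field_def)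
  have g: "nat (char_genus (K q) \<psi>) = 3 * g" using \<psi> by (auto simp: cubic_family_def)
  have dim: "dim_row \<Theta> = 3 * g" using \<Theta> g by (auto simp: frobenius_class_def unitary_group_def)
  have "(of_nat q :: complex) powr (1 / 2 - 1 / 3) = of_real (real q) powr of_real (1 / 6)" by simp
  also have "\<dots> = of_real (real q powr (1 / 6))" by (rule powr_of_real) simp
  finally have p: "(of_nat q :: complex) powr (1 / 2 - 1 / 3) = of_real (real q powr (1 / 6))" .
  have "L_function (K q) \<psi> (1 / 3) = Determinant.det (1\<^sub>m (3 * g) - of_real (real q powr (1 / 6)) \<cdot>\<^sub>m \<Theta>)"
    using \<Theta> unfolding frobenius_class_def g d F(2) p[symmetric] by simp
  then show ?thesis by (simp add: f_det_def dim)
qed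

section \<open>Haar integrals\<close>

lemma dim_mat_adjoint [simp]: "dim_row (mat_adjoint A) = dim_col A" "dim_col (mat_adjoint A) = dim_row A"
  by (auto simp: mat_adjoint_def)

lemma unitary_group_iff:
  "U \<in> unitary_group N \<longleftrightarrow> U \<in> carrier_mat N N \<and>
     (\<forall>i<N. \<forall>j<N. (\<Sum>k<N. cnj (U $$ (k, i)) * U $$ (k, j)) = (if i = j then 1 else 0))"
proof (cases "U \<in> carrier_mat N N")
  case U: True
  have e: "(mat_adjoint U * U) $$ (i, j) = (\<Sum>k<N. cnj (U $$ (k, i)) * U $$ (k, j))" if "i < N" "j < N" for i j
    using U that by (simp add: mat_adjoint_def scalar_prod_def atLeast0LessThan)
  have "mat_adjoint U * U = 1\<^sub>m N \<longleftrightarrow> (\<forall>i<N. \<forall>j<N. (mat_adjoint U * U) $$ (i, j) = (if i = j then 1 else 0))"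
    using U by (auto simp: mat_eq_iff)
  then show ?thesis using U e by (simp add: unitary_group_def)
qed (simp add: unitary_group_def)

lemma unitary_entry_bound:
  assumes U: "U \<in> unitary_group N" and ij: "i < N" "j < N" shows "cmod (U $$ (i, j)) \<le> 1"
proof -
  have "(\<Sum>k<N. of_real (cmod (U $$ (k, j)) ^ 2) :: complex) = 1"
  proof -
    have "of_real (cmod x ^ 2) = cnj x * x" for x
      by (metis complex_norm_square mult.commute of_real_power)
    then show ?thesis using U ij by (simp only: unitary_group_iff) auto
  qed
  then have "(\<Sum>k<N. cmod (U $$ (k, j)) ^ 2) = 1" unfolding of_real_sum[symmetric] by (simp only: of_real_eq_1_iff)
  moreover have "cmod (U $$ (i, j)) ^ 2 \<le> (\<Sum>k<N. cmod (U $$ (k, j)) ^ 2)"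
    using ij by (intro member_le_sum) auto
  ultimately show ?thesis using abs_square_le_1[of "cmod (U $$ (i, j))"] by simp
qed

section \<open>Monomial matrices and left invariance\<close>

definition monomial_mat :: "nat \<Rightarrow> (nat \<Rightarrow> nat) \<Rightarrow> (nat \<Rightarrow> complex) \<Rightarrow> complex mat" where
  "monomial_mat N \<tau> z = Matrix.mat N N (\<lambda>(i, j). if j = \<tau> i then z i else 0)"

lemma monomial_mat_unitary:
  assumes \<tau>: "\<tau> permutes {..<N}" and z: "\<And>i. cmod (z i) = 1"
  shows "monomial_mat N \<tau> z \<in> unitary_group N"
  unfolding unitary_group_iff
proof (intro conjI allI impI)
  show "monomial_mat N \<tau> z \<in> carrier_mat N N" by (simp add: monomial_mat_def)
  fix i j assume ij: "i < N" "j < N"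
  have "(\<Sum>k<N. cnj (monomial_mat N \<tau> z $$ (k, i)) * monomial_mat N \<tau> z $$ (k, j))
    = (\<Sum>k<N. if i = j \<and> k = Hilbert_Choice.inv \<tau> i then 1 else 0)"
  proof (rule sum.cong[OF refl])
    fix k assume "k \<in> {..<N}"
    moreover have "i = \<tau> k \<longleftrightarrow> k = Hilbert_Choice.inv \<tau> i" using permutes_inv_eq[OF \<tau>] by metis
    moreover have "cnj (z k) * z k = 1" using complex_norm_square[of "z k"] z[of k] by (simp add: mult.commute)
    ultimately show "cnj (monomial_mat N \<tau> z $$ (k, i)) * monomial_mat N \<tau> z $$ (k, j) = (if i = j \<and> k = Hilbert_Choice.inv \<tau> i then 1 else 0)"
      using ij by (auto simp: monomial_mat_def)
  qed
  also have "\<dots> = (if i = j then 1 else 0)"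
    using permutes_in_image[OF permutes_inv[OF \<tau>], of i] ij by (cases "i = j") (simp_all add: sum.delta)
  finally show "(\<Sum>k<N. cnj (monomial_mat N \<tau> z $$ (k, i)) * monomial_mat N \<tau> z $$ (k, j)) = (if i = j then 1 else 0)" .
qed

lemma monomial_mat_mult:
  assumes \<tau>: "\<tau> permutes {..<N}" and U: "U \<in> carrier_mat N N" and ij: "i < N" "j < N"
  shows "(monomial_mat N \<tau> z * U) $$ (i, j) = z i * U $$ (\<tau> i, j)"
proof -
  have "\<tau> i < N" using permutes_in_image[OF \<tau>, of i] ij by simp
  moreover have "(monomial_mat N \<tau> z * U) $$ (i, j) = (\<Sum>k<N. (if k = \<tau> i then z i else 0) * U $$ (k, j))"
    using U ij by (simp add: monomial_mat_def scalar_prod_def atLeast0LessThan)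
  moreover have "\<dots> = (\<Sum>k<N. if k = \<tau> i then z i * U $$ (k, j) else 0)"
    by (rule sum.cong) auto
  ultimately show ?thesis by simp
qed

locale haar = prob_space M for M :: "complex mat measure" +
  fixes N :: nat
  assumes sets_M: "sets M = sets (unitary_borel N)"
    and invariant: "V \<in> unitary_group N \<Longrightarrow> distr M M (\<lambda>U. V * U) = M"
begin

lemma space_M: "space M = unitary_group N"
  using sets_eq_imp_space_eq[OF sets_M] by (simp add: unitary_borel_def)

lemma carrier: "U \<in> space M \<Longrightarrow> U \<in> carrier_mat N N"
  by (simp add: space_M unitary_group_iff)

lemma measurable_entry:
  assumes "i < N" "j < N" shows "(\<lambda>U. U $$ (i, j)) \<in> borel_measurable M"
proof -
  have "(\<lambda>U. \<lambda>ij\<in>{..<N} \<times> {..<N}. U $$ ij) \<in> measurable (unitary_borel N) (Pi\<^sub>M ({..<N} \<times> {..<N}) (\<lambda>_. borel))"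
    unfolding unitary_borel_def by (rule measurable_vimage_algebra1) (auto simp: space_PiM)
  moreover have "(\<lambda>\<omega>. \<omega> (i, j)) \<in> measurable (Pi\<^sub>M ({..<N} \<times> {..<N}) (\<lambda>_. borel)) borel"
    using assms by (intro measurable_component_singleton) auto
  ultimately have "(\<lambda>U. (\<lambda>ij\<in>{..<N} \<times> {..<N}. U $$ ij) (i, j)) \<in> measurable (unitary_borel N) borel"
    by (rule measurable_compose)
  then show ?thesis unfolding measurable_cong_sets[OF sets_M refl] using assms by simp
qed

text \<open>Bounded measurable functions on a probability space are integrable and form an algebra,
  so integrability of every polynomial in the entries and their conjugates is automatic.\<close>

definition bm :: "(complex mat \<Rightarrow> complex) \<Rightarrow> bool" where
  "bm f \<longleftrightarrow> f \<in> borel_measurable M \<and> (\<exists>B. \<forall>U\<in>space M. cmod (f U) \<le> B)"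

lemma bm_const: "bm (\<lambda>_. c)" by (auto simp: bm_def)

lemma bm_entry: "i < N \<Longrightarrow> j < N \<Longrightarrow> bm (\<lambda>U. U $$ (i, j))"
  using measurable_entry unitary_entry_bound by (auto simp: bm_def space_M intro!: exI[of _ 1])

lemma bm_add: assumes "bm f" "bm g" shows "bm (\<lambda>U. f U + g U)"
proof -
  obtain A B where "\<forall>U\<in>space M. cmod (f U) \<le> A" "\<forall>U\<in>space M. cmod (g U) \<le> B" using assms by (auto simp: bm_def)
  then have "\<forall>U\<in>space M. cmod (f U + g U) \<le> A + B" by (meson add_mono norm_triangle_ineq order_trans)
  then show ?thesis using assms by (auto simp: bm_def)
qed

lemma bm_mult: assumes "bm f" "bm g" shows "bm (\<lambda>U. f U * g U)"
proof -
  obtain A B where AB: "\<forall>U\<in>space M. cmod (f U) \<le> A" "\<forall>U\<in>space M. cmod (g U) \<le> B" using assms by (auto simp: bm_def)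
  have "cmod (f U * g U) \<le> A * B" if "U \<in> space M" for U
    unfolding norm_mult using AB that by (intro mult_mono) (auto intro: order_trans[OF norm_ge_zero])
  then show ?thesis using assms by (auto simp: bm_def)
qed

lemma bm_cnj: "bm f \<Longrightarrow> bm (\<lambda>U. cnj (f U))"
  by (auto simp: bm_def intro: borel_measurable_continuous_onI[THEN measurable_compose[rotated]] continuous_intros)

lemma bm_sum: "(\<And>i. i \<in> A \<Longrightarrow> bm (f i)) \<Longrightarrow> bm (\<lambda>U. \<Sum>i\<in>A. f i U)"
  by (induction A rule: infinite_finite_induct) (auto intro: bm_const bm_add)

lemma bm_prod: "(\<And>i. i \<in> A \<Longrightarrow> bm (f i)) \<Longrightarrow> bm (\<lambda>U. \<Prod>i\<in>A. f i U)"
  by (induction A rule: infinite_finite_induct) (auto intro: bm_const bm_mult)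

lemma bm_integrable: "bm f \<Longrightarrow> integrable M f"
  by (auto simp: bm_def intro: integrable_const_bound)

lemma bm_cong: "bm f \<Longrightarrow> (\<And>U. U \<in> space M \<Longrightarrow> f U = g U) \<Longrightarrow> bm g"
  using measurable_cong[of M f g borel] by (simp add: bm_def)

lemma integral_left:
  assumes V: "V \<in> unitary_group N" and h: "h \<in> borel_measurable M"
  shows "(\<integral>U. h (V * U) \<partial>M) = (\<integral>U. h U \<partial>M :: complex)"
proof -
  have Vc: "V \<in> carrier_mat N N" using V by (simp add: unitary_group_iff)
  have adj: "mat_adjoint V * V = 1\<^sub>m N" using V by (simp add: unitary_group_def)
  have "V * U \<in> unitary_group N" if U: "U \<in> unitary_group N" for U
  proof -
    have Uc: "U \<in> carrier_mat N N" using U by (simp add: unitary_group_iff)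
    have "(\<Sum>k<N. cnj ((V * U) $$ (k, i)) * (V * U) $$ (k, j)) = (if i = j then 1 else 0)" if ij: "i < N" "j < N" for i j
    proof -
      have e: "(V * U) $$ (k, l) = (\<Sum>m<N. V $$ (k, m) * U $$ (m, l))" if "k < N" "l < N" for k l
        using Vc Uc that by (simp add: scalar_prod_def atLeast0LessThan)
      have "(\<Sum>k<N. cnj ((V * U) $$ (k, i)) * (V * U) $$ (k, j)) =
        (\<Sum>k<N. \<Sum>m<N. \<Sum>m'<N. cnj (U $$ (m, i)) * U $$ (m', j) * (cnj (V $$ (k, m)) * V $$ (k, m')))"
        using ij by (intro sum.cong refl) (simp add: e sum_product, intro sum.cong refl, simp add: mult_ac)
      also have "\<dots> = (\<Sum>m<N. \<Sum>m'<N. cnj (U $$ (m, i)) * U $$ (m', j) * (\<Sum>k<N. cnj (V $$ (k, m)) * V $$ (k, m')))"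
        unfolding sum_distrib_left by (subst sum.swap, rule sum.cong[OF refl], subst sum.swap) (rule refl)
      also have "\<dots> = (\<Sum>m<N. \<Sum>m'<N. if m = m' then cnj (U $$ (m, i)) * U $$ (m', j) else 0)"
        using V by (intro sum.cong refl) (simp add: unitary_group_iff)
      also have "\<dots> = (if i = j then 1 else 0)" using U ij by (simp add: unitary_group_iff)
      finally show ?thesis .
    qed
    then show ?thesis using Vc Uc by (simp add: unitary_group_iff)
  qed
  then have "(\<lambda>U. V * U) \<in> measurable M (unitary_borel N)"
    unfolding unitary_borel_def
  proof (intro measurable_vimage_algebra2)
    show "(\<lambda>U. \<lambda>ij\<in>{..<N} \<times> {..<N}. (V * U) $$ ij) \<in> measurable M (Pi\<^sub>M ({..<N} \<times> {..<N}) (\<lambda>_. borel))"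
    proof (rule measurable_restrict)
      fix ij assume ij: "ij \<in> {..<N} \<times> {..<N}"
      have "(\<lambda>U. \<Sum>k<N. V $$ (fst ij, k) * U $$ (k, snd ij)) \<in> borel_measurable M"
        using ij by (intro borel_measurable_sum borel_measurable_times measurable_entry) auto
      moreover have "(V * U) $$ ij = (\<Sum>k<N. V $$ (fst ij, k) * U $$ (k, snd ij))" if "U \<in> space M" for U
        using Vc carrier[OF that] ij by (auto simp: scalar_prod_def atLeast0LessThan)
      ultimately show "(\<lambda>U. (V * U) $$ ij) \<in> measurable M borel" by (simp cong: measurable_cong)
    qed
  qed (auto simp: space_M)
  then have m: "(\<lambda>U. V * U) \<in> measurable M M" using measurable_cong_sets[OF refl sets_M] by blast
  show ?thesis using integral_distr[OF m h] invariant[OF V] by simp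
qed

lemma bm_monomial:
  assumes \<tau>: "\<tau> permutes {..<N}" and z: "\<And>i. cmod (z i) = 1" and h: "bm h"
  shows "(\<integral>U. h (monomial_mat N \<tau> z * U) \<partial>M) = (\<integral>U. h U \<partial>M)"
  by (rule integral_left[OF monomial_mat_unitary[OF \<tau> z]]) (use h in \<open>simp add: bm_def\<close>)

end

text \<open>The determinant of the array with rows \<open>a i\<close> and columns in
  \<open>I\<close>. Rows may repeat, which allows a sum over all maps \<open>a\<close> and makes
  left translation by a monomial matrix act on \<open>a\<close>.\<close>

definition minor :: "nat set \<Rightarrow> (nat \<Rightarrow> nat) \<Rightarrow> complex mat \<Rightarrow> complex" where
  "minor I a U = (\<Sum>\<sigma>\<in>{\<sigma>. \<sigma> permutes I}. of_int (sign \<sigma>) * (\<Prod>i\<in>I. U $$ (a i, \<sigma> i)))"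

text \<open>Multiply out the Leibniz formula for \<open>1 - U\<close>: choosing the entry of
  \<open>1\<close> in the rows outside \<open>I\<close> forces the permutation to fix them, and what
  remains is a principal minor.\<close>

lemma f_det_expand:
  assumes U: "U \<in> carrier_mat N N"
  shows "f_det U = (\<Sum>I\<in>Pow {..<N}. (- 1) ^ card I * minor I id U)"
proof -
  let ?P = "{p. p permutes {..<N}}"
  have "f_det U = (\<Sum>p\<in>?P. of_int (sign p) * (\<Prod>i<N. (1\<^sub>m N - U) $$ (i, p i)))"
    using U unfolding f_det_def by (subst det_def'[of _ N]) (auto simp: atLeast0LessThan)
  also have "\<dots> = (\<Sum>p\<in>?P. of_int (sign p) * (\<Prod>i<N. (if p i = i then 1 else 0) - U $$ (i, p i)))"
  proof (intro sum.cong refl arg_cong2[where f = "(*)"] prod.cong)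
    fix p i assume "p \<in> ?P" "i \<in> {..<N}"
    then have "p i < N" "i < N" using permutes_in_image[of p "{..<N}" i] by auto
    then show "(1\<^sub>m N - U) $$ (i, p i) = (if p i = i then 1 else 0) - U $$ (i, p i)" using U by auto
  qed
  also have "\<dots> = (\<Sum>p\<in>?P. \<Sum>I\<in>Pow {..<N}. (- 1) ^ card I * (if \<forall>i\<in>{..<N} - I. p i = i then of_int (sign p) * (\<Prod>i\<in>I. U $$ (i, p i)) else 0))"
  proof (rule sum.cong[OF refl])
    fix p
    have d: "(\<Prod>i\<in>{..<N} - I. if p i = i then 1 else 0) = (if \<forall>i\<in>{..<N} - I. p i = i then 1 else 0 :: complex)" for I
      by (auto intro: prod.neutral)
    show "of_int (sign p) * (\<Prod>i<N. (if p i = i then 1 else 0) - U $$ (i, p i)) =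
      (\<Sum>I\<in>Pow {..<N}. (- 1) ^ card I * (if \<forall>i\<in>{..<N} - I. p i = i then of_int (sign p) * (\<Prod>i\<in>I. U $$ (i, p i)) else 0))"
      by (subst prod_diff_conv_sum) (auto simp: d sum_distrib_left intro!: sum.cong)
  qed
  also have "\<dots> = (\<Sum>I\<in>Pow {..<N}. (- 1) ^ card I * (\<Sum>p\<in>?P. if \<forall>i\<in>{..<N} - I. p i = i then of_int (sign p) * (\<Prod>i\<in>I. U $$ (i, p i)) else 0))"
    by (subst sum.swap) (simp add: sum_distrib_left)
  also have "\<dots> = (\<Sum>I\<in>Pow {..<N}. (- 1) ^ card I * minor I id U)"
  proof (intro sum.cong refl arg_cong2[where f = "(*)"])
    fix I assume I: "I \<in> Pow {..<N}"
    have "{p \<in> ?P. \<forall>i\<in>{..<N} - I. p i = i} = {p. p permutes I}"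
      using I permutes_superset[of _ "{..<N}" I] permutes_subset[of _ I "{..<N}"] permutes_not_in[of _ I] by auto
    then show "(\<Sum>p\<in>?P. if \<forall>i\<in>{..<N} - I. p i = i then of_int (sign p) * (\<Prod>i\<in>I. U $$ (i, p i)) else 0) = minor I id U"
      unfolding minor_def by (subst sum.inter_filter[symmetric]) (auto simp: finite_permutations)
  qed
  finally show ?thesis .
qed

lemma minor_not_inj:
  assumes I: "finite I" and a: "\<not> inj_on a I" shows "minor I a U = 0"
proof -
  obtain x y where xy: "x \<in> I" "y \<in> I" "x \<noteq> y" "a x = a y" using a by (auto simp: inj_on_def)
  let ?t = "Transposition.transpose x y"
  have t: "?t permutes I" using xy by (simp add: permutes_swap_id)
  have "minor I a U = (\<Sum>\<sigma>\<in>{\<sigma>. \<sigma> permutes I}. of_int (sign (\<sigma> \<circ> ?t)) * (\<Prod>i\<in>I. U $$ (a i, (\<sigma> \<circ> ?t) i)))"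
    unfolding minor_def by (rule sum_permutations_compose_right[OF t])
  also have "\<dots> = (\<Sum>\<sigma>\<in>{\<sigma>. \<sigma> permutes I}. - (of_int (sign \<sigma>) * (\<Prod>i\<in>I. U $$ (a i, \<sigma> i))))"
  proof (rule sum.cong[OF refl])
    fix \<sigma> assume "\<sigma> \<in> {\<sigma>. \<sigma> permutes I}"
    then have "sign (\<sigma> \<circ> ?t) = - sign \<sigma>"
      using I t xy by (simp add: sign_compose permutes_imp_permutation sign_swap_id)
    moreover have "(\<Prod>i\<in>I. U $$ (a i, (\<sigma> \<circ> ?t) i)) = (\<Prod>i\<in>I. U $$ (a (?t i), \<sigma> (?t i)))"
      by (rule prod.cong) (auto simp: Transposition.transpose_def xy)
    moreover have "\<dots> = (\<Prod>i\<in>I. U $$ (a i, \<sigma> i))"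
      by (rule prod.reindex_bij_betw[OF permutes_imp_bij[OF t]])
    ultimately show "of_int (sign (\<sigma> \<circ> ?t)) * (\<Prod>i\<in>I. U $$ (a i, (\<sigma> \<circ> ?t) i)) = - (of_int (sign \<sigma>) * (\<Prod>i\<in>I. U $$ (a i, \<sigma> i)))"
      by simp
  qed
  also have "\<dots> = - minor I a U" by (simp add: minor_def sum_negf)
  finally show ?thesis by simp
qed

lemma minor_permute_rows:
  assumes I: "finite I" and \<tau>: "\<tau> permutes I"
  shows "minor I \<tau> U = of_int (sign \<tau>) * minor I id U"
proof -
  have "minor I \<tau> U = (\<Sum>\<sigma>\<in>{\<sigma>. \<sigma> permutes I}. of_int (sign (\<sigma> \<circ> \<tau>)) * (\<Prod>i\<in>I. U $$ (\<tau> i, (\<sigma> \<circ> \<tau>) i)))"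
    unfolding minor_def by (rule sum_permutations_compose_right[OF \<tau>])
  also have "\<dots> = (\<Sum>\<sigma>\<in>{\<sigma>. \<sigma> permutes I}. of_int (sign \<tau>) * (of_int (sign \<sigma>) * (\<Prod>i\<in>I. U $$ (i, \<sigma> i))))"
  proof (rule sum.cong[OF refl])
    fix \<sigma> assume "\<sigma> \<in> {\<sigma>. \<sigma> permutes I}"
    then have "sign (\<sigma> \<circ> \<tau>) = sign \<tau> * sign \<sigma>"
      using I \<tau> by (simp add: sign_compose permutes_imp_permutation)
    moreover have "(\<Prod>i\<in>I. U $$ (\<tau> i, (\<sigma> \<circ> \<tau>) i)) = (\<Prod>i\<in>I. U $$ (i, \<sigma> i))"
      using prod.reindex_bij_betw[OF permutes_imp_bij[OF \<tau>], of "\<lambda>i. U $$ (i, \<sigma> i)"] by simp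
    ultimately show "of_int (sign (\<sigma> \<circ> \<tau>)) * (\<Prod>i\<in>I. U $$ (\<tau> i, (\<sigma> \<circ> \<tau>) i)) = of_int (sign \<tau>) * (of_int (sign \<sigma>) * (\<Prod>i\<in>I. U $$ (i, \<sigma> i)))"
      by (simp add: mult.assoc)
  qed
  also have "\<dots> = of_int (sign \<tau>) * minor I id U" by (simp add: minor_def sum_distrib_left)
  finally show ?thesis .
qed

lemma minor_monomial:
  assumes \<tau>: "\<tau> permutes {..<N}" and U: "U \<in> carrier_mat N N" and I: "I \<subseteq> {..<N}" and a: "a ` I \<subseteq> {..<N}"
  shows "minor I a (monomial_mat N \<tau> z * U) = (\<Prod>i\<in>I. z (a i)) * minor I (\<tau> \<circ> a) U"
proof -
  have "(\<Prod>i\<in>I. (monomial_mat N \<tau> z * U) $$ (a i, \<sigma> i)) = (\<Prod>i\<in>I. z (a i)) * (\<Prod>i\<in>I. U $$ (\<tau> (a i), \<sigma> i))"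
    if \<sigma>: "\<sigma> permutes I" for \<sigma>
    unfolding prod.distrib[symmetric]
  proof (rule prod.cong[OF refl])
    fix i assume i: "i \<in> I"
    then have "\<sigma> i < N" "a i < N" using permutes_in_image[OF \<sigma>, of i] I a by auto
    then show "(monomial_mat N \<tau> z * U) $$ (a i, \<sigma> i) = z (a i) * U $$ (\<tau> (a i), \<sigma> i)"
      using monomial_mat_mult[OF \<tau> U] by simp
  qed
  then show ?thesis by (simp add: minor_def sum_distrib_left mult_ac)
qed

lemma inj_extends_to_permutation:
  assumes I: "I \<subseteq> A" "finite A" and a: "inj_on a I" "a ` I \<subseteq> A"
  obtains \<tau> where "\<tau> permutes A" "\<And>i. i \<in> I \<Longrightarrow> \<tau> i = a i"
proof -
  have "card (A - I) = card (A - a ` I)"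
    using I a by (simp add: card_Diff_subset finite_subset card_image)
  then obtain h where h: "bij_betw h (A - I) (A - a ` I)" using I(2) by (metis finite_Diff finite_same_card_bij)
  define f where "f = (\<lambda>i. if i \<in> I then a i else h i)"
  have "bij_betw f I (a ` I)" using a by (auto simp: bij_betw_def f_def inj_on_def)
  moreover have "bij_betw f (A - I) (A - a ` I)" using h by (subst bij_betw_cong[where g = h]) (auto simp: f_def)
  ultimately have "bij_betw f (I \<union> (A - I)) (a ` I \<union> (A - a ` I))" by (rule bij_betw_combine) auto
  moreover have "I \<union> (A - I) = A" "a ` I \<union> (A - a ` I) = A" using I a by auto
  ultimately have "bij_betw f A A" by simp
  then have "(\<lambda>i. if i \<in> A then f i else i) permutes A"
    by (intro bij_imp_permutes) (auto cong: bij_betw_cong)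
  moreover have "(if i \<in> A then f i else i) = a i" if "i \<in> I" for i using that I by (auto simp: f_def)
  ultimately show ?thesis using that by blast
qed

lemma card_inj_funcset_cong:
  assumes f: "bij_betw f I J"
  shows "card {a \<in> J \<rightarrow>\<^sub>E A. inj_on a J} = card {a \<in> I \<rightarrow>\<^sub>E A. inj_on a I}"
proof -
  define g where "g = inv_into I f"
  have g: "bij_betw g J I" unfolding g_def by (rule bij_betw_inv_into[OF f])
  have fg: "f (g j) = j" if "j \<in> J" for j using that f by (simp add: g_def bij_betw_inv_into_right)
  have gf: "g (f i) = i" if "i \<in> I" for i using that f by (simp add: g_def bij_betw_inv_into_left)
  have fI: "f i \<in> J" if "i \<in> I" for i using bij_betwE[OF f] that by blast
  have gJ: "g j \<in> I" if "j \<in> J" for j using bij_betwE[OF g] that by blast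
  have "bij_betw (\<lambda>a. restrict (a \<circ> f) I) {a \<in> J \<rightarrow>\<^sub>E A. inj_on a J} {a \<in> I \<rightarrow>\<^sub>E A. inj_on a I}"
  proof (rule bij_betw_byWitness[where f' = "\<lambda>b. restrict (b \<circ> g) J"])
    show "\<forall>a\<in>{a \<in> J \<rightarrow>\<^sub>E A. inj_on a J}. restrict (restrict (a \<circ> f) I \<circ> g) J = a"
      by (auto simp: fun_eq_iff restrict_def fg gJ PiE_def extensional_def)
    show "\<forall>b\<in>{a \<in> I \<rightarrow>\<^sub>E A. inj_on a I}. restrict (restrict (b \<circ> g) J \<circ> f) I = b"
      by (auto simp: fun_eq_iff restrict_def gf fI PiE_def extensional_def)
    show "(\<lambda>a. restrict (a \<circ> f) I) ` {a \<in> J \<rightarrow>\<^sub>E A. inj_on a J} \<subseteq> {a \<in> I \<rightarrow>\<^sub>E A. inj_on a I}"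
    proof (rule image_subsetI)
      fix a assume "a \<in> {a \<in> J \<rightarrow>\<^sub>E A. inj_on a J}"
      then show "restrict (a \<circ> f) I \<in> {a \<in> I \<rightarrow>\<^sub>E A. inj_on a I}"
        using fI gf by (auto simp: inj_on_def) metis
    qed
    show "(\<lambda>b. restrict (b \<circ> g) J) ` {a \<in> I \<rightarrow>\<^sub>E A. inj_on a I} \<subseteq> {a \<in> J \<rightarrow>\<^sub>E A. inj_on a J}"
    proof (rule image_subsetI)
      fix a assume "a \<in> {a \<in> I \<rightarrow>\<^sub>E A. inj_on a I}"
      then show "restrict (a \<circ> g) J \<in> {a \<in> J \<rightarrow>\<^sub>E A. inj_on a J}"
        using gJ fg by (auto simp: inj_on_def) metis
    qed
  qed
  then show ?thesis by (rule bij_betw_same_card)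
qed

context haar
begin

lemma bm_minor: "I \<subseteq> {..<N} \<Longrightarrow> a ` I \<subseteq> {..<N} \<Longrightarrow> bm (minor I a)"
  unfolding minor_def
  by (intro bm_sum bm_mult bm_const bm_prod bm_entry) (auto dest: permutes_in_image)

text \<open>Rescaling a single row shows that both factors must involve it equally often.\<close>

lemma integral_minor_torus:
  assumes I: "I \<subseteq> {..<N}" and S: "finite S" and a: "a ` S \<subseteq> {..<N}" and b: "b ` S \<subseteq> {..<N}"
    and nb: "\<not> bij_betw a S I"
  shows "(\<integral>U. minor I id U * cnj (\<Prod>s\<in>S. U $$ (a s, b s)) \<partial>M) = 0"
proof -
  \<comment> \<open>\<open>c i\<close> and \<open>e i\<close> count how often row \<open>i\<close>
    occurs in the monomial and in the minor. If all counts agree, \<open>a\<close> is a bijection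
    onto \<open>I\<close>.\<close>
  define c where "c = (\<lambda>i. card {s \<in> S. a s = i})"
  define e where "e = (\<lambda>i. if i \<in> I then 1 else 0 :: nat)"
  have "\<exists>i<N. c i \<noteq> e i"
  proof (rule ccontr)
    assume h: "\<not> ?thesis"
    have "inj_on a S"
    proof (rule inj_onI)
      fix s t assume st: "s \<in> S" "t \<in> S" "a s = a t"
      have "a s < N" using a st by auto
      then have "card {x \<in> S. a x = a s} \<le> 1" using h by (auto simp: c_def e_def)
      moreover have "finite {x \<in> S. a x = a s}" using S by simp
      ultimately show "s = t" using st by (simp add: card_le_Suc0_iff_eq)
    qed
    moreover have "a ` S = I"
    proof (intro equalityI subsetI)
      fix i assume "i \<in> a ` S"
      then have i: "i < N" "c i \<noteq> 0" using a S by (auto simp: c_def)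
      then show "i \<in> I" using h by (auto simp: e_def split: if_splits)
    next
      fix i assume i: "i \<in> I"
      then have "c i = 1" using h I by (auto simp: e_def)
      then have "{s \<in> S. a s = i} \<noteq> {}" unfolding c_def by (metis card.empty zero_neq_one)
      then show "i \<in> a ` S" by auto
    qed
    ultimately show False using nb by (simp add: bij_betw_def)
  qed
  then obtain i0 where i0: "i0 < N" "c i0 \<noteq> e i0" by blast
  define m where "m = real (e i0) - real (c i0)"
  have m: "m \<noteq> 0" using i0 by (simp add: m_def)
  \<comment> \<open>Scaling row \<open>i0\<close> by \<open>w\<close> multiplies the integrand by
    \<open>w^(e i0 - c i0)\<close>. With this angle the factor is -1, so the integral equals its own
    negative.\<close>
  define w where "w = cis (pi / m)"
  define z where "z = (\<lambda>i. if i = i0 then w else 1)"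
  have z: "cmod (z i) = 1" for i by (simp add: z_def w_def)
  have p1: "(\<Prod>i\<in>I. z (id i)) = w ^ e i0"
  proof -
    have "{s \<in> I. s = i0} = (if i0 \<in> I then {i0} else {})" by auto
    then have "(\<Prod>i\<in>I. z i) = w ^ e i0"
      using finite_subset[OF I] by (simp add: z_def prod.If_cases Int_def e_def)
    then show ?thesis by simp
  qed
  have cw: "cnj w = cis (- (pi / m))" by (simp add: w_def cis_cnj)
  have ww: "w ^ e i0 * cnj w ^ c i0 = - 1"
  proof -
    have "w ^ e i0 * cnj w ^ c i0 = cis (real (e i0) * (pi / m) + real (c i0) * (- (pi / m)))"
      unfolding cw unfolding w_def Complex.DeMoivre cis_mult ..
    also have "real (e i0) * (pi / m) + real (c i0) * (- (pi / m)) = m * (pi / m)" unfolding m_def by (simp only: left_diff_distrib)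
    finally show ?thesis using m by simp
  qed
  let ?h = "\<lambda>U. minor I id U * cnj (\<Prod>s\<in>S. U $$ (a s, b s))"
  have bmh: "bm ?h"
    by (intro bm_mult bm_minor bm_cnj bm_prod bm_entry) (use I a b in auto)
  have "(\<integral>U. ?h U \<partial>M) = (\<integral>U. ?h (monomial_mat N id z * U) \<partial>M)"
    by (rule bm_monomial[OF permutes_id z bmh, symmetric])
  also have "\<dots> = (\<integral>U. (- 1) * ?h U \<partial>M)"
  proof (rule Bochner_Integration.integral_cong[OF refl])
    fix U assume U: "U \<in> space M"
    have "(\<Prod>s\<in>S. (monomial_mat N id z * U) $$ (a s, b s)) = (\<Prod>s\<in>S. z (a s)) * (\<Prod>s\<in>S. U $$ (a s, b s))"
      unfolding prod.distrib[symmetric]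
    proof (rule prod.cong[OF refl])
      fix s assume "s \<in> S"
      then have "a s < N" "b s < N" using a b by auto
      then show "(monomial_mat N id z * U) $$ (a s, b s) = z (a s) * U $$ (a s, b s)"
        using monomial_mat_mult[OF permutes_id carrier[OF U]] by simp
    qed
    moreover have "minor I id (monomial_mat N id z * U) = w ^ e i0 * minor I id U"
      using minor_monomial[OF permutes_id carrier[OF U] I, of id z] I unfolding p1 by simp
    moreover have "(\<Prod>s\<in>S. z (a s)) = w ^ c i0"
      using S by (simp add: z_def prod.If_cases Int_def c_def)
    ultimately have "?h (monomial_mat N id z * U) = (w ^ e i0 * cnj w ^ c i0) * ?h U" by (simp add: mult_ac)
    then show "?h (monomial_mat N id z * U) = (- 1) * ?h U" unfolding ww .
  qed
  also have "\<dots> = - (\<integral>U. ?h U \<partial>M)" by simp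
  finally show ?thesis by simp
qed

text \<open>The integral of a principal minor against the conjugate of its diagonal product.
  \<open>\<kappa>_eq\<close> evaluates it as the reciprocal of the number of injections of
  \<open>I\<close> into the row indices.\<close>

definition \<kappa> :: "nat set \<Rightarrow> complex" where
  "\<kappa> I = (\<integral>U. minor I id U * cnj (\<Prod>i\<in>I. U $$ (i, i)) \<partial>M)"

text \<open>Left translation by the permutation matrix of \<sigma> straightens the monomial to the
  diagonal and multiplies the minor by the sign.\<close>

lemma integral_minor_permutation:
  assumes I: "I \<subseteq> {..<N}" and \<sigma>: "\<sigma> permutes I"
  shows "(\<integral>U. minor I id U * cnj (\<Prod>i\<in>I. U $$ (i, \<sigma> i)) \<partial>M) = of_int (sign \<sigma>) * \<kappa> I"
proof -
  have fin: "finite I" using I finite_subset by blast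
  have \<sigma>N: "\<sigma> permutes {..<N}" by (rule permutes_subset[OF \<sigma> I])
  let ?h = "\<lambda>U. minor I id U * cnj (\<Prod>i\<in>I. U $$ (i, \<sigma> i))"
  have bmh: "bm ?h"
    by (intro bm_mult bm_minor bm_cnj bm_prod bm_entry) (use I permutes_in_image[OF \<sigma>N] in auto)
  have "(\<integral>U. ?h U \<partial>M) = (\<integral>U. ?h (monomial_mat N \<sigma> (\<lambda>_. 1) * U) \<partial>M)"
    by (rule bm_monomial[OF \<sigma>N _ bmh, symmetric]) simp
  also have "\<dots> = (\<integral>U. of_int (sign \<sigma>) * (minor I id U * cnj (\<Prod>i\<in>I. U $$ (i, i))) \<partial>M)"
  proof (rule Bochner_Integration.integral_cong[OF refl])
    fix U assume U: "U \<in> space M"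
    have "(\<Prod>i\<in>I. (monomial_mat N \<sigma> (\<lambda>_. 1) * U) $$ (i, \<sigma> i)) = (\<Prod>i\<in>I. U $$ (\<sigma> i, \<sigma> i))"
      by (rule prod.cong) (use I permutes_in_image[OF \<sigma>N] in \<open>auto simp: monomial_mat_mult[OF \<sigma>N carrier[OF U]]\<close>)
    also have "\<dots> = (\<Prod>i\<in>I. U $$ (i, i))"
      by (rule prod.reindex_bij_betw[OF permutes_imp_bij[OF \<sigma>]])
    finally show "?h (monomial_mat N \<sigma> (\<lambda>_. 1) * U) = of_int (sign \<sigma>) * (minor I id U * cnj (\<Prod>i\<in>I. U $$ (i, i)))"
      using minor_monomial[OF \<sigma>N carrier[OF U] I, of id "\<lambda>_. 1"] I minor_permute_rows[OF fin \<sigma>, of U] by simp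
  qed
  finally show ?thesis by (simp add: \<kappa>_def)
qed

text \<open>Summing over the rows independently turns each permutation \<sigma> of the columns into
  a product of inner products of columns \<open>i\<close> and \<open>\<sigma> i\<close>.
  Orthonormality leaves only the identity.\<close>

lemma sum_minor_orthogonality:
  assumes U: "U \<in> unitary_group N" and I: "I \<subseteq> {..<N}"
  shows "(\<Sum>a\<in>I \<rightarrow>\<^sub>E {..<N}. minor I a U * cnj (\<Prod>i\<in>I. U $$ (a i, i))) = 1"
proof -
  have fin: "finite I" using I finite_subset by blast
  have "(\<Sum>a\<in>I \<rightarrow>\<^sub>E {..<N}. minor I a U * cnj (\<Prod>i\<in>I. U $$ (a i, i)))
    = (\<Sum>\<sigma>\<in>{\<sigma>. \<sigma> permutes I}. of_int (sign \<sigma>) * (\<Sum>a\<in>I \<rightarrow>\<^sub>E {..<N}. \<Prod>i\<in>I. cnj (U $$ (a i, i)) * U $$ (a i, \<sigma> i)))"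
    unfolding minor_def sum_distrib_right sum_distrib_left
    by (subst sum.swap) (simp add: prod.distrib mult_ac)
  also have "\<dots> = (\<Sum>\<sigma>\<in>{\<sigma>. \<sigma> permutes I}. if \<sigma> = id then 1 else 0)"
  proof (rule sum.cong[OF refl])
    fix \<sigma> assume "\<sigma> \<in> {\<sigma>. \<sigma> permutes I}"
    then have \<sigma>: "\<sigma> permutes I" by simp
    have "(\<Sum>a\<in>I \<rightarrow>\<^sub>E {..<N}. \<Prod>i\<in>I. cnj (U $$ (a i, i)) * U $$ (a i, \<sigma> i)) = (\<Prod>i\<in>I. \<Sum>k<N. cnj (U $$ (k, i)) * U $$ (k, \<sigma> i))"
      using fin by (subst prod_sum_PiE) auto
    also have "\<dots> = (\<Prod>i\<in>I. if \<sigma> i = i then 1 else 0)"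
    proof (rule prod.cong[OF refl])
      fix i assume "i \<in> I"
      then have "i < N" "\<sigma> i < N" using I permutes_in_image[OF \<sigma>, of i] by auto
      then show "(\<Sum>k<N. cnj (U $$ (k, i)) * U $$ (k, \<sigma> i)) = (if \<sigma> i = i then 1 else 0)"
        using U by (auto simp: unitary_group_iff)
    qed
    also have "\<dots> = (if \<forall>i\<in>I. \<sigma> i = i then 1 else 0)"
      using fin by (auto intro: prod.neutral)
    also have "(\<forall>i\<in>I. \<sigma> i = i) \<longleftrightarrow> \<sigma> = id" using permutes_not_in[OF \<sigma>] by (auto simp: fun_eq_iff)
    finally show "of_int (sign \<sigma>) * (\<Sum>a\<in>I \<rightarrow>\<^sub>E {..<N}. \<Prod>i\<in>I. cnj (U $$ (a i, i)) * U $$ (a i, \<sigma> i)) = (if \<sigma> = id then 1 else 0)"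
      by simp
  qed
  also have "\<dots> = 1" using fin by (simp add: finite_permutations permutes_id sum.delta)
  finally show ?thesis .
qed

text \<open>Integrate the preceding identity. Maps \<open>a\<close> that are not injective give a
  minor with repeated rows, hence 0; all injective ones give \<kappa> of \<open>I\<close>, because
  they extend to permutations of the rows.\<close>

lemma \<kappa>_eq:
  assumes I: "I \<subseteq> {..<N}"
  shows "of_nat (card {a \<in> I \<rightarrow>\<^sub>E {..<N}. inj_on a I}) * \<kappa> I = 1"
proof -
  have fin: "finite I" using I finite_subset by blast
  let ?h = "\<lambda>a U. minor I a U * cnj (\<Prod>i\<in>I. U $$ (a i, i))"
  have bmh: "bm (?h a)" if "a \<in> I \<rightarrow>\<^sub>E {..<N}" for a
    by (intro bm_mult bm_minor bm_cnj bm_prod bm_entry) (use I that in auto)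
  have "1 = (\<integral>U. (1 :: complex) \<partial>M)" by (simp add: prob_space)
  also have "\<dots> = (\<integral>U. (\<Sum>a\<in>I \<rightarrow>\<^sub>E {..<N}. ?h a U) \<partial>M)"
    by (rule Bochner_Integration.integral_cong[OF refl]) (use sum_minor_orthogonality[OF _ I] in \<open>simp add: space_M\<close>)
  also have "\<dots> = (\<Sum>a\<in>I \<rightarrow>\<^sub>E {..<N}. \<integral>U. ?h a U \<partial>M)"
    by (rule Bochner_Integration.integral_sum) (use bmh bm_integrable in auto)
  also have "\<dots> = (\<Sum>a\<in>I \<rightarrow>\<^sub>E {..<N}. if inj_on a I then \<kappa> I else 0)"
  proof (rule sum.cong[OF refl])
    fix a assume a: "a \<in> I \<rightarrow>\<^sub>E {..<N}"
    show "(\<integral>U. ?h a U \<partial>M) = (if inj_on a I then \<kappa> I else 0)"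
    proof (cases "inj_on a I")
      case True
      have aI: "a ` I \<subseteq> {..<N}" using a by auto
      obtain \<tau> where \<tau>: "\<tau> permutes {..<N}" "\<And>i. i \<in> I \<Longrightarrow> \<tau> i = a i"
        using inj_extends_to_permutation[OF I _ True aI] by auto
      have "bm (?h id)" by (intro bm_mult bm_minor bm_cnj bm_prod bm_entry) (use I in auto)
      then have "\<kappa> I = (\<integral>U. ?h id (monomial_mat N \<tau> (\<lambda>_. 1) * U) \<partial>M)"
        unfolding \<kappa>_def by (subst bm_monomial[OF \<tau>(1), of "\<lambda>_. 1" "?h id"]) auto
      also have "\<dots> = (\<integral>U. ?h a U \<partial>M)"
      proof (rule Bochner_Integration.integral_cong[OF refl])
        fix U assume U: "U \<in> space M"
        have "minor I (\<tau> \<circ> id) U = minor I a U" using \<tau>(2) by (simp add: minor_def)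
        moreover have "(\<Prod>i\<in>I. (monomial_mat N \<tau> (\<lambda>_. 1) * U) $$ (id i, i)) = (\<Prod>i\<in>I. U $$ (a i, i))"
          by (rule prod.cong) (use I \<tau>(2) in \<open>auto simp: monomial_mat_mult[OF \<tau>(1) carrier[OF U]]\<close>)
        ultimately show "?h id (monomial_mat N \<tau> (\<lambda>_. 1) * U) = ?h a U"
          using minor_monomial[OF \<tau>(1) carrier[OF U] I, of id "\<lambda>_. 1"] I by simp
      qed
      finally show ?thesis using True by simp
    next
      case False
      then show ?thesis using minor_not_inj[OF fin] by simp
    qed
  qed
  also have "\<dots> = of_nat (card {a \<in> I \<rightarrow>\<^sub>E {..<N}. inj_on a I}) * \<kappa> I"
    using fin by (subst sum.inter_filter[symmetric]) (auto intro: finite_PiE)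
  finally show ?thesis ..
qed

text \<open>By the row count only the minor on the image of an injective \<open>a\<close>
  contributes, and \<pi> becomes a conjugate permutation of that image with the same sign. Each
  injection contributes the reciprocal of their number, so the total is independent of
  \<open>N\<close> as long as injections exist.\<close>

lemma integral_f_det_cycles:
  assumes \<pi>: "\<pi> permutes {..<r}"
  shows "(\<integral>U. f_det U * cnj (\<Sum>a\<in>{..<r} \<rightarrow>\<^sub>E {..<N}. \<Prod>s<r. U $$ (a s, a (\<pi> s))) \<partial>M)
    = (if r \<le> N then (- 1) ^ r * of_int (sign \<pi>) else 0)"
proof -
  let ?E = "{..<r} \<rightarrow>\<^sub>E {..<N}"
  let ?n = "card {a \<in> ?E. inj_on a {..<r}}"
  let ?h = "\<lambda>I a U. minor I id U * cnj (\<Prod>s<r. U $$ (a s, a (\<pi> s)))"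
  have aN: "a s < N" "a (\<pi> s) < N" if "a \<in> ?E" "s < r" for a s
    using that permutes_in_image[OF \<pi>, of s] by (auto simp: PiE_def Pi_def)
  have bmh: "bm (?h I a)" if "I \<in> Pow {..<N}" "a \<in> ?E" for I a
    by (intro bm_mult bm_minor bm_cnj bm_prod bm_entry) (use that aN in auto)
  have finE: "finite ?E" by (intro finite_PiE) auto
  have val: "(\<integral>U. ?h I a U \<partial>M) = (if bij_betw a {..<r} I then of_int (sign \<pi>) / of_nat ?n else 0)"
    if I: "I \<in> Pow {..<N}" and a: "a \<in> ?E" for I a
  proof (cases "bij_betw a {..<r} I")
    case True
    have inj: "inj_on a {..<r}" "a ` {..<r} = I" using True by (auto simp: bij_betw_def)
    \<comment> \<open>\<pi> transported along \<open>a\<close>: the entry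
      \<open>(a s, a (\<pi> s))\<close> is the entry in row \<open>i = a s\<close> and column
      \<open>\<sigma> i\<close>.\<close>
    define \<sigma> where "\<sigma> = map_permutation {..<r} a \<pi>"
    have \<sigma>: "\<sigma> permutes I" unfolding \<sigma>_def inj(2)[symmetric] by (rule map_permutation_permutes) (use \<pi> True inj(2) in auto)
    have s: "sign \<sigma> = sign \<pi>" unfolding \<sigma>_def by (rule sign_map_permutation) (use inj \<pi> in auto)
    have p: "(\<Prod>s<r. U $$ (a s, a (\<pi> s))) = (\<Prod>i\<in>I. U $$ (i, \<sigma> i))" for U :: "complex mat"
    proof -
      have "(\<Prod>s<r. U $$ (a s, a (\<pi> s))) = (\<Prod>s<r. U $$ (a s, \<sigma> (a s)))"
        by (rule prod.cong) (use inj in \<open>auto simp: \<sigma>_def map_permutation_apply\<close>)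
      also have "\<dots> = (\<Prod>i\<in>I. U $$ (i, \<sigma> i))" by (rule prod.reindex_bij_betw[OF True])
      finally show ?thesis .
    qed
    have "(\<integral>U. ?h I a U \<partial>M) = of_int (sign \<pi>) * \<kappa> I"
      unfolding p s[symmetric] by (rule integral_minor_permutation[OF _ \<sigma>]) (use I in auto)
    moreover have "of_nat ?n * \<kappa> I = 1"
      using \<kappa>_eq[of I] I card_inj_funcset_cong[OF True, of "{..<N}"] by simp
    then have "\<kappa> I = 1 / of_nat ?n" by (metis mult_zero_left nonzero_mult_div_cancel_left zero_neq_one)
    ultimately show ?thesis using True by simp
  next
    case False
    then show ?thesis using integral_minor_torus[of I "{..<r}" a "\<lambda>s. a (\<pi> s)"] I aN[OF a] by auto
  qed
  have "(\<integral>U. f_det U * cnj (\<Sum>a\<in>?E. \<Prod>s<r. U $$ (a s, a (\<pi> s))) \<partial>M) =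
    (\<integral>U. (\<Sum>I\<in>Pow {..<N}. \<Sum>a\<in>?E. (- 1) ^ card I * ?h I a U) \<partial>M)"
    by (rule Bochner_Integration.integral_cong[OF refl])
      (simp add: f_det_expand[OF carrier] sum_distrib_left sum_distrib_right mult_ac, rule sum.swap)
  also have "\<dots> = (\<Sum>I\<in>Pow {..<N}. \<integral>U. (\<Sum>a\<in>?E. (- 1) ^ card I * ?h I a U) \<partial>M)"
    by (rule Bochner_Integration.integral_sum) (intro bm_integrable bm_sum bm_mult[OF bm_const] bmh)
  also have "\<dots> = (\<Sum>I\<in>Pow {..<N}. \<Sum>a\<in>?E. \<integral>U. (- 1) ^ card I * ?h I a U \<partial>M)"
    by (rule sum.cong[OF refl], rule Bochner_Integration.integral_sum) (intro bm_integrable bm_mult[OF bm_const] bmh)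
  also have "\<dots> = (\<Sum>I\<in>Pow {..<N}. \<Sum>a\<in>?E. if bij_betw a {..<r} I then (- 1) ^ r * (of_int (sign \<pi>) / of_nat ?n) else 0)"
  proof (intro sum.cong refl)
    fix I a assume Ia: "I \<in> Pow {..<N}" "a \<in> ?E"
    have "card I = r" if "bij_betw a {..<r} I" using bij_betw_same_card[OF that] by simp
    then show "(\<integral>U. (- 1) ^ card I * ?h I a U \<partial>M) = (if bij_betw a {..<r} I then (- 1) ^ r * (of_int (sign \<pi>) / of_nat ?n) else 0)"
      using val[OF Ia] by simp
  qed
  also have "\<dots> = (\<Sum>a\<in>?E. \<Sum>I\<in>Pow {..<N}. if I = a ` {..<r} \<and> inj_on a {..<r} then (- 1) ^ r * (of_int (sign \<pi>) / of_nat ?n) else 0)"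
    by (subst sum.swap, intro sum.cong refl if_cong) (auto simp: bij_betw_def)
  also have "\<dots> = (\<Sum>a\<in>?E. if inj_on a {..<r} then (- 1) ^ r * (of_int (sign \<pi>) / of_nat ?n) else 0)"
  proof (rule sum.cong[OF refl])
    fix a assume a: "a \<in> ?E"
    then have "a ` {..<r} \<in> Pow {..<N}" by auto
    then show "(\<Sum>I\<in>Pow {..<N}. if I = a ` {..<r} \<and> inj_on a {..<r} then (- 1) ^ r * (of_int (sign \<pi>) / of_nat ?n) else 0) =
      (if inj_on a {..<r} then (- 1) ^ r * (of_int (sign \<pi>) / of_nat ?n) else (0 :: complex))"
      by (cases "inj_on a {..<r}") (simp_all add: sum.delta)
  qed
  also have "\<dots> = of_nat ?n * ((- 1) ^ r * (of_int (sign \<pi>) / of_nat ?n))"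
    using finE by (subst sum.inter_filter[symmetric]) auto
  also have "\<dots> = (if r \<le> N then (- 1) ^ r * of_int (sign \<pi>) else 0)"
  proof (cases "r \<le> N")
    case True
    have "restrict id {..<r} \<in> {a \<in> ?E. inj_on a {..<r}}" using True by (auto simp: inj_on_def)
    then have "?n \<noteq> 0" using finE by (metis (no_types, lifting) card_eq_0_iff empty_iff finite_Collect_conjI finite_subset mem_Collect_eq subsetI)
    then show ?thesis using True by simp
  next
    case False
    have "\<not> inj_on a {..<r}" if "a \<in> ?E" for a
    proof
      assume "inj_on a {..<r}"
      then have "r \<le> N" using card_inj_on_le[of a "{..<r}" "{..<N}"] that by auto
      then show False using False by simp
    qed
    then have "{a \<in> ?E. inj_on a {..<r}} = {}" by auto
    then have "?n = 0" by (simp only: card.empty)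
    then show ?thesis using False by (simp only: of_nat_0 mult_zero_left if_False)
  qed
  finally show ?thesis .
qed

end

section \<open>Power sums and Newton's identities\<close>

lemma linear_factors_prod:
  fixes y :: "'t \<Rightarrow> 'a::idom" assumes "finite T"
  shows "degree (\<Prod>t\<in>T. [:1, - y t:]) \<le> card T" "coeff (\<Prod>t\<in>T. [:1, - y t:]) 0 = 1"
    "poly (\<Prod>t\<in>T. [:1, - y t:]) 1 = (\<Prod>t\<in>T. 1 - y t)"
proof -
  have "degree (\<Prod>t\<in>T. [:1, - y t:]) \<le> (\<Sum>t\<in>T. degree [:1, - y t:])" 
    using degree_prod_sum_le[OF assms, of "\<lambda>t. [:1, - y t:]"] by (simp only: o_def)
  also have "\<dots> \<le> (\<Sum>t\<in>T. 1)" by (rule sum_mono) simp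
  finally show "degree (\<Prod>t\<in>T. [:1, - y t:]) \<le> card T" by simp
  show "coeff (\<Prod>t\<in>T. [:1, - y t:]) 0 = 1" by (simp add: poly_0_coeff_0[symmetric] poly_prod)
qed (simp add: poly_prod)

text \<open>Compare coefficients in the logarithmic derivative of the product of the factors
  \<open>1 - y t * X\<close>.\<close>

lemma newton_identity:
  fixes y :: "'t \<Rightarrow> complex" assumes T: "finite T"
  defines "c \<equiv> coeff (\<Prod>t\<in>T. [:1, - y t:])"
  shows "of_nat k * c k = - (\<Sum>j=1..k. (\<Sum>t\<in>T. y t ^ j) * c (k - j))"
proof -
  \<comment> \<open>The series of \<open>a * X / (1 - a * X)\<close>, which generates the powers of
    \<open>a\<close> from exponent 1 on.\<close>
  define A where "A = (\<lambda>a :: complex. Abs_fps (\<lambda>j. if j = 0 then 0 else a ^ j))"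
  define L where "L = (\<lambda>a :: complex. 1 - fps_const a * fps_X)"
  have LA: "L a * A a = fps_const a * fps_X" for a
  proof (rule fps_ext)
    fix n show "fps_nth (L a * A a) n = fps_nth (fps_const a * fps_X) n"
      by (cases n) (auto simp: L_def A_def left_diff_distrib mult.assoc)
  qed
  have L': "fps_X * fps_deriv (L a) = - (L a * A a)" for a
    unfolding LA by (simp add: L_def mult.commute)
  have main: "fps_X * fps_deriv (\<Prod>t\<in>T. L (y t)) = - ((\<Sum>t\<in>T. A (y t)) * (\<Prod>t\<in>T. L (y t)))"
    using T
  proof (induction T)
    case (insert t T)
    have "fps_X * fps_deriv (\<Prod>t\<in>insert t T. L (y t)) =
      (fps_X * fps_deriv (L (y t))) * (\<Prod>t\<in>T. L (y t)) + L (y t) * (fps_X * fps_deriv (\<Prod>t\<in>T. L (y t)))"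
      using insert.hyps by (simp add: algebra_simps)
    also have "\<dots> = - ((\<Sum>t\<in>insert t T. A (y t)) * (\<Prod>t\<in>insert t T. L (y t)))"
      unfolding L' insert.IH using insert.hyps by (simp add: algebra_simps)
    finally show ?case .
  qed simp
  have Lpoly: "L a = fps_of_poly [:1, - a:]" for a
    by (rule fps_ext) (auto simp: L_def coeff_pCons fps_X_def split: nat.splits)
  have "(\<Prod>t\<in>T. L (y t)) = fps_of_poly (\<Prod>t\<in>T. [:1, - y t:])"
    unfolding Lpoly by (simp add: fps_of_poly_prod)
  then have c: "fps_nth (\<Prod>t\<in>T. L (y t)) n = c n" for n by (simp add: c_def)
  have "of_nat k * c k = fps_nth (fps_X * fps_deriv (\<Prod>t\<in>T. L (y t))) k"
    by (cases k) (simp_all add: c[symmetric])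
  also have "\<dots> = - (\<Sum>j=0..k. fps_nth (\<Sum>t\<in>T. A (y t)) j * c (k - j))"
    unfolding main by (simp add: fps_mult_nth c)
  also have "(\<Sum>j=0..k. fps_nth (\<Sum>t\<in>T. A (y t)) j * c (k - j)) = (\<Sum>j=1..k. fps_nth (\<Sum>t\<in>T. A (y t)) j * c (k - j))"
    by (rule sum.mono_neutral_right) (auto simp: fps_sum_nth A_def not_less_eq_eq)
  also have "\<dots> = (\<Sum>j=1..k. (\<Sum>t\<in>T. y t ^ j) * c (k - j))"
    by (rule sum.cong) (auto simp: fps_sum_nth A_def)
  finally show ?thesis .
qed

definition triples :: "nat \<Rightarrow> (nat \<times> nat \<times> nat) set" where
  "triples n = {(i, j, k). i < j \<and> j < k \<and> k < n}"

lemma finite_triples [simp]: "finite (triples n)"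
  by (rule finite_subset[of _ "{..<n} \<times> {..<n} \<times> {..<n}"]) (auto simp: triples_def)

text \<open>The third elementary symmetric polynomial in terms of power sums. The induction splits
  off the largest index, which requires the corresponding formula for pairs.\<close>

lemma sum_triples:
  fixes u :: "nat \<Rightarrow> complex"
  shows "(\<Sum>(i, j, k)\<in>triples n. u i * u j * u k) =
    ((\<Sum>i<n. u i) ^ 3 - 3 * (\<Sum>i<n. u i) * (\<Sum>i<n. u i ^ 2) + 2 * (\<Sum>i<n. u i ^ 3)) / 6"
proof (induction n)
  case 0
  have "triples 0 = {}" by (auto simp: triples_def)
  then show ?case by simp
next
  case (Suc n)
  define E where "E = (\<lambda>n. {(i, j). i < j \<and> j < (n :: nat)})"
  have finE: "finite (E n)" for n
    by (rule finite_subset[of _ "{..<n} \<times> {..<n}"]) (auto simp: E_def)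
  have pairs: "(\<Sum>(i, j)\<in>E n. u i * u j) = ((\<Sum>i<n. u i) ^ 2 - (\<Sum>i<n. u i ^ 2)) / 2" for n
  proof (induction n)
    case 0
    have "E 0 = {}" by (auto simp: E_def)
    then show ?case by simp
  next
    case (Suc n)
    have "E (Suc n) = E n \<union> (\<lambda>i. (i, n)) ` {..<n}" by (auto simp: E_def less_Suc_eq)
    moreover have "E n \<inter> (\<lambda>i. (i, n)) ` {..<n} = {}" by (auto simp: E_def)
    moreover have "inj_on (\<lambda>i. (i, n)) {..<n}" by (auto simp: inj_on_def)
    ultimately have "(\<Sum>(i, j)\<in>E (Suc n). u i * u j) = (\<Sum>(i, j)\<in>E n. u i * u j) + (\<Sum>i<n. u i) * u n"
      using finE by (simp add: sum.union_disjoint sum.reindex sum_distrib_right)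
    then show ?case unfolding Suc by (simp add: field_simps power2_eq_square)
  qed
  have "triples (Suc n) = triples n \<union> (\<lambda>(i, j). (i, j, n)) ` E n" by (auto simp: triples_def E_def less_Suc_eq)
  moreover have "triples n \<inter> (\<lambda>(i, j). (i, j, n)) ` E n = {}" by (auto simp: triples_def)
  moreover have "inj_on (\<lambda>(i, j). (i, j, n)) (E n)" by (auto simp: inj_on_def)
  ultimately have e: "(\<Sum>(i, j, k)\<in>triples (Suc n). u i * u j * u k) = (\<Sum>(i, j, k)\<in>triples n. u i * u j * u k) + (\<Sum>(i, j)\<in>E n. u i * u j) * u n"
    using finE by (simp add: sum.union_disjoint sum.reindex sum_distrib_right case_prod_unfold)
  show ?case unfolding e Suc pairs by (simp add: field_simps power2_eq_square power3_eq_cube)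
qed

section \<open>Traces of powers and the third exterior power\<close>

definition tr_pow :: "nat \<Rightarrow> complex mat \<Rightarrow> complex" where
  "tr_pow l U = (\<Sum>i<dim_row U. (U ^\<^sub>m l) $$ (i, i))"

lemma pow_mat_entry_Suc:
  assumes "A \<in> carrier_mat n n" "i < n" "j < n"
  shows "(A ^\<^sub>m Suc k) $$ (i, j) = (\<Sum>c<n. (A ^\<^sub>m k) $$ (i, c) * A $$ (c, j))"
  using assms by (simp add: scalar_prod_def atLeast0LessThan)

lemma upper_triangular_pow_entry:
  fixes B :: "complex mat"
  assumes B: "B \<in> carrier_mat n n" "upper_triangular B" and ij: "i < n" "j \<le> i"
  shows "(B ^\<^sub>m k) $$ (i, j) = (if i = j then (B $$ (i, i)) ^ k else 0)"
  using ij
proof (induction k arbitrary: j)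
  case 0
  then show ?case using B by auto
next
  case (Suc k)
  have "(B ^\<^sub>m Suc k) $$ (i, j) = (\<Sum>c<n. (B ^\<^sub>m k) $$ (i, c) * B $$ (c, j))"
    using pow_mat_entry_Suc[OF B(1)] Suc by simp
  also have "\<dots> = (\<Sum>c<n. if c = i \<and> j = i then (B $$ (i, i)) ^ Suc k else 0)"
  proof (rule sum.cong[OF refl])
    fix c assume c: "c \<in> {..<n}"
    show "(B ^\<^sub>m k) $$ (i, c) * B $$ (c, j) = (if c = i \<and> j = i then (B $$ (i, i)) ^ Suc k else 0)"
    proof (cases "c < i \<or> j < c")
      case True
      then show ?thesis using Suc B c by (auto simp: upper_triangular_def)
    next
      case False
      then have "c = i" "j = i" using Suc.prems by auto
      then show ?thesis using Suc by simp
    qed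
  qed
  also have "\<dots> = (if i = j then (B $$ (i, i)) ^ Suc k else 0)" using Suc.prems by (cases "i = j") (auto simp: sum.delta)
  finally show ?case .
qed

text \<open>The chosen list factors the characteristic polynomial, so a Schur decomposition has it
  as the diagonal. Powers of a triangular matrix have the powers of the entries on the diagonal, and
  the trace is invariant under conjugation.\<close>

lemma eigenvalue_list:
  assumes U: "U \<in> carrier_mat n n"
  shows "length (eigenvalue_list U) = n" "tr_pow l U = (\<Sum>i<n. (eigenvalue_list U ! i) ^ l)"
proof -
  define es where "es = eigenvalue_list U"
  have "\<exists>xs. char_poly U = (\<Prod>x\<leftarrow>xs. [:- x, 1:])" using char_poly_factorized[OF U] by blast
  then have c: "char_poly U = (\<Prod>x\<leftarrow>es. [:- x, 1:])" unfolding es_def eigenvalue_list_def by (rule someI_ex)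
  have "degree (char_poly U) = n" using degree_monic_char_poly[OF U] by simp
  then show "length (eigenvalue_list U) = n"
    using c degree_linear_factors[of uminus es] by (simp add: es_def)
  obtain B P Q where B: "schur_decomposition U es = (B, P, Q)" by (cases "schur_decomposition U es") auto
  then have s: "similar_mat_wit U B P Q" "upper_triangular B" "diag_mat B = es"
    using schur_decomposition[OF U c] by auto
  note w = similar_mat_witD2[OF U s(1)]
  note wl = similar_mat_witD2[OF pow_carrier_mat[OF U] similar_mat_wit_pow[OF s(1), of l]]
  let ?X = "B ^\<^sub>m l"
  have X: "?X \<in> carrier_mat n n" using w by simp
  have "tr_pow l U = (\<Sum>i<n. (P * ?X * Q) $$ (i, i))" using U wl(3) by (simp add: tr_pow_def)
  also have "\<dots> = (\<Sum>i<n. \<Sum>k<n. \<Sum>j<n. P $$ (i, j) * ?X $$ (j, k) * Q $$ (k, i))"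
    using w X by (intro sum.cong refl) (simp add: scalar_prod_def atLeast0LessThan sum_distrib_right)
  also have "\<dots> = (\<Sum>k<n. \<Sum>j<n. ?X $$ (j, k) * (\<Sum>i<n. Q $$ (k, i) * P $$ (i, j)))"
    unfolding sum_distrib_left
    by (subst sum.swap, rule sum.cong[OF refl], subst sum.swap) (simp add: mult_ac)
  also have "\<dots> = (\<Sum>k<n. \<Sum>j<n. if j = k then ?X $$ (j, k) else 0)"
  proof (intro sum.cong refl)
    fix k j assume kj: "k \<in> {..<n}" "j \<in> {..<n}"
    have "(\<Sum>i<n. Q $$ (k, i) * P $$ (i, j)) = (Q * P) $$ (k, j)"
      using w(6,7) kj by (simp add: scalar_prod_def atLeast0LessThan)
    then show "?X $$ (j, k) * (\<Sum>i<n. Q $$ (k, i) * P $$ (i, j)) = (if j = k then ?X $$ (j, k) else 0)"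
      using w(2) kj by simp
  qed
  also have "\<dots> = (\<Sum>k<n. (B $$ (k, k)) ^ l)"
    using upper_triangular_pow_entry[OF w(5) s(2)] by simp
  also have "\<dots> = (\<Sum>k<n. es ! k ^ l)"
  proof (rule sum.cong[OF refl])
    fix k assume "k \<in> {..<n}"
    then show "(B $$ (k, k)) ^ l = es ! k ^ l" using s(3) w(5) by (auto simp: diag_mat_def)
  qed
  finally show "tr_pow l U = (\<Sum>i<n. (eigenvalue_list U ! i) ^ l)" by (simp add: es_def)
qed

definition wedge3_coeff :: "nat \<Rightarrow> complex mat \<Rightarrow> complex" where
  "wedge3_coeff k U = (let xs = eigenvalue_list U in
     coeff (\<Prod>(i, j, l)\<in>triples (dim_row U). [:1, - (xs ! i * xs ! j * xs ! l):]) k)"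

text \<open>The trace of the \<open>l\<close>-th power of the third exterior power of
  \<open>U\<close>, that is, the \<open>l\<close>-th power sum of its eigenvalues, expressed through
  traces of powers of \<open>U\<close>.\<close>

definition wedge3_tr :: "nat \<Rightarrow> complex mat \<Rightarrow> complex" where
  "wedge3_tr l U = (tr_pow l U ^ 3 - 3 * tr_pow l U * tr_pow (2 * l) U + 2 * tr_pow (3 * l) U) / 6"

lemma wedge3_newton:
  assumes U: "U \<in> carrier_mat n n"
  shows "of_nat k * wedge3_coeff k U = - (\<Sum>j=1..k. wedge3_tr j U * wedge3_coeff (k - j) U)"
proof -
  define xs where "xs = eigenvalue_list U"
  define y where "y = (\<lambda>(i, j, l). xs ! i * xs ! j * xs ! l)"
  have c: "wedge3_coeff k U = coeff (\<Prod>t\<in>triples n. [:1, - y t:]) k" for k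
    using U by (simp add: wedge3_coeff_def xs_def y_def case_prod_unfold Let_def)
  have P: "(\<Sum>t\<in>triples n. y t ^ l) = wedge3_tr l U" for l
  proof -
    have "(\<Sum>t\<in>triples n. y t ^ l) = (\<Sum>(i, j, k)\<in>triples n. xs ! i ^ l * xs ! j ^ l * xs ! k ^ l)"
      by (simp add: y_def case_prod_unfold power_mult_distrib)
    also have "\<dots> = wedge3_tr l U"
      unfolding sum_triples wedge3_tr_def eigenvalue_list(2)[OF U] xs_def by (simp add: power_mult[symmetric] mult.commute)
    finally show ?thesis .
  qed
  show ?thesis using newton_identity[OF finite_triples, of k y n] unfolding c P .
qed

lemma wedge3_coeff_0: "wedge3_coeff 0 U = 1"
  using linear_factors_prod(2)[OF finite_triples, of "\<lambda>(i, j, l). eigenvalue_list U ! i * eigenvalue_list U ! j * eigenvalue_list U ! l" "dim_row U"]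
  by (simp add: wedge3_coeff_def case_prod_unfold Let_def)

lemma det_one_minus_wedge3_eq:
  assumes U: "U \<in> carrier_mat n n" and m: "card (triples n) \<le> m"
  shows "det_one_minus_wedge3 U = (\<Sum>k\<le>m. wedge3_coeff k U)"
proof -
  define xs where "xs = eigenvalue_list U"
  define y where "y = (\<lambda>(i, j, l). xs ! i * xs ! j * xs ! l)"
  let ?Q = "\<Prod>t\<in>triples n. [:1, - y t:]"
  have "det_one_minus_wedge3 U = (\<Prod>t\<in>triples n. 1 - y t)"
    using eigenvalue_list(1)[OF U] unfolding det_one_minus_wedge3_def Let_def triples_def
    by (simp add: xs_def y_def case_prod_unfold)
  also have "\<dots> = poly ?Q 1" by (rule linear_factors_prod(3)[symmetric]) simp
  also have "\<dots> = (\<Sum>k\<le>m. coeff ?Q k)"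
    using linear_factors_prod(1)[OF finite_triples, of y n] m unfolding poly_altdef
    by (intro sum.mono_neutral_cong_left) (auto intro!: coeff_eq_0)
  also have "\<dots> = (\<Sum>k\<le>m. wedge3_coeff k U)"
    using U by (simp add: wedge3_coeff_def xs_def y_def case_prod_unfold Let_def)
  finally show ?thesis .
qed

section \<open>Integrals against products of traces\<close>

lemma sum_PiE_insert:
  fixes f :: "('i \<Rightarrow> 'b) \<Rightarrow> complex"
  assumes x: "x \<notin> S"
  shows "(\<Sum>a\<in>insert x S \<rightarrow>\<^sub>E T. f a) = (\<Sum>a\<in>S \<rightarrow>\<^sub>E T. \<Sum>c\<in>T. f (a(x := c)))"
proof -
  have "(\<Sum>a\<in>insert x S \<rightarrow>\<^sub>E T. f a) = (\<Sum>(c, a)\<in>T \<times> (S \<rightarrow>\<^sub>E T). f (a(x := c)))"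
    unfolding PiE_insert_eq
    by (subst sum.reindex) (use inj_combinator[OF x, of "\<lambda>_. T"] in \<open>auto simp: case_prod_unfold\<close>)
  also have "\<dots> = (\<Sum>c\<in>T. \<Sum>a\<in>S \<rightarrow>\<^sub>E T. f (a(x := c)))" by (simp only: sum.cartesian_product)
  also have "\<dots> = (\<Sum>a\<in>S \<rightarrow>\<^sub>E T. \<Sum>c\<in>T. f (a(x := c)))" by (rule sum.swap)
  finally show ?thesis .
qed

context haar
begin

text \<open>A product over the cycles of \<pi>: each contributes the trace of \<open>U\<close> to
  the sum of the exponents \<open>h\<close> along the cycle. It interpolates between products of
  traces, for the identity, and cyclic sums of single entries, for exponents 1.\<close>

definition trace_sum :: "nat \<Rightarrow> (nat \<Rightarrow> nat) \<Rightarrow> (nat \<Rightarrow> nat) \<Rightarrow> complex mat \<Rightarrow> complex" where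
  "trace_sum m \<pi> h U = (\<Sum>a\<in>{..<m} \<rightarrow>\<^sub>E {..<N}. \<Prod>s<m. (U ^\<^sub>m h s) $$ (a s, a (\<pi> s)))"

text \<open>Writing \<open>U^(k+1)\<close> as \<open>U^k * U\<close> introduces one more summation
  index \<open>m\<close>, inserted in the cycle right after \<open>t\<close>.\<close>

lemma trace_sum_split:
  assumes U: "U \<in> carrier_mat N N" and \<pi>: "\<pi> permutes {..<m}" and t: "t < m" "h t = Suc k"
  shows "trace_sum m \<pi> h U = trace_sum (Suc m) (\<pi> \<circ> Transposition.transpose t m) (h(t := k, m := 1)) U"
proof -
  let ?\<pi> = "\<pi> \<circ> Transposition.transpose t m" and ?h = "h(t := k, m := 1)"
  have ins: "{..<Suc m} = insert m {..<m}" by auto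
  have \<pi>m: "\<pi> m = m" using permutes_not_in[OF \<pi>, of m] by simp
  have \<pi>s: "\<pi> s < m" if "s < m" for s using permutes_in_image[OF \<pi>, of s] that by simp
  have U1: "U ^\<^sub>m 1 = U" using U by simp
  have "(\<Sum>c<N. \<Prod>s<Suc m. (U ^\<^sub>m ?h s) $$ ((a(m := c)) s, (a(m := c)) (?\<pi> s))) = (\<Prod>s<m. (U ^\<^sub>m h s) $$ (a s, a (\<pi> s)))"
    if a: "a \<in> {..<m} \<rightarrow>\<^sub>E {..<N}" for a
  proof -
    define R where "R = (\<Prod>s\<in>{..<m} - {t}. (U ^\<^sub>m h s) $$ (a s, a (\<pi> s)))"
    have aN: "a s < N" if "s < m" for s using a that by auto
    have "(\<Prod>s<Suc m. (U ^\<^sub>m ?h s) $$ ((a(m := c)) s, (a(m := c)) (?\<pi> s))) = R * ((U ^\<^sub>m k) $$ (a t, c) * U $$ (c, a (\<pi> t)))" for c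
    proof -
      have "(\<Prod>s<Suc m. (U ^\<^sub>m ?h s) $$ ((a(m := c)) s, (a(m := c)) (?\<pi> s))) =
        (U ^\<^sub>m ?h m) $$ ((a(m := c)) m, (a(m := c)) (?\<pi> m)) * ((U ^\<^sub>m ?h t) $$ ((a(m := c)) t, (a(m := c)) (?\<pi> t)) *
          (\<Prod>s\<in>{..<m} - {t}. (U ^\<^sub>m ?h s) $$ ((a(m := c)) s, (a(m := c)) (?\<pi> s))))"
        unfolding ins using t(1) by (subst prod.insert, simp, simp, subst prod.remove[of _ t]) auto
      also have "(\<Prod>s\<in>{..<m} - {t}. (U ^\<^sub>m ?h s) $$ ((a(m := c)) s, (a(m := c)) (?\<pi> s))) = R"
        unfolding R_def
      proof (rule prod.cong[OF refl])
        fix s assume s: "s \<in> {..<m} - {t}"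
        then have "?\<pi> s = \<pi> s" "\<pi> s \<noteq> m" "s \<noteq> m" "s \<noteq> t" using \<pi>s[of s] by (auto simp: Transposition.transpose_def)
        then show "(U ^\<^sub>m ?h s) $$ ((a(m := c)) s, (a(m := c)) (?\<pi> s)) = (U ^\<^sub>m h s) $$ (a s, a (\<pi> s))" by simp
      qed
      also have "(U ^\<^sub>m ?h m) $$ ((a(m := c)) m, (a(m := c)) (?\<pi> m)) = U $$ (c, a (\<pi> t))"
        using \<pi>s[OF t(1)] U1 by simp
      also have "(U ^\<^sub>m ?h t) $$ ((a(m := c)) t, (a(m := c)) (?\<pi> t)) = (U ^\<^sub>m k) $$ (a t, c)"
        using t(1) \<pi>m by simp
      finally show ?thesis by (simp only: mult_ac)
    qed
    then have "(\<Sum>c<N. \<Prod>s<Suc m. (U ^\<^sub>m ?h s) $$ ((a(m := c)) s, (a(m := c)) (?\<pi> s))) =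
      R * (\<Sum>c<N. (U ^\<^sub>m k) $$ (a t, c) * U $$ (c, a (\<pi> t)))"
      by (simp only: sum_distrib_left)
    also have "\<dots> = R * (U ^\<^sub>m h t) $$ (a t, a (\<pi> t))"
      unfolding t(2) using pow_mat_entry_Suc[OF U, of "a t" "a (\<pi> t)" k] aN t(1) \<pi>s[OF t(1)] by simp
    also have "\<dots> = (\<Prod>s<m. (U ^\<^sub>m h s) $$ (a s, a (\<pi> s)))"
      unfolding R_def using t(1) by (subst prod.remove[of "{..<m}" t]) (auto simp: mult.commute)
    finally show ?thesis .
  qed
  then have "(\<Sum>a\<in>{..<m} \<rightarrow>\<^sub>E {..<N}. \<Sum>c<N. \<Prod>s<Suc m. (U ^\<^sub>m ?h s) $$ ((a(m := c)) s, (a(m := c)) (?\<pi> s))) = trace_sum m \<pi> h U"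
    unfolding trace_sum_def by (intro sum.cong refl)
  then show ?thesis unfolding trace_sum_def[of "Suc m"] ins
    by (subst sum_PiE_insert) simp_all
qed

lemma trace_sum_id:
  assumes U: "U \<in> carrier_mat N N" shows "trace_sum m id h U = (\<Prod>s<m. tr_pow (h s) U)"
  unfolding trace_sum_def tr_pow_def using U by (subst prod_sum_PiE) auto

text \<open>Splitting an exponent adds one index and composes \<pi> with a transposition. Both
  \<open>(- 1) ^ m\<close> and the sign change, so their product is stable until all exponents are 1
  and \<open>integral_f_det_cycles\<close> applies.\<close>

lemma integral_trace_sum:
  assumes "\<pi> permutes {..<m}" "\<And>s. s < m \<Longrightarrow> h s \<ge> 1"
  shows "(\<integral>U. f_det U * cnj (trace_sum m \<pi> h U) \<partial>M) = (if (\<Sum>s<m. h s) \<le> N then (- 1) ^ m * of_int (sign \<pi>) else 0)"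
  using assms
proof (induction "\<Sum>s<m. h s - 1" arbitrary: m \<pi> h rule: less_induct)
  case less
  show ?case
  proof (cases "\<forall>s<m. h s = 1")
    case True
    have "trace_sum m \<pi> h U = (\<Sum>a\<in>{..<m} \<rightarrow>\<^sub>E {..<N}. \<Prod>s<m. U $$ (a s, a (\<pi> s)))" if "U \<in> space M" for U
    proof -
      have "U ^\<^sub>m 1 = U" using carrier[OF that] by simp
      then show ?thesis unfolding trace_sum_def using True by (intro sum.cong prod.cong refl) auto
    qed
    then have "(\<integral>U. f_det U * cnj (trace_sum m \<pi> h U) \<partial>M) = (\<integral>U. f_det U * cnj (\<Sum>a\<in>{..<m} \<rightarrow>\<^sub>E {..<N}. \<Prod>s<m. U $$ (a s, a (\<pi> s))) \<partial>M)"
      by (intro Bochner_Integration.integral_cong refl) simp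
    moreover have "(\<Sum>s<m. h s) = m" using True by simp
    ultimately show ?thesis using integral_f_det_cycles[OF less.prems(1)] by simp
  next
    case False
    then obtain t where t: "t < m" "h t \<noteq> 1" by blast
    define k where "k = h t - 1"
    have k: "h t = Suc k" "k \<ge> 1" using less.prems(2)[OF t(1)] t(2) by (auto simp: k_def)
    let ?\<pi> = "\<pi> \<circ> Transposition.transpose t m" and ?h = "h(t := k, m := 1)"
    have sum': "(\<Sum>s<Suc m. f (?h s)) = f 1 + (f k + (\<Sum>s\<in>{..<m} - {t}. f (h s)))" for f :: "nat \<Rightarrow> nat"
    proof -
      have "(\<Sum>s<Suc m. f (?h s)) = f 1 + (\<Sum>s<m. f ((h(t := k)) s))" by simp
      also have "(\<Sum>s<m. f ((h(t := k)) s)) = f k + (\<Sum>s\<in>{..<m} - {t}. f (h s))"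
        using t(1) by (subst sum.remove[of _ t]) auto
      finally show ?thesis .
    qed
    have sum: "(\<Sum>s<m. f (h s)) = f (Suc k) + (\<Sum>s\<in>{..<m} - {t}. f (h s))" for f :: "nat \<Rightarrow> nat"
      using t(1) k(1) by (subst sum.remove[of _ t]) auto
    have \<pi>m: "\<pi> permutes {..<Suc m}" using less.prems(1) by (rule permutes_subset) auto
    have tp: "Transposition.transpose t m permutes {..<Suc m}" using t(1) by (intro permutes_swap_id) auto
    have "sign ?\<pi> = - sign \<pi>"
      using \<pi>m tp t(1) by (subst sign_compose) (auto simp: sign_swap_id intro: permutes_imp_permutation[OF finite_lessThan])
    moreover have "(\<integral>U. f_det U * cnj (trace_sum (Suc m) ?\<pi> ?h U) \<partial>M) =
      (if (\<Sum>s<Suc m. ?h s) \<le> N then (- 1) ^ Suc m * of_int (sign ?\<pi>) else 0)"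
    proof (rule less.hyps)
      show "(\<Sum>s<Suc m. ?h s - 1) < (\<Sum>s<m. h s - 1)"
        unfolding sum'[of "\<lambda>x. x - 1"] sum[of "\<lambda>x. x - 1"] using k(2) by simp
      show "?\<pi> permutes {..<Suc m}" by (rule permutes_compose[OF tp \<pi>m])
      show "?h s \<ge> 1" if "s < Suc m" for s using that k(2) less.prems(2)[of s] by (auto simp: less_Suc_eq)
    qed
    moreover have "(\<Sum>s<Suc m. ?h s) = (\<Sum>s<m. h s)" using sum'[of "\<lambda>x. x"] sum[of "\<lambda>x. x"] by simp
    moreover have "(\<integral>U. f_det U * cnj (trace_sum m \<pi> h U) \<partial>M) = (\<integral>U. f_det U * cnj (trace_sum (Suc m) ?\<pi> ?h U) \<partial>M)"
      by (intro Bochner_Integration.integral_cong refl) (simp only: trace_sum_split[where h = h, OF carrier less.prems(1) t(1) k(1)])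
    ultimately show ?thesis by simp
  qed
qed

lemma bm_pow_entry: "i < N \<Longrightarrow> j < N \<Longrightarrow> bm (\<lambda>U. (U ^\<^sub>m k) $$ (i, j))"
proof (induction k arbitrary: j)
  case 0
  have "(if i = j then 1 else 0) = (U ^\<^sub>m 0) $$ (i, j)" if "U \<in> space M" for U
    using 0 carrier[OF that] by auto
  then show ?case by (rule bm_cong[OF bm_const])
next
  case (Suc k)
  have "bm (\<lambda>U. \<Sum>c<N. (U ^\<^sub>m k) $$ (i, c) * U $$ (c, j))"
    by (intro bm_sum bm_mult bm_entry Suc.IH) (use Suc.prems in auto)
  moreover have "(\<Sum>c<N. (U ^\<^sub>m k) $$ (i, c) * U $$ (c, j)) = (U ^\<^sub>m Suc k) $$ (i, j)" if "U \<in> space M" for U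
    using pow_mat_entry_Suc[OF carrier[OF that]] Suc.prems by simp
  ultimately show ?case by (rule bm_cong)
qed

lemma bm_tr_pow: "bm (tr_pow l)"
proof (rule bm_cong)
  show "bm (\<lambda>U. \<Sum>i<N. (U ^\<^sub>m l) $$ (i, i))" by (intro bm_sum bm_pow_entry) auto
  show "(\<Sum>i<N. (U ^\<^sub>m l) $$ (i, i)) = tr_pow l U" if "U \<in> space M" for U
    using carrier[OF that] by (simp add: tr_pow_def)
qed

lemma bm_f_det: "bm f_det"
proof (rule bm_cong)
  show "bm (\<lambda>U. \<Sum>I\<in>Pow {..<N}. (- 1) ^ card I * minor I id U)"
    by (intro bm_sum bm_mult bm_const bm_minor) auto
  show "(\<Sum>I\<in>Pow {..<N}. (- 1) ^ card I * minor I id U) = f_det U" if "U \<in> space M" for U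
    using f_det_expand[OF carrier[OF that]] by simp
qed

definition pairing :: "(complex mat \<Rightarrow> complex) \<Rightarrow> nat \<Rightarrow> (nat \<Rightarrow> nat) \<Rightarrow> complex" where
  "pairing G m h = (\<integral>U. f_det U * cnj (G U * (\<Prod>s<m. tr_pow (h s) U)) \<partial>M)"

text \<open>\<open>evaluates d G v\<close> says that the symmetric function \<open>G\<close>, homogeneous of degree \<open>d\<close> in the eigenvalues,
  takes the value \<open>v\<close> under the ring homomorphism sending every power sum to \<open>-1\<close>;
  the integral against \<open>f_det\<close> is this homomorphism, truncated at degree \<open>N\<close>.\<close>

definition evaluates :: "nat \<Rightarrow> (complex mat \<Rightarrow> complex) \<Rightarrow> real \<Rightarrow> bool" where
  "evaluates d G v \<longleftrightarrow> bm G \<and> (\<forall>m h. (\<forall>s<m. h s \<ge> 1) \<longrightarrow>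
     pairing G m h = (if d + (\<Sum>s<m. h s) \<le> N then of_real v * (- 1) ^ m else 0))"

lemma pairing_integrable:
  "bm G \<Longrightarrow> integrable M (\<lambda>U. f_det U * cnj (G U * (\<Prod>s<m. tr_pow (h s) U)))"
  by (intro bm_integrable bm_mult bm_f_det bm_cnj bm_prod bm_tr_pow)

lemma pairing_tr: "pairing (\<lambda>U. G U * tr_pow j U) m h = pairing G (Suc m) (h(m := j))"
  unfolding pairing_def by (rule Bochner_Integration.integral_cong[OF refl]) (simp add: mult_ac)

lemma pairing_add: "bm G \<Longrightarrow> bm H \<Longrightarrow> pairing (\<lambda>U. G U + H U) m h = pairing G m h + pairing H m h"
  unfolding pairing_def
  by (subst Bochner_Integration.integral_add[OF pairing_integrable pairing_integrable, symmetric])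
    (simp_all add: algebra_simps)

lemma pairing_scale: "pairing (\<lambda>U. of_real c * G U) m h = of_real c * pairing G m h"
  unfolding pairing_def
  by (subst Bochner_Integration.integral_mult_right_zero[symmetric]) (simp add: mult_ac)

lemma evaluates_one: "evaluates 0 (\<lambda>_. 1) 1"
proof -
  have "pairing (\<lambda>_. 1) m h = (if 0 + (\<Sum>s<m. h s) \<le> N then of_real 1 * (- 1) ^ m else 0)"
    if "\<forall>s<m. h s \<ge> 1" for m h
  proof -
    have "pairing (\<lambda>_. 1) m h = (\<integral>U. f_det U * cnj (trace_sum m id h U) \<partial>M)"
      unfolding pairing_def
      by (rule Bochner_Integration.integral_cong[OF refl]) (simp only: trace_sum_id[OF carrier] mult_1)
    also have "\<dots> = (if (\<Sum>s<m. h s) \<le> N then (- 1) ^ m * of_int (sign (id :: nat \<Rightarrow> nat)) else 0)"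
      by (rule integral_trace_sum) (use that permutes_id in auto)
    finally show ?thesis by simp
  qed
  then show ?thesis unfolding evaluates_def using bm_const by blast
qed

lemma evaluates_cong:
  assumes "evaluates d G v" "\<And>U. U \<in> space M \<Longrightarrow> G U = H U" shows "evaluates d H v"
proof -
  have "bm H" using assms bm_cong unfolding evaluates_def by blast
  moreover have "pairing H m h = pairing G m h" for m h
    unfolding pairing_def by (rule Bochner_Integration.integral_cong[OF refl]) (simp only: assms(2))
  ultimately show ?thesis using assms(1) unfolding evaluates_def by simp
qed

text \<open>The extra trace is absorbed as one more factor of the test product; its value under the
  homomorphism is -1. This is why \<open>evaluates\<close> is stated against all products of
  traces.\<close>

lemma evaluates_tr:
  assumes G: "evaluates d G v" and j: "j \<ge> 1" shows "evaluates (d + j) (\<lambda>U. G U * tr_pow j U) (- v)"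
proof -
  have "pairing (\<lambda>U. G U * tr_pow j U) m h = (if d + j + (\<Sum>s<m. h s) \<le> N then of_real (- v) * (- 1) ^ m else 0)"
    if h: "\<forall>s<m. h s \<ge> 1" for m h
  proof -
    have "\<forall>s<Suc m. (h(m := j)) s \<ge> 1" using h j by (auto simp: less_Suc_eq)
    moreover have "d + (\<Sum>s<Suc m. (h(m := j)) s) = d + j + (\<Sum>s<m. h s)" by simp
    ultimately show ?thesis
      using G unfolding evaluates_def pairing_tr by (simp del: sum.lessThan_Suc fun_upd_apply)
  qed
  then show ?thesis using G bm_mult[OF _ bm_tr_pow] unfolding evaluates_def by blast
qed

lemma evaluates_add:
  "evaluates d G v \<Longrightarrow> evaluates d H w \<Longrightarrow> evaluates d (\<lambda>U. G U + H U) (v + w)"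
  unfolding evaluates_def by (auto simp: pairing_add bm_add algebra_simps)

lemma evaluates_scale: "evaluates d G v \<Longrightarrow> evaluates d (\<lambda>U. of_real c * G U) (c * v)"
  unfolding evaluates_def pairing_scale by (auto simp: bm_mult[OF bm_const] mult.assoc)

lemma evaluates_sum:
  "finite A \<Longrightarrow> A \<noteq> {} \<Longrightarrow> (\<And>i. i \<in> A \<Longrightarrow> evaluates d (G i) (v i)) \<Longrightarrow> evaluates d (\<lambda>U. \<Sum>i\<in>A. G i U) (\<Sum>i\<in>A. v i)"
  by (induction A rule: finite_ne_induct) (auto intro: evaluates_add)

text \<open>With all power sums equal to -1, \<open>(p1^3 - 3 * p1 * p2 + 2 * p3) / 6\<close> is
  \<open>(-1 - 3 - 2) / 6 = -1\<close>.\<close>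

lemma evaluates_wedge3_tr:
  assumes G: "evaluates d G v" and j: "j \<ge> 1" shows "evaluates (d + 3 * j) (\<lambda>U. G U * wedge3_tr j U) (- v)"
proof -
  have a: "evaluates (d + 3 * j) (\<lambda>U. G U * tr_pow j U * tr_pow j U * tr_pow j U) (- v)"
    using evaluates_tr[OF evaluates_tr[OF evaluates_tr[OF G j] j] j] by (simp add: add.assoc numeral_3_eq_3)
  have b: "evaluates (d + 3 * j) (\<lambda>U. G U * tr_pow j U * tr_pow (2 * j) U) v"
    using evaluates_tr[OF evaluates_tr[OF G j], of "2 * j"] j by (simp add: add.assoc)
  have c: "evaluates (d + 3 * j) (\<lambda>U. G U * tr_pow (3 * j) U) (- v)"
    using evaluates_tr[OF G, of "3 * j"] j by simp
  have "evaluates (d + 3 * j) (\<lambda>U. of_real (1 / 6) * (G U * tr_pow j U * tr_pow j U * tr_pow j U) +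
      of_real (- 1 / 2) * (G U * tr_pow j U * tr_pow (2 * j) U) + of_real (1 / 3) * (G U * tr_pow (3 * j) U))
    (1 / 6 * (- v) + (- 1 / 2) * v + 1 / 3 * (- v))"
    by (intro evaluates_add evaluates_scale a b c)
  moreover have "1 / 6 * (- v) + (- 1 / 2) * v + 1 / 3 * (- v) = - v" by simp
  moreover have "of_real (1 / 6) * (x * a * a * a) + of_real (- 1 / 2) * (x * a * b) + of_real (1 / 3) * (x * c)
      = x * ((a ^ 3 - 3 * a * b + 2 * c) / 6)" for x a b c :: complex
    by (simp add: field_simps power3_eq_cube)
  ultimately show ?thesis unfolding wedge3_tr_def by (simp only:)
qed

text \<open>Newton's identity with all power sums -1 reads
  \<open>k * c k = c 0 + ... + c (k - 1)\<close>, so by induction every coefficient has the value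
  1.\<close>

lemma evaluates_wedge3_coeff: "evaluates (3 * k) (wedge3_coeff k) 1"
proof (induction k rule: less_induct)
  case (less k)
  show ?case
  proof (cases "k = 0")
    case True
    have "evaluates 0 (wedge3_coeff 0) 1" by (rule evaluates_cong[OF evaluates_one]) (rule wedge3_coeff_0[symmetric])
    then show ?thesis using True by simp
  next
    case False
    have "evaluates (3 * k) (\<lambda>U. of_real (- 1 / real k) * (wedge3_coeff (k - j) U * wedge3_tr j U)) (- 1 / real k * (- 1))"
      if j: "j \<in> {1..k}" for j
    proof -
      have "3 * (k - j) + 3 * j = 3 * k" using j by auto
      then show ?thesis using evaluates_scale[OF evaluates_wedge3_tr[OF less.IH[of "k - j"], of j], of "- 1 / real k"] j False by simp
    qed
    then have "evaluates (3 * k) (\<lambda>U. \<Sum>j\<in>{1..k}. of_real (- 1 / real k) * (wedge3_coeff (k - j) U * wedge3_tr j U)) (\<Sum>j\<in>{1..k}. - 1 / real k * (- 1))"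
      using False by (intro evaluates_sum) auto
    moreover have "(\<Sum>j\<in>{1..k}. of_real (- 1 / real k) * (wedge3_coeff (k - j) U * wedge3_tr j U)) = wedge3_coeff k U"
      if "U \<in> space M" for U
    proof -
      have "(\<Sum>j\<in>{1..k}. of_real (- 1 / real k) * (wedge3_coeff (k - j) U * wedge3_tr j U)) =
        - (\<Sum>j=1..k. wedge3_tr j U * wedge3_coeff (k - j) U) / of_nat k"
        by (simp add: sum_distrib_left[symmetric] sum_negf sum_divide_distrib mult.commute)
      also have "\<dots> = wedge3_coeff k U"
        unfolding wedge3_newton[OF carrier[OF that], symmetric] using False by simp
      finally show ?thesis .
    qed
    ultimately have "evaluates (3 * k) (wedge3_coeff k) (\<Sum>j\<in>{1..k}. - 1 / real k * (- 1))"
      by (rule evaluates_cong)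
    then show ?thesis using False by simp
  qed
qed

lemma wedge3_integral_eq:
  assumes N: "N = 3 * g" shows "wedge3_integral M = of_nat g + 1"
proof -
  \<comment> \<open>Large enough to include every coefficient of the characteristic polynomial of
    the exterior power and every index up to \<open>g\<close>; the indices beyond \<open>g\<close>
    integrate to 0 for reasons of degree.\<close>
  define m where "m = max g (card (triples N))"
  have bmk: "bm (wedge3_coeff k)" for k using evaluates_wedge3_coeff by (simp add: evaluates_def)
  have "wedge3_integral M = (\<integral>U. (\<Sum>k\<le>m. f_det U * cnj (wedge3_coeff k U)) \<partial>M)"
    unfolding wedge3_integral_def
    by (rule Bochner_Integration.integral_cong[OF refl])
      (simp add: det_one_minus_wedge3_eq[OF carrier, of _ m] m_def sum_distrib_left)
  also have "\<dots> = (\<Sum>k\<le>m. \<integral>U. f_det U * cnj (wedge3_coeff k U) \<partial>M)"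
    by (rule Bochner_Integration.integral_sum) (intro bm_integrable bm_mult bm_f_det bm_cnj bmk)
  also have "\<dots> = (\<Sum>k\<le>m. if k \<le> g then 1 else 0)"
  proof (rule sum.cong[OF refl])
    fix k
    show "(\<integral>U. f_det U * cnj (wedge3_coeff k U) \<partial>M) = (if k \<le> g then 1 else 0)"
      using evaluates_wedge3_coeff[of k, unfolded evaluates_def pairing_def, THEN conjunct2, rule_format, of 0] N by simp
  qed
  also have "\<dots> = of_nat (card {k \<in> {..m}. k \<le> g})" by (simp add: sum.If_cases Int_def)
  also have "{k \<in> {..m}. k \<le> g} = {..g}" by (auto simp: m_def)
  finally show ?thesis by simp
qed

end

lemma haar_wedge3_integral: "haar_prob (3 * g) M \<Longrightarrow> wedge3_integral M = of_nat g + 1"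
proof -
  assume h: "haar_prob (3 * g) M"
  interpret prob_space M using h by (simp add: haar_prob_def)
  interpret haar M "3 * g" by unfold_locales (use h in \<open>auto simp: haar_prob_def\<close>)
  show ?thesis by (rule wedge3_integral_eq[OF refl])
qed

theorem theorem1p5:
  shows "\<exists>(l :: nat \<Rightarrow> complex) (\<epsilon> :: nat \<Rightarrow> complex) (C :: real).
    \<epsilon> \<longlonglongrightarrow> 0 \<and>
    (\<forall>g\<ge>2.
      (\<forall>(K :: nat \<Rightarrow> 'a ring) \<Omega> (\<Theta> :: nat \<Rightarrow> ('a list \<Rightarrow> complex) \<Rightarrow> complex mat).
         field_family K \<Omega> \<and>
         (\<forall>q\<in>admissible. \<forall>\<psi>\<in>cubic_family (K q) (\<Omega> q) (3 * g).
            \<Theta> q \<psi> \<in> frobenius_class (K q) \<psi>) \<longrightarrow>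
         ((\<lambda>q. family_average (K q) (\<Omega> q) (3 * g)
                (\<lambda>\<psi>. f_det (complex_of_real (real q powr (1 / 6)) \<cdot>\<^sub>m \<Theta> q \<psi>))) \<longlongrightarrow> l g)
           q_to_infinity \<and>
         (\<forall>q\<in>admissible. \<forall>\<psi>\<in>cubic_family (K q) (\<Omega> q) (3 * g).
            f_det (complex_of_real (real q powr (1 / 6)) \<cdot>\<^sub>m \<Theta> q \<psi>) =
            L_function (K q) \<psi> (1 / 3))) \<and>
      (\<forall>(K :: nat \<Rightarrow> 'a ring) \<Omega>. field_family K \<Omega> \<longrightarrow>
         ((\<lambda>q. family_average (K q) (\<Omega> q) (3 * g) (\<lambda>\<psi>. L_function (K q) \<psi> (1 / 3))) \<longlongrightarrow> l g)
           q_to_infinity) \<and>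
      cmod (l g - of_nat g) \<le> C \<and>
      (\<forall>M. haar_prob (3 * g) M \<longrightarrow>
         l g = (1 + \<epsilon> g) * wedge3_integral M \<and>
         wedge3_integral M = of_nat g + 1))"
proof (intro exI conjI allI impI ballI)
  \<comment> \<open>The goals fix the witnesses: \<open>l g = g + 1\<close>, \<epsilon> identically
    0, and \<open>C = 1\<close>.\<close>
  show "(\<lambda>_ :: nat. 0 :: complex) \<longlonglongrightarrow> 0" by simp
next
  fix g :: nat and K :: "nat \<Rightarrow> 'a ring" and \<Omega> and \<Theta> :: "nat \<Rightarrow> ('a list \<Rightarrow> complex) \<Rightarrow> complex mat"
  assume h: "field_family K \<Omega> \<and>
      (\<forall>q\<in>admissible. \<forall>\<psi>\<in>cubic_family (K q) (\<Omega> q) (3 * g). \<Theta> q \<psi> \<in> frobenius_class (K q) \<psi>)"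
  have f: "f_det (complex_of_real (real q powr (1 / 6)) \<cdot>\<^sub>m \<Theta> q \<psi>) = L_function (K q) \<psi> (1 / 3)"
    if "q \<in> admissible" "\<psi> \<in> cubic_family (K q) (\<Omega> q) (3 * g)" for q \<psi>
    using f_det_frobenius h that by blast
  then show "f_det (complex_of_real (real q powr (1 / 6)) \<cdot>\<^sub>m \<Theta> q \<psi>) = L_function (K q) \<psi> (1 / 3)"
    if "q \<in> admissible" "\<psi> \<in> cubic_family (K q) (\<Omega> q) (3 * g)" for q \<psi>
    using that .
  have "\<forall>\<^sub>F q in q_to_infinity. family_average (K q) (\<Omega> q) (3 * g) (\<lambda>\<psi>. L_function (K q) \<psi> (1 / 3)) =
    family_average (K q) (\<Omega> q) (3 * g) (\<lambda>\<psi>. f_det (complex_of_real (real q powr (1 / 6)) \<cdot>\<^sub>m \<Theta> q \<psi>))"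
    unfolding q_to_infinity_def eventually_inf_principal
    by (rule always_eventually) (simp add: family_average_def f)
  with family_average_limit show "((\<lambda>q. family_average (K q) (\<Omega> q) (3 * g)
      (\<lambda>\<psi>. f_det (complex_of_real (real q powr (1 / 6)) \<cdot>\<^sub>m \<Theta> q \<psi>))) \<longlongrightarrow> of_nat (g + 1)) q_to_infinity"
    by (rule Lim_transform_eventually) (use h in blast)
next
  fix g :: nat and K :: "nat \<Rightarrow> 'a ring" and \<Omega> assume "field_family K \<Omega>"
  then show "((\<lambda>q. family_average (K q) (\<Omega> q) (3 * g) (\<lambda>\<psi>. L_function (K q) \<psi> (1 / 3))) \<longlongrightarrow> of_nat (g + 1)) q_to_infinity"
    by (rule family_average_limit)
next
  fix g :: nat show "cmod (of_nat (g + 1) - of_nat g) \<le> 1" by simp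
next
  fix g :: nat and M assume "haar_prob (3 * g) M"
  then show e: "wedge3_integral M = of_nat g + 1" by (rule haar_wedge3_integral)
  then show "of_nat (g + 1) = (1 + 0) * wedge3_integral M" by simp
qed

end
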